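(* Let $n\in\mathbb{N}$, $n\ge1$, $\lambda>-1$, $1<p<\infty$, $1/p+1/q=1$, and let $\psi\in L^1_{\rm loc}(\mathbb{B}_{2n})$. Let $(B_j)_{j\in\mathbb{N}}$ and $\widehat\psi_j$ be the dyadic spherical boxes of $\mathbb{B}_{2n}$ and the associated quantities, as defined in the context (with $d=2n$). Suppose there exists $C_\psi\ge0$ with $\widehat\psi_j\le C_\psi|B_j|_\lambda$ for all $j\in\mathbb{N}$. Then: (a) the generalized Toeplitz operator $T^{\rm an}_\psi:A^p_\lambda(\mathbf{B}_n)\to A^p_\lambda(\mathbf{B}_n)$ is bounded; (b) if in addition $\lim_{j\to\infty}\widehat\psi_j/|B_j|_\lambda=0$, then $T^{\rm an}_\psi:A^p_\lambda(\mathbf{B}_n)\to A^p_\lambda(\mathbf{B}_n)$ is compact; (c) with $\psi_\rho(z)=\psi(z)$ for $|z|\le\rho$ and $\psi_\rho(z)=0$ for $\rho<|z|<1$ ($0<\rho<1$), one has $T^{\rm an}_\psi f=\lim_{\rho\to1}T^{\rm an}_{\psi_\rho}f$ in $A^p_\lambda(\mathbf{B}_n)$ for all $f\in A^p_\lambda(\mathbf{B}_n)$, and the adjoint $(T^{\rm an}_\psi)^*:A^q_\lambda(\mathbf{B}_n)\to A^q_\lambda(\mathbf{B}_n)$ satisfies $(T^{\rm an}_\psi)^*f=\lim_{\rho\to1}T^{\rm an}_{\overline{\psi}_\rho}f$ in $A^q_\lambda(\mathbf{B}_n)$ for all $f\in A^q_\lambda(\mathbf{B}_n)$.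
   Context: $\mathbb{B}_d$ is the open unit ball of $\mathbb{R}^d$; $\mathbf{B}_n$ is the open unit ball of $\mathbb{C}^n$, identified with $\mathbb{B}_{2n}$ via $\mathbb{C}^n\cong\mathbb{R}^{2n}$. Put $d=2n$. $\mathrm{d}V$ is Lebesgue measure on $\mathbb{B}_d$ normalized so that $V(\mathbb{B}_d)=1$; $\mathrm{d}V_\lambda=c(d,\lambda)(1-|x|^2)^\lambda\,\mathrm{d}V$ with $c(d,\lambda)=\frac{2}{d}\frac{\Gamma(d/2+\lambda+1)}{\Gamma(d/2)\Gamma(\lambda+1)}$. $L^p_\lambda=L^p(\mathbb{B}_d,\mathrm{d}V_\lambda)$. $A^p_\lambda(\mathbf{B}_n)$ is the closed subspace of $L^p_\lambda$ consisting of analytic functions of $n$ complex variables on $\mathbf{B}_n$. $L^1_{\rm loc}(\mathbb{B}_d)$ is the set of locally integrable functions. $|B|_\lambda=\int_B\mathrm{d}V_\lambda$; $\chi_E$ is a characteristic function; $\overline\psi_\rho$ is the complex conjugate of $\psi_\rho$. $P^{\rm an}_\lambda$ is the orthogonal projection of $L^2_\lambda$ onto $A^2_\lambda(\mathbf{B}_n)$, extended to $L^1_\lambda$ by its integral formula $P^{\rm an}_\lambda f(z)=\int_{\mathbf{B}_n}\frac{f(w)}{(1-\langle z,w\rangle)^{n+1+\lambda}}\,\mathrm{d}V_\lambda(w)$. The generalized Toeplitz operator is $T^{\rm an}_\psi f(z)=\sum_{j=1}^\infty P^{\rm an}_\lambda(\psi\chi_{B_j}f)(z)$. The adjoint is taken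 with respect to the standard duality $\langle f,g\rangle=\int f\overline g\,\mathrm{d}V_\lambda$ between $A^p_\lambda$ and $A^q_\lambda$. Boxes in $\mathbb{B}_d$, $d\ge2$. Let $\mathbb{Q}_d=[0,1)\times[0,\pi]^{d-2}\times[0,2\pi]$ and let $\sigma:\mathbb{Q}_d\to\mathbb{B}_d$ be the spherical coordinate map $\sigma(r,\theta_2,\dots,\theta_d)=(r\cos\theta_2,\,r\sin\theta_2\cos\theta_3,\dots,\,r\sin\theta_2\cdots\sin\theta_{d-1}\cos\theta_d,\,r\sin\theta_2\cdots\sin\theta_{d-1}\sin\theta_d)$. For $x,y\in\mathbb{Q}_d$ put $Q(x,y)=\{z\in\mathbb{Q}_d: z_j\in[\min\{x_j,y_j\},\max\{x_j,y_j\}]\ \forall j\}$ and $B(x,y)=\sigma(Q(x,y))$. Let $\mathcal{K}=\{(m,k_2,\dots,k_d)\in\mathbb{N}_0^d: 0\le k_d\le k_{d-1}\le\dots\le k_2\le 2^m-1\}$ and for $k\in\mathcal{K}$ let $C_k=[1-2^{-m},1-2^{-m-1}]\times[\frac{\pi}{2}k_22^{-m},\frac{\pi}{2}(k_2+1)2^{-m}]\times[\frac{\pi}{2}\frac{k_3}{k_2+1},\frac{\pi}{2}\frac{k_3+1}{k_2+1}]\times\dots\times[\frac{\pi}{2}\frac{k_{d-1}}{k_{d-2}+1},\frac{\pi}{2}\frac{k_{d-1}+1}{k_{d-2}+1}]\times[2\pi\frac{k_d}{k_{d-1}+1},2\pi\frac{k_d+1}{k_{d-1}+1}]$ (for $d=2$: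 $C_k=[1-2^{-m},1-2^{-m-1}]\times[2\pi k_22^{-m},2\pi(k_2+1)2^{-m}]$). Let $\mathcal{Q}$ be the collection of all sets obtained from the $C_k$ by applying any composition (possibly empty) of the reflections $\theta_i\mapsto\pi-\theta_i$, $i=2,\dots,d-1$. Enumerate $\mathcal{Q}$ as $Q_1,Q_2,\dots$ and put $B_j=\sigma(Q_j)$. Let $x^{(j)}$ and $y^{(j)}$ be the smallest, respectively largest, element of $Q_j$ for the order $x\le y\iff x_1\le y_1,\ |\frac{\pi}{2}-x_i|\ge|\frac{\pi}{2}-y_i|\ (2\le i\le d-1),\ x_d\le y_d$; these are opposite corners of $Q_j$ and $B_j=B(x^{(j)},y^{(j)})$. For $\psi\in L^1_{\rm loc}$, $$\widehat{\psi}_j=\sup_{y\in Q_j}\Big|\int_{B(x^{(j)},y)}\psi\,\mathrm{d}V_\lambda\Big|.$$ *)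

theory Defs
  imports "HOL-Analysis.Analysis"
begin

section \<open>The weighted measure on the unit ball\<close>

definition ball_vol :: "'a::euclidean_space measure" where
  "ball_vol = scale_measure (inverse (emeasure lebesgue (ball 0 1 :: 'a set)))
                (lebesgue_on (ball 0 1))"

definition weight_const :: "nat \<Rightarrow> real \<Rightarrow> real" where
  "weight_const d lam =
     2 / real d * (Gamma (real d / 2 + lam + 1) / (Gamma (real d / 2) * Gamma (lam + 1)))"

definition weighted_vol :: "real \<Rightarrow> 'a::euclidean_space measure" where
  "weighted_vol lam =
     density ball_vol (\<lambda>x. ennreal (weight_const DIM('a) lam * (1 - (norm x)\<^sup>2) powr lam))"

definition locally_integrable_ball :: "('a::euclidean_space \<Rightarrow> complex) \<Rightarrow> bool" where
  "locally_integrable_ball f \<longleftrightarrow>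
     (\<forall>K. compact K \<and> K \<subseteq> ball 0 1 \<longrightarrow> f absolutely_integrable_on K)"


section \<open>Bergman spaces\<close>

text \<open>Functions on the ball are represented by total functions whose values outside the ball
  are irrelevant.\<close>

definition Lp_space :: "real \<Rightarrow> real \<Rightarrow> ('a::euclidean_space \<Rightarrow> complex) set" where
  "Lp_space lam p =
     {f. f \<in> borel_measurable (weighted_vol lam) \<and>
         integrable (weighted_vol lam) (\<lambda>x. norm (f x) powr p)}"

definition Lp_norm :: "real \<Rightarrow> real \<Rightarrow> ('a::euclidean_space \<Rightarrow> complex) \<Rightarrow> real" where
  "Lp_norm lam p f = (LINT x|weighted_vol lam. norm (f x) powr p) powr (1 / p)"

text \<open>Analytic functions of several complex variables: the (real) Frechet derivative exists
  and is complex linear at each point.\<close>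

definition analytic_several :: "(complex ^ 'n \<Rightarrow> complex) \<Rightarrow> (complex ^ 'n) set \<Rightarrow> bool" where
  "analytic_several f S \<longleftrightarrow>
     (\<forall>z\<in>S. \<exists>L. (f has_derivative L) (at z) \<and> (\<forall>c v. L (c *s v) = c * L v))"

definition bergman_space :: "real \<Rightarrow> real \<Rightarrow> (complex ^ 'n \<Rightarrow> complex) set" where
  "bergman_space lam p = {f \<in> Lp_space lam p. analytic_several f (ball 0 1)}"

definition bergman_limit ::
    "real \<Rightarrow> real \<Rightarrow> ('i \<Rightarrow> complex ^ 'n \<Rightarrow> complex) \<Rightarrow> (complex ^ 'n \<Rightarrow> complex) \<Rightarrow> 'i filter \<Rightarrow> bool"
  where
  "bergman_limit lam p F g Fl \<longleftrightarrow>
     g \<in> bergman_space lam p \<and> (\<forall>\<^sub>F i in Fl. F i \<in> bergman_space lam p) \<and>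
     ((\<lambda>i. Lp_norm lam p (\<lambda>z. F i z - g z)) \<longlongrightarrow> 0) Fl"

definition bergman_bounded ::
    "real \<Rightarrow> real \<Rightarrow> ((complex ^ 'n \<Rightarrow> complex) \<Rightarrow> (complex ^ 'n \<Rightarrow> complex)) \<Rightarrow> bool" where
  "bergman_bounded lam p T \<longleftrightarrow>
     (\<forall>f\<in>bergman_space lam p. T f \<in> bergman_space lam p) \<and>
     (\<forall>f\<in>bergman_space lam p. \<forall>g\<in>bergman_space lam p. \<forall>a b. \<forall>z\<in>ball 0 1.
        T (\<lambda>w. a * f w + b * g w) z = a * T f z + b * T g z) \<and>
     (\<exists>M. \<forall>f\<in>bergman_space lam p. Lp_norm lam p (T f) \<le> M * Lp_norm lam p f)"

definition bergman_compact ::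
    "real \<Rightarrow> real \<Rightarrow> ((complex ^ 'n \<Rightarrow> complex) \<Rightarrow> (complex ^ 'n \<Rightarrow> complex)) \<Rightarrow> bool" where
  "bergman_compact lam p T \<longleftrightarrow>
     bergman_bounded lam p T \<and>
     (\<forall>F :: nat \<Rightarrow> complex ^ 'n \<Rightarrow> complex.
        range F \<subseteq> bergman_space lam p \<and> (\<exists>M. \<forall>k. Lp_norm lam p (F k) \<le> M) \<longrightarrow>
        (\<exists>g r. strict_mono r \<and> bergman_limit lam p (\<lambda>k. T (F (r k))) g sequentially))"

definition bergman_pairing ::
    "real \<Rightarrow> (complex ^ 'n \<Rightarrow> complex) \<Rightarrow> (complex ^ 'n \<Rightarrow> complex) \<Rightarrow> complex" where
  "bergman_pairing lam f g = (LINT z|weighted_vol lam. f z * cnj (g z))"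

definition bergman_adjoint ::
    "real \<Rightarrow> real \<Rightarrow> real \<Rightarrow> ((complex ^ 'n \<Rightarrow> complex) \<Rightarrow> (complex ^ 'n \<Rightarrow> complex))
       \<Rightarrow> ((complex ^ 'n \<Rightarrow> complex) \<Rightarrow> (complex ^ 'n \<Rightarrow> complex)) \<Rightarrow> bool" where
  "bergman_adjoint lam p q T S \<longleftrightarrow>
     bergman_bounded lam q S \<and>
     (\<forall>f\<in>bergman_space lam p. \<forall>g\<in>bergman_space lam q.
        bergman_pairing lam (T f) g = bergman_pairing lam f (S g))"


section \<open>The Bergman projection and generalized Toeplitz operators\<close>

definition herm_inner :: "complex ^ 'n \<Rightarrow> complex ^ 'n \<Rightarrow> complex" where
  "herm_inner z w = (\<Sum>i\<in>UNIV. z $ i * cnj (w $ i))"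

text \<open>The principal branch of the power is the right one, as the base has positive real part
  for points of the ball.\<close>

definition bergman_proj :: "real \<Rightarrow> (complex ^ 'n \<Rightarrow> complex) \<Rightarrow> complex ^ 'n \<Rightarrow> complex" where
  "bergman_proj lam f z =
     (LINT w|weighted_vol lam.
        f w / (1 - herm_inner z w) powr of_real (real CARD('n) + 1 + lam))"

definition toeplitz_term ::
    "real \<Rightarrow> (nat \<Rightarrow> (complex ^ 'n) set) \<Rightarrow> (complex ^ 'n \<Rightarrow> complex)
       \<Rightarrow> (complex ^ 'n \<Rightarrow> complex) \<Rightarrow> complex ^ 'n \<Rightarrow> nat \<Rightarrow> complex" where
  "toeplitz_term lam B \<psi> f z j = bergman_proj lam (\<lambda>w. \<psi> w * indicator (B j) w * f w) z"

definition toeplitz ::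
    "real \<Rightarrow> (nat \<Rightarrow> (complex ^ 'n) set) \<Rightarrow> (complex ^ 'n \<Rightarrow> complex)
       \<Rightarrow> (complex ^ 'n \<Rightarrow> complex) \<Rightarrow> complex ^ 'n \<Rightarrow> complex" where
  "toeplitz lam B \<psi> f z = (\<Sum>j. toeplitz_term lam B \<psi> f z j)"

text \<open>Since \<^const>\<open>suminf\<close> is total, convergence of the defining series has to be stated
  separately.\<close>

definition toeplitz_well_defined ::
    "real \<Rightarrow> real \<Rightarrow> (nat \<Rightarrow> (complex ^ 'n) set) \<Rightarrow> (complex ^ 'n \<Rightarrow> complex) \<Rightarrow> bool" where
  "toeplitz_well_defined lam p B \<psi> \<longleftrightarrow>
     (\<forall>f\<in>bergman_space lam p. \<forall>z\<in>ball 0 1. summable (toeplitz_term lam B \<psi> f z))"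

definition truncate_symbol :: "real \<Rightarrow> ('a::real_normed_vector \<Rightarrow> complex) \<Rightarrow> 'a \<Rightarrow> complex" where
  "truncate_symbol \<rho> \<psi> z = (if norm z \<le> \<rho> then \<psi> z else 0)"


section \<open>Spherical boxes\<close>

text \<open>Points of the parameter domain are functions on \<open>{1..d}\<close> (extended by \<^const>\<open>undefined\<close>);
  the first coordinate is the radius, the coordinates \<open>2, ..., d\<close> are the angles.\<close>

definition sph_domain :: "nat \<Rightarrow> (nat \<Rightarrow> real) set" where
  "sph_domain d =
     (\<Pi>\<^sub>E i\<in>{1..d}. if i = 1 then {0..<1} else if i = d then {0..2 * pi} else {0..pi})"

definition sph_coord :: "nat \<Rightarrow> (nat \<Rightarrow> real) \<Rightarrow> nat \<Rightarrow> real" where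
  "sph_coord d x i =
     (if i < d then x 1 * (\<Prod>k=2..i. sin (x k)) * cos (x (i + 1))
      else x 1 * (\<Prod>k=2..d. sin (x k)))"

text \<open>The identification of \<open>\<real>\<^sup>2\<^sup>n\<close> with \<open>\<complex>\<^sup>n\<close> is \<open>z\<^sub>k = u\<^sub>2\<^sub>k\<^sub>-\<^sub>1 + \<i> u\<^sub>2\<^sub>k\<close>. The index type is
  ordered, and the index \<open>j\<close> is the \<open>k\<close>-th one for \<open>k = card {i. i \<le> j}\<close>.\<close>

definition complex_of_coords :: "(nat \<Rightarrow> real) \<Rightarrow> complex ^ 'n::{finite,wellorder}" where
  "complex_of_coords u =
     (\<chi> j. Complex (u (2 * card {i. i \<le> j} - 1)) (u (2 * card {i. i \<le> j})))"

definition sph_map :: "(nat \<Rightarrow> real) \<Rightarrow> complex ^ 'n::{finite,wellorder}" where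
  "sph_map x = complex_of_coords (sph_coord (2 * CARD('n)) x)"

definition param_box :: "nat \<Rightarrow> (nat \<Rightarrow> real) \<Rightarrow> (nat \<Rightarrow> real) \<Rightarrow> (nat \<Rightarrow> real) set" where
  "param_box d x y =
     {z \<in> sph_domain d. \<forall>j\<in>{1..d}. z j \<in> {min (x j) (y j)..max (x j) (y j)}}"

definition sph_box ::
    "(nat \<Rightarrow> real) \<Rightarrow> (nat \<Rightarrow> real) \<Rightarrow> (complex ^ 'n::{finite,wellorder}) set" where
  "sph_box x y = sph_map ` param_box (2 * CARD('n)) x y"

text \<open>A multi-index is a function \<open>k\<close> of which only the values on \<open>{1..d}\<close> matter, with
  \<open>k 1\<close> playing the role of \<open>m\<close>.\<close>

definition dyadic_index :: "nat \<Rightarrow> (nat \<Rightarrow> nat) set" where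
  "dyadic_index d = {k. k 2 \<le> 2 ^ k 1 - 1 \<and> (\<forall>i\<in>{3..d}. k i \<le> k (i - 1))}"

text \<open>The \<open>i\<close>-th side of \<open>C\<^sub>k\<close> is \<open>[A t / N, A (t + 1) / N]\<close> with \<open>t = k i\<close>, where \<open>A = 2\<pi>\<close>
  for the last angle and \<open>\<pi>/2\<close> for the others, and \<open>N = 2\<^sup>m\<close> for the first angle and
  \<open>k (i - 1) + 1\<close> for the others.\<close>

definition dyadic_side :: "nat \<Rightarrow> (nat \<Rightarrow> nat) \<Rightarrow> nat \<Rightarrow> real set" where
  "dyadic_side d k i =
     (if i = 1 then {1 - 1 / 2 ^ k 1 .. 1 - 1 / 2 ^ (k 1 + 1)}
      else let A = (if i = d then 2 * pi else pi / 2);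
               N = (if i = 2 then 2 ^ k 1 else real (k (i - 1)) + 1)
           in {A * (real (k i) / N) .. A * ((real (k i) + 1) / N)})"

definition dyadic_box :: "nat \<Rightarrow> (nat \<Rightarrow> nat) \<Rightarrow> (nat \<Rightarrow> real) set" where
  "dyadic_box d k = (\<Pi>\<^sub>E i\<in>{1..d}. dyadic_side d k i)"

inductive_set dyadic_boxes :: "nat \<Rightarrow> (nat \<Rightarrow> real) set set" for d :: nat where
  base: "k \<in> dyadic_index d \<Longrightarrow> dyadic_box d k \<in> dyadic_boxes d"
| reflect: "Q \<in> dyadic_boxes d \<Longrightarrow> i \<in> {2..d - 1} \<Longrightarrow>
             (\<lambda>x. x(i := pi - x i)) ` Q \<in> dyadic_boxes d"

definition sph_le :: "nat \<Rightarrow> (nat \<Rightarrow> real) \<Rightarrow> (nat \<Rightarrow> real) \<Rightarrow> bool" where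
  "sph_le d x y \<longleftrightarrow>
     x 1 \<le> y 1 \<and> (\<forall>i\<in>{2..d - 1}. \<bar>pi / 2 - x i\<bar> \<ge> \<bar>pi / 2 - y i\<bar>) \<and> x d \<le> y d"

definition low_corner :: "nat \<Rightarrow> (nat \<Rightarrow> real) set \<Rightarrow> nat \<Rightarrow> real" where
  "low_corner d Q = (THE x. x \<in> Q \<and> (\<forall>y\<in>Q. sph_le d x y))"

definition box_sup ::
    "real \<Rightarrow> (complex ^ 'n::{finite,wellorder} \<Rightarrow> complex) \<Rightarrow> (nat \<Rightarrow> real) set \<Rightarrow> real" where
  "box_sup lam \<psi> Q =
     (SUP y\<in>Q. cmod (LINT z:sph_box (low_corner (2 * CARD('n)) Q) y|weighted_vol lam. \<psi> z))"

end

theory Submission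
  imports Defs "HOL-Complex_Analysis.Complex_Analysis"
begin

text \<open>
The symbol \<open>\<psi>\<close> is controlled only through its integrals over the boxes \<open>B(x, y)\<close> inside each dyadic box, where
cancellation is allowed, so \<open>|\<psi>|\<close> cannot be used. The reason why this suffices is summation by parts. On one dyadic box the
term of the series integrates \<open>\<psi>\<close> against \<open>f\<close> times the Bergman kernel, a function that is smooth at the scale of
the box: in normalised spherical parameters it extends to a bounded holomorphic function on a complex neighbourhood of the unit cube, of a size
depending on the dimension only. Abel summation in each of the \<open>2 n\<close> parameters (\<open>abel_estimate\<close>) then bounds the term
by the quantity \<open>box_sup\<close> times the suprema of \<open>|f|\<close> and of the kernel near the box (\<open>box_term_estimate\<close>). The geometric
input is that the dyadic boxes of the shell of index \<open>m\<close> behave like cubes of side \<open>2^(-m)\<close>, although the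
angular sides become long near the poles: the spherical Jacobian factors compensate exactly (\<open>ccoord_diff\<close>).

The mean value property replaces suprema by averages over neighbourhoods of the boxes. These neighbourhoods overlap
boundedly in a measure-weighted sense, because the boxes are almost disjoint. Summing up, every partial sum of the Toeplitz series is
dominated by the integral operator with kernel \<open>|1 - \<langle>z, w\<rangle>|^(-(n + 1 + lam))\<close> applied to \<open>|f|\<close>, with a
majorant that depends on \<open>f\<close> and \<open>z\<close> but only linearly on the bound for the box integrals (\<open>majorant\<close>). That operator is bounded on
\<open>L^p\<close> for \<open>1 < p\<close> by Schur's test and the estimate of Forelli and Rudin (\<open>pplus_bounded\<close>). Boundedness follows.

The other assertions use the same majorant. Truncating the symbol at radius \<open>\<rho>\<close> does not increase its box integrals, so the
truncated operators have a common majorant and converge by dominated convergence. Pairing term by term, where Fubini's theorem is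
available, identifies the adjoint with the operator of the conjugate symbol; adjoints are unique since kernels are test functions.
If the box integrals become small compared with the measures of the boxes, then up to a small multiple of the positive operator only finitely many
terms matter; each involves a compact set only, and a Montel argument gives compactness.

The Bergman projection has to reproduce analytic functions and produce them. Both facts are proved from integrals over circles
only: rotation invariance of Lebesgue measure and Cauchy's formula on complex lines give Gaussian moments of homogeneous
polynomials, a beta-gamma identity transfers them to the ball, and the binomial series sums them to the kernel (\<open>bergman_reproducing\<close>,
up to a positive constant).\<close>

type_synonym 'n cvec = "(complex, 'n) vec"

lemmas LINT_cong = Bochner_Integration.integral_cong
lemmas integrable_dominated = Bochner_Integration.integrable_bound

lemma integrable_dominated_on:
 fixes f :: "'a => 'b::{banach, second_countable_topology}" and g :: "'a => 'c::{banach, second_countable_topology}"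
 assumes "integrable M g" "f \<in> borel_measurable M" "\<And>x. x \<in> space M ==> norm (f x) <= norm (g x)"
 shows "integrable M f"
 by (rule integrable_dominated[OF assms(1,2) AE_I2[OF assms(3)]])

no_notation fps_nth (infixl "$" 75)

section \<open>Analytic functions and circle averages\<close>

lemma norm_vector_smult: "norm (c *s (x :: complex ^ 'n)) = cmod c * norm x"
 by (simp add: norm_vec_def L2_set_def norm_mult power_mult_distrib real_sqrt_mult
   flip: sum_distrib_left)

lemma holomorphic_vec_has_derivative:
 fixes g :: "complex => complex ^ 'n"
 assumes "\<And>i. ((\<lambda>\<zeta>. g \<zeta> $ i) has_field_derivative d $ i) (at x)"
 shows "(g has_derivative (\<lambda>h. h *s d)) (at x)"
proof -
 have "((\<lambda>\<zeta>. g \<zeta> \<bullet> b) has_derivative (\<lambda>h. (h *s d) \<bullet> b)) (at x)" if bB: "b \<in> Basis" for b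
 proof -
  obtain i u where b: "b = axis i u" "u \<in> Basis" using bB unfolding Basis_vec_def by blast
  have "((\<lambda>\<zeta>. g \<zeta> $ i) has_derivative (\<lambda>h. h * d $ i)) (at x)"
   using assms[of i] by (simp add: has_field_derivative_def mult.commute[of _ "d $ i"])
  from has_derivative_inner_left[OF this, of u]
  show ?thesis by (simp add: b inner_axis)
 qed
 thus ?thesis by (subst has_derivative_componentwise_within) simp
qed

lemma analytic_several_compose:
 fixes f :: "complex ^ 'n => complex"
 assumes f: "analytic_several f S" and U: "open U" and g: "\<And>i. (\<lambda>\<zeta>. g \<zeta> $ i) holomorphic_on U"
  and gS: "\<And>\<zeta>. \<zeta> \<in> U ==> g \<zeta> \<in> S"
 shows "(\<lambda>\<zeta>. f (g \<zeta>)) holomorphic_on U"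
proof (rule holomorphic_onI)
 fix x assume x: "x \<in> U"
 define d where "d = (\<chi> i. deriv (\<lambda>\<zeta>. g \<zeta> $ i) x)"
 have "(g has_derivative (\<lambda>h. h *s d)) (at x)"
  by (rule holomorphic_vec_has_derivative) (simp add: d_def holomorphic_derivI[OF g U x])
 moreover obtain L where L: "(f has_derivative L) (at (g x))" and lin: "\<And>c v. L (c *s v) = c * L v"
  using f gS[OF x] unfolding analytic_several_def by blast
 ultimately have "((\<lambda>\<zeta>. f (g \<zeta>)) has_derivative (\<lambda>h. L (h *s d))) (at x)"
  using has_derivative_compose by blast
 hence "((\<lambda>\<zeta>. f (g \<zeta>)) has_field_derivative L d) (at x)"
  by (simp add: lin has_field_derivative_def mult.commute[of _ "L d"])
 thus "(\<lambda>\<zeta>. f (g \<zeta>)) field_differentiable at x within U"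
  using field_differentiable_at_within field_differentiable_def by blast
qed

lemma analytic_several_continuous_on:
 fixes f :: "complex ^ 'n => complex"
 assumes "analytic_several f S" shows "continuous_on S f"
 using assms unfolding analytic_several_def
 by (meson continuous_at_imp_continuous_on has_derivative_continuous)

lemma analytic_several_slice:
 fixes f :: "complex ^ 'n => complex"
 assumes "analytic_several f S" "open U" "\<And>\<zeta>. \<zeta> \<in> U ==> a + \<zeta> *s u \<in> S"
 shows "(\<lambda>\<zeta>. f (a + \<zeta> *s u)) holomorphic_on U"
 by (rule analytic_several_compose[OF assms(1,2) _ assms(3)]) (auto intro!: holomorphic_intros)

text \<open>An orthogonal map preserves balls around the origin. Comparing \<open>A\<close> with the unit ball \<open>B\<close> in
\<open>\<integral>\<integral> 1_A(x) 1_B(R y) dx dy\<close>, and substituting by translations only, therefore shows that \<open>R\<close> scales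
volume by the factor 1; no Jacobian is involved.\<close>

lemma lborel_distr_orthogonal:
 fixes R :: "'a::euclidean_space => 'a"
 assumes R: "orthogonal_transformation R"
 shows "distr lborel borel R = lborel"
proof (rule measure_eqI)
 show "sets (distr lborel borel R) = sets lborel" by simp
 fix A assume "A \<in> sets (distr lborel borel R)"
 hence A[measurable]: "A \<in> sets borel" by simp
 have lin: "linear R" using R orthogonal_transformation_linear by blast
 have Rm[measurable]: "R \<in> borel_measurable borel"
  using lin by (intro borel_measurable_continuous_onI linear_continuous_on linear_conv_bounded_linear[THEN iffD1])
 have nR: "norm (R x) = norm x" for x using R orthogonal_transformation_norm by blast
 obtain R' where R': "\<And>x. R (R' x) = x"
  using orthogonal_transformation_surj[OF R] by (metis surjD)
 define B where "B = ball (0::'a) 1"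
 have B[measurable]: "B \<in> sets borel" by (simp add: B_def)
 have trans: "(\<integral>\<^sup>+x. g (x + c) \<partial>lborel) = (\<integral>\<^sup>+x. g x \<partial>lborel)" if [measurable]: "g \<in> borel_measurable borel" for g :: "'a => ennreal" and c
  by (subst (2) lborel_distr_plus[of c, symmetric]) (simp add: nn_integral_distr add.commute)
 have "emeasure lborel A * emeasure lborel B = (\<integral>\<^sup>+y. (\<integral>\<^sup>+x. indicator A x * indicator B (R y) \<partial>lborel) \<partial>lborel)"
 proof -
  have "indicator B (R y) = (indicator B y :: ennreal)" for y
   by (simp add: B_def indicator_def nR)
  thus ?thesis by (simp add: nn_integral_multc nn_integral_cmult)
 qed
 also have "... = (\<integral>\<^sup>+y. (\<integral>\<^sup>+x. indicator A (x + R y) * indicator B (R y) \<partial>lborel) \<partial>lborel)"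
  by (intro nn_integral_cong trans[symmetric]) measurable
 also have "... = (\<integral>\<^sup>+x. (\<integral>\<^sup>+y. indicator A (x + R y) * indicator B (R y) \<partial>lborel) \<partial>lborel)"
  by (rule lborel_pair.Fubini'[symmetric]) measurable
 also have "... = (\<integral>\<^sup>+x. (\<integral>\<^sup>+y. indicator A (R y) * indicator B (R y - x) \<partial>lborel) \<partial>lborel)"
 proof (rule nn_integral_cong)
  fix x
  have "(\<integral>\<^sup>+y. indicator A (x + R y) * indicator B (R y) \<partial>lborel)
   = (\<integral>\<^sup>+y. indicator A (x + R (y + R' (-x))) * indicator B (R (y + R' (-x))) \<partial>lborel)"
   by (rule trans[symmetric]) measurable
  also have "... = (\<integral>\<^sup>+y. indicator A (R y) * indicator B (R y - x) \<partial>lborel)"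
   by (simp add: linear_add[OF lin] R')
  finally show "(\<integral>\<^sup>+y. indicator A (x + R y) * indicator B (R y) \<partial>lborel)
   = (\<integral>\<^sup>+y. indicator A (R y) * indicator B (R y - x) \<partial>lborel)" .
 qed
 also have "... = (\<integral>\<^sup>+y. (\<integral>\<^sup>+x. indicator A (R y) * indicator B (R y - x) \<partial>lborel) \<partial>lborel)"
  by (rule lborel_pair.Fubini') measurable
 also have "... = (\<integral>\<^sup>+y. indicator A (R y) * emeasure lborel B \<partial>lborel)"
 proof (rule nn_integral_cong)
  fix y
  have "(\<integral>\<^sup>+x. indicator B (R y - x) \<partial>lborel) = (\<integral>\<^sup>+x. indicator B (R y - (x + R y)) \<partial>lborel)"
   by (rule trans[symmetric]) measurable
  also have "... = (\<integral>\<^sup>+x. indicator B x \<partial>lborel)"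
   by (intro nn_integral_cong) (simp add: B_def indicator_def)
  finally show "(\<integral>\<^sup>+x. indicator A (R y) * indicator B (R y - x) \<partial>lborel) = indicator A (R y) * emeasure lborel B"
   by (simp add: nn_integral_cmult)
 qed
 also have "... = emeasure (distr lborel borel R) A * emeasure lborel B"
 proof -
  have "(\<integral>\<^sup>+y. indicator A (R y) \<partial>lborel) = emeasure (distr lborel borel R) A"
   by (subst nn_integral_indicator[symmetric], simp) (subst nn_integral_distr, auto)
  thus ?thesis by (simp add: nn_integral_multc)
 qed
 finally have eq: "emeasure lborel A * emeasure lborel B = emeasure (distr lborel borel R) A * emeasure lborel B" .
 have "emeasure lborel B \<noteq> 0" "emeasure lborel B \<noteq> \<infinity>"
  using emeasure_lborel_ball_finite[of "0::'a" 1] content_ball_pos[of 1 "0::'a"]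
  by (auto simp: B_def less_top measure_def)
 thus "emeasure (distr lborel borel R) A = emeasure lborel A"
  using eq by (metis ennreal_mult_cancel_left infinity_ennreal_def mult.commute)
qed

lemma orthogonal_transformation_smult:
 assumes "cmod c = 1" shows "orthogonal_transformation ((*s) c :: complex ^ 'n => complex ^ 'n)"
 unfolding orthogonal_transformation
proof (intro conjI allI)
 show "linear ((*s) c :: complex ^ 'n => complex ^ 'n)"
  by (intro linearI) (vector algebra_simps)+
qed (simp add: norm_vector_smult assms)

lemma lborel_distr_smult:
 assumes "cmod c = 1" shows "distr lborel borel ((*s) c :: complex ^ 'n => complex ^ 'n) = lborel"
 by (rule lborel_distr_orthogonal[OF orthogonal_transformation_smult[OF assms]])

lemma borel_measurable_vector_smult[measurable]:
 fixes g :: "'a => complex ^ 'n"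
 assumes [measurable]: "c \<in> borel_measurable M" "g \<in> borel_measurable M"
 shows "(\<lambda>x. c x *s g x) \<in> borel_measurable M"
proof -
 have "continuous_on UNIV (\<lambda>p :: complex \<times> (complex ^ 'n). fst p *s snd p)"
  unfolding vector_scalar_mult_def by (intro continuous_intros)
 from borel_measurable_continuous_onI[OF this]
 have "(\<lambda>p :: complex \<times> (complex ^ 'n). fst p *s snd p) \<in> borel_measurable (borel \<Otimes>\<^sub>M borel)"
  by (simp add: borel_prod)
 from measurable_compose[OF _ this, of "\<lambda>x. (c x, g x)" M] show ?thesis by simp
qed

text \<open>Normalised arc length on the unit circle, parametrised by \<open>cs\<close> over the unit interval.\<close>

definition circ :: "real measure" where "circ = restrict_space lborel {0..1}"

definition cs :: "real => complex" where "cs t = exp (2 * of_real pi * \<i> * of_real t)"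

lemma cmod_cs [simp]: "cmod (cs t) = 1" by (simp add: cs_def norm_exp_eq_Re)

lemma cs_nz [simp]: "cs t \<noteq> 0" by (simp add: cs_def)

lemma finite_measure_circ: "finite_measure circ" "space circ = {0..1}" "measure circ {0..1} = 1"
proof -
 have e: "emeasure circ {0..1} = 1" unfolding circ_def by (subst emeasure_restrict_space) auto
 show "finite_measure circ" "space circ = {0..1}"
  by (intro finite_measureI) (auto simp: e[unfolded circ_def] circ_def space_restrict_space)
 show "measure circ {0..1} = 1" using e by (simp add: measure_def)
qed

lemma circ_measurable: "f \<in> borel_measurable borel ==> f \<in> borel_measurable circ"
 unfolding circ_def by (simp add: measurable_restrict_space1)

lemma circ_id: "(\<lambda>t. t) \<in> borel_measurable circ"
 by (rule circ_measurable) simp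

lemma cs_measurable[measurable]: "cs \<in> borel_measurable borel"
 unfolding cs_def by (intro borel_measurable_continuous_onI continuous_intros)

text \<open>Lebesgue measure is invariant under each rotation \<open>u \<mapsto> cs t *s u\<close>, so averaging over \<open>t\<close> and exchanging
the integrals changes nothing. On each complex line the inner average is a Taylor coefficient, which is how
all exact integral formulas below arise.\<close>

lemma integral_circle_average:
 fixes \<Phi> :: "complex ^ 'n => complex"
 assumes \<Phi>: "integrable lborel \<Phi>"
 shows "(LINT u|lborel. \<Phi> u) = (LINT u|lborel. (LINT t|circ. \<Phi> (cs t *s u)))"
proof -
 interpret circ: finite_measure circ by (rule finite_measure_circ)
 interpret P: pair_sigma_finite circ "lborel :: (complex ^ 'n) measure"
  by (intro pair_sigma_finite.intro circ.sigma_finite_measure_axioms sigma_finite_lborel)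
 have [measurable]: "\<Phi> \<in> borel_measurable borel" using \<Phi> by auto
 note circ_id[measurable]
 have rot: "(LINT u|lborel. \<Phi> (cs t *s u)) = (LINT u|lborel. \<Phi> u)" for t
  by (subst (2) lborel_distr_smult[of "cs t", symmetric]) (simp_all add: integral_distr)
 have rotn: "(\<integral>\<^sup>+u. norm (\<Phi> (cs t *s u)) \<partial>lborel) = (\<integral>\<^sup>+u. norm (\<Phi> u) \<partial>lborel)" for t
  by (subst (2) lborel_distr_smult[of "cs t", symmetric]) (simp_all add: nn_integral_distr)
 have meas: "(\<lambda>(t, u). \<Phi> (cs t *s u)) \<in> borel_measurable (circ \<Otimes>\<^sub>M lborel)" by measurable
 have "(\<integral>\<^sup>+p. norm (case p of (t, u) => \<Phi> (cs t *s u)) \<partial>(circ \<Otimes>\<^sub>M lborel)) < \<infinity>"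
 proof -
  have "(\<integral>\<^sup>+p. norm (case p of (t, u) => \<Phi> (cs t *s u)) \<partial>(circ \<Otimes>\<^sub>M lborel))
   = (\<integral>\<^sup>+t. (\<integral>\<^sup>+u. norm (\<Phi> (cs t *s u)) \<partial>lborel) \<partial>circ)"
   by (subst lborel.nn_integral_fst[symmetric]) auto
  also have "... = (\<integral>\<^sup>+u. norm (\<Phi> u) \<partial>lborel) * emeasure circ (space circ)"
   by (simp add: rotn)
  also have "... < \<infinity>"
  proof -
   have "emeasure circ (space circ) < \<infinity>"
    using circ.emeasure_finite[of "space circ"] unfolding infinity_ennreal_def by (rule top.not_eq_extremum[THEN iffD1])
   thus ?thesis using \<Phi> by (simp add: integrable_iff_bounded ennreal_mult_less_top)
  qed
  finally show ?thesis .
 qed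
 hence int: "integrable (circ \<Otimes>\<^sub>M lborel) (\<lambda>(t, u). \<Phi> (cs t *s u))"
  using meas by (simp add: integrable_iff_bounded)
 have "(LINT u|lborel. (LINT t|circ. \<Phi> (cs t *s u))) = (LINT t|circ. (LINT u|lborel. \<Phi> (cs t *s u)))"
  by (rule P.Fubini_integral[OF int])
 also have "... = (LINT u|lborel. \<Phi> u)"
  by (simp add: rot finite_measure_circ)
 finally show ?thesis by simp
qed

lemma circle_taylor_coeff:
 assumes c: "continuous_on (cball 0 1) g" and h: "g holomorphic_on ball 0 1"
 shows "(LINT t|circ. g (cs t) / cs t ^ k) = (deriv ^^ k) g 0 / fact k"
proof -
 have *: "((\<lambda>u. g u / (u - 0) ^ (Suc k)) has_contour_integral ((2 * pi * \<i>) / (fact k) * (deriv ^^ k) g 0))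
     (circlepath 0 1)"
  by (rule Cauchy_has_contour_integral_higher_derivative_circlepath[OF c h]) simp
 have cp: "circlepath 0 1 t = cs t" for t by (simp add: circlepath cs_def)
 have "((\<lambda>t. g (cs t) / cs t ^ Suc k * (2 * of_real pi * \<i> * cs t)) has_integral ((2 * pi * \<i>) / (fact k) * (deriv ^^ k) g 0)) {0..1}"
  using * unfolding has_contour_integral_def
  by (rule has_integral_eq[rotated]) (simp add: cp vector_derivative_circlepath01 cs_def algebra_simps)
 from has_integral_mult_right[OF this, of "1 / (2 * of_real pi * \<i>)"]
 have hi: "((\<lambda>t. g (cs t) / cs t ^ k) has_integral ((deriv ^^ k) g 0 / fact k)) {0..1}"
  by (simp add: field_simps)
 have cont: "continuous_on {0..1} (\<lambda>t. g (cs t) / cs t ^ k)"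
 proof -
  have "continuous_on {0..1} cs" unfolding cs_def by (intro continuous_intros)
  thus ?thesis by (intro continuous_intros continuous_on_compose2[OF c]) auto
 qed
 have "set_integrable lborel {0..1} (\<lambda>t. g (cs t) / cs t ^ k)"
  by (rule borel_integrable_atLeastAtMost') (rule cont)
 from set_borel_integral_eq_integral(2)[OF this]
 have "(LINT t:{0..1}|lborel. g (cs t) / cs t ^ k) = (deriv ^^ k) g 0 / fact k"
  using hi by (simp add: integral_unique)
 thus ?thesis
  unfolding circ_def set_lebesgue_integral_def by (subst integral_restrict_space) auto
qed

text \<open>Cauchy's inequality on discs of radius \<open>r/4\<close> bounds the derivative on the half ball.\<close>

lemma holomorphic_lipschitz:
 assumes h: "g holomorphic_on ball a r" and r: "r > 0" and B: "\<And>x. x \<in> ball a r ==> cmod (g x) <= B"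
  and x: "cmod (x - a) < r / 2" and y: "cmod (y - a) < r / 2"
 shows "cmod (g x - g y) <= (4 * B / r) * cmod (x - y)"
proof -
 have d: "cmod (deriv g u) <= 4 * B / r" if u: "u \<in> ball a (r/2)" for u
 proof -
  have sub: "cball u (r/4) \<subseteq> ball a r"
  proof
   fix v assume "v \<in> cball u (r/4)"
   thus "v \<in> ball a r" using u r dist_triangle[of a v u] by (auto simp: dist_commute)
  qed
  have "cmod ((deriv ^^ 1) g u) <= fact 1 * B / (r/4) ^ 1"
  proof (rule Cauchy_inequality)
   show "g holomorphic_on ball u (r / 4)"
    by (rule holomorphic_on_subset[OF h]) (use sub ball_subset_cball in blast)
   show "continuous_on (cball u (r / 4)) g"
    by (rule continuous_on_subset[OF holomorphic_on_imp_continuous_on[OF h] sub])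
   show "0 < r / 4" using r by simp
   fix v assume "cmod (u - v) = r / 4"
   hence "v \<in> cball u (r/4)" by (simp add: dist_norm)
   thus "cmod (g v) <= B" using sub B by blast
  qed
  thus ?thesis by (simp add: field_simps)
 qed
 show ?thesis
 proof (rule field_differentiable_bound[of "ball a (r/2)" g "deriv g"])
  fix u assume u: "u \<in> ball a (r/2)"
  hence "u \<in> ball a r" using r by auto
  thus "(g has_field_derivative deriv g u) (at u within ball a (r/2))"
   using h holomorphic_derivI open_ball has_field_derivative_at_within by blast
 qed (use d x y in \<open>auto simp: dist_norm norm_minus_commute\<close>)
qed

text \<open>The difference quotients are dominated by \<open>holomorphic_lipschitz\<close>, so differentiation under the
integral sign is dominated convergence.\<close>

lemma holomorphic_integral:
 fixes h :: "'a => complex => complex"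
 assumes U: "open U" and hol: "\<And>w. w \<in> space M ==> h w holomorphic_on U"
  and meas: "\<And>\<zeta>. \<zeta> \<in> U ==> (\<lambda>w. h w \<zeta>) \<in> borel_measurable M"
  and bd: "\<And>w \<zeta>. w \<in> space M ==> \<zeta> \<in> U ==> cmod (h w \<zeta>) <= g w" and g: "integrable M g"
 shows "(\<lambda>\<zeta>. \<integral>w. h w \<zeta> \<partial>M) holomorphic_on U"
proof (rule holomorphic_onI)
 fix a assume a: "a \<in> U"
 then obtain r where r: "r > 0" "ball a r \<subseteq> U" using U open_contains_ball by blast
 have int: "integrable M (\<lambda>w. h w \<zeta>)" if "\<zeta> \<in> U" for \<zeta>
  by (rule integrable_dominated[OF g meas[OF that]]) (use bd that in \<open>fastforce intro: AE_I2\<close>)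
 define I where "I \<zeta> = (LINT w|M. h w \<zeta>)" for \<zeta>
 have "((\<lambda>x. (I x - I a) / (x - a)) \<longlongrightarrow> (LINT w|M. deriv (h w) a)) (at a)"
 proof (subst tendsto_at_iff_sequentially, intro allI impI)
  fix X :: "nat => complex" assume X0: "\<forall>i. X i \<in> UNIV - {a}" "X \<longlonglongrightarrow> a"
  then obtain N where N: "\<And>i. i >= N ==> dist (X i) a < r / 2"
   using r by (metis half_gt_zero lim_sequentially)
  define Y where "Y i = X (i + N)" for i
  have Y: "Y \<longlonglongrightarrow> a" "\<And>i. Y i \<noteq> a" "\<And>i. cmod (Y i - a) < r/2"
   using X0 N LIMSEQ_ignore_initial_segment[of X a N] by (auto simp: Y_def[abs_def] dist_norm)
  have YU: "Y i \<in> U" for i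
   using Y(3)[of i] r by (auto simp: dist_norm norm_minus_commute subset_iff)
  have eq: "(I (Y i) - I a) / (Y i - a) = (LINT w|M. (h w (Y i) - h w a) / (Y i - a))" for i
  proof -
   have "I (Y i) - I a = (LINT w|M. h w (Y i) - h w a)"
    unfolding I_def by (rule Bochner_Integration.integral_diff[OF int[OF YU] int[OF a], symmetric])
   thus ?thesis by simp
  qed
  have "(\<lambda>i. \<integral>w. (h w (Y i) - h w a) / (Y i - a) \<partial>M) \<longlonglongrightarrow> (LINT w|M. deriv (h w) a)"
  proof (rule integral_dominated_convergence[where w = "\<lambda>w. 4 * g w / r"])
   have lim: "(\<lambda>i. (h w (Y i) - h w a) / (Y i - a)) \<longlonglongrightarrow> deriv (h w) a" if "w \<in> space M" for w
   proof -
    have "(h w has_field_derivative deriv (h w) a) (at a)"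
     using hol[OF that] U a holomorphic_derivI by blast
    hence "((\<lambda>x. (h w x - h w a) / (x - a)) \<longlongrightarrow> deriv (h w) a) (at a)"
     by (simp add: has_field_derivative_iff)
    thus ?thesis using Y by (auto simp: tendsto_at_iff_sequentially o_def)
   qed
   show "AE w in M. (\<lambda>i. (h w (Y i) - h w a) / (Y i - a)) \<longlonglongrightarrow> deriv (h w) a"
    using lim by (rule AE_I2)
   show m: "(\<lambda>w. (h w (Y i) - h w a) / (Y i - a)) \<in> borel_measurable M" for i
    using meas[OF YU[of i]] meas[OF a] by simp
   show "(\<lambda>w. deriv (h w) a) \<in> borel_measurable M"
    by (rule borel_measurable_LIMSEQ_metric[OF m lim])
   show "integrable M (\<lambda>w. 4 * g w / r)" using g by simp
   show "AE w in M. cmod ((h w (Y i) - h w a) / (Y i - a)) <= 4 * g w / r" for i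
   proof (rule AE_I2)
    fix w assume w: "w \<in> space M"
    have "cmod (h w (Y i) - h w a) <= 4 * g w / r * cmod (Y i - a)"
     by (rule holomorphic_lipschitz[of _ a]) (use w r hol[OF w] bd Y in \<open>auto intro: holomorphic_on_subset\<close>)
    thus "cmod ((h w (Y i) - h w a) / (Y i - a)) <= 4 * g w / r"
     using Y(2)[of i] by (simp add: norm_divide divide_le_eq)
   qed
  qed
  hence "(\<lambda>i. (I (Y i) - I a) / (Y i - a)) \<longlonglongrightarrow> (LINT w|M. deriv (h w) a)" by (simp add: eq)
  thus "((\<lambda>x. (I x - I a) / (x - a)) \<circ> X) \<longlonglongrightarrow> (LINT w|M. deriv (h w) a)"
   unfolding Y_def o_def by (rule LIMSEQ_offset)
 qed
 hence "(I has_field_derivative (LINT w|M. deriv (h w) a)) (at a)" by (simp add: has_field_derivative_iff)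
 thus "(\<lambda>\<zeta>. \<integral>w. h w \<zeta> \<partial>M) field_differentiable at a within U"
  unfolding I_def using field_differentiable_at_within field_differentiable_def by blast
qed

section \<open>The Hermitian product\<close>

lemma herm_inner_cnj: "cnj (herm_inner z w) = herm_inner w z"
 by (simp add: herm_inner_def mult.commute)

lemma herm_inner_smult_left: "herm_inner (c *s z) w = c * herm_inner z w"
 by (simp add: herm_inner_def sum_distrib_left mult.assoc)

lemma herm_inner_smult_right: "herm_inner z (c *s w) = cnj c * herm_inner z w"
 by (simp add: herm_inner_def sum_distrib_left mult_ac)

lemma herm_inner_scaleR_right: "herm_inner z (c *\<^sub>R w) = complex_of_real c * herm_inner z w"
 by (simp add: herm_inner_def sum_distrib_left mult_ac scaleR_conv_of_real[where 'a = complex])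

lemma herm_inner_add_left: "herm_inner (z + z') w = herm_inner z w + herm_inner z' w"
 by (simp add: herm_inner_def algebra_simps sum.distrib)

lemma herm_inner_add_right: "herm_inner z (w + w') = herm_inner z w + herm_inner z w'"
 by (simp add: herm_inner_def algebra_simps sum.distrib)

lemma herm_inner_diff_right: "herm_inner z (w - w') = herm_inner z w - herm_inner z w'"
 by (simp add: herm_inner_def algebra_simps sum_subtractf)

lemma herm_inner_diff_left: "herm_inner (z - z') w = herm_inner z w - herm_inner z' w"
 by (simp add: herm_inner_def algebra_simps sum_subtractf)

lemma herm_inner_0 [simp]: "herm_inner 0 w = 0" "herm_inner z 0 = 0"
 by (simp_all add: herm_inner_def)

lemma herm_inner_self: "herm_inner z z = of_real ((norm z)\<^sup>2)"
proof -
 have "(norm z)\<^sup>2 = (\<Sum>i\<in>UNIV. (cmod (z $ i))\<^sup>2)"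
  by (simp add: norm_vec_def L2_set_def sum_nonneg)
 thus ?thesis by (simp add: herm_inner_def complex_norm_square flip: of_real_power)
qed

lemma herm_inner_bound: "cmod (herm_inner z w) <= norm z * norm w"
proof -
 have "cmod (herm_inner z w) <= (\<Sum>i\<in>UNIV. \<bar>cmod (z $ i)\<bar> * \<bar>cmod (w $ i)\<bar>)"
  unfolding herm_inner_def by (rule order_trans[OF norm_sum]) (simp add: norm_mult)
 also have "... <= norm z * norm w"
  using L2_set_mult_ineq[of "\<lambda>i. cmod (z $ i)" "\<lambda>i. cmod (w $ i)" UNIV] by (simp add: norm_vec_def)
 finally show ?thesis .
qed

lemma herm_inner_less_1:
 assumes "norm z < 1" "norm w < 1" shows "cmod (herm_inner z w) < 1"
proof -
 have "norm z * norm w <= norm z * 1" using assms by (intro mult_left_mono) auto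
 thus ?thesis using herm_inner_bound[of z w] assms by linarith
qed

lemma continuous_on_herm_inner [continuous_intros]:
 "continuous_on A f ==> continuous_on A g ==> continuous_on A (\<lambda>x. herm_inner (f x) (g x))"
 unfolding herm_inner_def by (intro continuous_intros)

lemma borel_measurable_herm_inner [measurable]:
 fixes g h :: "'a => complex ^ 'n"
 assumes [measurable]: "g \<in> borel_measurable M" "h \<in> borel_measurable M"
 shows "(\<lambda>x. herm_inner (g x) (h x)) \<in> borel_measurable M"
proof -
 have "continuous_on UNIV (\<lambda>p :: (complex ^ 'n) \<times> (complex ^ 'n). herm_inner (fst p) (snd p))"
  by (intro continuous_intros)
 from borel_measurable_continuous_onI[OF this]
 have "(\<lambda>p :: (complex ^ 'n) \<times> (complex ^ 'n). herm_inner (fst p) (snd p)) \<in> borel_measurable (borel \<Otimes>\<^sub>M borel)"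
  by (simp add: borel_prod)
 from measurable_compose[OF _ this, of "\<lambda>x. (g x, h x)" M] show ?thesis by simp
qed

lemma vec_smult_scaleR: "of_real c *s (x :: complex ^ 'n) = c *\<^sub>R x"
 by (vector scaleR_conv_of_real)

section \<open>Radial weights and Gaussians\<close>

text \<open>The weight of \<open>dV_lam\<close> without its normalising constant, extended by zero so that integrals over the ball
become Borel integrals over the whole space.\<close>

definition bwt :: "real => 'a::euclidean_space => real" where
 "bwt m x = indicator (ball 0 1) x * (1 - (norm x)\<^sup>2) powr m"

lemma bwt_nonneg [simp]: "0 <= bwt m x" by (simp add: bwt_def)

lemma bwt_measurable [measurable]: "bwt m \<in> borel_measurable borel"
 unfolding bwt_def[abs_def] by (intro borel_measurable_times borel_measurable_indicator powr_real_measurable) auto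

lemma nn_integral_lborel_scale:
 fixes g :: "'a::euclidean_space => ennreal"
 assumes [measurable]: "g \<in> borel_measurable borel" and c: "c > 0"
 shows "(\<integral>\<^sup>+x. g x \<partial>lborel) = ennreal (c ^ DIM('a)) * (\<integral>\<^sup>+x. g (c *\<^sub>R x) \<partial>lborel)"
 by (subst lborel_affine[of c 0])
  (use c in \<open>simp_all add: nn_integral_density nn_integral_distr nn_integral_cmult\<close>)

lemma Gamma_nn_integral_shift:
 fixes m a :: real
 assumes "m > -1"
 shows "(\<integral>\<^sup>+t. ennreal (indicator {0<..} (t - a) * (t - a) powr m * exp (- t)) \<partial>lborel) = ennreal (Gamma (m + 1) * exp (- a))"
proof -
 have "(\<integral>\<^sup>+t. ennreal (indicator {0<..} (t - a) * (t - a) powr m * exp (- t)) \<partial>lborel)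
  = (\<integral>\<^sup>+t. ennreal (indicator {0<..} t * t powr m * exp (- (a + t))) \<partial>lborel)"
  by (subst nn_integral_real_affine[where c = 1 and t = a]) auto
 also have "... = (\<integral>\<^sup>+t. ennreal (exp (- a)) * ennreal (indicator {0..} t * t powr (m + 1 - 1) / exp t) \<partial>lborel)"
  by (intro nn_integral_cong)
   (auto simp: indicator_def exp_diff exp_minus field_simps ennreal_mult'[symmetric] exp_add)
 also have "... = ennreal (exp (- a)) * ennreal (Gamma (m + 1))"
  by (subst nn_integral_cmult, simp, subst Gamma_conv_nn_integral_real) (use assms in auto)
 finally show ?thesis by (simp add: ennreal_mult'[symmetric] mult.commute)
qed

text \<open>Integrating \<open>(t - |w|^2)_+^m exp(-t)\<close> over \<open>t\<close> gives a Gaussian in \<open>w\<close>, and rescaling \<open>w\<close> by the square root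
of \<open>t\<close> gives the weight \<open>(1 - |w|^2)_+^m\<close> times a power of \<open>t\<close>. This density thus links Gaussian integrals
with integrals over the ball.\<close>

definition bgk :: "real => real => 'a::euclidean_space => real" where
 "bgk m t w = indicator {0<..} (t - (norm w)\<^sup>2) * (t - (norm w)\<^sup>2) powr m * exp (- t)"

lemma bgk_nonneg [simp]: "0 <= bgk m t w" by (simp add: bgk_def)

lemma bgk_measurable [measurable]: "(\<lambda>(t, w). bgk m t w) \<in> borel_measurable (lborel \<Otimes>\<^sub>M lborel)"
 unfolding bgk_def by measurable

lemma bgk_neg: "t <= 0 ==> bgk m t w = 0"
proof -
 assume "t <= 0"
 hence "\<not> 0 < t - (norm w)\<^sup>2" using zero_le_power2[of "norm w"] by linarith
 thus ?thesis by (simp add: bgk_def)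
qed

lemma bgk_scale:
 assumes t: "t > 0"
 shows "bgk m t (sqrt t *\<^sub>R w) = t powr m * exp (- t) * bwt m w"
proof -
 have eq: "t - (norm (sqrt t *\<^sub>R w))\<^sup>2 = t * (1 - (norm w)\<^sup>2)"
  using t by (simp add: power_mult_distrib algebra_simps)
 have "0 < 1 - (norm w)\<^sup>2 \<longleftrightarrow> norm w < 1" by (simp add: abs_square_less_1)
 thus ?thesis unfolding bgk_def eq bwt_def
  using t by (auto simp: indicator_def zero_less_mult_iff powr_mult)
qed

text \<open>The two iterated integrals of \<open>bgk\<close> against a homogeneous function of degree \<open>2 k\<close>: homogeneity pulls the
power of \<open>t\<close> out of the inner integral, and what remains over \<open>t\<close> is a Gamma integral.\<close>

lemma nn_integral_beta_gamma:
 fixes g :: "'a::euclidean_space => real"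
 assumes [measurable]: "g \<in> borel_measurable borel" and g0: "\<And>x. g x >= 0"
  and hom: "\<And>r x. r > 0 ==> g (r *\<^sub>R x) = r ^ (2 * k) * g x" and a: "a > -1"
 shows "(\<integral>\<^sup>+t. (\<integral>\<^sup>+w. ennreal (bgk a t w * g w) \<partial>lborel) \<partial>lborel)
  = ennreal (Gamma (real DIM('a) / 2 + k + a + 1)) * (\<integral>\<^sup>+w. ennreal (g w * bwt a w) \<partial>lborel)" (is ?A)
  and "(\<integral>\<^sup>+w. (\<integral>\<^sup>+t. ennreal (bgk a t w * g w) \<partial>lborel) \<partial>lborel)
  = ennreal (Gamma (a + 1)) * (\<integral>\<^sup>+w. ennreal (g w * exp (- (norm w)\<^sup>2)) \<partial>lborel)" (is ?B)
proof -
 define d where "d = real DIM('a) / 2"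
 have dpos: "d > 0" by (simp add: d_def)
 have inner: "(\<integral>\<^sup>+w. ennreal (bgk a t w * g w) \<partial>lborel)
  = ennreal (indicator {0<..} (t - 0) * (t - 0) powr (d + k + a) * exp (- t)) * (\<integral>\<^sup>+w. ennreal (g w * bwt a w) \<partial>lborel)" for t
 proof (cases "t > 0")
  case False thus ?thesis by (simp add: bgk_neg)
 next
  case True
  have "(\<integral>\<^sup>+w. ennreal (bgk a t w * g w) \<partial>lborel)
   = ennreal (sqrt t ^ DIM('a)) * (\<integral>\<^sup>+w. ennreal (bgk a t (sqrt t *\<^sub>R w) * g (sqrt t *\<^sub>R w)) \<partial>lborel)"
   by (rule nn_integral_lborel_scale) (use True in auto)
  also have "(\<integral>\<^sup>+w. ennreal (bgk a t (sqrt t *\<^sub>R w) * g (sqrt t *\<^sub>R w)) \<partial>lborel)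
   = (\<integral>\<^sup>+w. ennreal (t powr a * exp (- t) * sqrt t ^ (2 * k)) * ennreal (g w * bwt a w) \<partial>lborel)"
   using True by (intro nn_integral_cong, subst ennreal_mult'[symmetric]) (auto simp: bgk_scale hom mult_ac)
  also have "... = ennreal (t powr a * exp (- t) * sqrt t ^ (2 * k)) * (\<integral>\<^sup>+w. ennreal (g w * bwt a w) \<partial>lborel)"
   by (rule nn_integral_cmult) measurable
  also have "ennreal (sqrt t ^ DIM('a)) * ... = ennreal (sqrt t ^ DIM('a) * (t powr a * exp (- t) * sqrt t ^ (2 * k))) * (\<integral>\<^sup>+w. ennreal (g w * bwt a w) \<partial>lborel)"
   using True by (simp add: ennreal_mult' mult.assoc)
  also have "sqrt t ^ DIM('a) * (t powr a * exp (- t) * sqrt t ^ (2 * k)) = t powr (d + k + a) * exp (- t)"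
  proof -
   have "sqrt t ^ m = t powr (real m / 2)" for m
    using True by (simp add: powr_half_sqrt[symmetric] powr_powr flip: powr_realpow)
   thus ?thesis using True by (simp add: d_def powr_add)
  qed
  finally show ?thesis using True by simp
 qed
 show ?A
  unfolding inner using Gamma_nn_integral_shift[of "d + k + a" 0] a dpos
  by (subst nn_integral_multc) (auto simp: d_def)
 have inner': "(\<integral>\<^sup>+t. ennreal (bgk a t w * g w) \<partial>lborel) = ennreal (Gamma (a + 1)) * ennreal (g w * exp (- (norm w)\<^sup>2))" for w
 proof -
  have "(\<integral>\<^sup>+t. ennreal (bgk a t w * g w) \<partial>lborel) = (\<integral>\<^sup>+t. ennreal (bgk a t w) * ennreal (g w) \<partial>lborel)"
   by (simp add: ennreal_mult')
  also have "... = ennreal (Gamma (a + 1) * exp (- (norm w)\<^sup>2)) * ennreal (g w)"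
   unfolding bgk_def by (subst nn_integral_multc) (use Gamma_nn_integral_shift[OF a] in auto)
  finally show ?thesis
   using a g0 by (simp add: ennreal_mult'[symmetric] Gamma_real_nonneg mult_ac ennreal_mult''[symmetric])
 qed
 show ?B unfolding inner' by (rule nn_integral_cmult) measurable
qed

lemma exp_neg_norm_integrable: "integrable lborel (\<lambda>w::'a::euclidean_space. exp (- (norm w)\<^sup>2))"
 and bwt_integrable: "(m::real) > -1 ==> integrable lborel (bwt m :: 'a => real)"
proof -
 have sw: "ennreal (Gamma (real DIM('a) / 2 + m + 1)) * (\<integral>\<^sup>+w. ennreal (bwt m (w::'a)) \<partial>lborel)
  = ennreal (Gamma (m + 1)) * (\<integral>\<^sup>+w. ennreal (exp (- (norm (w::'a))\<^sup>2)) \<partial>lborel)" if "m > -1" for m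
 proof -
  have "(\<integral>\<^sup>+t. (\<integral>\<^sup>+w. ennreal (bgk m t (w::'a) * 1) \<partial>lborel) \<partial>lborel) = (\<integral>\<^sup>+w. (\<integral>\<^sup>+t. ennreal (bgk m t (w::'a) * 1) \<partial>lborel) \<partial>lborel)"
   by (rule lborel_pair.Fubini'[symmetric]) measurable
  thus ?thesis using nn_integral_beta_gamma[of "\<lambda>_::'a. 1" 0 m] that by simp
 qed
 have b0: "(\<integral>\<^sup>+w. ennreal (bwt 0 (w::'a)) \<partial>lborel) < \<infinity>"
 proof -
  have "(\<integral>\<^sup>+w. ennreal (bwt 0 (w::'a)) \<partial>lborel) <= (\<integral>\<^sup>+w. indicator (ball (0::'a) 1) w \<partial>lborel)"
   by (intro nn_integral_mono) (auto simp: bwt_def indicator_def)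
  also have "... < \<infinity>" using emeasure_lborel_ball_finite[of "0::'a" 1] by simp
  finally show ?thesis .
 qed
 hence e: "(\<integral>\<^sup>+w. ennreal (exp (- (norm (w::'a))\<^sup>2)) \<partial>lborel) < \<infinity>"
 proof -
  have "(\<integral>\<^sup>+w. ennreal (exp (- (norm (w::'a))\<^sup>2)) \<partial>lborel)
   = ennreal (Gamma (real DIM('a) / 2 + 1)) * (\<integral>\<^sup>+w. ennreal (bwt 0 (w::'a)) \<partial>lborel)"
   using sw[of 0] by simp
  thus ?thesis using b0 by (simp only: ennreal_mult_less_top infinity_ennreal_def) simp
 qed
 thus "integrable lborel (\<lambda>w::'a. exp (- (norm w)\<^sup>2))"
  by (simp add: integrable_iff_bounded)
 show "integrable lborel (bwt m :: 'a => real)" if m: "m > -1"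
 proof -
  have "ennreal (Gamma (real DIM('a) / 2 + m + 1)) \<noteq> 0"
  proof -
   have "real DIM('a) / 2 >= 0" by simp
   hence "0 < real DIM('a) / 2 + m + 1" using m by linarith
   from Gamma_real_pos[OF this] show ?thesis unfolding ennreal_eq_0_iff by linarith
  qed
  hence "(\<integral>\<^sup>+w. ennreal (bwt m (w::'a)) \<partial>lborel) < \<infinity>"
  proof -
   have "ennreal (Gamma (real DIM('a) / 2 + m + 1)) * (\<integral>\<^sup>+w. ennreal (bwt m (w::'a)) \<partial>lborel) < \<infinity>"
    unfolding sw[OF m] using e by (simp add: ennreal_mult_less_top)
   thus ?thesis using \<open>ennreal (Gamma (real DIM('a) / 2 + m + 1)) \<noteq> 0\<close>
    unfolding infinity_ennreal_def ennreal_mult_less_top by (elim disjE) auto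
  qed
  thus ?thesis by (simp add: integrable_iff_bounded)
 qed
qed

lemma beta_gamma_nonneg:
 fixes g :: "'a::euclidean_space => real"
 assumes g: "g \<in> borel_measurable borel" "\<And>x. g x >= 0" "\<And>r x. r > 0 ==> g (r *\<^sub>R x) = r ^ (2 * k) * g x"
  and m: "m > -1" and int: "integrable lborel (\<lambda>w. g w * bwt m w)"
 shows "has_bochner_integral lborel (\<lambda>w. g w * exp (- (norm w)\<^sup>2))
  (Gamma (real DIM('a) / 2 + k + m + 1) / Gamma (m + 1) * (LINT w|lborel. g w * bwt m w))"
proof (rule has_bochner_integral_nn_integral)
 note [measurable] = g(1)
 define I where "I = (LINT w|lborel. g w * bwt m w)"
 define b where "b = Gamma (real DIM('a) / 2 + k + m + 1)"
 define c where "c = Gamma (m + 1)"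
 have I: "I >= 0" unfolding I_def using g(2) by (intro integral_nonneg_AE) auto
 have b: "b >= 0" unfolding b_def using m by (intro Gamma_real_nonneg) (auto intro: add_nonneg_pos simp: add.assoc)
 have c: "c > 0" unfolding c_def using m by simp
 show "(\<lambda>w. g w * exp (- (norm w)\<^sup>2)) \<in> borel_measurable lborel" by measurable
 show "AE w in lborel. 0 <= g w * exp (- (norm w)\<^sup>2)" using g(2) by auto
 show "0 <= b / c * I" using I b c by simp
 define X where "X = (\<integral>\<^sup>+w. ennreal (g w * exp (- (norm w)\<^sup>2)) \<partial>lborel)"
 have "ennreal c * X = (\<integral>\<^sup>+w. (\<integral>\<^sup>+t. ennreal (bgk m t w * g w) \<partial>lborel) \<partial>lborel)"
  using nn_integral_beta_gamma(2)[OF g m] by (simp add: X_def c_def)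
 also have "... = (\<integral>\<^sup>+t. (\<integral>\<^sup>+w. ennreal (bgk m t w * g w) \<partial>lborel) \<partial>lborel)"
  by (rule lborel_pair.Fubini') measurable
 also have "... = ennreal b * ennreal I"
  using nn_integral_beta_gamma(1)[OF g m] nn_integral_eq_integral[OF int] g(2) by (simp add: b_def I_def)
 finally have e: "ennreal c * X = ennreal (b * I)" using b by (simp add: ennreal_mult')
 have "X = ennreal (1 / c) * (ennreal c * X)" using c by (simp add: mult.assoc[symmetric] flip: ennreal_mult')
 thus "X = ennreal (b / c * I)" unfolding e using c by (simp flip: ennreal_mult')
qed

text \<open>Reduction to the nonnegative case: the positive and negative parts inherit homogeneity.\<close>

lemma beta_gamma_real:
 fixes g :: "'a::euclidean_space => real"
 assumes g[measurable]: "g \<in> borel_measurable borel" and hom: "\<And>r x. r > 0 ==> g (r *\<^sub>R x) = r ^ (2 * k) * g x"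
  and m: "m > -1" and int: "integrable lborel (\<lambda>w. g w * bwt m w)"
 shows "has_bochner_integral lborel (\<lambda>w. g w * exp (- (norm w)\<^sup>2))
  (Gamma (real DIM('a) / 2 + k + m + 1) / Gamma (m + 1) * (LINT w|lborel. g w * bwt m w))"
proof -
 define G where "G s x = max (s * g x) 0" for s x
 have Gi: "integrable lborel (\<lambda>w. G s w * bwt m w)" if "\<bar>s\<bar> = 1" for s
 proof (rule integrable_dominated[OF int])
  have "s * g w <= \<bar>g w\<bar>" for w using abs_ge_self[of "s * g w"] that by (simp add: abs_mult)
  thus "AE w in lborel. norm (G s w * bwt m w) <= norm (g w * bwt m w)"
   by (auto simp: G_def abs_mult max_def intro!: mult_right_mono)
 qed (simp add: G_def)
 have hG: "G s (r *\<^sub>R x) = r ^ (2 * k) * G s x" if "r > 0" for s r x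
  using that max_mult_distrib_left[of "r ^ (2 * k)" "s * g x" 0] by (simp add: G_def hom mult.left_commute)
 have h: "has_bochner_integral lborel (\<lambda>w. G s w * exp (- (norm w)\<^sup>2))
  (Gamma (real DIM('a) / 2 + k + m + 1) / Gamma (m + 1) * (LINT w|lborel. G s w * bwt m w))" if "\<bar>s\<bar> = 1" for s
  by (rule beta_gamma_nonneg[OF _ _ hG m Gi[OF that]]) (auto simp: G_def[abs_def])
 have e: "g w * x = G 1 w * x - G (-1) w * x" for w x by (simp add: G_def max_def left_diff_distrib)
 show ?thesis using has_bochner_integral_diff[OF h[of 1] h[of "-1"]] Gi[of 1] Gi[of "-1"]
  unfolding e by (simp add: right_diff_distrib)
qed

text \<open>For a homogeneous integrand, the ball integral and the Gaussian integral differ by a quotient of Gamma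
values, so moments over the ball can be read off from Gaussian moments.\<close>

lemma integral_beta_gamma:
 fixes g :: "'a::euclidean_space => complex"
 assumes g[measurable]: "g \<in> borel_measurable borel"
  and hom: "\<And>r x. r > 0 ==> g (r *\<^sub>R x) = of_real (r ^ (2 * k)) * g x" and m: "m > -1"
  and int: "integrable lborel (\<lambda>w. g w * bwt m w)"
 shows "of_real (Gamma (m + 1)) * (LINT w|lborel. g w * exp (- (norm w)\<^sup>2))
   = of_real (Gamma (real DIM('a) / 2 + k + m + 1)) * (LINT w|lborel. g w * bwt m w)"
proof -
 define c where "c = Gamma (real DIM('a) / 2 + k + m + 1) / Gamma (m + 1)"
 have i: "integrable lborel (\<lambda>w. Re (g w) * bwt m w)" "integrable lborel (\<lambda>w. Im (g w) * bwt m w)"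
  using integrable_Re[OF int] integrable_Im[OF int] by simp_all
 have "has_bochner_integral lborel (\<lambda>w. Re (g w) * exp (- (norm w)\<^sup>2)) (c * (LINT w|lborel. Re (g w) * bwt m w))"
  "has_bochner_integral lborel (\<lambda>w. Im (g w) * exp (- (norm w)\<^sup>2)) (c * (LINT w|lborel. Im (g w) * bwt m w))"
  unfolding c_def by (intro beta_gamma_real m i; simp add: hom)+
 from has_bochner_integral_add[OF has_bochner_integral_of_real[OF this(1)] has_bochner_integral_mult_right[OF has_bochner_integral_of_real[OF this(2)], of \<i>]]
 have "has_bochner_integral lborel (\<lambda>w. g w * exp (- (norm w)\<^sup>2))
  (of_real c * (of_real (LINT w|lborel. Re (g w) * bwt m w) + \<i> * of_real (LINT w|lborel. Im (g w) * bwt m w)))"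
 proof -
  have e: "g w * x = of_real (Re (g w)) * x + \<i> * (of_real (Im (g w)) * x)" for w x by (simp add: complex_eq_iff)
  assume "has_bochner_integral lborel (\<lambda>x. complex_of_real (Re (g x) * exp (- (norm x)\<^sup>2)) + \<i> * complex_of_real (Im (g x) * exp (- (norm x)\<^sup>2)))
   (complex_of_real (c * (LINT w|lborel. Re (g w) * bwt m w)) + \<i> * complex_of_real (c * (LINT w|lborel. Im (g w) * bwt m w)))"
  thus ?thesis unfolding e by (simp add: algebra_simps)
 qed
 hence "(LINT w|lborel. g w * exp (- (norm w)\<^sup>2)) = of_real c * (of_real (LINT w|lborel. Re (g w) * bwt m w) + \<i> * of_real (LINT w|lborel. Im (g w) * bwt m w))"
  by (rule has_bochner_integral_integral_eq)
 also have "of_real (LINT w|lborel. Re (g w) * bwt m w) + \<i> * of_real (LINT w|lborel. Im (g w) * bwt m w) = (LINT w|lborel. g w * bwt m w)"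
  using integral_Re[OF int] integral_Im[OF int] by (simp add: complex_eq_iff)
 moreover have "Gamma (m + 1) \<noteq> 0" using Gamma_real_pos[of "m + 1"] m by linarith
 ultimately show ?thesis by (simp add: c_def)
qed

section \<open>The Gaussian reproducing formula\<close>

definition gauss_mass :: "(complex ^ 'n) itself => real" where
 "gauss_mass _ = (LINT w|lborel. exp (- (norm (w :: complex ^ 'n))\<^sup>2))"

lemma norm_add_herm: "(norm (z + u))\<^sup>2 = (norm z)\<^sup>2 + (norm u)\<^sup>2 + 2 * Re (herm_inner z u)"
proof -
 have "complex_of_real ((norm (z + u))\<^sup>2) = of_real ((norm z)\<^sup>2 + (norm u)\<^sup>2) + (herm_inner z u + cnj (herm_inner z u))"
  unfolding herm_inner_self[symmetric] of_real_add herm_inner_cnj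
  by (simp add: herm_inner_add_left herm_inner_add_right)
 also have "... = of_real ((norm z)\<^sup>2 + (norm u)\<^sup>2 + 2 * Re (herm_inner z u))"
  by (simp add: complex_add_cnj)
 finally show ?thesis using of_real_eq_iff by blast
qed

text \<open>Completing the square moves the centre of the Gaussian from the origin to \<open>z\<close>. After the translation
the integrand is an entire function on every complex line times a radial weight, and the circle average replaces it
by its value at the centre.\<close>

lemma integral_gauss_reproducing:
 fixes g :: "complex ^ 'n => complex"
 assumes [measurable]: "g \<in> borel_measurable borel"
  and ent: "\<And>a u. (\<lambda>\<zeta>. g (a + \<zeta> *s u)) holomorphic_on UNIV"
  and int: "integrable lborel (\<lambda>w. g w * exp (herm_inner z w) * exp (- (norm w)\<^sup>2))"
 shows "(LINT w|lborel. g w * exp (herm_inner z w) * exp (- (norm w)\<^sup>2)) = of_real (gauss_mass TYPE(complex ^ 'n)) * g z"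
proof -
 define \<Psi> where "\<Psi> w = g w * exp (herm_inner z w) * complex_of_real (exp (- (norm w)\<^sup>2))" for w
 define \<Phi> where "\<Phi> u = g (z + u) * exp (- herm_inner u z) * complex_of_real (exp (- (norm u)\<^sup>2))" for u
 have [measurable]: "\<Psi> \<in> borel_measurable borel" unfolding \<Psi>_def by measurable
 have \<Phi>eq: "\<Psi> (z + u) = \<Phi> u" for u
 proof -
  have "herm_inner z (z + u) + complex_of_real (- (norm (z + u))\<^sup>2) = - herm_inner u z + complex_of_real (- (norm u)\<^sup>2)"
  proof -
   have "complex_of_real (2 * Re (herm_inner z u)) = herm_inner z u + herm_inner u z"
    by (simp add: complex_add_cnj flip: herm_inner_cnj[of z u])
   thus ?thesis
    unfolding norm_add_herm herm_inner_add_right herm_inner_self by (simp add: algebra_simps)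
  qed
  thus ?thesis unfolding \<Psi>_def \<Phi>_def
   by (metis (no_types, lifting) exp_add exp_of_real mult.assoc)
 qed
 have int\<Phi>: "integrable lborel \<Phi>"
 proof -
  have "integrable (distr lborel borel ((+) z)) \<Psi>" using int by (simp add: lborel_distr_plus \<Psi>_def[abs_def])
  thus ?thesis by (subst (asm) integrable_distr_eq) (auto simp: \<Phi>eq)
 qed
 have "(LINT w|lborel. \<Psi> w) = (LINT u|lborel. \<Phi> u)"
  by (subst lborel_distr_plus[of z, symmetric]) (simp add: integral_distr \<Phi>eq)
 also have "... = (LINT u|lborel. (LINT t|circ. \<Phi> (cs t *s u)))"
  by (rule integral_circle_average[OF int\<Phi>])
 also have "... = (LINT u|lborel. g z * complex_of_real (exp (- (norm (u :: complex ^ 'n))\<^sup>2)))"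
 proof (rule LINT_cong)
  fix u
  define h where "h \<zeta> = g (z + \<zeta> *s u) * exp (- (\<zeta> * herm_inner u z))" for \<zeta>
  have hol: "h holomorphic_on UNIV" unfolding h_def by (intro holomorphic_intros ent)
  have "(LINT t|circ. h (cs t) / cs t ^ 0) = (deriv ^^ 0) h 0 / fact 0"
   by (rule circle_taylor_coeff) (use hol holomorphic_on_imp_continuous_on holomorphic_on_subset continuous_on_subset in blast)+
  hence "(LINT t|circ. h (cs t)) = g z" by (simp add: h_def)
  moreover have "\<Phi> (cs t *s u) = h (cs t) * complex_of_real (exp (- (norm u)\<^sup>2))" for t
   by (simp add: \<Phi>_def h_def herm_inner_smult_left norm_vector_smult)
  ultimately show "(LINT t|circ. \<Phi> (cs t *s u)) = g z * complex_of_real (exp (- (norm u)\<^sup>2))" by simp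
 qed simp
 also have "... = of_real (gauss_mass TYPE(complex ^ 'n)) * g z"
  using exp_neg_norm_integrable[where 'a = "complex ^ 'n"] by (simp add: gauss_mass_def mult.commute)
 finally show ?thesis by (simp add: \<Psi>_def)
qed

section \<open>Homogeneous expansions and moments\<close>

text \<open>The homogeneous polynomial of degree \<open>k\<close> in the expansion of \<open>f\<close> at the origin.\<close>

definition hcoef :: "(complex ^ 'n => complex) => nat => complex ^ 'n => complex" where
 "hcoef f k u = (deriv ^^ k) (\<lambda>\<zeta>. f (\<zeta> *s u)) 0 / fact k"

lemma open_smult_ball: "open {z. norm (z *s (u :: complex ^ 'n)) < r}"
 unfolding norm_vector_smult by (intro open_Collect_less continuous_intros)

lemma slice0_holomorphic:
 assumes "analytic_several f (ball 0 1)"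
 shows "(\<lambda>\<zeta>. f (\<zeta> *s u)) holomorphic_on {\<zeta>. norm (\<zeta> *s u) < 1}"
 using analytic_several_slice[OF assms open_smult_ball[of u 1], of 0 u] by simp

lemma hcoef_circle:
 assumes f: "analytic_several f (ball 0 1)" and u: "norm u < 1"
 shows "hcoef f k u = (LINT t|circ. f (cs t *s u) / cs t ^ k)"
proof -
 have sub: "cball 0 1 \<subseteq> {\<zeta>. norm (\<zeta> *s u) < 1}"
 proof
  fix \<zeta> :: complex assume "\<zeta> \<in> cball 0 1"
  hence "cmod \<zeta> * norm u <= 1 * norm u" by (intro mult_right_mono) auto
  thus "\<zeta> \<in> {\<zeta>. norm (\<zeta> *s u) < 1}" using u by (simp add: norm_vector_smult)
 qed
 have h: "(\<lambda>\<zeta>. f (\<zeta> *s u)) holomorphic_on cball 0 1"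
  using slice0_holomorphic[OF f] sub holomorphic_on_subset by blast
 show ?thesis unfolding hcoef_def
  by (rule circle_taylor_coeff[symmetric])
   (use h holomorphic_on_imp_continuous_on holomorphic_on_subset ball_subset_cball in blast)+
qed

lemma hcoef_smult:
 assumes f: "analytic_several f (ball 0 1)"
 shows "hcoef f k (c *s u) = c ^ k * hcoef f k u"
proof -
 have "(deriv ^^ k) (\<lambda>\<zeta>. (\<lambda>\<zeta>. f (\<zeta> *s u)) (c * \<zeta>)) 0 = c ^ k * (deriv ^^ k) (\<lambda>\<zeta>. f (\<zeta> *s u)) (c * 0)"
 proof (rule higher_deriv_compose_linear[OF slice0_holomorphic[OF f] _ open_smult_ball])
  show "open {\<zeta>. norm (\<zeta> *s (c *s u)) < 1}" by (rule open_smult_ball)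
 qed (auto simp: norm_vector_smult norm_mult mult_ac)
 thus ?thesis by (simp add: hcoef_def vector_smult_assoc mult.commute)
qed

lemma hcoef_scaleR:
 assumes "analytic_several f (ball 0 1)"
 shows "hcoef f k (r *\<^sub>R u) = of_real (r ^ k) * hcoef f k u"
 using hcoef_smult[OF assms, of k "of_real r" u] by (simp add: vec_smult_scaleR)

lemma analytic_several_bounded:
 fixes f :: "complex ^ 'n => complex"
 assumes f: "analytic_several f (ball 0 1)" and r: "r < 1"
 shows "\<exists>B. \<forall>u. norm u <= r --> cmod (f u) <= B"
proof -
 have "compact (f ` cball 0 r)"
  by (intro compact_continuous_image continuous_on_subset[OF analytic_several_continuous_on[OF f]])
   (use r in auto)
 hence "bounded (f ` cball 0 r)" by (rule compact_imp_bounded)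
 thus ?thesis unfolding bounded_iff by (meson imageI mem_cball_0)
qed

lemma circ_bound:
 assumes "\<And>t. cmod (F t) <= B" shows "cmod (LINT t|circ. F t) <= B"
proof (cases "integrable circ F")
 case True
 interpret circ: finite_measure circ by (rule finite_measure_circ)
 have "cmod (LINT t|circ. F t) <= (LINT t|circ. cmod (F t))" by (rule integral_norm_bound)
 also have "... <= (LINT t|circ. B)" by (rule integral_mono) (use True assms in auto)
 also have "... = B" by (simp add: finite_measure_circ)
 finally show ?thesis .
next
 case False
 thus ?thesis using order_trans[OF norm_ge_zero assms[of 0]] by (simp add: not_integrable_integral_eq)
qed

text \<open>The circle formula bounds the polynomial on the ball of radius \<open>1/2\<close>; homogeneity does the rest.\<close>

lemma hcoef_bounded:
 fixes f :: "complex ^ 'n => complex"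
 assumes f: "analytic_several f (ball 0 1)"
 shows "\<exists>M\<ge>0. \<forall>u. cmod (hcoef f k u) <= M * norm u ^ k"
proof -
 obtain B where B: "\<And>u. norm u <= 1/2 ==> cmod (f u) <= B" using analytic_several_bounded[OF f, of "1/2"] by auto
 have B0: "B >= 0" using order_trans[OF norm_ge_zero B[of 0]] by simp
 interpret circ: finite_measure circ by (rule finite_measure_circ)
 have half: "cmod (hcoef f k u) <= B" if u: "norm u <= 1/2" for u
 proof -
  have "cmod (LINT t|circ. f (cs t *s u) / cs t ^ k) <= B"
   by (rule circ_bound) (use B u B0 in \<open>auto simp: norm_divide norm_power norm_vector_smult\<close>)
  thus ?thesis using hcoef_circle[OF f, of u] u by simp
 qed
 have "cmod (hcoef f k u) <= (2 ^ k * B) * norm u ^ k" for u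
 proof (cases "u = 0")
  case True thus ?thesis using half[of 0] B0 hcoef_smult[OF f, of k 0 0] by (cases k) auto
 next
  case False
  have "u = (2 * norm u) *\<^sub>R ((1 / (2 * norm u)) *\<^sub>R u)" using False by simp
  hence "hcoef f k u = of_real ((2 * norm u) ^ k) * hcoef f k ((1 / (2 * norm u)) *\<^sub>R u)"
   using hcoef_scaleR[OF f] by metis
  moreover have "cmod (hcoef f k ((1 / (2 * norm u)) *\<^sub>R u)) <= B" using False by (intro half) auto
  moreover have "cmod (complex_of_real ((2 * norm u) ^ k)) = (2 * norm u) ^ k"
   by (simp add: norm_power norm_mult)
  ultimately have "cmod (hcoef f k u) <= (2 * norm u) ^ k * B"
   by (metis norm_mult mult_left_mono norm_ge_zero)
  thus ?thesis by (simp add: power_mult_distrib mult_ac)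
 qed
 thus ?thesis using B0 by (intro exI[of _ "2 ^ k * B"]) auto
qed

lemma borel_measurable_ball_indicator:
 fixes f :: "complex ^ 'n => complex"
 assumes "analytic_several f (ball 0 1)"
 shows "(\<lambda>w. indicator (ball 0 1) w *\<^sub>R f w) \<in> borel_measurable borel"
 by (rule borel_measurable_continuous_on_indicator[OF _ analytic_several_continuous_on[OF assms]]) simp

text \<open>On the unit ball the circle formula exhibits measurability; dividing by \<open>|u| + 1\<close> brings every point there.\<close>

lemma hcoef_measurable [measurable]:
 fixes f :: "complex ^ 'n => complex"
 assumes f: "analytic_several f (ball 0 1)"
 shows "hcoef f k \<in> borel_measurable borel"
proof -
 interpret circ: finite_measure circ by (rule finite_measure_circ)
 note circ_id[measurable]
 define f1 where "f1 w = indicator (ball 0 1) w *\<^sub>R f w" for w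
 have [measurable]: "f1 \<in> borel_measurable borel"
  unfolding f1_def[abs_def] by (rule borel_measurable_ball_indicator[OF f])
 define G where "G v = (LINT t|circ. f1 (cs t *s v) / cs t ^ k)" for v
 have [measurable]: "G \<in> borel_measurable borel"
 proof -
  have "(\<lambda>v. \<integral>t. f1 (cs t *s v) / cs t ^ k \<partial>circ) \<in> borel_measurable (borel :: (complex ^ 'n) measure)"
   by (rule circ.borel_measurable_lebesgue_integral) measurable
  thus ?thesis by (simp add: G_def[abs_def])
 qed
 have "hcoef f k u = of_real ((norm u + 1) ^ k) * G ((1 / (norm u + 1)) *\<^sub>R u)" for u
 proof -
  have p: "norm u + 1 > 0" by (simp add: add_nonneg_pos)
  have n: "norm ((1 / (norm u + 1)) *\<^sub>R u) < 1" using p by simp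
  have "u = (norm u + 1) *\<^sub>R ((1 / (norm u + 1)) *\<^sub>R u)" using p by simp
  hence "hcoef f k u = of_real ((norm u + 1) ^ k) * hcoef f k ((1 / (norm u + 1)) *\<^sub>R u)"
   using hcoef_scaleR[OF f] by metis
  also have "hcoef f k ((1 / (norm u + 1)) *\<^sub>R u) = G ((1 / (norm u + 1)) *\<^sub>R u)"
   unfolding hcoef_circle[OF f n] G_def f1_def using n by (simp add: norm_vector_smult)
  finally show ?thesis .
 qed
 hence "hcoef f k = (\<lambda>u. of_real ((norm u + 1) ^ k) * G ((1 / (norm u + 1)) *\<^sub>R u))" by (rule ext)
 moreover have "(\<lambda>u. of_real ((norm u + 1) ^ k) * G ((1 / (norm u + 1)) *\<^sub>R u)) \<in> borel_measurable borel"
  by measurable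
 ultimately show ?thesis by metis
qed

text \<open>Homogeneity scales any bounded piece of a complex line into the ball of radius \<open>1/2\<close>, where
the circle formula depends holomorphically on the parameter.\<close>

lemma hcoef_slice:
 fixes f :: "complex ^ 'n => complex"
 assumes f: "analytic_several f (ball 0 1)"
 shows "(\<lambda>\<zeta>. hcoef f k (a + \<zeta> *s u)) holomorphic_on UNIV"
proof -
 interpret circ: finite_measure circ by (rule finite_measure_circ)
 have *: "(\<lambda>\<zeta>. hcoef f k (a + \<zeta> *s u)) holomorphic_on ball 0 R" if R: "R > 0" for R
 proof -
  define \<tau> where "\<tau> = 1 / (2 * (norm a + R * norm u + 1))"
  have pos: "norm a + R * norm u + 1 > 0" using R by (simp add: add_nonneg_pos)
  have \<tau>: "\<tau> > 0" using pos by (simp add: \<tau>_def)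
  have small: "norm (\<tau> *\<^sub>R (a + \<zeta> *s u)) <= 1/2" if "\<zeta> \<in> ball 0 R" for \<zeta>
  proof -
   have "norm (a + \<zeta> *s u) <= norm a + cmod \<zeta> * norm u"
    by (rule order_trans[OF norm_triangle_ineq]) (simp add: norm_vector_smult)
   also have "... <= norm a + R * norm u" using that by (intro add_left_mono mult_right_mono) auto
   finally have "norm (a + \<zeta> *s u) <= norm a + R * norm u + 1" by simp
   hence "\<tau> * norm (a + \<zeta> *s u) <= \<tau> * (norm a + R * norm u + 1)"
    using \<tau> by (intro mult_left_mono) auto
   also have "... = 1/2" using pos by (simp add: \<tau>_def)
   finally show ?thesis using \<tau> by simp
  qed
  obtain B where B: "\<And>u. norm u <= 1/2 ==> cmod (f u) <= B" using analytic_several_bounded[OF f, of "1/2"] by auto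
  define h where "h t \<zeta> = f (cs t *s (\<tau> *\<^sub>R (a + \<zeta> *s u))) / cs t ^ k" for t \<zeta>
  have h: "(\<lambda>\<zeta>. \<integral>t. h t \<zeta> \<partial>circ) holomorphic_on ball 0 R"
  proof (rule holomorphic_integral[where g = "\<lambda>_. B"])
   show "h t holomorphic_on ball 0 R" for t
    unfolding h_def
   proof (intro holomorphic_intros analytic_several_compose[OF f])
    show "(\<lambda>\<zeta>. (cs t *s (\<tau> *\<^sub>R (a + \<zeta> *s u))) $ i) holomorphic_on ball 0 R" for i
     by (simp add: scaleR_conv_of_real[where 'a = complex]) (intro holomorphic_intros)
    show "\<zeta> \<in> ball 0 R ==> cs t *s (\<tau> *\<^sub>R (a + \<zeta> *s u)) \<in> ball 0 1" for \<zeta>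
     using small[of \<zeta>] by (simp add: norm_vector_smult del: norm_scaleR)
   qed auto
   show "(\<lambda>t. h t \<zeta>) \<in> borel_measurable circ" if \<zeta>: "\<zeta> \<in> ball 0 R" for \<zeta>
   proof (rule circ_measurable)
    have "continuous_on UNIV (\<lambda>t. f (cs t *s (\<tau> *\<^sub>R (a + \<zeta> *s u))))"
    proof (rule continuous_on_compose2[OF analytic_several_continuous_on[OF f]])
     show "continuous_on UNIV (\<lambda>t. cs t *s (\<tau> *\<^sub>R (a + \<zeta> *s u)))"
      unfolding cs_def vector_scalar_mult_def by (intro continuous_intros)
     show "(\<lambda>t. cs t *s (\<tau> *\<^sub>R (a + \<zeta> *s u))) ` UNIV \<subseteq> ball 0 1"
      using small[OF \<zeta>] by (auto simp: norm_vector_smult simp del: norm_scaleR)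
    qed
    from borel_measurable_continuous_onI[OF this]
    show "(\<lambda>t. h t \<zeta>) \<in> borel_measurable borel" unfolding h_def by measurable
   qed
   show "cmod (h t \<zeta>) <= B" if "\<zeta> \<in> ball 0 R" for t \<zeta>
    unfolding h_def using small[OF that] by (auto simp: norm_divide norm_power norm_vector_smult simp del: norm_scaleR intro!: B)
  qed auto
  have eq: "of_real ((1/\<tau>) ^ k) * (LINT t|circ. h t \<zeta>) = hcoef f k (a + \<zeta> *s u)" if "\<zeta> \<in> ball 0 R" for \<zeta>
  proof -
   have "(a + \<zeta> *s u) = (1/\<tau>) *\<^sub>R (\<tau> *\<^sub>R (a + \<zeta> *s u))" using \<tau> by simp
   hence "hcoef f k (a + \<zeta> *s u) = of_real ((1/\<tau>) ^ k) * hcoef f k (\<tau> *\<^sub>R (a + \<zeta> *s u))"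
    using hcoef_scaleR[OF f] by metis
   thus ?thesis unfolding h_def using small[OF that] by (subst (asm) (2) hcoef_circle[OF f]) auto
  qed
  have "(\<lambda>\<zeta>. of_real ((1/\<tau>) ^ k) * (LINT t|circ. h t \<zeta>)) holomorphic_on ball 0 R"
   by (intro holomorphic_intros h)
  thus ?thesis using eq by (rule holomorphic_transform)
 qed
 show ?thesis
 proof (rule holomorphic_onI)
  fix x :: complex
  have "(\<lambda>\<zeta>. hcoef f k (a + \<zeta> *s u)) field_differentiable (at x)"
   by (rule holomorphic_on_imp_differentiable_at[OF *[of "norm x + 1"]]) (auto simp: add_nonneg_pos)
  thus "(\<lambda>\<zeta>. hcoef f k (a + \<zeta> *s u)) field_differentiable (at x within UNIV)" by simp
 qed
qed

lemma cs_reflect: "cs (1 - t) = 1 / cs t"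
 by (simp add: cs_def exp_diff right_diff_distrib)

lemma cnj_cs: "cnj (cs t) = 1 / cs t"
 using complex_norm_square[of "cs t"] by (simp add: field_simps)

lemma integral_circ_reflect:
 "(LINT t|circ. F t) = (LINT t|circ. (F (1 - t) :: complex))"
proof -
 have "(LINT t|circ. F t) = (LINT t|lborel. indicator {0..1} t *\<^sub>R F t)" for F :: "real => complex"
  unfolding circ_def by (subst integral_restrict_space) auto
 note e = this
 have "(LINT t|lborel. indicator {0..1} t *\<^sub>R F t) = (LINT t|lborel. indicator {0..1} (1 - t) *\<^sub>R F (1 - t))"
  using lborel_integral_real_affine[of "-1" "\<lambda>t. indicator {0..1} t *\<^sub>R F t" 1] by simp
 also have "... = (LINT t|lborel. indicator {0..1} t *\<^sub>R F (1 - t))"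
  by (intro LINT_cong) (auto simp: indicator_def)
 finally show ?thesis by (simp only: e)
qed

lemma higher_deriv_exp_linear: "(deriv ^^ k) (\<lambda>\<zeta>. exp (x * \<zeta>)) = (\<lambda>\<zeta>. x ^ k * exp (x * \<zeta> :: complex))"
proof (induction k)
 case (Suc k)
 have "deriv (\<lambda>\<zeta>. x ^ k * exp (x * \<zeta>)) \<zeta> = x ^ Suc k * exp (x * \<zeta>)" for \<zeta>
  by (rule DERIV_imp_deriv) (auto intro!: derivative_eq_intros)
 thus ?case by (simp add: Suc fun_eq_iff)
qed simp

lemma circle_exp_moment: "(LINT t|circ. cs t ^ k * exp (x / cs t)) = x ^ k / fact k"
proof -
 have "(LINT t|circ. cs t ^ k * exp (x / cs t)) = (LINT t|circ. exp (x * cs t) / cs t ^ k)"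
  by (subst integral_circ_reflect) (simp add: cs_reflect field_simps)
 also have "... = (deriv ^^ k) (\<lambda>\<zeta>. exp (x * \<zeta>)) 0 / fact k"
  by (rule circle_taylor_coeff) (auto intro!: continuous_intros holomorphic_intros)
 finally show ?thesis by (simp add: higher_deriv_exp_linear)
qed

lemma exp_neg_half_norm_integrable: "integrable lborel (\<lambda>w::'a::euclidean_space. exp (- (norm w)\<^sup>2 / 2))"
proof -
 have "(\<integral>\<^sup>+w. ennreal (exp (- (norm (w::'a))\<^sup>2 / 2)) \<partial>lborel)
   = ennreal (sqrt 2 ^ DIM('a)) * (\<integral>\<^sup>+w. ennreal (exp (- (norm (sqrt 2 *\<^sub>R (w::'a)))\<^sup>2 / 2)) \<partial>lborel)"
  by (rule nn_integral_lborel_scale) auto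
 also have "... = ennreal (sqrt 2 ^ DIM('a)) * (\<integral>\<^sup>+w. ennreal (exp (- (norm (w::'a))\<^sup>2)) \<partial>lborel)"
  by (simp add: power_mult_distrib)
 also have "... < \<infinity>"
  using exp_neg_norm_integrable[where 'a='a] by (simp add: integrable_iff_bounded ennreal_mult_less_top)
 finally show ?thesis by (simp add: integrable_iff_bounded)
qed

lemma power_le_fact_exp:
 assumes "x >= (0::real)" shows "x ^ k <= fact k * exp x"
proof -
 have "(\<Sum>n\<in>{k}. x ^ n /\<^sub>R fact n) <= (\<Sum>n. x ^ n /\<^sub>R fact n)"
  using assms by (intro sum_le_suminf summable_exp_generic) auto
 hence "x ^ k / fact k <= exp x" by (simp add: exp_def divide_inverse mult.commute)
 thus ?thesis by (simp add: field_simps)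
qed

text \<open>In the Gaussian reproducing formula for the polynomial \<open>hcoef f k\<close>, circle averaging picks from the exponential
of \<open>\<langle>z, w\<rangle>\<close> the single term of matching degree \<open>k\<close>, which carries the factor \<open>1 / k!\<close>.\<close>

lemma gauss_moment:
 fixes f :: "complex ^ 'n => complex"
 assumes f: "analytic_several f (ball 0 1)"
 shows "(LINT w|lborel. hcoef f k w * herm_inner z w ^ k * exp (- (norm w)\<^sup>2))
  = fact k * of_real (gauss_mass TYPE(complex ^ 'n)) * hcoef f k z"
proof -
 note [measurable] = hcoef_measurable[OF f]
 obtain M where M: "M >= 0" "\<And>u. cmod (hcoef f k u) <= M * norm u ^ k" using hcoef_bounded[OF f] by blast
 define \<Psi> where "\<Psi> w = hcoef f k w * exp (herm_inner z w) * complex_of_real (exp (- (norm w)\<^sup>2))" for w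
 define b where "b = norm z + 1"
 have int: "integrable lborel \<Psi>"
 proof (rule integrable_dominated_on)
  show "integrable lborel (\<lambda>w :: complex ^ 'n. (M * fact k * exp (b\<^sup>2 / 2)) * exp (- (norm w)\<^sup>2 / 2))"
   by (intro integrable_mult_right exp_neg_half_norm_integrable)
  show "\<Psi> \<in> borel_measurable lborel" unfolding \<Psi>_def by measurable
  fix w :: "complex ^ 'n"
  define r where "r = norm w"
  have r0: "r >= 0" by (simp add: r_def)
  have "norm (\<Psi> w) = cmod (hcoef f k w) * exp (Re (herm_inner z w)) * exp (- r\<^sup>2)"
   by (simp add: \<Psi>_def norm_mult r_def)
  also have "... <= (M * (fact k * exp r)) * exp (norm z * r) * exp (- r\<^sup>2)"
  proof (intro mult_right_mono mult_mono)
   have "cmod (hcoef f k w) <= M * r ^ k" using M(2) by (simp add: r_def)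
   also have "... <= M * (fact k * exp r)" by (intro mult_left_mono power_le_fact_exp M r0)
   finally show "cmod (hcoef f k w) <= M * (fact k * exp r)" .
   have "Re (herm_inner z w) <= norm z * r"
    using complex_Re_le_cmod herm_inner_bound order_trans unfolding r_def by blast
   thus "exp (Re (herm_inner z w)) <= exp (norm z * r)" by simp
  qed (use M in auto)
  also have "... = (M * fact k) * exp (b * r - r\<^sup>2)"
   by (simp add: b_def exp_add exp_diff exp_minus algebra_simps field_simps)
  also have "... <= (M * fact k) * exp (b\<^sup>2 / 2 + (- r\<^sup>2 / 2))"
  proof -
   have "0 <= (b - r)\<^sup>2" by simp
   hence "b * r - r\<^sup>2 <= b\<^sup>2 / 2 + (- r\<^sup>2 / 2)" by (simp add: power2_diff field_simps)
   thus ?thesis using M by (intro mult_left_mono) auto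
  qed
  also have "... = (M * fact k * exp (b\<^sup>2 / 2)) * exp (- (norm w)\<^sup>2 / 2)"
   by (simp only: exp_add r_def mult.assoc)
  finally show "norm (\<Psi> w) <= norm ((M * fact k * exp (b\<^sup>2 / 2)) * exp (- (norm w)\<^sup>2 / 2))"
   using M by simp
 qed
 have "of_real (gauss_mass TYPE(complex ^ 'n)) * hcoef f k z = (LINT w|lborel. \<Psi> w)"
  unfolding \<Psi>_def
  by (rule integral_gauss_reproducing[symmetric]) (use int hcoef_slice[OF f] in \<open>auto simp: \<Psi>_def[abs_def]\<close>)
 also have "... = (LINT u|lborel. (LINT t|circ. \<Psi> (cs t *s u)))"
  by (rule integral_circle_average[OF int])
 also have "... = (LINT u|lborel. (hcoef f k u * herm_inner z u ^ k * exp (- (norm u)\<^sup>2)) / fact k)"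
 proof (rule LINT_cong)
  fix u
  have "\<Psi> (cs t *s u) = (cs t ^ k * exp (herm_inner z u / cs t)) * (hcoef f k u * exp (- (norm u)\<^sup>2))" for t
   by (simp add: \<Psi>_def hcoef_smult[OF f] herm_inner_smult_right cnj_cs norm_vector_smult)
  thus "(LINT t|circ. \<Psi> (cs t *s u)) = (hcoef f k u * herm_inner z u ^ k * exp (- (norm u)\<^sup>2)) / fact k"
   by (simp add: circle_exp_moment)
 qed simp
 also have "... = (LINT u|lborel. (hcoef f k u * herm_inner z u ^ k * exp (- (norm u)\<^sup>2))) / fact k"
  by (rule integral_divide_zero)
 finally show ?thesis by (simp add: field_simps)
qed

section \<open>The reproducing formula on the ball\<close>

text \<open>The circle average projects \<open>f\<close> onto its part of degree \<open>k\<close>, since \<open>\<langle>z, w\<rangle>^k\<close> is conjugate-homogeneous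
and the weight is rotation invariant; for that part the beta-gamma identity turns the moment into a Gaussian one.\<close>

lemma bergman_moment:
 fixes f :: "complex ^ 'n => complex"
 assumes f: "analytic_several f (ball 0 1)" and m: "m > -1"
  and int: "integrable lborel (\<lambda>w. f w * bwt m w)"
 shows "integrable lborel (\<lambda>w. f w * herm_inner z w ^ k * bwt m w)"
  and "(LINT w|lborel. f w * herm_inner z w ^ k * bwt m w)
  = of_real (Gamma (m + 1) * fact k * gauss_mass TYPE(complex ^ 'n) / Gamma (real CARD('n) + k + m + 1)) * hcoef f k z"
proof -
 note [measurable] = hcoef_measurable[OF f]
 obtain M where M: "M >= 0" "\<And>u. cmod (hcoef f k u) <= M * norm u ^ k" using hcoef_bounded[OF f] by blast
 define \<Phi> where "\<Phi> w = f w * herm_inner z w ^ k * complex_of_real (bwt m w)" for w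
 have [measurable]: "(\<lambda>w. f w * complex_of_real (bwt m w)) \<in> borel_measurable lborel" using int by auto
 have xb: "cmod (herm_inner z w) <= norm z" if "bwt m w \<noteq> 0" for w
 proof -
  have "norm w <= 1" using that by (auto simp: bwt_def indicator_def split: if_splits)
  hence "norm z * norm w <= norm z * 1" by (intro mult_left_mono) auto
  thus ?thesis using herm_inner_bound[of z w] by simp
 qed
 show int\<Phi>: "integrable lborel \<Phi>"
 proof (rule integrable_dominated_on)
  show "integrable lborel (\<lambda>w. of_real (norm z ^ k) * (f w * complex_of_real (bwt m w)))" using int by simp
  have "(\<lambda>w. (f w * complex_of_real (bwt m w)) * herm_inner z w ^ k) \<in> borel_measurable lborel" by measurable
  thus "\<Phi> \<in> borel_measurable lborel" by (simp add: \<Phi>_def[abs_def] mult_ac)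
  fix w
  show "norm (\<Phi> w) <= norm (of_real (norm z ^ k) * (f w * complex_of_real (bwt m w)))"
  proof (cases "bwt m w = 0")
   case False
   from power_mono[OF xb[OF this], of k]
   have "cmod (herm_inner z w) ^ k * (cmod (f w) * bwt m w) <= norm z ^ k * (cmod (f w) * bwt m w)"
    by (intro mult_right_mono) auto
   thus ?thesis by (simp add: \<Phi>_def norm_mult norm_power mult_ac)
  qed (simp add: \<Phi>_def)
 qed
 have "(LINT w|lborel. \<Phi> w) = (LINT u|lborel. (LINT t|circ. \<Phi> (cs t *s u)))"
  by (rule integral_circle_average[OF int\<Phi>])
 also have "... = (LINT u|lborel. (hcoef f k u * herm_inner z u ^ k) * bwt m u)"
 proof (rule LINT_cong)
  fix u :: "complex ^ 'n"
  have b: "bwt m (cs t *s u) = bwt m u" for t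
   by (simp add: bwt_def norm_vector_smult indicator_def)
  have e: "\<Phi> (cs t *s u) = f (cs t *s u) / cs t ^ k * (herm_inner z u ^ k * bwt m u)" for t
   by (simp add: \<Phi>_def b herm_inner_smult_right cnj_cs power_divide)
  show "(LINT t|circ. \<Phi> (cs t *s u)) = (hcoef f k u * herm_inner z u ^ k) * bwt m u"
  proof (cases "norm u < 1")
   case True
   show ?thesis unfolding e by (subst integral_mult_left_zero) (simp add: hcoef_circle[OF f True])
  next
   case False hence "bwt m u = 0" by (simp add: bwt_def)
   thus ?thesis by (simp add: e)
  qed
 qed simp
 also have "of_real (Gamma (real CARD('n) + k + m + 1)) * ... = of_real (Gamma (m + 1)) * (LINT w|lborel. (hcoef f k w * herm_inner z w ^ k) * exp (- (norm w)\<^sup>2))"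
 proof -
  have "of_real (Gamma (m + 1)) * (LINT w|lborel. (hcoef f k w * herm_inner z w ^ k) * exp (- (norm w)\<^sup>2))
   = of_real (Gamma (real DIM(complex ^ 'n) / 2 + k + m + 1)) * (LINT w|lborel. (hcoef f k w * herm_inner z w ^ k) * bwt m w)"
  proof (rule integral_beta_gamma[OF _ _ m])
   show "(\<lambda>w. hcoef f k w * herm_inner z w ^ k) \<in> borel_measurable borel" by measurable
   show "hcoef f k (r *\<^sub>R x) * herm_inner z (r *\<^sub>R x) ^ k = of_real (r ^ (2 * k)) * (hcoef f k x * herm_inner z x ^ k)" for r x
    by (simp add: hcoef_scaleR[OF f] herm_inner_scaleR_right power_mult_distrib mult_2 power_add)
   show "integrable lborel (\<lambda>w. (hcoef f k w * herm_inner z w ^ k) * bwt m w)"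
   proof (rule integrable_dominated_on)
    show "integrable lborel (\<lambda>w. (M * norm z ^ k) * bwt m (w :: complex ^ 'n))"
     by (intro integrable_mult_right bwt_integrable m)
    show "(\<lambda>w. (hcoef f k w * herm_inner z w ^ k) * bwt m w) \<in> borel_measurable lborel" by measurable
    fix w :: "complex ^ 'n"
    show "norm ((hcoef f k w * herm_inner z w ^ k) * bwt m w) <= norm ((M * norm z ^ k) * bwt m w)"
    proof (cases "bwt m w = 0")
     case False
     hence "norm w <= 1" by (auto simp: bwt_def indicator_def split: if_splits)
     hence "M * norm w ^ k <= M * 1" using M by (intro mult_left_mono power_le_one) auto
     hence "cmod (hcoef f k w) <= M" using M(2)[of w] by simp
     hence "cmod (hcoef f k w) * cmod (herm_inner z w) ^ k * bwt m w <= M * norm z ^ k * bwt m w"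
      using M by (intro mult_right_mono mult_mono power_mono xb False) auto
     thus ?thesis using M by (simp add: norm_mult norm_power)
    qed simp
   qed
  qed
  thus ?thesis by simp
 qed
 also have "... = of_real (Gamma (m + 1)) * (fact k * of_real (gauss_mass TYPE(complex ^ 'n)) * hcoef f k z)"
  by (simp only: gauss_moment[OF f])
 finally have *: "of_real (Gamma (real CARD('n) + k + m + 1)) * (LINT w|lborel. \<Phi> w) = of_real (Gamma (m + 1)) * (fact k * of_real (gauss_mass TYPE(complex ^ 'n)) * hcoef f k z)" .
 have "0 < real CARD('n) + k + m + 1" using m by (smt (verit) of_nat_0_le_iff)
 hence "Gamma (real CARD('n) + k + m + 1) \<noteq> 0" using Gamma_real_pos by (metis less_irrefl)
 thus "(LINT w|lborel. f w * herm_inner z w ^ k * bwt m w)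
  = of_real (Gamma (m + 1) * fact k * gauss_mass TYPE(complex ^ 'n) / Gamma (real CARD('n) + k + m + 1)) * hcoef f k z"
  using * unfolding \<Phi>_def by (simp add: field_simps)
qed

lemma gbinomial_neg_pochhammer:
 "((- a) gchoose k) * (- x) ^ k = pochhammer a k / fact k * (x :: 'a :: field_char_0) ^ k"
proof -
 have "(- x) ^ k = (-1) ^ k * x ^ k" by (rule power_minus)
 thus ?thesis by (simp add: gbinomial_pochhammer flip: power_add mult_2)
qed

lemma binomial_series_complex:
 assumes "cmod x < 1"
 shows "(\<lambda>k. of_real (pochhammer s k / fact k) * x ^ k) sums (1 / (1 - x) powr of_real s)"
proof -
 have "(\<lambda>k. ((- of_real s) gchoose k) * (- x) ^ k) sums (1 + (- x)) powr (- of_real s)"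
  by (rule gen_binomial_complex) (use assms in simp)
 thus ?thesis by (simp only: gbinomial_neg_pochhammer) (simp add: powr_minus field_simps pochhammer_of_real)
qed

lemma binomial_series_real:
 fixes r a :: real
 assumes "\<bar>r\<bar> < 1"
 shows "(\<lambda>k. pochhammer a k / fact k * r ^ k) sums ((1 - r) powr (- a))"
proof -
 have "(\<lambda>k. ((- a) gchoose k) * (- r) ^ k) sums (1 + (- r)) powr (- a)"
  by (rule gen_binomial_real) (use assms in simp)
 thus ?thesis by (simp only: gbinomial_neg_pochhammer) simp
qed

lemma pochhammer_Gamma_real: "s > (0::real) ==> pochhammer s k = Gamma (s + k) / Gamma s"
 by (rule pochhammer_Gamma) (auto elim!: nonpos_Ints_cases)

lemma bwt_nz: "bwt m w \<noteq> 0 ==> norm w < 1"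
 by (auto simp: bwt_def indicator_def split: if_splits)

text \<open>The binomial series of the kernel converges uniformly in \<open>w\<close> for fixed \<open>z\<close>, so it may be integrated
term by term. The formula is used for two exponents: the reproducing one, where all coefficients coincide, and half of it,
which yields the growth estimate of Forelli and Rudin.\<close>

lemma bergman_series:
 fixes f :: "complex ^ 'n => complex"
 assumes f: "analytic_several f (ball 0 1)" and m: "m > -1" and s: "s > 0"
  and int: "integrable lborel (\<lambda>w. f w * bwt m w)" and z: "norm z < 1"
 shows "(\<lambda>k. of_real (pochhammer s k * Gamma (m + 1) * gauss_mass TYPE(complex ^ 'n) / Gamma (real CARD('n) + k + m + 1)) * hcoef f k z)
  sums (LINT w|lborel. f w / (1 - herm_inner z w) powr of_real s * bwt m w)"
proof -
 define p where "p k = pochhammer s k / fact k" for k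
 have p0: "p k >= 0" for k using s by (simp add: p_def pochhammer_nonneg)
 define F where "F k w = of_real (p k) * (f w * herm_inner z w ^ k * complex_of_real (bwt m w))" for k w
 have sp: "summable (\<lambda>k. p k * norm z ^ k)"
  using binomial_series_real[of "norm z" s] z by (auto simp: p_def sums_iff)
 have xb: "cmod (herm_inner z w) <= norm z" if "bwt m w \<noteq> 0" for w
 proof -
  have "norm z * norm w <= norm z * 1" using bwt_nz[OF that] by (intro mult_left_mono) auto
  thus ?thesis using herm_inner_bound[of z w] by simp
 qed
 have Fb: "cmod (F k w) <= (p k * norm z ^ k) * (cmod (f w) * bwt m w)" for k w
 proof (cases "bwt m w = 0")
  case False
  have "cmod (herm_inner z w) ^ k * (p k * (cmod (f w) * bwt m w)) <= norm z ^ k * (p k * (cmod (f w) * bwt m w))"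
   by (intro mult_right_mono power_mono xb False) (use p0 in auto)
  thus ?thesis using p0 by (simp add: F_def norm_mult norm_power mult_ac)
 qed (simp add: F_def)
 have Fint: "integrable lborel (F k)" for k
  unfolding F_def using bergman_moment(1)[OF f m int, of z k] by simp
 have aint: "integrable lborel (\<lambda>w. cmod (f w) * bwt m w)"
  using integrable_norm[OF int] by (simp add: norm_mult)
 have "(\<lambda>k. integral\<^sup>L lborel (F k)) sums (LINT w|lborel. (\<Sum>k. F k w))"
 proof (rule sums_integral[OF Fint])
  show "AE w in lborel. summable (\<lambda>k. norm (F k w))"
  proof (rule AE_I2)
   fix w
   show "summable (\<lambda>k. norm (F k w))"
    by (rule summable_comparison_test'[OF summable_mult2[OF sp, of "cmod (f w) * bwt m w"]]) (simp add: Fb)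
  qed
  show "summable (\<lambda>k. \<integral>w. norm (F k w) \<partial>lborel)"
  proof (rule summable_comparison_test'[OF summable_mult2[OF sp, of "\<integral>w. cmod (f w) * bwt m w \<partial>lborel"]])
   fix k
   have "(LINT w|lborel. norm (F k w)) <= (LINT w|lborel. (p k * norm z ^ k) * (cmod (f w) * bwt m w))"
    by (intro integral_mono integrable_norm Fint integrable_mult_right aint Fb)
   also have "... = (p k * norm z ^ k) * (LINT w|lborel. (cmod (f w) * bwt m w))" by simp
   finally show "norm (LINT w|lborel. norm (F k w)) <= (p k * norm z ^ k) * (LINT w|lborel. (cmod (f w) * bwt m w))" by simp
  qed
 qed
 moreover have "(\<Sum>k. F k w) = f w / (1 - herm_inner z w) powr of_real s * bwt m w" for w
 proof (cases "bwt m w = 0")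
  case False
  have "cmod (herm_inner z w) < 1" using xb[OF False] z by simp
  from sums_mult2[OF binomial_series_complex[OF this, of s], of "f w * bwt m w"]
  have "(\<lambda>k. F k w) sums (1 / (1 - herm_inner z w) powr of_real s * (f w * bwt m w))"
   by (simp add: F_def p_def mult_ac)
  thus ?thesis by (simp add: sums_iff)
 qed (simp add: F_def)
 moreover have "integral\<^sup>L lborel (F k) = of_real (pochhammer s k * Gamma (m + 1) * gauss_mass TYPE(complex ^ 'n) / Gamma (real CARD('n) + k + m + 1)) * hcoef f k z" for k
 proof -
  have "integral\<^sup>L lborel (F k) = of_real (p k) * (LINT w|lborel. f w * herm_inner z w ^ k * bwt m w)"
   unfolding F_def by simp
  also have "... = of_real (p k) * (of_real (Gamma (m + 1) * fact k * gauss_mass TYPE(complex ^ 'n) / Gamma (real CARD('n) + k + m + 1)) * hcoef f k z)"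
   by (simp only: bergman_moment(2)[OF f m int])
  also have "... = of_real (p k * (Gamma (m + 1) * fact k * gauss_mass TYPE(complex ^ 'n) / Gamma (real CARD('n) + k + m + 1))) * hcoef f k z"
   by simp
  also have "p k * (Gamma (m + 1) * fact k * gauss_mass TYPE(complex ^ 'n) / Gamma (real CARD('n) + k + m + 1))
   = pochhammer s k * Gamma (m + 1) * gauss_mass TYPE(complex ^ 'n) / Gamma (real CARD('n) + k + m + 1)"
   by (simp add: p_def)
  finally show ?thesis .
 qed
 ultimately show ?thesis by simp
qed

lemma hcoef_sums:
 fixes f :: "complex ^ 'n => complex"
 assumes f: "analytic_several f (ball 0 1)" and z: "norm z < 1"
 shows "(\<lambda>k. hcoef f k z) sums f z"
proof -
 have pos: "1 + norm z > 0" by (simp add: add_pos_nonneg)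
 have "ball 0 (2 / (1 + norm z)) \<subseteq> {\<zeta>. norm (\<zeta> *s z) < 1}"
 proof
  fix \<zeta> :: complex assume "\<zeta> \<in> ball 0 (2 / (1 + norm z))"
  hence "cmod \<zeta> * norm z <= 2 / (1 + norm z) * norm z" by (intro mult_right_mono) auto
  also have "... < 1" using z pos by (simp add: field_simps)
  finally show "\<zeta> \<in> {\<zeta>. norm (\<zeta> *s z) < 1}" by (simp add: norm_vector_smult)
 qed
 hence "(\<lambda>\<zeta>. f (\<zeta> *s z)) holomorphic_on ball 0 (2 / (1 + norm z))"
  using slice0_holomorphic[OF f] holomorphic_on_subset by blast
 from holomorphic_power_series[OF this, of 1]
 show ?thesis using z pos by (simp add: hcoef_def field_simps)
qed

definition rep_const :: "(complex ^ 'n) itself => real => real" where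
 "rep_const T m = Gamma (m + 1) * gauss_mass T / Gamma (real CARD('n) + 1 + m)"

text \<open>For the exponent \<open>n + 1 + m\<close> the Pochhammer symbol cancels the Gamma value of the moment, so
every coefficient is the same constant and the series sums to a multiple of \<open>f z\<close>.\<close>

theorem bergman_reproducing:
 fixes f :: "complex ^ 'n => complex"
 assumes f: "analytic_several f (ball 0 1)" and m: "m > -1"
  and int: "integrable lborel (\<lambda>w. f w * bwt m w)" and z: "norm z < 1"
 shows "(LINT w|lborel. f w / (1 - herm_inner z w) powr of_real (real CARD('n) + 1 + m) * bwt m w)
  = of_real (rep_const TYPE(complex ^ 'n) m) * f z"
proof -
 define s where "s = real CARD('n) + 1 + m"
 have s: "s > 0" using m by (simp add: s_def add_nonneg_pos)
 have c: "pochhammer s k * Gamma (m + 1) * gauss_mass TYPE(complex ^ 'n) / Gamma (real CARD('n) + k + m + 1)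
  = rep_const TYPE(complex ^ 'n) m" for k
 proof -
  have "real CARD('n) + k + m + 1 = s + k" by (simp add: s_def)
  moreover have "0 < Gamma (s + k)" by (rule Gamma_real_pos) (use s in simp)
  ultimately show ?thesis
   by (simp only: pochhammer_Gamma_real[OF s] rep_const_def s_def[symmetric]) (simp add: field_simps)
 qed
 have "(\<lambda>k. of_real (rep_const TYPE(complex ^ 'n) m) * hcoef f k z)
  sums (LINT w|lborel. f w / (1 - herm_inner z w) powr of_real s * bwt m w)"
  using bergman_series[OF f m s int z] by (simp only: c)
 moreover have "(\<lambda>k. of_real (rep_const TYPE(complex ^ 'n) m) * hcoef f k z) sums (of_real (rep_const TYPE(complex ^ 'n) m) * f z)"
  by (intro sums_mult hcoef_sums f z)
 ultimately show ?thesis unfolding s_def by (rule sums_unique2)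
qed

section \<open>The growth estimate of Forelli and Rudin\<close>

lemma bounded_linear_herm_left: "bounded_linear (\<lambda>w. herm_inner w z)"
proof (rule bounded_linear_intro)
 show "norm (herm_inner x z) <= norm x * norm z" for x by (rule herm_inner_bound)
qed (simp add: herm_inner_add_left, simp add: herm_inner_def scaleR_sum_right)

lemma has_derivative_herm:
 assumes "(g has_field_derivative g') (at (herm_inner w z))"
 shows "((\<lambda>w. g (herm_inner w z)) has_derivative (\<lambda>v. g' * herm_inner v z)) (at w)"
proof -
 have 1: "((\<lambda>w. herm_inner w z) has_derivative (\<lambda>v. herm_inner v z)) (at w)"
  by (rule bounded_linear_imp_has_derivative[OF bounded_linear_herm_left])
 have 2: "(g has_derivative (*) g') (at (herm_inner w z))" using assms by (simp add: has_field_derivative_def)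
 show ?thesis using has_derivative_compose[OF 1 2] by simp
qed

lemma analytic_several_herm:
 assumes "\<And>w. w \<in> S ==> g field_differentiable (at (herm_inner w z))"
 shows "analytic_several (\<lambda>w. g (herm_inner w z)) S"
 unfolding analytic_several_def
proof
 fix w assume "w \<in> S"
 then obtain g' where "(g has_field_derivative g') (at (herm_inner w z))"
  using assms field_differentiable_def by blast
 thus "\<exists>L. ((\<lambda>w. g (herm_inner w z)) has_derivative L) (at w) \<and> (\<forall>c v. L (c *s v) = c * L v)"
  by (intro exI[of _ "\<lambda>v. g' * herm_inner v z"] conjI has_derivative_herm) (simp_all add: herm_inner_smult_left)
qed

lemma not_nonpos_Reals: "Re y > 0 ==> y \<notin> \<real>\<^sub>\<le>\<^sub>0"
 by (auto simp: complex_nonpos_Reals_iff)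

lemma Re_one_minus: "cmod x < 1 ==> Re (1 - x) > 0"
 using complex_Re_le_cmod[of x] by simp

lemma cmod_powr_real: "cmod (y powr of_real s) = cmod y powr s"
 by (simp add: norm_powr_real_powr')

lemma kernel_analytic:
 assumes "norm z < 1"
 shows "analytic_several (\<lambda>w. 1 / (1 - herm_inner w z) powr of_real s) (ball 0 1)"
proof (rule analytic_several_herm[where g = "\<lambda>x. 1 / (1 - x) powr of_real s"])
 fix w :: "complex ^ 'a" assume "w \<in> ball 0 1"
 hence "cmod (herm_inner w z) < 1" using assms by (intro herm_inner_less_1) auto
 hence nz: "1 - herm_inner w z \<notin> \<real>\<^sub>\<le>\<^sub>0" by (intro not_nonpos_Reals Re_one_minus)
 moreover have "1 - herm_inner w z \<noteq> 0" using nz by auto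
 ultimately have "(\<lambda>x. 1 / (1 - x) powr of_real s) holomorphic_on {x. cmod x < 1}"
  by (intro holomorphic_intros) (auto intro!: not_nonpos_Reals[OF Re_one_minus])
 moreover have "open {x::complex. cmod x < 1}" by (intro open_Collect_less continuous_intros)
 ultimately show "(\<lambda>x. 1 / (1 - x) powr of_real s) field_differentiable at (herm_inner w z)"
  using \<open>cmod (herm_inner w z) < 1\<close> holomorphic_on_imp_differentiable_at by blast
qed

lemma higher_deriv_powr_linear:
 assumes "cmod (y * \<zeta>) < 1"
 shows "(deriv ^^ k) (\<lambda>\<zeta>. 1 / (1 - y * \<zeta>) powr of_real s) \<zeta>
  = of_real (pochhammer s k) * y ^ k * (1 - y * \<zeta>) powr (- of_real (s + k))"
 using assms
proof (induction k arbitrary: \<zeta>)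
 case 0 thus ?case by (simp add: powr_minus field_simps)
next
 case (Suc k)
 have op: "open {\<zeta>. cmod (y * \<zeta>) < 1}" by (intro open_Collect_less continuous_intros)
 have ev: "\<forall>\<^sub>F \<zeta> in nhds \<zeta>. (deriv ^^ k) (\<lambda>\<zeta>. 1 / (1 - y * \<zeta>) powr of_real s) \<zeta>
   = of_real (pochhammer s k) * y ^ k * (1 - y * \<zeta>) powr (- of_real (s + k))"
  by (rule eventually_mono[OF eventually_nhds_in_open[OF op]]) (use Suc in auto)
 have nz: "1 - y * \<zeta> \<notin> \<real>\<^sub>\<le>\<^sub>0" using Suc.prems by (intro not_nonpos_Reals Re_one_minus)
 have "((\<lambda>\<zeta>. (1 - y * \<zeta>) powr (- of_real (s + k))) has_field_derivative
   (- of_real (s + k)) * (1 - y * \<zeta>) powr (- of_real (s + k) - 1) * (- y)) (at \<zeta>)"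
  by (rule DERIV_chain2[of "\<lambda>u. u powr (- of_real (s + k))" _ "\<lambda>\<zeta>. 1 - y * \<zeta>", OF has_field_derivative_powr[OF nz]]) (auto intro!: derivative_eq_intros)
 from DERIV_cmult[OF this, of "of_real (pochhammer s k) * y ^ k"]
 have "deriv (\<lambda>\<zeta>. of_real (pochhammer s k) * y ^ k * (1 - y * \<zeta>) powr (- of_real (s + k))) \<zeta>
  = of_real (pochhammer s k) * y ^ k * ((- of_real (s + k)) * (1 - y * \<zeta>) powr (- of_real (s + k) - 1) * (- y))"
  by (rule DERIV_imp_deriv)
 also have "- of_real (s + k) - 1 = - complex_of_real (s + Suc k)" by simp
 finally show ?case using deriv_cong_ev[OF ev refl]
  by (simp add: pochhammer_Suc algebra_simps)
qed

lemma hcoef_kernel: "hcoef (\<lambda>w. 1 / (1 - herm_inner w z) powr of_real s) k z = of_real (pochhammer s k / fact k * norm z ^ (2 * k))"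
proof -
 have "hcoef (\<lambda>w. 1 / (1 - herm_inner w z) powr of_real s) k z
  = (deriv ^^ k) (\<lambda>\<zeta>. 1 / (1 - of_real ((norm z)\<^sup>2) * \<zeta>) powr of_real s) 0 / fact k"
  unfolding hcoef_def herm_inner_smult_left herm_inner_self by (simp only: mult.commute)
 thus ?thesis by (subst (asm) higher_deriv_powr_linear) (simp_all add: power_mult)
qed

text \<open>Midpoint log-convexity of Gamma, in the form used to compare Gamma quotients.\<close>

lemma Gamma_midpoint:
 assumes "x > (0::real)" "y > 0"
 shows "Gamma ((x + y) / 2) ^ 2 <= Gamma x * Gamma y"
proof -
 have "(ln \<circ> Gamma) ((1 - 1/2) *\<^sub>R x + (1/2) *\<^sub>R y) <= (1 - 1/2) * (ln \<circ> Gamma) x + (1/2) * (ln \<circ> Gamma) y"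
  by (rule convex_onD[OF log_convex_Gamma_real]) (use assms in auto)
 moreover have "(1 - 1/2) *\<^sub>R x + (1/2) *\<^sub>R y = (x + y) / 2" by (simp add: field_simps)
 moreover have "1 - 1 / 2 = (1 / 2 :: real)" by simp
 ultimately have "ln (Gamma ((x + y) / 2)) <= 1 / 2 * ln (Gamma x) + 1 / 2 * ln (Gamma y)"
  by (simp only: o_def)
 hence "2 * ln (Gamma ((x + y) / 2)) <= ln (Gamma x) + ln (Gamma y)" by linarith
 moreover have "m ^ 2 <= u * v" if "2 * ln m <= ln u + ln v" "m > 0" "u > 0" "v > 0" for m u v :: real
 proof -
  have "m ^ 2 = exp (2 * ln m)" using that by (simp add: exp_double)
  also have "... <= exp (ln u + ln v)" using that(1) by simp
  also have "... = u * v" using that by (simp add: exp_add)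
  finally show ?thesis .
 qed
 ultimately show ?thesis using assms by (auto intro: Gamma_real_pos)
qed

text \<open>Write the modulus of the kernel as \<open>f(w)\<close> times the conjugate of \<open>f(w)\<close>, where \<open>f\<close> is the kernel
with half the exponent. Then \<open>bergman_series\<close> expresses the integral as a power series in \<open>|z|^2\<close>, whose coefficients are
dominated, by log-convexity of Gamma, by those of \<open>(1 - |z|^2)^(-a)\<close>.\<close>

theorem forelli_rudin:
 assumes lam: "lam > -1" and a: "0 < a" "a < lam + 1"
 defines "s \<equiv> real CARD('n) + 1 + lam"
 shows "\<exists>C\<ge>0. \<forall>z :: complex ^ 'n. norm z < 1 -->
  integrable lborel (\<lambda>w. cmod (1 - herm_inner z w) powr (- s) * bwt (lam - a) w) \<and>
  (LINT w|lborel. cmod (1 - herm_inner z w) powr (- s) * bwt (lam - a) w) <= C * (1 - (norm z)\<^sup>2) powr (- a)"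
proof -
 define b where "b = lam - a"
 define q where "q = s / 2"
 define G where "G = gauss_mass TYPE(complex ^ 'n)"
 have b: "b > -1" using a by (simp add: b_def)
 have q: "q > 0" using lam by (simp add: q_def s_def add_nonneg_pos)
 have G0: "G >= 0" by (simp add: G_def gauss_mass_def)
 define C where "C = Gamma (b + 1) * G * Gamma a / (Gamma q)\<^sup>2"
 have C0: "C >= 0" using b q a G0 by (simp add: C_def Gamma_real_nonneg)
 show ?thesis
 proof (intro exI[of _ C] conjI C0 allI impI)
  fix z :: "complex ^ 'n" assume z: "norm z < 1"
  define f where "f w = 1 / (1 - herm_inner w z) powr of_real q" for w
  have f: "analytic_several f (ball 0 1)" unfolding f_def by (rule kernel_analytic[OF z])
  define g where "g w = cmod (1 - herm_inner z w) powr (- s) * bwt b w" for w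
  have low: "cmod (1 - herm_inner z w) >= 1 - norm z" if "norm w < 1" for w
  proof -
   have "norm z * norm w <= norm z * 1" using that by (intro mult_left_mono) auto
   hence "cmod (herm_inner z w) <= norm z" using herm_inner_bound[of z w] by simp
   thus ?thesis using norm_triangle_ineq2[of 1 "herm_inner z w"] by simp
  qed
  have s0: "s > 0" using q by (simp add: q_def)
  have gint: "integrable lborel g"
  proof (rule integrable_dominated_on)
   show "integrable lborel (\<lambda>w :: complex ^ 'n. (1 - norm z) powr (- s) * bwt b w)"
    by (intro integrable_mult_right bwt_integrable b)
   show "g \<in> borel_measurable lborel" unfolding g_def by measurable
   fix w
   show "norm (g w) <= norm ((1 - norm z) powr (- s) * bwt b w)"
   proof (cases "bwt b w = 0")
    case False
    have "cmod (1 - herm_inner z w) powr (- s) <= (1 - norm z) powr (- s)"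
     using low[OF bwt_nz[OF False]] z s0 by (intro powr_mono2') auto
    thus ?thesis by (simp add: g_def mult_right_mono)
   qed (simp add: g_def)
  qed
  have prod: "f w / (1 - herm_inner z w) powr of_real q * bwt b w = complex_of_real (g w)" for w
  proof (cases "bwt b w = 0")
   case False
   hence "cmod (herm_inner z w) < 1" using z bwt_nz by (intro herm_inner_less_1) auto
   hence nz: "1 - herm_inner z w \<notin> \<real>\<^sub>\<le>\<^sub>0" by (intro not_nonpos_Reals Re_one_minus)
   have "1 - herm_inner w z = cnj (1 - herm_inner z w)" by (simp add: herm_inner_cnj)
   hence "(1 - herm_inner w z) powr of_real q = cnj ((1 - herm_inner z w) powr of_real q)"
    using cnj_powr[of "1 - herm_inner z w" "of_real q"] nz by (auto simp: complex_nonpos_Reals_iff)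
   hence "(1 - herm_inner w z) powr of_real q * (1 - herm_inner z w) powr of_real q
    = of_real ((cmod ((1 - herm_inner z w) powr of_real q))\<^sup>2)"
    by (simp add: complex_norm_square mult.commute del: of_real_power)
   also have "(cmod ((1 - herm_inner z w) powr of_real q))\<^sup>2 = cmod (1 - herm_inner z w) powr s"
    by (simp only: cmod_powr_real power2_eq_square powr_add[symmetric]) (simp add: q_def)
   finally have e: "(1 - herm_inner w z) powr of_real q * (1 - herm_inner z w) powr of_real q
    = complex_of_real (cmod (1 - herm_inner z w) powr s)" .
   have "f w / (1 - herm_inner z w) powr of_real q = 1 / ((1 - herm_inner w z) powr of_real q * (1 - herm_inner z w) powr of_real q)"
    by (simp add: f_def)
   also have "... = complex_of_real (cmod (1 - herm_inner z w) powr (- s))"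
    unfolding e by (simp add: powr_minus_divide)
   finally show ?thesis by (simp add: g_def)
  qed (simp add: g_def)
  have fint: "integrable lborel (\<lambda>w. f w * complex_of_real (bwt b w))"
  proof (rule integrable_dominated_on)
   show "integrable lborel (\<lambda>w :: complex ^ 'n. (1 - norm z) powr (- q) * bwt b w)"
    by (intro integrable_mult_right bwt_integrable b)
   have "(\<lambda>w. (indicator (ball 0 1) w *\<^sub>R f w) * complex_of_real (bwt b w)) \<in> borel_measurable lborel"
    using borel_measurable_ball_indicator[OF f] by measurable
   also have "(\<lambda>w. (indicator (ball 0 1) w *\<^sub>R f w) * complex_of_real (bwt b w)) = (\<lambda>w. f w * complex_of_real (bwt b w))"
    by (auto simp: fun_eq_iff bwt_def indicator_def)
   finally show "(\<lambda>w. f w * complex_of_real (bwt b w)) \<in> borel_measurable lborel" .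
   fix w
   show "norm (f w * complex_of_real (bwt b w)) <= norm ((1 - norm z) powr (- q) * bwt b w)"
   proof (cases "bwt b w = 0")
    case False
    have "cmod (1 - herm_inner w z) = cmod (1 - herm_inner z w)"
     using complex_mod_cnj[of "1 - herm_inner z w"] by (simp add: herm_inner_cnj)
    hence "cmod (f w) = cmod (1 - herm_inner z w) powr (- q)"
     by (simp add: f_def norm_divide cmod_powr_real powr_minus inverse_eq_divide)
    also have "... <= (1 - norm z) powr (- q)"
     using low[OF bwt_nz[OF False]] z q by (intro powr_mono2') auto
    finally show ?thesis by (simp add: norm_mult mult_right_mono)
   qed simp
  qed
  \<comment> \<open>The Taylor coefficients of the kernel at \<open>z\<close> itself are real, which makes the series a series of reals.\<close>
  define T where "T k = pochhammer q k * Gamma (b + 1) * G / Gamma (real CARD('n) + k + b + 1) * (pochhammer q k / fact k * norm z ^ (2 * k))" for k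
  have "(\<lambda>k. complex_of_real (T k)) sums (LINT w|lborel. complex_of_real (g w))"
   using bergman_series[OF f b q fint z] unfolding prod
   by (simp add: hcoef_kernel f_def[abs_def] T_def G_def mult_ac)
  hence Ts: "T sums (LINT w|lborel. g w)"
   by (simp add: sums_of_real_iff)
  have Tb: "T k <= C * (pochhammer a k / fact k * ((norm z)\<^sup>2) ^ k)" for k
  proof -
   have e: "real CARD('n) + k + b + 1 = s - a + k" by (simp add: s_def b_def)
   have sa: "s - a > 0" using a by (simp add: s_def add_nonneg_pos)
   have m: "((s - a + k) + (a + k)) / 2 = q + k" by (simp add: q_def)
   have "Gamma (((s - a + k) + (a + k)) / 2) ^ 2 <= Gamma (s - a + k) * Gamma (a + k)"
    by (rule Gamma_midpoint) (use sa a in auto)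
   hence "Gamma (q + k) ^ 2 <= Gamma (s - a + k) * Gamma (a + k)" unfolding m .
   moreover have pos: "Gamma (s - a + k) > 0" "Gamma (a + k) > 0" "Gamma a > 0" "Gamma q > 0" "Gamma (b + 1) > 0"
    using sa a q b by (auto intro!: Gamma_real_pos add_pos_nonneg)
   ultimately have "Gamma (q + k) ^ 2 / Gamma (s - a + k) <= Gamma (a + k)"
    by (simp add: divide_le_eq mult.commute)
   hence "(Gamma (q + k) ^ 2 / Gamma (s - a + k)) * (Gamma (b + 1) * G * norm z ^ (2 * k) / fact k / (Gamma q)\<^sup>2)
    <= Gamma (a + k) * (Gamma (b + 1) * G * norm z ^ (2 * k) / fact k / (Gamma q)\<^sup>2)"
    using pos G0 by (intro mult_right_mono) auto
   moreover have "T k = (Gamma (q + k) ^ 2 / Gamma (s - a + k)) * (Gamma (b + 1) * G * norm z ^ (2 * k) / fact k / (Gamma q)\<^sup>2)"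
    unfolding T_def e pochhammer_Gamma_real[OF q] by (simp add: power2_eq_square mult_ac)
   moreover have "C * (pochhammer a k / fact k * ((norm z)\<^sup>2) ^ k) = Gamma (a + k) * (Gamma (b + 1) * G * norm z ^ (2 * k) / fact k / (Gamma q)\<^sup>2)"
    unfolding C_def pochhammer_Gamma_real[OF a(1)] using pos by (simp add: mult_ac power_commutes flip: power_mult)
   ultimately show ?thesis by simp
  qed
  have "norm z ^ 2 < 1" using z by (simp add: abs_square_less_1)
  hence "(\<lambda>k. C * (pochhammer a k / fact k * ((norm z)\<^sup>2) ^ k)) sums (C * (1 - (norm z)\<^sup>2) powr (- a))"
   by (intro sums_mult binomial_series_real) auto
  from sums_le[OF Tb Ts this]
  show "(LINT w|lborel. cmod (1 - herm_inner z w) powr (- s) * bwt (lam - a) w) <= C * (1 - (norm z)\<^sup>2) powr (- a)"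
   by (simp add: g_def b_def)
  show "integrable lborel (\<lambda>w. cmod (1 - herm_inner z w) powr (- s) * bwt (lam - a) w)"
   using gint by (simp add: g_def[abs_def] b_def)
 qed
qed

section \<open>The weighted measure\<close>

text \<open>The constant for which \<open>weighted_vol lam\<close> has density \<open>wconst * bwt lam\<close> with respect to Lebesgue measure.\<close>

definition wconst :: "'a::euclidean_space itself => real => real" where
 "wconst T lam = inverse (measure lborel (ball (0::'a) 1)) * weight_const DIM('a) lam"

lemma wconst_pos:
 assumes "lam > -1" shows "wconst TYPE('a::euclidean_space) lam > 0"
proof -
 have 1: "real DIM('a) > 0" by simp
 have 2: "measure lborel (ball (0::'a) 1) > 0" using content_ball_pos[of 1 "0::'a"] by simp
 have "0 < Gamma (real DIM('a) / 2 + lam + 1)" "0 < Gamma (real DIM('a) / 2)" "0 < Gamma (lam + 1)"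
  using assms 1 by (auto intro!: Gamma_real_pos simp: add_pos_pos add_nonneg_pos) 
 hence "weight_const DIM('a) lam > 0" unfolding weight_const_def using 1 by simp
 thus ?thesis using 2 by (simp add: wconst_def)
qed

text \<open>Merging the normalisation of the ball volume into the density makes the measure accessible to the
transfer rules for densities.\<close>

lemma weighted_vol_eq:
 fixes lam :: real
 assumes lam: "lam > -1"
 shows "(weighted_vol lam :: 'a::euclidean_space measure)
  = density (lebesgue_on (ball 0 1)) (\<lambda>x. ennreal (wconst TYPE('a) lam * bwt lam x))"
proof (rule measure_eqI)
 show "sets (weighted_vol lam :: 'a measure) = sets (density (lebesgue_on (ball 0 1)) (\<lambda>x. ennreal (wconst TYPE('a) lam * bwt lam x)))"
  by (simp add: weighted_vol_def ball_vol_def)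
 fix A :: "'a set" assume "A \<in> sets (weighted_vol lam)"
 hence A: "A \<in> sets (lebesgue_on (ball 0 1))" by (simp add: weighted_vol_def ball_vol_def)
 let ?r = "inverse (emeasure lebesgue (ball 0 1 :: 'a set))"
 let ?g = "\<lambda>x::'a. ennreal (weight_const DIM('a) lam * (1 - (norm x)\<^sup>2) powr lam)"
 have bm: "f \<in> borel_measurable borel ==> f \<in> borel_measurable (lebesgue_on (ball 0 1))" for f :: "'a => ennreal"
  by (intro measurable_restrict_space1 measurable_completion) simp
 have g: "?g \<in> borel_measurable (lebesgue_on (ball 0 1))"
  by (rule bm) measurable
 have r: "?r = ennreal (inverse (measure lborel (ball (0::'a) 1)))"
 proof -
  have "emeasure lebesgue (ball 0 1 :: 'a set) = ennreal (measure lborel (ball (0::'a) 1))"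
   using emeasure_lborel_ball_finite[of "0::'a" 1] by (simp add: emeasure_eq_ennreal_measure)
  thus ?thesis using content_ball_pos[of 1 "0::'a"] by (simp add: inverse_ennreal)
 qed
 have "emeasure (weighted_vol lam) A = (\<integral>\<^sup>+x. ?g x * indicator A x \<partial>ball_vol)"
  unfolding weighted_vol_def by (subst emeasure_density) (use g A in \<open>auto simp: ball_vol_def measurable_cong_sets[OF sets_scale_measure refl]\<close>)
 also have "... = ?r * (\<integral>\<^sup>+x. ?g x * indicator A x \<partial>lebesgue_on (ball 0 1))"
  unfolding ball_vol_def by (subst nn_integral_scale_measure) (use g A in auto)
 also have "... = (\<integral>\<^sup>+x. ?r * (?g x * indicator A x) \<partial>lebesgue_on (ball 0 1))"
  by (subst nn_integral_cmult) (use g A in auto)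
 also have "... = (\<integral>\<^sup>+x. ennreal (wconst TYPE('a) lam * bwt lam x) * indicator A x \<partial>lebesgue_on (ball 0 1))"
 proof (rule nn_integral_cong)
  fix x :: 'a assume "x \<in> space (lebesgue_on (ball 0 1))"
  hence x: "x \<in> ball 0 1" by (simp add: space_restrict_space)
  have "?r * ?g x = ennreal (wconst TYPE('a) lam * bwt lam x)"
   unfolding r using x by (subst ennreal_mult'[symmetric]) (auto simp: wconst_def bwt_def mult.assoc)
  thus "?r * (?g x * indicator A x) = ennreal (wconst TYPE('a) lam * bwt lam x) * indicator A x"
   by (simp add: mult.assoc[symmetric])
 qed
 also have "... = emeasure (density (lebesgue_on (ball 0 1)) (\<lambda>x. ennreal (wconst TYPE('a) lam * bwt lam x))) A"
  by (subst emeasure_density) (use A in \<open>auto intro!: bm\<close>)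
 finally show "emeasure (weighted_vol lam) A = emeasure (density (lebesgue_on (ball 0 1)) (\<lambda>x. ennreal (wconst TYPE('a) lam * bwt lam x))) A" .
qed

lemma space_weighted_vol [simp]: "space (weighted_vol lam :: 'a::euclidean_space measure) = ball 0 1"
 by (simp add: weighted_vol_def ball_vol_def space_restrict_space space_scale_measure)

lemma sets_weighted_vol: "sets (weighted_vol lam :: 'a::euclidean_space measure) = sets (lebesgue_on (ball 0 1))"
 by (simp add: weighted_vol_def ball_vol_def)

lemma measurable_weighted_vol_borel:
 "f \<in> measurable borel N ==> f \<in> measurable (weighted_vol lam :: 'a::euclidean_space measure) N"
 unfolding measurable_cong_sets[OF sets_weighted_vol refl]
 by (intro measurable_restrict_space1 measurable_completion) simp

lemma weighted_vol_id [measurable]: "(\<lambda>x. x) \<in> borel_measurable (weighted_vol lam :: 'a::euclidean_space measure)"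
 by (rule measurable_weighted_vol_borel) simp

lemma sets_weighted_vol_borel: "A \<in> sets borel ==> A \<subseteq> ball 0 1 ==> A \<in> sets (weighted_vol lam :: 'a::euclidean_space measure)"
 unfolding sets_weighted_vol by (auto simp: sets_restrict_space_iff)

text \<open>The measure lives on the Lebesgue completion of the ball; Borel integrands can be moved to \<open>lborel\<close>.\<close>

lemma integral_weighted_vol_borel:
 fixes g :: "'a::euclidean_space => 'b::{banach, second_countable_topology}"
 assumes lam: "lam > -1" and g[measurable]: "g \<in> borel_measurable borel"
 shows "integrable (weighted_vol lam) g \<longleftrightarrow> integrable lborel (\<lambda>x. bwt lam x *\<^sub>R g x)"
  and "(LINT x|weighted_vol lam. g x) = wconst TYPE('a) lam *\<^sub>R (LINT x|lborel. bwt lam x *\<^sub>R g x)"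
proof -
 have c: "wconst TYPE('a) lam > 0" by (rule wconst_pos[OF lam])
 have bm: "f \<in> borel_measurable borel ==> f \<in> borel_measurable (lebesgue_on (ball 0 1))" for f :: "'a => 'c::{banach, second_countable_topology}"
  by (intro measurable_restrict_space1 measurable_completion) simp
 have ind: "indicator (ball 0 1) x *\<^sub>R (wconst TYPE('a) lam * bwt lam x) *\<^sub>R g x = wconst TYPE('a) lam *\<^sub>R (bwt lam x *\<^sub>R g x)" for x
  by (auto simp: bwt_def indicator_def)
 have gm: "(\<lambda>x. wconst TYPE('a) lam *\<^sub>R (bwt lam x *\<^sub>R g x)) \<in> borel_measurable lborel"
  by (intro borel_measurable_scaleR borel_measurable_const) (use g bwt_measurable[of lam] in simp_all)
 have "integrable (weighted_vol lam) g \<longleftrightarrow> integrable (lebesgue_on (ball 0 1)) (\<lambda>x. (wconst TYPE('a) lam * bwt lam x) *\<^sub>R g x)"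
  unfolding weighted_vol_eq[OF lam] by (subst integrable_density) (use c in \<open>auto intro!: bm AE_I2\<close>)
 also have "... \<longleftrightarrow> integrable lebesgue (\<lambda>x. indicator (ball 0 1) x *\<^sub>R (wconst TYPE('a) lam * bwt lam x) *\<^sub>R g x)"
  by (subst integrable_restrict_space) auto
 also have "... \<longleftrightarrow> integrable lborel (\<lambda>x. wconst TYPE('a) lam *\<^sub>R (bwt lam x *\<^sub>R g x))"
  unfolding ind by (rule integrable_completion[OF gm])
 also have "... \<longleftrightarrow> integrable lborel (\<lambda>x. bwt lam x *\<^sub>R g x)"
 proof
  assume "integrable lborel (\<lambda>x. wconst TYPE('a) lam *\<^sub>R (bwt lam x *\<^sub>R g x))"
  from integrable_scaleR_right[OF this, of "inverse (wconst TYPE('a) lam)"]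
  show "integrable lborel (\<lambda>x. bwt lam x *\<^sub>R g x)" using c by (simp add: mult.assoc[symmetric])
 qed (rule integrable_scaleR_right)
 finally show "integrable (weighted_vol lam) g \<longleftrightarrow> integrable lborel (\<lambda>x. bwt lam x *\<^sub>R g x)" .
 have "(LINT x|weighted_vol lam. g x) = (\<integral>x. (wconst TYPE('a) lam * bwt lam x) *\<^sub>R g x \<partial>lebesgue_on (ball 0 1))"
  unfolding weighted_vol_eq[OF lam] by (subst integral_density) (use c in \<open>auto intro!: bm AE_I2\<close>)
 also have "... = (LINT x|lebesgue. indicator (ball 0 1) x *\<^sub>R (wconst TYPE('a) lam * bwt lam x) *\<^sub>R g x)"
  by (subst integral_restrict_space) auto
 also have "... = (LINT x|lborel. wconst TYPE('a) lam *\<^sub>R (bwt lam x *\<^sub>R g x))"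
  unfolding ind by (rule integral_completion[OF gm])
 also have "... = wconst TYPE('a) lam *\<^sub>R (LINT x|lborel. bwt lam x *\<^sub>R g x)"
  by (rule integral_scaleR_right)
 finally show "(LINT x|weighted_vol lam. g x) = wconst TYPE('a) lam *\<^sub>R (LINT x|lborel. bwt lam x *\<^sub>R g x)" .
qed

lemma finite_measure_weighted_vol:
 assumes lam: "lam > -1" shows "finite_measure (weighted_vol lam :: 'a::euclidean_space measure)"
proof -
 have "integrable (weighted_vol lam :: 'a measure) (\<lambda>_. 1 :: real)"
  using bwt_integrable[OF lam, where 'a='a] by (subst integral_weighted_vol_borel(1)[OF lam]) auto
 thus ?thesis by (intro finite_measureI) (auto simp: integrable_iff_bounded less_top)
qed

lemma analytic_measurable:
 fixes f :: "complex ^ 'n => complex"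
 assumes f: "analytic_several f (ball 0 1)"
 shows "f \<in> borel_measurable (weighted_vol lam)"
proof -
 have "(\<lambda>w. indicator (ball 0 1) w *\<^sub>R f w) \<in> borel_measurable (weighted_vol lam)"
  by (rule measurable_weighted_vol_borel[OF borel_measurable_ball_indicator[OF f]])
 thus ?thesis by (rule measurable_cong[THEN iffD1, rotated]) simp
qed

section \<open>The projection on analytic functions\<close>

text \<open>The factor with which \<open>bergman_proj\<close> reproduces analytic functions.\<close>

definition berg_const :: "(complex ^ 'n) itself => real => real" where
 "berg_const T lam = wconst T lam * rep_const T lam"

lemma berg_const_pos: "lam > -1 ==> berg_const TYPE(complex ^ 'n) lam > 0"
proof -
 assume lam: "lam > -1"
 have "gauss_mass TYPE(complex ^ 'n) > 0"
 proof -
  have "gauss_mass TYPE(complex ^ 'n) \<noteq> 0"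
  proof
   assume "gauss_mass TYPE(complex ^ 'n) = 0"
   hence "AE w::complex ^ 'n in lborel. exp (- (norm w)\<^sup>2) = 0"
    unfolding gauss_mass_def by (subst (asm) integral_nonneg_eq_0_iff_AE) (use exp_neg_norm_integrable in auto)
   hence "AE w::complex ^ 'n in lborel. False" by simp
   thus False by (simp add: eventually_False ae_filter_eq_bot_iff)
  qed
  moreover have "gauss_mass TYPE(complex ^ 'n) >= 0" by (simp add: gauss_mass_def)
  ultimately show ?thesis by simp
 qed
 moreover have "Gamma (lam + 1) > 0" "Gamma (real CARD('n) + 1 + lam) > 0"
  using lam by (auto intro!: Gamma_real_pos add_nonneg_pos simp: add.assoc)
 ultimately show ?thesis using wconst_pos[OF lam, where 'a = "complex ^ 'n"]
  by (simp add: berg_const_def rep_const_def)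
qed

theorem bergman_proj_analytic:
 fixes f :: "complex ^ 'n => complex"
 assumes lam: "lam > -1" and f: "analytic_several f (ball 0 1)" and int: "integrable (weighted_vol lam) f"
  and z: "z \<in> ball 0 1"
 shows "bergman_proj lam f z = of_real (berg_const TYPE(complex ^ 'n) lam) * f z"
proof -
 define f1 where "f1 w = indicator (ball 0 1) w *\<^sub>R f w" for w
 have f1[measurable]: "f1 \<in> borel_measurable borel" unfolding f1_def[abs_def] by (rule borel_measurable_ball_indicator[OF f])
 have f1': "f1 w = f w" if "w \<in> ball 0 1" for w using that by (simp add: f1_def)
 have b: "bwt lam w *\<^sub>R f1 w = f w * of_real (bwt lam w)" for w
  by (auto simp: f1_def bwt_def indicator_def scaleR_conv_of_real mult.commute)
 have "integrable (weighted_vol lam) f1"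
  using int by (rule Bochner_Integration.integrable_cong[THEN iffD1, rotated -1]) (auto simp: f1')
 hence i: "integrable lborel (\<lambda>w. f w * of_real (bwt lam w))"
  by (subst (asm) integral_weighted_vol_borel(1)[OF lam f1]) (simp only: b)
 let ?s = "complex_of_real (real CARD('n) + 1 + lam)"
 have [measurable]: "(\<lambda>w. f1 w / (1 - herm_inner z w) powr ?s) \<in> borel_measurable borel"
 proof -
  have "(\<lambda>w. indicator (ball 0 1) w *\<^sub>R (f w / (1 - herm_inner z w) powr ?s)) \<in> borel_measurable borel"
  proof (rule borel_measurable_continuous_on_indicator)
   have nz: "Re (herm_inner z w) < 1" if "norm w < 1" for w
    using Re_one_minus[OF herm_inner_less_1, of z w] that z by simp
   thus "continuous_on (ball 0 1) (\<lambda>w. f w / (1 - herm_inner z w) powr ?s)"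
    by (intro continuous_intros analytic_several_continuous_on f) (auto dest!: nz)
  qed simp
  thus ?thesis by (simp add: f1_def scaleR_conv_of_real)
 qed
 have "bergman_proj lam f z = (LINT w|weighted_vol lam. f1 w / (1 - herm_inner z w) powr ?s)"
  unfolding bergman_proj_def by (rule LINT_cong) (auto simp: f1')
 also have "... = wconst TYPE(complex ^ 'n) lam *\<^sub>R (LINT w|lborel. bwt lam w *\<^sub>R (f1 w / (1 - herm_inner z w) powr ?s))"
  by (rule integral_weighted_vol_borel(2)[OF lam]) measurable
 also have "(\<lambda>w. bwt lam w *\<^sub>R (f1 w / (1 - herm_inner z w) powr ?s)) = (\<lambda>w. f w / (1 - herm_inner z w) powr ?s * of_real (bwt lam w))"
  by (auto simp: f1_def bwt_def indicator_def scaleR_conv_of_real mult.commute)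
 also have "(LINT w|lborel. f w / (1 - herm_inner z w) powr ?s * of_real (bwt lam w)) = of_real (rep_const TYPE(complex ^ 'n) lam) * f z"
  by (rule bergman_reproducing[OF f lam i]) (use z in simp)
 finally show ?thesis by (simp add: berg_const_def scaleR_conv_of_real)
qed

section \<open>The positive Bergman operator\<close>

text \<open>Young's inequality gives integrability of the product; applied to normalised functions it gives
the estimate.\<close>

lemma Holder_integral:
 fixes u v :: "'a => real"
 assumes p: "p > 1" "q > 1" "1/p + 1/q = 1"
  and m[measurable]: "u \<in> borel_measurable N" "v \<in> borel_measurable N"
  and nn: "\<And>x. u x >= 0" "\<And>x. v x >= 0"
  and iu: "integrable N (\<lambda>x. u x powr q)" and iv: "integrable N (\<lambda>x. v x powr p)"
 shows "integrable N (\<lambda>x. u x * v x)"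
  and "(LINT x|N. u x * v x) <= (LINT x|N. u x powr q) powr (1/q) * (LINT x|N. v x powr p) powr (1/p)"
proof -
 have Y: "u x * v x <= u x powr q / q + v x powr p / p" for x
  using Youngs_inequality[of q p "u x" "v x"] p nn by (simp add: add.commute)
 show int: "integrable N (\<lambda>x. u x * v x)"
 proof (rule integrable_dominated)
  show "integrable N (\<lambda>x. u x powr q / q + v x powr p / p)" using iu iv by simp
  show "AE x in N. norm (u x * v x) <= norm (u x powr q / q + v x powr p / p)"
   using nn Y by (intro AE_I2) (simp add: order_trans[OF _ abs_ge_self])
 qed measurable
 define X where "X = (LINT x|N. u x powr q)"
 define Z where "Z = (LINT x|N. v x powr p)"
 have X0: "X >= 0" "Z >= 0" by (simp_all add: X_def Z_def)
 show "(LINT x|N. u x * v x) <= (LINT x|N. u x powr q) powr (1/q) * (LINT x|N. v x powr p) powr (1/p)"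
 proof (cases "X = 0 \<or> Z = 0")
  case True
  hence "(AE x in N. u x powr q = 0) \<or> (AE x in N. v x powr p = 0)"
   unfolding X_def Z_def using integral_nonneg_eq_0_iff_AE[OF iu] integral_nonneg_eq_0_iff_AE[OF iv] by auto
  hence "AE x in N. u x * v x = 0" by auto
  hence "(LINT x|N. u x * v x) = 0" by (rule integral_eq_zero_AE)
  thus ?thesis by simp
 next
  case False
  hence pos: "X > 0" "Z > 0" using X0 by auto
  define a where "a = X powr (1/q)"
  define b where "b = Z powr (1/p)"
  have ab: "a > 0" "b > 0" using pos by (auto simp: a_def b_def)
  have aq: "a powr q = X" "b powr p = Z" using pos p by (auto simp: a_def b_def powr_powr)
  have "(LINT x|N. u x * v x) / (a * b) = (LINT x|N. (u x * v x) / (a * b))" by simp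
  also have "... <= (LINT x|N. u x powr q / X / q + v x powr p / Z / p)"
  proof (rule integral_mono)
   fix x
   have "(u x / a) * (v x / b) <= (u x / a) powr q / q + (v x / b) powr p / p"
    using Youngs_inequality[of q p "u x / a" "v x / b"] p nn ab by (simp add: add.commute)
   thus "u x * v x / (a * b) <= u x powr q / X / q + v x powr p / Z / p"
    using nn ab by (simp add: powr_divide aq)
  qed (use int iu iv in auto)
  also have "... = X / X / q + Z / Z / p"
   using iu iv by (simp add: X_def Z_def)
  also have "... = 1" using pos p by simp
  finally show ?thesis using ab by (simp add: divide_le_eq a_def b_def X_def Z_def)
 qed
qed

text \<open>The modulus of the Bergman kernel.\<close>

definition kab :: "real => complex ^ 'n => complex ^ 'n => real" where
 "kab lam z w = cmod (1 - herm_inner z w) powr (- (real CARD('n) + 1 + lam))"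

lemma kab_nonneg [simp]: "kab lam z w >= 0" by (simp add: kab_def)

lemma kab_commute: "kab lam z w = kab lam w z"
 using complex_mod_cnj[of "1 - herm_inner z w"] by (simp add: kab_def herm_inner_cnj)

lemma kab_measurable [measurable]:
 fixes f g :: "'a => complex ^ 'n"
 assumes [measurable]: "f \<in> borel_measurable M" "g \<in> borel_measurable M"
 shows "(\<lambda>x. kab lam (f x) (g x)) \<in> borel_measurable M"
 unfolding kab_def by measurable

lemma one_minus_herm_low:
 assumes "norm w <= 1" shows "cmod (1 - herm_inner z w) >= 1 - norm z"
proof -
 have "norm z * norm w <= norm z * 1" using assms by (intro mult_left_mono) auto
 hence "cmod (herm_inner z w) <= norm z" using herm_inner_bound[of z w] by simp
 thus ?thesis using norm_triangle_ineq2[of 1 "herm_inner z w"] by simp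
qed

lemma kab_bound:
 assumes lam: "lam > -1" and z: "norm z < 1" and w: "norm w <= 1"
 shows "kab lam (z :: complex ^ 'n) w <= (1 - norm z) powr (- (real CARD('n) + 1 + lam))"
 unfolding kab_def
proof (rule powr_mono2')
 show "- (real CARD('n) + 1 + lam) <= 0" using lam by (simp add: add_nonneg_nonneg)
qed (use z one_minus_herm_low[OF w, of z] in auto)

lemma forelli_rudin_weighted:
 assumes lam: "lam > -1" and a: "0 < a" "a < lam + 1"
 shows "\<exists>C\<ge>0. \<forall>z :: complex ^ 'n. norm z < 1 -->
  integrable (weighted_vol lam) (\<lambda>w. kab lam z w * (1 - (norm w)\<^sup>2) powr (- a)) \<and>
  (LINT w|weighted_vol lam. kab lam z w * (1 - (norm w)\<^sup>2) powr (- a)) <= C * (1 - (norm z)\<^sup>2) powr (- a)"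
proof -
 obtain C where C: "C >= 0" "\<And>z :: complex ^ 'n. norm z < 1 ==>
  integrable lborel (\<lambda>w. kab lam z w * bwt (lam - a) w) \<and>
  (LINT w|lborel. kab lam z w * bwt (lam - a) w) <= C * (1 - (norm z)\<^sup>2) powr (- a)"
  using forelli_rudin[OF lam a, where 'n = 'n] unfolding kab_def[symmetric] by blast
 have b: "bwt lam w *\<^sub>R (kab lam z w * (1 - (norm w)\<^sup>2) powr (- a)) = kab lam z w * bwt (lam - a) w" for w z :: "complex ^ 'n"
  by (simp add: bwt_def powr_diff powr_minus divide_inverse)
 have c: "wconst TYPE(complex ^ 'n) lam > 0" by (rule wconst_pos[OF lam])
 show ?thesis
 proof (intro exI[of _ "wconst TYPE(complex ^ 'n) lam * C"] conjI allI impI)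
  show "0 <= wconst TYPE(complex ^ 'n) lam * C" using c C by simp
  fix z :: "complex ^ 'n" assume z: "norm z < 1"
  have m: "(\<lambda>w. kab lam z w * (1 - (norm w)\<^sup>2) powr (- a)) \<in> borel_measurable borel" by measurable
  show "integrable (weighted_vol lam) (\<lambda>w. kab lam z w * (1 - (norm w)\<^sup>2) powr (- a))"
   unfolding integral_weighted_vol_borel(1)[OF lam m] b using C(2)[OF z] by blast
  show "(LINT w|weighted_vol lam. kab lam z w * (1 - (norm w)\<^sup>2) powr (- a)) <= wconst TYPE(complex ^ 'n) lam * C * (1 - (norm z)\<^sup>2) powr (- a)"
   unfolding integral_weighted_vol_borel(2)[OF lam m] b using C(2)[OF z] c by (simp add: mult.assoc mult_left_mono)
 qed
qed

lemma Lp_imp_integrable: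
 fixes f :: "complex ^ 'n => real"
 assumes lam: "lam > -1" and p: "p >= 1" and f[measurable]: "f \<in> borel_measurable (weighted_vol lam)" and f0: "\<And>w. f w >= 0"
  and int: "integrable (weighted_vol lam) (\<lambda>w. f w powr p)"
 shows "integrable (weighted_vol lam) f"
proof -
 interpret W: finite_measure "weighted_vol lam :: (complex ^ 'n) measure" by (rule finite_measure_weighted_vol[OF lam])
 show ?thesis
 proof (rule integrable_dominated_on)
  show "integrable (weighted_vol lam) (\<lambda>w. 1 + f w powr p)" using int by simp
  fix w
  show "norm (f w) <= norm (1 + f w powr p)"
  proof (cases "f w <= 1")
   case False
   hence "f w powr 1 <= f w powr p" using p by (intro powr_mono) auto
   thus ?thesis using False by simp
  qed (use f0[of w] in \<open>simp add: add_increasing2\<close>)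
 qed simp
qed

text \<open>The Bergman operator with its kernel replaced by the modulus.\<close>

definition pplus :: "real => (complex ^ 'n => real) => complex ^ 'n => real" where
 "pplus lam f z = (LINT w|weighted_vol lam. kab lam z w * f w)"

abbreviation pabs :: "real => (complex ^ 'n => complex) => complex ^ 'n => real" where
 "pabs lam f \<equiv> pplus lam (\<lambda>w. cmod (f w))"

lemma kab_mult_integrable:
 fixes f :: "complex ^ 'n => real"
 assumes lam: "lam > -1" and int: "integrable (weighted_vol lam) f" and z: "norm z < 1"
 shows "integrable (weighted_vol lam) (\<lambda>w. kab lam z w * f w)"
proof (rule integrable_dominated_on)
 show "integrable (weighted_vol lam) (\<lambda>w. (1 - norm z) powr (- (real CARD('n) + 1 + lam)) * f w)" using int by simp
 have [measurable]: "f \<in> borel_measurable (weighted_vol lam)" using int by auto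
 show "(\<lambda>w. kab lam z w * f w) \<in> borel_measurable (weighted_vol lam)" by measurable
 fix w :: "complex ^ 'n" assume "w \<in> space (weighted_vol lam)"
 hence "kab lam z w <= (1 - norm z) powr (- (real CARD('n) + 1 + lam))" by (intro kab_bound lam z) auto
 thus "norm (kab lam z w * f w) <= norm ((1 - norm z) powr (- (real CARD('n) + 1 + lam)) * f w)"
  by (simp add: abs_mult mult_right_mono)
qed

lemma pplus_measurable:
 assumes lam: "lam > -1" and [measurable]: "f \<in> borel_measurable (weighted_vol lam :: (complex ^ 'n) measure)"
 shows "pplus lam f \<in> borel_measurable (weighted_vol lam :: (complex ^ 'n) measure)"
proof -
 interpret W: finite_measure "weighted_vol lam :: (complex ^ 'n) measure" by (rule finite_measure_weighted_vol[OF lam])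
 show ?thesis unfolding pplus_def by measurable
qed

text \<open>Schur's test with a small power of \<open>1 - |w|^2\<close>: Hoelder's inequality splits the kernel, the first
factor is controlled by \<open>forelli_rudin_weighted\<close>, and after exchanging the integrals the same estimate controls the second.\<close>

theorem pplus_bounded:
 assumes lam: "lam > -1" and p: "p > 1"
 shows "\<exists>C\<ge>0. \<forall>f :: complex ^ 'n => real. f \<in> borel_measurable (weighted_vol lam) \<and> (\<forall>w. f w >= 0) \<and>
   integrable (weighted_vol lam) (\<lambda>w. f w powr p) -->
  integrable (weighted_vol lam) (\<lambda>z. pplus lam f z powr p) \<and>
  (LINT z|weighted_vol lam. pplus lam f z powr p) <= C * (LINT w|weighted_vol lam. f w powr p)"
proof -
 define W where "W = (weighted_vol lam :: (complex ^ 'n) measure)"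
 interpret W: finite_measure W unfolding W_def by (rule finite_measure_weighted_vol[OF lam])
 interpret WW: pair_sigma_finite W W ..
 have idW[measurable]: "(\<lambda>x. x) \<in> borel_measurable W" unfolding W_def by simp
 define q where "q = p / (p - 1)"
 have q: "q > 1" "1/p + 1/q = 1" using p by (auto simp: q_def field_simps)
 \<comment> \<open>Any positive exponent with both \<open>a p\<close> and \<open>a q\<close> below \<open>lam + 1\<close> will do.\<close>
 define a where "a = (lam + 1) / (2 * (p + q))"
 have a: "a > 0" using lam p q by (simp add: a_def)
 have aq: "0 < a * q" "a * q < lam + 1" "0 < a * p" "a * p < lam + 1"
 proof -
  have "(lam + 1) * q < (lam + 1) * (2 * (p + q))" "(lam + 1) * p < (lam + 1) * (2 * (p + q))"
   using lam p q by (auto intro!: mult_strict_left_mono)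
  thus "a * q < lam + 1" "a * p < lam + 1" using p q by (auto simp: a_def divide_less_eq)
 qed (use a p q in auto)
 obtain C1 where C1: "C1 >= 0" "\<And>z :: complex ^ 'n. norm z < 1 ==>
  integrable W (\<lambda>w. kab lam z w * (1 - (norm w)\<^sup>2) powr (- (a * q)))"
  "\<And>z :: complex ^ 'n. norm z < 1 ==> (LINT w|W. kab lam z w * (1 - (norm w)\<^sup>2) powr (- (a * q))) <= C1 * (1 - (norm z)\<^sup>2) powr (- (a * q))"
  using forelli_rudin_weighted[OF lam aq(1,2), where 'n = 'n] unfolding W_def by blast
 obtain C2 where C2: "C2 >= 0" "\<And>z :: complex ^ 'n. norm z < 1 ==>
  integrable W (\<lambda>w. kab lam z w * (1 - (norm w)\<^sup>2) powr (- (a * p)))"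
  "\<And>z :: complex ^ 'n. norm z < 1 ==> (LINT w|W. kab lam z w * (1 - (norm w)\<^sup>2) powr (- (a * p))) <= C2 * (1 - (norm z)\<^sup>2) powr (- (a * p))"
  using forelli_rudin_weighted[OF lam aq(3,4), where 'n = 'n] unfolding W_def by blast
 define h where "h w = 1 - (norm (w :: complex ^ 'n))\<^sup>2" for w
 have h[measurable]: "h \<in> borel_measurable W" unfolding h_def by measurable
 have h01: "0 < h w" "h w <= 1" if "w \<in> space W" for w
  using that by (auto simp: h_def W_def abs_square_less_1)
 show ?thesis unfolding W_def[symmetric]
 proof (intro exI[of _ "C1 powr (p / q) * C2"] conjI allI impI; (elim conjE)?)
  show "0 <= C1 powr (p / q) * C2" using C2 by simp
  fix f :: "complex ^ 'n => real"
  assume f[measurable]: "f \<in> borel_measurable W" and f0: "\<forall>w. f w >= 0" and fp: "integrable W (\<lambda>w. f w powr p)"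
  have f1: "integrable W f" using Lp_imp_integrable[OF lam, of p f] f f0 fp p unfolding W_def by auto
  have Pm[measurable]: "pplus lam f \<in> borel_measurable W" using pplus_measurable[OF lam] f unfolding W_def by blast
  have gint: "integrable W (\<lambda>w. f w powr p * h w powr (a * p))"
  proof (rule integrable_dominated_on[OF fp])
   fix w assume w: "w \<in> space W"
   have "h w powr (a * p) <= 1" using h01[OF w] aq by (intro powr_le1) auto
   thus "norm (f w powr p * h w powr (a * p)) <= norm (f w powr p)" by (simp add: mult_left_le)
  qed simp
  have point: "pplus lam f z powr p <= C1 powr (p / q) * (h z powr (- (a * p)) * (LINT w|W. kab lam z w * (f w powr p * h w powr (a * p))))"
   if z: "z \<in> space W" for z
  proof -
   have nz: "norm z < 1" using z by (simp add: W_def)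
   define u where "u w = kab lam z w powr (1/q) * \<bar>h w\<bar> powr (- a)" for w
   define v where "v w = kab lam z w powr (1/p) * (f w * \<bar>h w\<bar> powr a)" for w
   have [measurable]: "u \<in> borel_measurable W" "v \<in> borel_measurable W"
    unfolding u_def v_def by measurable
   have uv: "u w * v w = kab lam z w * f w" if "w \<in> space W" for w
   proof -
    have "u w * v w = kab lam z w powr (1/q + 1/p) * f w * (h w powr (-a) * h w powr a)"
     using h01[OF that] by (simp add: u_def v_def powr_add)
    also have "h w powr (-a) * h w powr a = 1" using h01[OF that] by (simp flip: powr_add)
    finally show ?thesis using q(2) by (simp add: add.commute)
   qed
   have uq: "u w powr q = kab lam z w * (1 - (norm w)\<^sup>2) powr (- (a * q))" if "w \<in> space W" for w
    using h01[OF that] q by (simp add: u_def powr_mult powr_powr h_def)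
   have vp: "v w powr p = kab lam z w * (f w powr p * h w powr (a * p))" if "w \<in> space W" for w
    using h01[OF that] p f0 by (simp add: v_def powr_mult powr_powr)
   have iu: "integrable W (\<lambda>w. u w powr q)"
    using C1(2)[OF nz] by (rule Bochner_Integration.integrable_cong[THEN iffD2, rotated -1]) (auto simp: uq)
   have iv: "integrable W (\<lambda>w. v w powr p)"
    using kab_mult_integrable[OF lam gint[unfolded W_def] nz, folded W_def]
    by (rule Bochner_Integration.integrable_cong[THEN iffD2, rotated -1]) (auto simp: vp)
   have "pplus lam f z = (LINT w|W. u w * v w)"
    unfolding pplus_def W_def[symmetric] by (rule LINT_cong) (auto simp: uv)
   also have "... <= (LINT w|W. u w powr q) powr (1/q) * (LINT w|W. v w powr p) powr (1/p)"
    by (rule Holder_integral(2)[OF p q _ _ _ _ iu iv]) (use f0 in \<open>auto simp: u_def v_def\<close>)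
   also have "(LINT w|W. u w powr q) = (LINT w|W. kab lam z w * (1 - (norm w)\<^sup>2) powr (- (a * q)))"
    by (rule LINT_cong) (auto simp: uq)
   also have "(LINT w|W. v w powr p) = (LINT w|W. kab lam z w * (f w powr p * h w powr (a * p)))"
    by (rule LINT_cong) (auto simp: vp)
   finally have "pplus lam f z <= (LINT w|W. kab lam z w * (1 - (norm w)\<^sup>2) powr (- (a * q))) powr (1/q)
     * (LINT w|W. kab lam z w * (f w powr p * h w powr (a * p))) powr (1/p)" (is "_ <= ?X powr _ * ?Y powr _") .
   moreover have P0: "pplus lam f z >= 0" unfolding pplus_def by (rule integral_nonneg_AE) (use f0 in simp)
   ultimately have "pplus lam f z powr p <= (?X powr (1/q) * ?Y powr (1/p)) powr p"
    using p by (intro powr_mono2) auto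
   also have "... = ?X powr (p/q) * ?Y"
   proof -
    have "?Y >= 0" by (rule integral_nonneg_AE) simp
    thus ?thesis using p by (simp add: powr_mult powr_powr)
   qed
   also have "... <= (C1 * h z powr (- (a * q))) powr (p/q) * ?Y"
    using C1(3)[OF nz] p q by (intro mult_right_mono powr_mono2) (auto simp: h_def intro!: integral_nonneg_AE)
   also have "(C1 * h z powr (- (a * q))) powr (p/q) = C1 powr (p/q) * h z powr (- (a * p))"
    using C1(1) q by (simp add: powr_mult powr_powr)
   finally show ?thesis by (simp add: mult.assoc)
  qed
  have main: "(\<integral>\<^sup>+z. ennreal (pplus lam f z powr p) \<partial>W) <= ennreal (C1 powr (p / q) * C2 * (LINT w|W. f w powr p))"
  proof -
   have "(\<integral>\<^sup>+z. ennreal (pplus lam f z powr p) \<partial>W)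
    <= (\<integral>\<^sup>+z. ennreal (C1 powr (p / q)) * (\<integral>\<^sup>+w. ennreal (h z powr (- (a * p)) * kab lam z w * (f w powr p * h w powr (a * p))) \<partial>W) \<partial>W)"
   proof (rule nn_integral_mono)
    fix z assume z: "z \<in> space W"
    have nz: "norm z < 1" using z by (simp add: W_def)
    have "ennreal (pplus lam f z powr p) <= ennreal (C1 powr (p / q) * (h z powr (- (a * p)) * (LINT w|W. kab lam z w * (f w powr p * h w powr (a * p)))))"
     by (rule ennreal_leI[OF point[OF z]])
    also have "... = ennreal (C1 powr (p / q)) * ennreal (LINT w|W. h z powr (- (a * p)) * (kab lam z w * (f w powr p * h w powr (a * p))))"
     by (subst ennreal_mult'[symmetric]) auto
    also have "ennreal (LINT w|W. h z powr (- (a * p)) * (kab lam z w * (f w powr p * h w powr (a * p))))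
      = (\<integral>\<^sup>+w. ennreal (h z powr (- (a * p)) * (kab lam z w * (f w powr p * h w powr (a * p)))) \<partial>W)"
     by (rule nn_integral_eq_integral[symmetric])
      (use kab_mult_integrable[OF lam gint[unfolded W_def] nz, folded W_def] in auto)
    finally show "ennreal (pplus lam f z powr p)
     <= ennreal (C1 powr (p / q)) * (\<integral>\<^sup>+w. ennreal (h z powr (- (a * p)) * kab lam z w * (f w powr p * h w powr (a * p))) \<partial>W)"
     by (simp add: mult.assoc)
   qed
   also have "... = ennreal (C1 powr (p / q)) * (\<integral>\<^sup>+z. (\<integral>\<^sup>+w. ennreal (h z powr (- (a * p)) * kab lam z w * (f w powr p * h w powr (a * p))) \<partial>W) \<partial>W)"
    by (rule nn_integral_cmult) measurable
   also have "(\<integral>\<^sup>+z. (\<integral>\<^sup>+w. ennreal (h z powr (- (a * p)) * kab lam z w * (f w powr p * h w powr (a * p))) \<partial>W) \<partial>W)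
    = (\<integral>\<^sup>+w. (\<integral>\<^sup>+z. ennreal (h z powr (- (a * p)) * kab lam z w * (f w powr p * h w powr (a * p))) \<partial>W) \<partial>W)"
    by (rule WW.Fubini') measurable
   also have "... <= (\<integral>\<^sup>+w. ennreal C2 * ennreal (f w powr p) \<partial>W)"
   proof (rule nn_integral_mono)
    fix w assume w: "w \<in> space W"
    have nw: "norm w < 1" using w by (simp add: W_def)
    have "(\<integral>\<^sup>+z. ennreal (h z powr (- (a * p)) * kab lam z w * (f w powr p * h w powr (a * p))) \<partial>W)
     = (\<integral>\<^sup>+z. ennreal (kab lam w z * (1 - (norm z)\<^sup>2) powr (- (a * p))) * ennreal (f w powr p * h w powr (a * p)) \<partial>W)"
     by (intro nn_integral_cong) (simp add: ennreal_mult'[symmetric] h_def kab_commute[of lam w] mult_ac)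
    also have "... = (\<integral>\<^sup>+z. ennreal (kab lam w z * (1 - (norm z)\<^sup>2) powr (- (a * p))) \<partial>W) * ennreal (f w powr p * h w powr (a * p))"
     by (rule nn_integral_multc) measurable
    also have "(\<integral>\<^sup>+z. ennreal (kab lam w z * (1 - (norm z)\<^sup>2) powr (- (a * p))) \<partial>W) = ennreal (LINT z|W. kab lam w z * (1 - (norm z)\<^sup>2) powr (- (a * p)))"
     by (rule nn_integral_eq_integral[OF C2(2)[OF nw]]) simp
    also have "... * ennreal (f w powr p * h w powr (a * p)) <= ennreal (C2 * h w powr (- (a * p))) * ennreal (f w powr p * h w powr (a * p))"
     using C2(3)[OF nw] by (intro mult_right_mono ennreal_leI) (auto simp: h_def)
    also have "... = ennreal C2 * ennreal (f w powr p)"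
    proof -
     have "h w powr (- (a * p)) * h w powr (a * p) = 1" using h01[OF w] by (simp flip: powr_add)
     hence "(C2 * h w powr (- (a * p))) * (f w powr p * h w powr (a * p)) = C2 * f w powr p" by (simp add: mult_ac)
     thus ?thesis using C2(1) by (simp flip: ennreal_mult')
    qed
    finally show "(\<integral>\<^sup>+z. ennreal (h z powr (- (a * p)) * kab lam z w * (f w powr p * h w powr (a * p))) \<partial>W) <= ennreal C2 * ennreal (f w powr p)" .
   qed
   also have "... = ennreal C2 * ennreal (LINT w|W. f w powr p)"
    by (subst nn_integral_cmult) (use fp in \<open>auto simp: nn_integral_eq_integral\<close>)
   finally show ?thesis using C2(1) by (simp add: ennreal_mult' mult.assoc mult_left_mono)
  qed
  show I: "integrable W (\<lambda>z. pplus lam f z powr p)"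
   using main by (intro integrableI_bounded) (auto simp: order_le_less_trans)
  show "(LINT z|W. pplus lam f z powr p) <= C1 powr (p / q) * C2 * (LINT w|W. f w powr p)"
   using main nn_integral_eq_integral[OF I] C2(1) by (simp add: ennreal_le_iff)
 qed
qed

section \<open>Analyticity of projections and of limits\<close>

text \<open>The Bergman kernel itself, so that \<open>bergman_proj lam f z\<close> is the integral of \<open>f\<close> against \<open>kc lam z\<close>.\<close>

definition kc :: "real => complex ^ 'n => complex ^ 'n => complex" where
 "kc lam z w = 1 / (1 - herm_inner z w) powr of_real (real CARD('n) + 1 + lam)"

lemma kc_measurable [measurable]:
 fixes f g :: "'a => complex ^ 'n"
 assumes [measurable]: "f \<in> borel_measurable M" "g \<in> borel_measurable M"
 shows "(\<lambda>x. kc lam (f x) (g x)) \<in> borel_measurable M"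
 unfolding kc_def by measurable

lemma cmod_kc: "cmod (kc lam z w) = kab lam z w"
 unfolding kc_def kab_def norm_divide cmod_powr_real powr_minus_divide by simp

lemma cnj_kc:
 assumes "norm z < 1" "norm w < 1" shows "cnj (kc lam z w) = kc lam w z"
proof -
 have "Re (herm_inner z w) < 1" using Re_one_minus[OF herm_inner_less_1[OF assms]] by simp
 thus ?thesis unfolding kc_def complex_cnj_divide
  by (subst cnj_powr) (simp_all add: herm_inner_cnj)
qed

lemma bergman_proj_kc: "bergman_proj lam f z = (LINT w|weighted_vol lam. f w * kc lam z w)"
 by (simp add: bergman_proj_def kc_def)

lemma kc_integrable:
 fixes h :: "complex ^ 'n => complex"
 assumes lam: "lam > -1" and h: "integrable (weighted_vol lam) h" and z: "norm z < 1"
 shows "integrable (weighted_vol lam) (\<lambda>w. h w * kc lam z w)"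
proof -
 have [measurable]: "h \<in> borel_measurable (weighted_vol lam)" using h by auto
 show ?thesis
  by (rule integrable_dominated[OF kab_mult_integrable[OF lam integrable_norm[OF h] z]])
   (auto simp: norm_mult cmod_kc mult.commute)
qed

lemma bergman_proj_bound:
 fixes h :: "complex ^ 'n => complex"
 shows "cmod (bergman_proj lam h z) <= pabs lam h z"
 unfolding bergman_proj_kc pplus_def
 by (rule order_trans[OF integral_norm_bound]) (simp add: norm_mult cmod_kc mult.commute)

text \<open>A quadratic Taylor remainder, uniform on the disc of radius \<open>\<rho>\<close>; integrated against \<open>h\<close> it
makes the Bergman projection differentiable.\<close>

lemma has_derivative_kernel_taylor:
 fixes s :: real
 assumes \<rho>: "0 <= \<rho>" "\<rho> < 1" and s: "s > 0" and x: "cmod x <= \<rho>" and x0: "cmod x0 <= \<rho>"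
 shows "cmod (1 / (1 - x) powr of_real s - (1 / (1 - x0) powr of_real s
  + of_real s * (1 - x0) powr (- of_real (s + 1)) * (x - x0)))
  <= s * (s + 1) * (1 - \<rho>) powr (- (s + 2)) * (cmod (x - x0))\<^sup>2"
proof -
 define f where "f i x = of_real (pochhammer s i) * (1 - x) powr (- complex_of_real (s + i))" for i :: nat and x :: complex
 have "cmod (f 0 x - (\<Sum>i\<le>1. f i x0 * (x - x0) ^ i / fact i))
  <= (s * (s + 1) * (1 - \<rho>) powr (- (s + 2))) * cmod (x - x0) ^ Suc 1 / fact 1"
 proof (rule complex_Taylor[of "cball 0 \<rho>"])
  fix i :: nat and u :: complex assume u: "u \<in> cball 0 \<rho>"
  hence "1 - u \<notin> \<real>\<^sub>\<le>\<^sub>0" using \<rho> by (intro not_nonpos_Reals Re_one_minus) auto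
  hence "((\<lambda>x. (1 - x) powr (- complex_of_real (s + i))) has_field_derivative
    (- complex_of_real (s + i)) * (1 - u) powr (- complex_of_real (s + i) - 1) * (- 1)) (at u)"
   by (intro DERIV_chain2[of "\<lambda>u. u powr (- complex_of_real (s + i))" _ "\<lambda>x. 1 - x"] has_field_derivative_powr)
    (auto intro!: derivative_eq_intros)
  from DERIV_cmult[OF this, of "of_real (pochhammer s i)"]
  have "(f i has_field_derivative of_real (pochhammer s i) * ((- complex_of_real (s + i)) * (1 - u) powr (- complex_of_real (s + i) - 1) * (- 1))) (at u)"
   unfolding f_def .
  moreover have "of_real (pochhammer s i) * ((- complex_of_real (s + i)) * (1 - u) powr (- complex_of_real (s + i) - 1) * (- 1)) = f (Suc i) u"
  proof -
   have e: "- complex_of_real (s + i) - 1 = - complex_of_real (s + Suc i)" by simp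
   show ?thesis unfolding e f_def pochhammer_Suc of_real_mult by (simp add: algebra_simps)
  qed
  ultimately show "(f i has_field_derivative f (Suc i) u) (at u within cball 0 \<rho>)"
   by (metis has_field_derivative_at_within)
 next
  fix u :: complex assume u: "u \<in> cball 0 \<rho>"
  have "1 - \<rho> <= cmod (1 - u)" using norm_triangle_ineq2[of 1 u] u by simp
  hence "cmod (1 - u) powr (- (s + 2)) <= (1 - \<rho>) powr (- (s + 2))"
   using \<rho> s by (intro powr_mono2') auto
  hence "(s * (s + 1)) * cmod (1 - u) powr (- (s + 2)) <= (s * (s + 1)) * (1 - \<rho>) powr (- (s + 2))"
   using s by (intro mult_left_mono) auto
  moreover have "cmod ((1 - u) powr (- complex_of_real (s + 2))) = cmod (1 - u) powr (- (s + 2))"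
   using cmod_powr_real[of "1 - u" "- (s + 2)"] by simp
  moreover have "pochhammer s (Suc 1) = s * (s + 1)" by (simp add: pochhammer_Suc)
  ultimately show "cmod (f (Suc 1) u) <= s * (s + 1) * (1 - \<rho>) powr (- (s + 2))"
   unfolding f_def using s by (simp add: norm_mult)
 qed (use x x0 in auto)
 thus ?thesis by (simp add: f_def powr_minus divide_inverse power2_eq_square)
qed

text \<open>Differentiation under the integral sign: the first-order Taylor term is complex linear in the increment
of \<open>z\<close>, and the remainder is quadratic uniformly in \<open>w\<close>.\<close>

theorem bergman_proj_analytic_several:
 fixes h :: "complex ^ 'n => complex"
 assumes lam: "lam > -1" and h: "integrable (weighted_vol lam) h"
 shows "analytic_several (bergman_proj lam h) (ball 0 1)"
 unfolding analytic_several_def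
proof
 fix z0 :: "complex ^ 'n" assume "z0 \<in> ball 0 1"
 hence z0: "norm z0 < 1" by simp
 define W where "W = (weighted_vol lam :: (complex ^ 'n) measure)"
 have hW: "integrable W h" using h by (simp add: W_def)
 have [measurable]: "h \<in> borel_measurable W" "(\<lambda>x. x) \<in> borel_measurable W" using hW by (auto simp: W_def)
 define q where "q = real CARD('n) + 1 + lam"
 have q: "q > 0" using lam by (simp add: q_def add_nonneg_pos add.assoc)
 \<comment> \<open>Twice as close to the sphere as \<open>z0\<close>, to leave room for the increment.\<close>
 define \<rho> where "\<rho> = (1 + norm z0) / 2"
 have \<rho>: "0 <= \<rho>" "\<rho> < 1" "norm z0 <= \<rho>" using z0 by (auto simp: \<rho>_def)
 define D where "D w = h w * (of_real q * (1 - herm_inner z0 w) powr (- of_real (q + 1)))" for w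
 define B where "B = q * (q + 1) * (1 - \<rho>) powr (- (q + 2))"
 have xb: "cmod (herm_inner z w) <= \<rho>" if "norm z <= \<rho>" "w \<in> space W" for z w
 proof -
  have "norm z * norm w <= \<rho> * 1" using that \<rho> by (intro mult_mono) (auto simp: W_def)
  thus ?thesis using herm_inner_bound[of z w] by simp
 qed
 have Dint: "integrable W (\<lambda>w. D w * herm_inner v w)" for v
 proof (rule integrable_dominated_on)
  show "integrable W (\<lambda>w. of_real (q * (1 - \<rho>) powr (- (q + 1)) * norm v) * h w)" using hW by simp
  show "(\<lambda>w. D w * herm_inner v w) \<in> borel_measurable W" unfolding D_def by measurable
  fix w assume w: "w \<in> space W"
  have "1 - \<rho> <= cmod (1 - herm_inner z0 w)"
   using norm_triangle_ineq2[of 1 "herm_inner z0 w"] xb[OF \<rho>(3) w] by simp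
  hence "cmod (1 - herm_inner z0 w) powr (- (q + 1)) <= (1 - \<rho>) powr (- (q + 1))"
   using \<rho> q by (intro powr_mono2') auto
  moreover have "cmod (herm_inner v w) <= norm v"
  proof -
   have "norm v * norm w <= norm v * 1" using w by (intro mult_left_mono) (auto simp: W_def)
   thus ?thesis using herm_inner_bound[of v w] by simp
  qed
  ultimately have "(q * cmod (1 - herm_inner z0 w) powr (- (q + 1)) * cmod (herm_inner v w)) * cmod (h w)
   <= (q * (1 - \<rho>) powr (- (q + 1)) * norm v) * cmod (h w)"
   using q by (intro mult_right_mono mult_mono) auto
  moreover have e: "cmod ((1 - herm_inner z0 w) powr (- complex_of_real (q + 1))) = cmod (1 - herm_inner z0 w) powr (- (q + 1))"
   using cmod_powr_real[of "1 - herm_inner z0 w" "- (q + 1)"] by simp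
  have "norm (D w * herm_inner v w) = (q * cmod (1 - herm_inner z0 w) powr (- (q + 1)) * cmod (herm_inner v w)) * cmod (h w)"
   unfolding D_def norm_mult e norm_of_real abs_of_pos[OF q] by (simp only: mult_ac)
  moreover have X0: "0 <= q * (1 - \<rho>) powr (- (q + 1)) * norm v" using q by simp
  ultimately show "norm (D w * herm_inner v w) <= norm (of_real (q * (1 - \<rho>) powr (- (q + 1)) * norm v) * h w)"
   unfolding norm_mult[of _ "h w"] norm_of_real abs_of_nonneg[OF X0] by simp
 qed
 define L where "L v = (LINT w|W. D w * herm_inner v w)" for v
 have Ladd: "L (x + y) = L x + L y" for x y
  unfolding L_def herm_inner_add_left distrib_left by (rule Bochner_Integration.integral_add[OF Dint Dint])
 have Lsm: "L (c *s v) = c * L v" for c v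
 proof -
  have "L (c *s v) = (LINT w|W. c * (D w * herm_inner v w))"
   unfolding L_def herm_inner_smult_left by (simp add: mult_ac)
  thus ?thesis unfolding L_def by simp
 qed
 have Llin: "linear L"
  by (intro linearI Ladd) (metis Lsm scaleR_conv_of_real vec_smult_scaleR)
 have Lbl: "bounded_linear L" using Llin linear_conv_bounded_linear by blast
 define H where "H = (LINT w|W. cmod (h w))"
 have "(bergman_proj lam h has_derivative L) (at z0)"
 proof (rule has_derivativeI_sandwich[of "(1 - norm z0) / 2"])
  show "0 < (1 - norm z0) / 2" using z0 by simp
  show "bounded_linear L" by (rule Lbl)
  show "((\<lambda>y. B * H * norm (y - z0)) \<longlongrightarrow> 0) (at z0)"
   by (auto intro!: tendsto_eq_intros)
  fix y assume y: "y \<noteq> z0" "dist y z0 < (1 - norm z0) / 2"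
  have "norm y <= norm z0 + dist y z0" using norm_triangle_sub[of y z0] by (simp add: dist_norm)
  hence yr: "norm y <= \<rho>" using y by (simp add: \<rho>_def field_simps)
  have iy: "integrable W (\<lambda>w. h w * kc lam y w)" unfolding W_def by (rule kc_integrable[OF lam h]) (use yr \<rho> in simp)
  have iz: "integrable W (\<lambda>w. h w * kc lam z0 w)" unfolding W_def by (rule kc_integrable[OF lam h z0])
  have "bergman_proj lam h y - bergman_proj lam h z0 - L (y - z0)
   = (LINT w|W. h w * kc lam y w - h w * kc lam z0 w - D w * herm_inner (y - z0) w)"
   unfolding bergman_proj_kc L_def W_def[symmetric]
   using iy iz Dint by (simp add: Bochner_Integration.integral_diff)
  also have "cmod ... <= (LINT w|W. B * (norm (y - z0))\<^sup>2 * cmod (h w))"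
  proof (rule order_trans[OF integral_norm_bound], rule integral_mono)
   show "integrable W (\<lambda>w. cmod (h w * kc lam y w - h w * kc lam z0 w - D w * herm_inner (y - z0) w))"
    using iy iz Dint by (intro integrable_norm Bochner_Integration.integrable_diff)
   show "integrable W (\<lambda>w. B * (norm (y - z0))\<^sup>2 * cmod (h w))" using hW by simp
   fix w assume w: "w \<in> space W"
   have e: "h w * kc lam y w - h w * kc lam z0 w - D w * herm_inner (y - z0) w
    = h w * (1 / (1 - herm_inner y w) powr of_real q - (1 / (1 - herm_inner z0 w) powr of_real q
  + of_real q * (1 - herm_inner z0 w) powr (- of_real (q + 1)) * (herm_inner y w - herm_inner z0 w)))"
    by (simp only: kc_def D_def q_def[symmetric] herm_inner_diff_left) (simp add: algebra_simps)
   have "cmod (herm_inner y w - herm_inner z0 w) <= norm (y - z0)"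
   proof -
    have "norm (y - z0) * norm w <= norm (y - z0) * 1" using w by (intro mult_left_mono) (auto simp: W_def)
    thus ?thesis using herm_inner_bound[of "y - z0" w] by (simp add: herm_inner_diff_left)
   qed
   hence sq: "(cmod (herm_inner y w - herm_inner z0 w))\<^sup>2 <= (norm (y - z0))\<^sup>2" by (intro power_mono) auto
   have "cmod (h w * kc lam y w - h w * kc lam z0 w - D w * herm_inner (y - z0) w)
    <= cmod (h w) * (B * (cmod (herm_inner y w - herm_inner z0 w))\<^sup>2)"
    unfolding e norm_mult B_def
    by (intro mult_left_mono has_derivative_kernel_taylor \<rho> q xb yr w) auto
   also have "... <= cmod (h w) * (B * (norm (y - z0))\<^sup>2)"
    using sq q \<rho> by (intro mult_left_mono) (auto simp: B_def)
   finally show "cmod (h w * kc lam y w - h w * kc lam z0 w - D w * herm_inner (y - z0) w)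
    <= B * (norm (y - z0))\<^sup>2 * cmod (h w)" by (simp add: mult_ac)
  qed
  also have "... = B * H * norm (y - z0) * norm (y - z0)" by (simp add: H_def power2_eq_square)
  finally show "norm (bergman_proj lam h y - bergman_proj lam h z0 - L (y - z0)) / norm (y - z0) <= B * H * norm (y - z0)"
   using y by (simp add: divide_le_eq)
 qed
 thus "\<exists>L. (bergman_proj lam h has_derivative L) (at z0) \<and> (\<forall>c v. L (c *s v) = c * L v)"
  using Lsm by blast
qed

lemma analytic_several_scale:
 fixes f :: "complex ^ 'n => complex"
 assumes f: "analytic_several f S" and T: "\<And>z. z \<in> T ==> r *\<^sub>R z \<in> S"
 shows "analytic_several (\<lambda>z. f (r *\<^sub>R z)) T"
 unfolding analytic_several_def
proof
 fix z assume z: "z \<in> T"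
 obtain L where L: "(f has_derivative L) (at (r *\<^sub>R z))" "\<And>c v. L (c *s v) = c * L v"
  using f T[OF z] unfolding analytic_several_def by blast
 have "((\<lambda>z. r *\<^sub>R z) has_derivative (\<lambda>v. r *\<^sub>R v)) (at z)" by (auto intro!: derivative_eq_intros)
 from has_derivative_compose[OF this L(1)]
 have 1: "((\<lambda>z. f (r *\<^sub>R z)) has_derivative (\<lambda>v. L (r *\<^sub>R v))) (at z)" .
 have 2: "L (r *\<^sub>R (c *s v)) = c * L (r *\<^sub>R v)" for c v
 proof -
  have "r *\<^sub>R (c *s v) = c *s (r *\<^sub>R v)" by vector
  thus ?thesis by (simp only: L(2))
 qed
 from 1 2 show "\<exists>L. ((\<lambda>z. f (r *\<^sub>R z)) has_derivative L) (at z) \<and> (\<forall>c v. L (c *s v) = c * L v)"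
  by (intro exI[of _ "\<lambda>v. L (r *\<^sub>R v)"]) auto
qed

lemma analytic_several_cmult:
 assumes "analytic_several f S" shows "analytic_several (\<lambda>z. k * f z) S"
 unfolding analytic_several_def
proof
 fix z assume "z \<in> S"
 then obtain L where L: "(f has_derivative L) (at z)" "\<And>c v. L (c *s v) = c * L v"
  using assms unfolding analytic_several_def by blast
 have "((\<lambda>z. k * f z) has_derivative (\<lambda>v. k * L v)) (at z)" using L(1) by (rule has_derivative_mult_right)
 thus "\<exists>L. ((\<lambda>z. k * f z) has_derivative L) (at z) \<and> (\<forall>c v. L (c *s v) = c * L v)"
  by (intro exI[of _ "\<lambda>v. k * L v"]) (auto simp: L(2))
qed

lemma analytic_several_add:
 assumes "analytic_several f S" "analytic_several g S" shows "analytic_several (\<lambda>z. f z + g z) S"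
 unfolding analytic_several_def
proof
 fix z assume z: "z \<in> S"
 obtain L where L: "(f has_derivative L) (at z)" "\<And>c v. L (c *s v) = c * L v"
  using assms z unfolding analytic_several_def by blast
 obtain L' where L': "(g has_derivative L') (at z)" "\<And>c v. L' (c *s v) = c * L' v"
  using assms z unfolding analytic_several_def by blast
 show "\<exists>L. ((\<lambda>z. f z + g z) has_derivative L) (at z) \<and> (\<forall>c v. L (c *s v) = c * L v)"
  by (intro exI[of _ "\<lambda>v. L v + L' v"] conjI has_derivative_add L L') (auto simp: L(2) L'(2) algebra_simps)
qed

lemma analytic_several_cong:
 assumes f: "analytic_several f S" and S: "open S" and eq: "\<And>z. z \<in> S ==> f z = g z"
 shows "analytic_several g S"
 unfolding analytic_several_def
proof
 fix z assume z: "z \<in> S"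
 obtain L where L: "(f has_derivative L) (at z)" "\<forall>c v. L (c *s v) = c * L v"
  using f z unfolding analytic_several_def by blast
 have "(g has_derivative L) (at z)"
  by (rule has_derivative_transform_within_open[OF L(1) S z eq])
 thus "\<exists>L. (g has_derivative L) (at z) \<and> (\<forall>c v. L (c *s v) = c * L v)" using L(2) by blast
qed

text \<open>On a smaller ball the functions are bounded and reproduced by the Bergman projection. Dominated
convergence passes this to the limit, which is therefore itself a Bergman projection and hence analytic.\<close>

theorem analytic_several_limit:
 fixes F :: "nat => complex ^ 'n => complex"
 assumes F: "\<And>k. analytic_several (F k) (ball 0 1)"
  and bd: "\<And>r. 0 < r ==> r < 1 ==> \<exists>B. \<forall>k z. norm z <= r --> cmod (F k z) <= B"
  and lim: "\<And>z. norm z < 1 ==> (\<lambda>k. F k z) \<longlonglongrightarrow> f z"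
 shows "analytic_several f (ball 0 1)"
proof -
 interpret W: finite_measure "weighted_vol 0 :: (complex ^ 'n) measure" by (rule finite_measure_weighted_vol) simp
 have loc: "analytic_several f (ball 0 r)" if r: "0 < r" "r < 1" for r
 proof -
  obtain B where B: "\<And>k z. norm z <= r ==> cmod (F k z) <= B" using bd[OF r] by blast
  have rz: "norm (r *\<^sub>R z) <= r" if "norm z < 1" for z :: "complex ^ 'n" using that r by (simp add: mult_left_le)
  have rz': "norm (r *\<^sub>R z) < 1" if "norm z < 1" for z :: "complex ^ 'n" using rz[OF that] r(2) by linarith
  have an: "analytic_several (\<lambda>z. F k (r *\<^sub>R z)) (ball 0 1)" for k
   by (rule analytic_several_scale[OF F]) (use rz' in \<open>simp del: norm_scaleR\<close>)
  have meas: "(\<lambda>z. F k (r *\<^sub>R z)) \<in> borel_measurable (weighted_vol 0)" for k by (rule analytic_measurable[OF an])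
  have limr: "(\<lambda>k. F k (r *\<^sub>R z)) \<longlonglongrightarrow> f (r *\<^sub>R z)" if "z \<in> space (weighted_vol 0 :: (complex ^ 'n) measure)" for z
   using that by (intro lim rz') simp
  have measf: "(\<lambda>z. f (r *\<^sub>R z)) \<in> borel_measurable (weighted_vol 0)"
   by (rule borel_measurable_LIMSEQ_metric[OF meas limr])
  have Bf: "cmod (f (r *\<^sub>R z)) <= B" if "norm z < 1" for z
   by (rule LIMSEQ_le_const2[OF tendsto_norm[OF lim[OF rz'[OF that]]]]) (use B rz[OF that] in auto)
  have intF: "integrable (weighted_vol 0) (\<lambda>z. F k (r *\<^sub>R z))" for k
   by (rule W.integrable_const_bound[of _ B, OF _ meas]) (use B rz in \<open>auto intro!: AE_I2\<close>)
  have intf: "integrable (weighted_vol 0) (\<lambda>z. f (r *\<^sub>R z))"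
   by (rule W.integrable_const_bound[of _ B, OF _ measf]) (use Bf in \<open>auto intro!: AE_I2\<close>)
  define c where "c = berg_const TYPE(complex ^ 'n) 0"
  have c: "c > 0" unfolding c_def by (rule berg_const_pos) simp
  have eq: "bergman_proj 0 (\<lambda>z. f (r *\<^sub>R z)) z = of_real c * f (r *\<^sub>R z)" if z: "norm z < 1" for z
  proof (rule LIMSEQ_unique)
   have "(\<lambda>k. bergman_proj 0 (\<lambda>z. F k (r *\<^sub>R z)) z) \<longlonglongrightarrow> bergman_proj 0 (\<lambda>z. f (r *\<^sub>R z)) z"
    unfolding bergman_proj_kc
   proof (rule integral_dominated_convergence[where w = "\<lambda>w. B * kab 0 z w"])
    show "(\<lambda>w. f (r *\<^sub>R w) * kc 0 z w) \<in> borel_measurable (weighted_vol 0)" using measf by measurable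
    show "(\<lambda>w. F k (r *\<^sub>R w) * kc 0 z w) \<in> borel_measurable (weighted_vol 0)" for k using meas[of k] by measurable
    show "integrable (weighted_vol 0) (\<lambda>w. B * kab 0 z w)"
     using kab_mult_integrable[of 0 "\<lambda>_. 1" z] z by simp
    show "AE w in weighted_vol 0. (\<lambda>k. F k (r *\<^sub>R w) * kc 0 z w) \<longlonglongrightarrow> f (r *\<^sub>R w) * kc 0 z w"
     by (intro AE_I2 tendsto_mult limr tendsto_const)
    show "AE w in weighted_vol 0. norm (F k (r *\<^sub>R w) * kc 0 z w) <= B * kab 0 z w" for k
     using B rz by (intro AE_I2) (auto simp: norm_mult cmod_kc intro!: mult_right_mono)
   qed
   thus "(\<lambda>k. of_real c * F k (r *\<^sub>R z)) \<longlonglongrightarrow> bergman_proj 0 (\<lambda>z. f (r *\<^sub>R z)) z"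
    using bergman_proj_analytic[OF _ an intF, of z] z by (simp add: c_def)
   show "(\<lambda>k. of_real c * F k (r *\<^sub>R z)) \<longlonglongrightarrow> of_real c * f (r *\<^sub>R z)"
    by (intro tendsto_mult tendsto_const lim rz' z)
  qed
  have "analytic_several (\<lambda>z. (1 / of_real c) * bergman_proj 0 (\<lambda>z. f (r *\<^sub>R z)) z) (ball 0 1)"
   by (intro analytic_several_cmult bergman_proj_analytic_several intf) simp
  hence "analytic_several (\<lambda>z. f (r *\<^sub>R z)) (ball 0 1)"
   by (rule analytic_several_cong) (use eq c in auto)
  hence "analytic_several (\<lambda>z. f (r *\<^sub>R ((1/r) *\<^sub>R z))) (ball 0 r)"
   by (rule analytic_several_scale) (use r in auto)
  thus ?thesis using r by simp
 qed
 show ?thesis unfolding analytic_several_def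
 proof
  fix z :: "complex ^ 'n" assume z: "z \<in> ball 0 1"
  define r where "r = (norm z + 1) / 2"
  have "0 < r" "r < 1" "z \<in> ball 0 r" using z by (auto simp: r_def add_nonneg_pos)
  thus "\<exists>L. (f has_derivative L) (at z) \<and> (\<forall>c v. L (c *s v) = c * L v)"
   using loc[of r] unfolding analytic_several_def by blast
 qed
qed

section \<open>Mean values\<close>

text \<open>Averaging over circles around \<open>a\<close> replaces the function by its centre value.\<close>

lemma analytic_mean_value:
 fixes f :: "complex ^ 'n => complex"
 assumes f: "analytic_several f (ball 0 1)" and r: "r > 0" and sub: "cball a r \<subseteq> ball 0 1"
 shows "integrable lborel (\<lambda>w. indicator (ball a r) w *\<^sub>R f w)"
  and "measure lborel (ball (0 :: complex ^ 'n) r) * cmod (f a) <= (LINT w|lborel. indicator (ball a r) w * cmod (f w))"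
proof -
 define \<Phi> where "\<Phi> u = indicator (ball a r) u *\<^sub>R f u" for u
 have c: "continuous_on (cball a r) f" by (rule continuous_on_subset[OF analytic_several_continuous_on[OF f] sub])
 have "integrable lborel (\<lambda>w. indicator (cball a r) w *\<^sub>R f w)" by (rule borel_integrable_compact[OF compact_cball c])
 from integrable_mult_indicator[OF _ this, of "ball a r"]
 have int: "integrable lborel \<Phi>"
  by (rule Bochner_Integration.integrable_cong[THEN iffD1, rotated -1]) (auto simp: \<Phi>_def indicator_def)
 thus "integrable lborel (\<lambda>w. indicator (ball a r) w *\<^sub>R f w)" by (simp add: \<Phi>_def[abs_def])
 have [measurable]: "\<Phi> \<in> borel_measurable borel" using int by auto
 have int': "integrable lborel (\<lambda>u. \<Phi> (a + u))" using int by (subst (asm) lborel_distr_plus[of a, symmetric]) (simp add: integrable_distr_eq)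
 have "(LINT u|lborel. \<Phi> u) = (LINT u|lborel. \<Phi> (a + u))"
  by (subst lborel_distr_plus[of a, symmetric]) (simp add: integral_distr)
 also have "... = (LINT u|lborel. (LINT t|circ. \<Phi> (a + cs t *s u)))" by (rule integral_circle_average[OF int'])
 also have "... = (LINT u|lborel. indicator (ball (0 :: complex ^ 'n) r) u *\<^sub>R f a)"
 proof (rule LINT_cong)
  fix u :: "complex ^ 'n"
  have e: "\<Phi> (a + cs t *s u) = indicator (ball 0 r) u *\<^sub>R f (a + cs t *s u)" for t
   by (simp add: \<Phi>_def indicator_def dist_norm norm_vector_smult)
  show "(LINT t|circ. \<Phi> (a + cs t *s u)) = indicator (ball 0 r) u *\<^sub>R f a"
  proof (cases "norm u < r")
   case True
   have hol: "(\<lambda>\<zeta>. f (a + \<zeta> *s u)) holomorphic_on {\<zeta>. norm (\<zeta> *s u) < r}"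
   proof (rule analytic_several_slice[OF f open_smult_ball])
    fix \<zeta> assume "\<zeta> \<in> {\<zeta>. norm (\<zeta> *s u) < r}"
    hence "a + \<zeta> *s u \<in> cball a r" by (simp add: dist_norm)
    thus "a + \<zeta> *s u \<in> ball 0 1" using sub by blast
   qed
   have "cball 0 1 \<subseteq> {\<zeta>. norm (\<zeta> *s u) < r}"
    using True mult_right_mono[of "cmod _" 1 "norm u"] by (force simp: norm_vector_smult)
   hence "(\<lambda>\<zeta>. f (a + \<zeta> *s u)) holomorphic_on cball 0 1" using hol holomorphic_on_subset by blast
   hence "(LINT t|circ. f (a + cs t *s u) / cs t ^ 0) = (deriv ^^ 0) (\<lambda>\<zeta>. f (a + \<zeta> *s u)) 0 / fact 0"
    by (intro circle_taylor_coeff) (auto intro: holomorphic_on_imp_continuous_on holomorphic_on_subset)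
   thus ?thesis unfolding e using True by simp
  qed (simp add: e)
 qed simp
 also have "... = measure lborel (ball (0 :: complex ^ 'n) r) *\<^sub>R f a"
  using emeasure_lborel_ball_finite[of "0 :: complex ^ 'n" r] by (simp add: less_top)
 finally have "measure lborel (ball (0 :: complex ^ 'n) r) * cmod (f a) = cmod (LINT u|lborel. \<Phi> u)" by simp
 also have "... <= (LINT u|lborel. cmod (\<Phi> u))" by (rule integral_norm_bound)
 finally show "measure lborel (ball (0 :: complex ^ 'n) r) * cmod (f a) <= (LINT w|lborel. indicator (ball a r) w * cmod (f w))"
  by (simp add: \<Phi>_def)
qed

section \<open>Multivariate Abel summation\<close>

definition unit_nbhd :: "real => complex set" where
 "unit_nbhd e = (\<Union>s\<in>{0..1}. ball (complex_of_real s) e)"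

lemma open_unit_nbhd: "open (unit_nbhd e)" unfolding unit_nbhd_def by blast

lemma unit_nbhd_real: "e > 0 ==> 0 <= s ==> s <= 1 ==> complex_of_real s \<in> unit_nbhd e"
 unfolding unit_nbhd_def by force

lemma unit_nbhd_ball: "0 <= s ==> s <= 1 ==> ball (complex_of_real s) e \<subseteq> unit_nbhd e"
 unfolding unit_nbhd_def by force

text \<open>Discrete summation by parts: a value at grid point \<open>k\<close> is the end value minus the later increments, each
multiplied by an indicator. The indicator of an increment is that of an initial box.\<close>

lemma telescope_grid:
 fixes g :: "nat => 'a::ab_group_add"
 assumes "k <= N"
 shows "g k = g N - (\<Sum>m<N. if k <= m then g (Suc m) - g m else 0)"
 using assms
proof (induction N)
 case (Suc N)
 show ?case
 proof (cases "k = Suc N")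
  case True thus ?thesis by simp
 next
  case False
  hence "k <= N" using Suc.prems by simp
  from Suc.IH[OF this] \<open>k <= N\<close> show ?thesis by simp
 qed
qed simp

text \<open>Rounding up to the grid \<open>m / N\<close>; comparison with grid points is unaffected.\<close>

lemma ceiling_grid:
 assumes "0 <= \<tau>" "\<tau> <= 1" "N > 0"
 shows "nat \<lceil>real N * \<tau>\<rceil> <= N" "\<And>m. nat \<lceil>real N * \<tau>\<rceil> <= m \<longleftrightarrow> \<tau> <= real m / real N"
  "\<bar>real (nat \<lceil>real N * \<tau>\<rceil>) / real N - \<tau>\<bar> <= 1 / real N"
proof -
 have nn: "0 <= real N * \<tau>" using assms by simp
 show 2: "nat \<lceil>real N * \<tau>\<rceil> <= m \<longleftrightarrow> \<tau> <= real m / real N" for m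
  using assms by (simp add: nat_le_iff ceiling_le_iff field_simps)
 show "nat \<lceil>real N * \<tau>\<rceil> <= N" using 2[of N] assms by simp
 have "real (nat \<lceil>real N * \<tau>\<rceil>) = of_int \<lceil>real N * \<tau>\<rceil>" using nn by simp
 hence "real N * \<tau> <= real (nat \<lceil>real N * \<tau>\<rceil>)" "real (nat \<lceil>real N * \<tau>\<rceil>) <= real N * \<tau> + 1" by linarith+
 hence "\<bar>real (nat \<lceil>real N * \<tau>\<rceil>) - real N * \<tau>\<bar> / real N <= 1 / real N"
  by (intro divide_right_mono) auto
 moreover have "real (nat \<lceil>real N * \<tau>\<rceil>) / real N - \<tau> = (real (nat \<lceil>real N * \<tau>\<rceil>) - real N * \<tau>) / real N"
  using assms(3) by (simp add: diff_divide_distrib)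
 ultimately show "\<bar>real (nat \<lceil>real N * \<tau>\<rceil>) / real N - \<tau>\<bar> <= 1 / real N"
  by (simp add: abs_divide)
qed

text \<open>Multivariate Abel summation. If the integrals of \<open>\<psi>\<close> over all initial boxes \<open>{t <= s}\<close> are at most \<open>S\<close>, then
\<open>\<psi>\<close> can be integrated against a smooth function of the parameters at the price of a constant, although \<open>|\<psi>|\<close> may
have a much larger integral. Smoothness is expressed by a bounded holomorphic extension to a neighbourhood of the unit cube: it bounds
increments by Cauchy's inequality, and the increment in one variable is again a bounded holomorphic function of the others,
so the induction on the variables carries the same kind of hypothesis and no mixed derivatives occur.\<close>

theorem abel_estimate:
 fixes \<psi> :: "'a => complex" and t :: "'a => nat => real"
 assumes J: "finite J" and \<epsilon>: "\<epsilon> > 0" and \<psi>: "integrable M \<psi>"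
  and tm: "\<And>i. i \<in> J ==> (\<lambda>\<omega>. t \<omega> i) \<in> borel_measurable M"
  and t01: "\<And>i \<omega>. i \<in> J ==> \<omega> \<in> space M ==> 0 <= t \<omega> i \<and> t \<omega> i <= 1"
  and hol: "\<And>i x. i \<in> J ==> (\<And>j. j \<in> J ==> x j \<in> unit_nbhd \<epsilon>) ==> (\<lambda>\<zeta>. H (x(i := \<zeta>))) holomorphic_on unit_nbhd \<epsilon>"
  and bd: "\<And>x. (\<And>j. j \<in> J ==> x j \<in> unit_nbhd \<epsilon>) ==> cmod (H x) <= B"
  and A: "A \<in> sets M"
  and S: "\<And>s. (\<And>i. i \<in> J ==> 0 <= s i \<and> s i <= 1) ==>
   cmod (LINT \<omega>|M. indicator (A \<inter> {\<omega>\<in>space M. \<forall>i\<in>J. t \<omega> i <= s i}) \<omega> *\<^sub>R \<psi> \<omega>) <= S"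
 shows "(\<lambda>\<omega>. H (\<lambda>i. if i \<in> J then complex_of_real (t \<omega> i) else 0)) \<in> borel_measurable M \<and>
  cmod (LINT \<omega>|M. indicator A \<omega> *\<^sub>R (\<psi> \<omega> * H (\<lambda>i. if i \<in> J then complex_of_real (t \<omega> i) else 0))) <= (1 + 4 / \<epsilon>) ^ card J * S * B"
 using J tm t01 hol bd A S
proof (induction J arbitrary: H A B rule: finite_induct)
 case empty
 have "cmod (LINT \<omega>|M. indicator A \<omega> *\<^sub>R (\<psi> \<omega> * H (\<lambda>i. 0))) = cmod ((LINT \<omega>|M. indicator A \<omega> *\<^sub>R \<psi> \<omega>) * H (\<lambda>i. 0))"
 proof -
  have "(LINT \<omega>|M. indicator A \<omega> *\<^sub>R (\<psi> \<omega> * H (\<lambda>i. 0))) = (LINT \<omega>|M. (indicator A \<omega> *\<^sub>R \<psi> \<omega>) * H (\<lambda>i. 0))" by simp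
  also have "... = (LINT \<omega>|M. indicator A \<omega> *\<^sub>R \<psi> \<omega>) * H (\<lambda>i. 0)" by (rule integral_mult_left_zero)
  finally show ?thesis by simp
 qed
 also have "... <= S * B"
 proof -
  have "A \<inter> space M = A" using empty(5) sets.sets_into_space by blast
  hence "cmod (LINT \<omega>|M. indicator A \<omega> *\<^sub>R \<psi> \<omega>) <= S" using empty(6)[of "\<lambda>_. 0"] by simp
  moreover have "cmod (H (\<lambda>i. 0)) <= B" by (rule empty(4)) simp
  ultimately show ?thesis unfolding norm_mult
   by (intro mult_mono) (auto intro: order_trans[OF norm_ge_zero])
 qed
 finally show ?case by simp
next
 case (insert i J)
 define U where "U = unit_nbhd \<epsilon>"
 define X where "X \<omega> = (\<lambda>k. if k \<in> J then complex_of_real (t \<omega> k) else 0)" for \<omega>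
 define Hc where "Hc c \<omega> = H ((X \<omega>)(i := complex_of_real c))" for c \<omega>
 define K where "K = (1 + 4 / \<epsilon>) ^ card J"
 have B0: "B >= 0"
  using insert(7)[of "\<lambda>_. complex_of_real 0"] unit_nbhd_real[OF \<epsilon>, of 0] by (meson norm_ge_zero order_trans zero_le_one order_refl)
 have Xfull: "(\<lambda>k. if k \<in> insert i J then complex_of_real (t \<omega> k) else 0) = (X \<omega>)(i := complex_of_real (t \<omega> i))" for \<omega>
  using insert(2) by (auto simp: X_def)
 have tmi[measurable]: "(\<lambda>\<omega>. t \<omega> i) \<in> borel_measurable M" using insert(4) by simp
 have XU: "X \<omega> k \<in> U" if "\<omega> \<in> space M" "k \<in> J" for \<omega> k
  using that insert(5)[of k \<omega>] unit_nbhd_real[OF \<epsilon>, of "t \<omega> k"] by (simp add: X_def U_def)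
 have rU: "complex_of_real c \<in> U" if "0 <= c" "c <= 1" for c
  using unit_nbhd_real[OF \<epsilon>] that by (simp add: U_def)
 \<comment> \<open>The set \<open>A\<close> is general so that the hypothesis applies to the slab where the parameter \<open>t i\<close> is at most \<open>c\<close>.\<close>
 have hol1: "(\<lambda>\<zeta>. H ((x(i := c))(j := \<zeta>))) holomorphic_on U"
  if "j \<in> J" "\<And>j. j \<in> J ==> x j \<in> U" "c \<in> U" for j x c
  unfolding U_def by (rule insert(6)) (use that in \<open>auto simp: U_def\<close>)
 have IH: "(\<lambda>\<omega>. H' (X \<omega>)) \<in> borel_measurable M \<and>
   cmod (LINT \<omega>|M. indicator A' \<omega> *\<^sub>R (\<psi> \<omega> * H' (X \<omega>))) <= K * S * B'"
  if h1: "\<And>j x. j \<in> J ==> (\<And>j. j \<in> J ==> x j \<in> U) ==> (\<lambda>\<zeta>. H' (x(j := \<zeta>))) holomorphic_on U"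
   and h2: "\<And>x. (\<And>j. j \<in> J ==> x j \<in> U) ==> cmod (H' x) <= B'"
   and A': "A' = A \<inter> {\<omega>\<in>space M. t \<omega> i <= c}" "0 <= c" "c <= 1" for H' A' B' c
  unfolding X_def K_def
 proof (rule insert.IH[where H = H'])
  show "A' \<in> sets M" unfolding A' using insert(8) by measurable
  fix s :: "nat => real" assume s: "\<And>i. i \<in> J ==> 0 <= s i \<and> s i <= 1"
  have e: "A' \<inter> {\<omega> \<in> space M. \<forall>i\<in>J. t \<omega> i <= s i} = A \<inter> {\<omega>\<in>space M. \<forall>k\<in>insert i J. t \<omega> k <= (s(i := c)) k}"
   unfolding A' using insert(2) by (auto simp: fun_upd_def)
  show "cmod (LINT \<omega>|M. indicator (A' \<inter> {\<omega> \<in> space M. \<forall>i\<in>J. t \<omega> i <= s i}) \<omega> *\<^sub>R \<psi> \<omega>) <= S"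
   unfolding e by (rule insert(9)) (use s A' in auto)
 next
  show "(\<lambda>\<zeta>. H' (x(j := \<zeta>))) holomorphic_on unit_nbhd \<epsilon>"
   if "j \<in> J" "\<And>j. j \<in> J ==> x j \<in> unit_nbhd \<epsilon>" for j x
   using h1[unfolded U_def] that by blast
  show "cmod (H' x) <= B'" if "\<And>j. j \<in> J ==> x j \<in> unit_nbhd \<epsilon>" for x
   using h2[unfolded U_def] that by blast
 qed (use insert(4,5) in auto)
 have A1: "A = A \<inter> {\<omega>\<in>space M. t \<omega> i <= 1}"
  using insert(5)[of i] insert(8) sets.sets_into_space by fastforce
 have c1: "Hc c \<in> borel_measurable M" if "0 <= c" "c <= 1" for c
 proof -
  have "(\<lambda>\<omega>. (\<lambda>x. H (x(i := complex_of_real c))) (X \<omega>)) \<in> borel_measurable M"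
  proof (rule IH[OF _ _ A1, THEN conjunct1])
   show "(\<lambda>\<zeta>. H ((x(j := \<zeta>))(i := complex_of_real c))) holomorphic_on U"
    if "j \<in> J" "\<And>j. j \<in> J ==> x j \<in> U" for j x
   proof -
    have ji: "j \<noteq> i" using that(1) insert(2) by blast
    show ?thesis unfolding fun_upd_twist[OF ji] by (rule hol1[OF that rU[OF \<open>0 <= c\<close> \<open>c <= 1\<close>]])
   qed
   show "cmod (H (x(i := complex_of_real c))) <= B" if "\<And>j. j \<in> J ==> x j \<in> U" for x
    by (rule insert(7)) (use that rU \<open>0 <= c\<close> \<open>c <= 1\<close> in \<open>auto simp: U_def\<close>)
  qed auto
  thus ?thesis by (simp add: Hc_def[abs_def])
 qed
 have top: "cmod (LINT \<omega>|M. indicator A \<omega> *\<^sub>R (\<psi> \<omega> * Hc 1 \<omega>)) <= K * S * B"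
 proof -
  have "cmod (LINT \<omega>|M. indicator A \<omega> *\<^sub>R (\<psi> \<omega> * (\<lambda>x. H (x(i := complex_of_real 1))) (X \<omega>))) <= K * S * B"
  proof (rule IH[OF _ _ A1, THEN conjunct2])
   show "(\<lambda>\<zeta>. H ((x(j := \<zeta>))(i := complex_of_real 1))) holomorphic_on U"
    if "j \<in> J" "\<And>j. j \<in> J ==> x j \<in> U" for j x
   proof -
    have ji: "j \<noteq> i" using that(1) insert(2) by blast
    show ?thesis unfolding fun_upd_twist[OF ji] by (rule hol1[OF that rU[OF zero_le_one order_refl]])
   qed
   show "cmod (H (x(i := complex_of_real 1))) <= B" if "\<And>j. j \<in> J ==> x j \<in> U" for x
    by (rule insert(7)) (use that rU[of 1] in \<open>auto simp: U_def\<close>)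
  qed auto
  thus ?thesis by (simp add: Hc_def)
 qed
 have HcB: "cmod (Hc c \<omega>) <= B" if "0 <= c" "c <= 1" "\<omega> \<in> space M" for c \<omega>
  unfolding Hc_def by (rule insert(7)) (use that XU rU in \<open>auto simp: U_def\<close>)
 have lip: "cmod (H (x(i := complex_of_real c')) - H (x(i := complex_of_real c))) <= (4 * B / \<epsilon>) * \<bar>c' - c\<bar>"
  if x: "\<And>j. j \<in> J ==> x j \<in> U" and c: "0 <= c" "c <= 1" and c': "\<bar>c' - c\<bar> < \<epsilon> / 2" for x c c'
 proof -
  let ?x = "x(i := complex_of_real 0)"
  have xx: "\<And>j. j \<in> insert i J ==> ?x j \<in> unit_nbhd \<epsilon>" using x rU[of 0] by (auto simp: U_def)
  have h: "(\<lambda>\<zeta>. H (?x(i := \<zeta>))) holomorphic_on unit_nbhd \<epsilon>" by (rule insert(6)) (use xx in auto)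
  have h2: "(\<lambda>\<zeta>. H (x(i := \<zeta>))) holomorphic_on ball (complex_of_real c) \<epsilon>"
   using holomorphic_on_subset[OF h unit_nbhd_ball[OF c]] by simp
  have "cmod (H (x(i := complex_of_real c')) - H (x(i := complex_of_real c))) <= (4 * B / \<epsilon>) * cmod (complex_of_real c' - complex_of_real c)"
  proof (rule holomorphic_lipschitz[OF h2 \<epsilon>])
   fix \<zeta> assume "\<zeta> \<in> ball (complex_of_real c) \<epsilon>"
   hence "\<zeta> \<in> unit_nbhd \<epsilon>" using unit_nbhd_ball[OF c] by blast
   thus "cmod (H (x(i := \<zeta>))) <= B" by (intro insert(7)) (use x in \<open>auto simp: U_def\<close>)
  qed (use c' \<epsilon> in \<open>auto simp flip: of_real_diff\<close>)
  thus ?thesis by (simp flip: of_real_diff)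
 qed
 \<comment> \<open>The step function approximation of the integrand in the variable \<open>i\<close>, written by summation by parts.\<close>
 define G where "G N \<omega> = Hc 1 \<omega> - (\<Sum>m<N. if t \<omega> i <= real m / real N then Hc (real (Suc m) / real N) \<omega> - Hc (real m / real N) \<omega> else 0)" for N \<omega>
 have Geq: "G N \<omega> = Hc (real (nat \<lceil>real N * t \<omega> i\<rceil>) / real N) \<omega>" if N: "N > 0" and \<omega>: "\<omega> \<in> space M" for N \<omega>
 proof -
  have t: "0 <= t \<omega> i" "t \<omega> i <= 1" using insert(5)[of i \<omega>] \<omega> by auto
  show ?thesis
   using telescope_grid[OF ceiling_grid(1)[OF t N], of "\<lambda>m. Hc (real m / real N) \<omega>"] N
   unfolding G_def ceiling_grid(2)[OF t N] by simp
 qed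
 have Gm: "G N \<in> borel_measurable M" for N
 proof -
  have "(\<lambda>\<omega>. if t \<omega> i <= real m / real N then Hc (real (Suc m) / real N) \<omega> - Hc (real m / real N) \<omega> else 0) \<in> borel_measurable M"
   if "m < N" for m
   using c1[of "real (Suc m) / real N"] c1[of "real m / real N"] that
   by (intro measurable_If borel_measurable_diff) (auto simp: divide_le_eq)
  thus ?thesis unfolding G_def[abs_def] by (intro borel_measurable_diff borel_measurable_sum c1) auto
 qed
 have GB: "cmod (G N \<omega>) <= B" if "N > 0" "\<omega> \<in> space M" for N \<omega>
 proof -
  have t: "0 <= t \<omega> i" "t \<omega> i <= 1" using insert(5)[of i \<omega>] that by auto
  show ?thesis unfolding Geq[OF that]
   using ceiling_grid(1)[OF t that(1)] that by (intro HcB) (auto simp: divide_le_eq)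
 qed
 define F where "F \<omega> = H (\<lambda>k. if k \<in> insert i J then complex_of_real (t \<omega> k) else 0)" for \<omega>
 have Glim: "(\<lambda>N. G (Suc N) \<omega>) \<longlonglongrightarrow> F \<omega>" if \<omega>: "\<omega> \<in> space M" for \<omega>
 proof -
  have t: "0 <= t \<omega> i" "t \<omega> i <= 1" using insert(5)[of i \<omega>] \<omega> by auto
  obtain N0 where N0: "1 / real (Suc N0) < \<epsilon> / 2" using \<epsilon> nat_approx_posE[of "\<epsilon>/2"] by auto
  have "(\<lambda>N. G (Suc N) \<omega> - F \<omega>) \<longlonglongrightarrow> 0"
  proof (rule Lim_null_comparison)
   show "(\<lambda>N. (4 * B / \<epsilon>) * (1 / real (Suc N))) \<longlonglongrightarrow> 0"
    using tendsto_mult_right_zero[OF LIMSEQ_inverse_real_of_nat, of "4 * B / \<epsilon>"] by (simp only: inverse_eq_divide)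
   show "\<forall>\<^sub>F N in sequentially. norm (G (Suc N) \<omega> - F \<omega>) <= (4 * B / \<epsilon>) * (1 / real (Suc N))"
    unfolding eventually_sequentially
   proof (intro exI[of _ N0] allI impI)
    fix N assume N: "N0 <= N"
    let ?c = "real (nat \<lceil>real (Suc N) * t \<omega> i\<rceil>) / real (Suc N)"
    have d: "\<bar>?c - t \<omega> i\<bar> <= 1 / real (Suc N)" using ceiling_grid(3)[OF t, of "Suc N"] by simp
    also have "... <= 1 / real (Suc N0)" using N by (intro divide_left_mono) auto
    finally have "\<bar>?c - t \<omega> i\<bar> < \<epsilon> / 2" using N0 by simp
    from lip[of "X \<omega>", OF XU[OF \<omega>] t this]
    have "cmod (G (Suc N) \<omega> - F \<omega>) <= (4 * B / \<epsilon>) * \<bar>?c - t \<omega> i\<bar>"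
     unfolding F_def Xfull Geq[OF zero_less_Suc \<omega>] Hc_def by simp
    also have "... <= (4 * B / \<epsilon>) * (1 / real (Suc N))" using d B0 \<epsilon> by (intro mult_left_mono) auto
    finally show "norm (G (Suc N) \<omega> - F \<omega>) <= (4 * B / \<epsilon>) * (1 / real (Suc N))" .
   qed
  qed
  thus ?thesis by (simp add: LIM_zero_iff)
 qed
 have Fm: "F \<in> borel_measurable M" by (rule borel_measurable_LIMSEQ_metric[OF Gm Glim])
 have Gint: "cmod (LINT \<omega>|M. indicator A \<omega> *\<^sub>R (\<psi> \<omega> * G N \<omega>)) <= (1 + 4 / \<epsilon>) * (K * S * B)"
  if N: "N > 0" "1 / real N < \<epsilon> / 2" for N
 proof -
  define Am where "Am m = A \<inter> {\<omega>\<in>space M. t \<omega> i <= real m / real N}" for m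
  have Am: "Am m \<in> sets M" for m unfolding Am_def using insert(8) by measurable
  define D where "D m \<omega> = Hc (real (Suc m) / real N) \<omega> - Hc (real m / real N) \<omega>" for m \<omega>
  have grid: "0 <= real m / real N" "real m / real N <= 1" "0 <= real (Suc m) / real N" "real (Suc m) / real N <= 1" if "m < N" for m
   using that by (auto simp: divide_le_eq)
  have Dm: "D m \<in> borel_measurable M" if "m < N" for m
   unfolding D_def[abs_def] by (intro borel_measurable_diff c1 grid that)
  have DB: "cmod (D m \<omega>) <= 2 * B" if "m < N" "\<omega> \<in> space M" for m \<omega>
  proof -
   have "cmod (D m \<omega>) <= cmod (Hc (real (Suc m) / real N) \<omega>) + cmod (Hc (real m / real N) \<omega>)"
    unfolding D_def by (rule norm_triangle_ineq4)
   also have "... <= B + B" by (intro add_mono HcB grid that)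
   finally show ?thesis by simp
  qed
  have bint: "integrable M (\<lambda>\<omega>. indicator A' \<omega> *\<^sub>R (\<psi> \<omega> * g \<omega>))"
   if "A' \<in> sets M" "g \<in> borel_measurable M" "\<And>\<omega>. \<omega> \<in> space M ==> cmod (g \<omega>) <= b" for A' g b
  proof -
   have "b >= 0 \<or> space M = {}" using that(3) by (meson norm_ge_zero order_trans ex_in_conv)
   have "integrable M (\<lambda>\<omega>. \<psi> \<omega> * g \<omega>)"
   proof (rule integrable_dominated_on)
    show "integrable M (\<lambda>\<omega>. b * cmod (\<psi> \<omega>))" using \<psi> by simp
    show "(\<lambda>\<omega>. \<psi> \<omega> * g \<omega>) \<in> borel_measurable M" using \<psi> that(2) by (intro borel_measurable_times) auto
    fix \<omega> assume "\<omega> \<in> space M"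
    hence "cmod (\<psi> \<omega>) * cmod (g \<omega>) <= cmod (\<psi> \<omega>) * b" using that(3) by (intro mult_left_mono) auto
    thus "norm (\<psi> \<omega> * g \<omega>) <= norm (b * cmod (\<psi> \<omega>))" by (simp add: norm_mult mult.commute order_trans[OF _ abs_ge_self])
   qed
   thus ?thesis using that(1) by (simp add: integrable_mult_indicator)
  qed
  \<comment> \<open>Each increment is a function of the other variables with bound of order \<open>1 / N\<close>; the \<open>N\<close> of them add up to order 1.\<close>
  have small: "cmod (LINT \<omega>|M. indicator (Am m) \<omega> *\<^sub>R (\<psi> \<omega> * D m \<omega>)) <= K * S * ((4 * B / \<epsilon>) * (1 / real N))" if m: "m < N" for m
  proof -
   let ?H = "\<lambda>x. H (x(i := complex_of_real (real (Suc m) / real N))) - H (x(i := complex_of_real (real m / real N)))"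
   have "cmod (LINT \<omega>|M. indicator (Am m) \<omega> *\<^sub>R (\<psi> \<omega> * ?H (X \<omega>))) <= K * S * ((4 * B / \<epsilon>) * (1 / real N))"
   proof (rule IH[OF _ _ Am_def, THEN conjunct2])
    show "(\<lambda>\<zeta>. ?H (x(j := \<zeta>))) holomorphic_on U"
     if "j \<in> J" "\<And>j. j \<in> J ==> x j \<in> U" for j x
    proof -
     have ji: "j \<noteq> i" using that(1) insert(2) by blast
     show ?thesis
      using hol1[OF that rU[OF grid(1,2)[OF m]]] hol1[OF that rU[OF grid(3,4)[OF m]]]
      unfolding fun_upd_twist[OF ji] by (rule holomorphic_on_diff[rotated])
    qed
    show "cmod (?H x) <= (4 * B / \<epsilon>) * (1 / real N)" if "\<And>j. j \<in> J ==> x j \<in> U" for x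
    proof -
     have "real (Suc m) / real N - real m / real N = 1 / real N" using N by (simp add: field_simps)
     hence d: "\<bar>real (Suc m) / real N - real m / real N\<bar> = 1 / real N" by simp
     show ?thesis using lip[where c' = "real (Suc m) / real N", OF that grid(1,2)[OF m]] N unfolding d by simp
    qed
   qed (use grid[OF m] in auto)
   thus ?thesis by (simp add: D_def Hc_def)
  qed
  have "(LINT \<omega>|M. indicator A \<omega> *\<^sub>R (\<psi> \<omega> * G N \<omega>))
   = (LINT \<omega>|M. indicator A \<omega> *\<^sub>R (\<psi> \<omega> * Hc 1 \<omega>) - (\<Sum>m<N. indicator (Am m) \<omega> *\<^sub>R (\<psi> \<omega> * D m \<omega>)))"
  proof (rule LINT_cong)
   fix \<omega> assume \<omega>: "\<omega> \<in> space M"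
   have "indicator A \<omega> *\<^sub>R (\<psi> \<omega> * G N \<omega>) = indicator A \<omega> *\<^sub>R (\<psi> \<omega> * Hc 1 \<omega>)
    - (\<Sum>m<N. indicator A \<omega> *\<^sub>R (\<psi> \<omega> * (if t \<omega> i <= real m / real N then D m \<omega> else 0)))"
    unfolding G_def D_def[symmetric] by (simp add: right_diff_distrib sum_distrib_left scaleR_right_diff_distrib scaleR_sum_right)
   also have "(\<Sum>m<N. indicator A \<omega> *\<^sub>R (\<psi> \<omega> * (if t \<omega> i <= real m / real N then D m \<omega> else 0))) = (\<Sum>m<N. indicator (Am m) \<omega> *\<^sub>R (\<psi> \<omega> * D m \<omega>))"
    by (rule sum.cong) (use \<omega> in \<open>auto simp: Am_def indicator_def\<close>)
   finally show "indicator A \<omega> *\<^sub>R (\<psi> \<omega> * G N \<omega>) = indicator A \<omega> *\<^sub>R (\<psi> \<omega> * Hc 1 \<omega>) - (\<Sum>m<N. indicator (Am m) \<omega> *\<^sub>R (\<psi> \<omega> * D m \<omega>))" .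
  qed simp
  also have "... = (LINT \<omega>|M. indicator A \<omega> *\<^sub>R (\<psi> \<omega> * Hc 1 \<omega>)) - (\<Sum>m<N. \<integral>\<omega>. indicator (Am m) \<omega> *\<^sub>R (\<psi> \<omega> * D m \<omega>) \<partial>M)"
  proof (subst Bochner_Integration.integral_diff)
   show "integrable M (\<lambda>\<omega>. indicator A \<omega> *\<^sub>R (\<psi> \<omega> * Hc 1 \<omega>))"
    by (rule bint[OF insert(8) c1 HcB]) auto
   show "integrable M (\<lambda>\<omega>. \<Sum>m<N. indicator (Am m) \<omega> *\<^sub>R (\<psi> \<omega> * D m \<omega>))"
    by (intro Bochner_Integration.integrable_sum bint[OF Am Dm DB]) auto
   show "(LINT \<omega>|M. indicator A \<omega> *\<^sub>R (\<psi> \<omega> * Hc 1 \<omega>)) - (LINT \<omega>|M. (\<Sum>m<N. indicator (Am m) \<omega> *\<^sub>R (\<psi> \<omega> * D m \<omega>))) =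
    (LINT \<omega>|M. indicator A \<omega> *\<^sub>R (\<psi> \<omega> * Hc 1 \<omega>)) - (\<Sum>m<N. \<integral>\<omega>. indicator (Am m) \<omega> *\<^sub>R (\<psi> \<omega> * D m \<omega>) \<partial>M)"
    by (subst Bochner_Integration.integral_sum) (auto intro!: bint[OF Am Dm DB])
  qed
  also have "cmod ... <= K * S * B + (\<Sum>m<N. K * S * ((4 * B / \<epsilon>) * (1 / real N)))"
   by (intro order_trans[OF norm_triangle_ineq4] add_mono top order_trans[OF norm_sum] sum_mono small) auto
  also have "... = (1 + 4 / \<epsilon>) * (K * S * B)" using N by (simp add: field_simps)
  finally show ?thesis .
 qed
 have "(\<lambda>N. \<integral>\<omega>. indicator A \<omega> *\<^sub>R (\<psi> \<omega> * G (Suc N) \<omega>) \<partial>M) \<longlonglongrightarrow> (LINT \<omega>|M. indicator A \<omega> *\<^sub>R (\<psi> \<omega> * F \<omega>))"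
 proof (rule integral_dominated_convergence[where w = "\<lambda>\<omega>. B * cmod (\<psi> \<omega>)"])
  have pm: "\<psi> \<in> borel_measurable M" using \<psi> by auto
  show "(\<lambda>\<omega>. indicator A \<omega> *\<^sub>R (\<psi> \<omega> * F \<omega>)) \<in> borel_measurable M"
   by (intro borel_measurable_scaleR borel_measurable_indicator borel_measurable_times pm Fm insert(8))
  show "(\<lambda>\<omega>. indicator A \<omega> *\<^sub>R (\<psi> \<omega> * G (Suc N) \<omega>)) \<in> borel_measurable M" for N
   by (intro borel_measurable_scaleR borel_measurable_indicator borel_measurable_times pm Gm insert(8))
  show "integrable M (\<lambda>\<omega>. B * cmod (\<psi> \<omega>))" using \<psi> by simp
  show "AE \<omega> in M. (\<lambda>N. indicator A \<omega> *\<^sub>R (\<psi> \<omega> * G (Suc N) \<omega>)) \<longlonglongrightarrow> indicator A \<omega> *\<^sub>R (\<psi> \<omega> * F \<omega>)"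
   by (intro AE_I2 tendsto_scaleR tendsto_mult tendsto_const Glim)
  show "AE \<omega> in M. norm (indicator A \<omega> *\<^sub>R (\<psi> \<omega> * G (Suc N) \<omega>)) <= B * cmod (\<psi> \<omega>)" for N
  proof (rule AE_I2)
   fix \<omega> assume "\<omega> \<in> space M"
   from GB[OF zero_less_Suc this, of N]
   have "cmod (\<psi> \<omega>) * cmod (G (Suc N) \<omega>) <= cmod (\<psi> \<omega>) * B" by (intro mult_left_mono) auto
   thus "norm (indicator A \<omega> *\<^sub>R (\<psi> \<omega> * G (Suc N) \<omega>)) <= B * cmod (\<psi> \<omega>)"
    using B0 by (auto simp: norm_mult indicator_def mult.commute)
  qed
 qed
 from tendsto_norm[OF this]
 have "cmod (LINT \<omega>|M. indicator A \<omega> *\<^sub>R (\<psi> \<omega> * F \<omega>)) <= (1 + 4 / \<epsilon>) * (K * S * B)"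
 proof (rule LIMSEQ_le_const2)
  obtain N0 where N0: "1 / real (Suc N0) < \<epsilon> / 2" using \<epsilon> nat_approx_posE[of "\<epsilon>/2"] by auto
  show "\<exists>N. \<forall>n\<ge>N. cmod (LINT \<omega>|M. indicator A \<omega> *\<^sub>R (\<psi> \<omega> * G (Suc n) \<omega>)) <= (1 + 4 / \<epsilon>) * (K * S * B)"
  proof (intro exI[of _ N0] allI impI Gint)
   fix n assume "n >= N0"
   hence "1 / real (Suc n) <= 1 / real (Suc N0)" by (intro divide_left_mono) auto
   thus "1 / real (Suc n) < \<epsilon> / 2" using N0 by linarith
  qed auto
 qed
 moreover have "(1 + 4 / \<epsilon>) * (K * S * B) = (1 + 4 / \<epsilon>) ^ card (insert i J) * S * B"
  using insert(1,2) by (simp add: K_def)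
 ultimately show ?case using Fm unfolding F_def by simp
qed

section \<open>Real coordinates on complex space\<close>

text \<open>The position of an index, so that complex coordinate \<open>j\<close> consists of the real coordinates
\<open>2 * rk j - 1\<close> and \<open>2 * rk j\<close>.\<close>

definition rk :: "'n::{finite,wellorder} => nat" where "rk j = card {i. i <= j}"

lemma rk_strict_mono: "i < j ==> rk i < rk (j :: 'n::{finite,wellorder})"
proof -
 assume ij: "i < j"
 have "j \<in> {k. k <= j}" "j \<notin> {k. k <= i}" "{k. k <= i} \<subseteq> {k. k <= j}" using ij by auto
 hence "{k. k <= i} \<subset> {k. k <= j}" by blast
 thus ?thesis unfolding rk_def by (intro psubset_card_mono) auto
qed

lemma bij_rk: "bij_betw (rk :: 'n::{finite,wellorder} => nat) UNIV {1..CARD('n)}"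
proof -
 have inj: "inj (rk :: 'n => nat)"
  by (rule linorder_injI) (metis rk_strict_mono less_irrefl)
 have sub: "range (rk :: 'n => nat) \<subseteq> {1..CARD('n)}"
 proof
  fix k assume "k \<in> range (rk :: 'n => nat)"
  then obtain j :: 'n where k: "k = rk j" by blast
  have "card {i. i <= j} > 0" by (subst card_gt_0_iff) auto
  moreover have "card {i. i <= j} <= CARD('n)" by (intro card_mono) auto
  ultimately show "k \<in> {1..CARD('n)}" by (auto simp: k rk_def)
 qed
 have "card (range (rk :: 'n => nat)) = card {1..CARD('n)}" using card_image[OF inj] by simp
 hence "range (rk :: 'n => nat) = {1..CARD('n)}" using sub by (intro card_subset_eq) auto
 thus ?thesis using inj by (simp add: bij_betw_def)
qed

lemma rk_range: "1 <= rk (j::'n::{finite,wellorder})" "rk j <= CARD('n)"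
 using bij_betwE[OF bij_rk] by (auto simp: Ball_def)

definition rkinv :: "nat => 'n::{finite,wellorder}" where "rkinv k = inv_into UNIV rk k"

lemma rk_rkinv: "1 <= k ==> k <= CARD('n) ==> rk (rkinv k :: 'n::{finite,wellorder}) = k"
 unfolding rkinv_def using bij_rk[where 'n='n] by (intro f_inv_into_f) (auto simp: bij_betw_def)

definition ebas :: "nat => complex ^ 'n::{finite,wellorder}" where
 "ebas l = axis (rkinv ((l + 1) div 2)) (if odd l then 1 else \<i>)"

definition crd :: "nat => complex ^ 'n::{finite,wellorder} => real" where
 "crd l w = w \<bullet> ebas l"

lemma crd_complex_of_coords:
 assumes l: "1 <= l" "l <= 2 * CARD('n::{finite,wellorder})"
 shows "crd l (complex_of_coords u :: complex ^ 'n::{finite,wellorder}) = u l"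
proof -
 define k where "k = (l + 1) div 2"
 have k: "1 <= k" "k <= CARD('n)" using l by (auto simp: k_def)
 have r: "card {i. i <= (rkinv k :: 'n)} = k" using rk_rkinv[OF k] by (simp add: rk_def)
 have e: "ebas l = (axis (rkinv k) (if odd l then 1 else \<i>) :: 'n cvec)"
  by (simp add: ebas_def k_def)
 show ?thesis
 proof (cases "odd l")
  case True
  hence "2 * k - 1 = l" unfolding k_def by presburger
  thus ?thesis using True by (simp add: crd_def e inner_axis complex_of_coords_def r inner_complex_def)
 next
  case False
  hence "2 * k = l" unfolding k_def by presburger
  thus ?thesis using False by (simp add: crd_def e inner_axis complex_of_coords_def r inner_complex_def)
 qed
qed

lemma continuous_on_crd [continuous_intros]: "continuous_on S f ==> continuous_on S (\<lambda>x. crd l (f x))"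
 unfolding crd_def by (intro continuous_intros)

lemma crd_scaleR: "crd l (c *\<^sub>R x) = c * crd l x" by (simp add: crd_def)
lemma crd_diff: "crd l (x - y) = crd l x - crd l y" by (simp add: crd_def inner_diff_left)

lemma crd_ebas:
 assumes "1 <= l" "l <= 2 * CARD('n::{finite,wellorder})" "1 <= k" "k <= 2 * CARD('n::{finite,wellorder})"
 shows "crd l (ebas k :: complex ^ 'n::{finite,wellorder}) = (if l = k then 1 else 0)"
proof -
 have a: "1 <= (l + 1) div 2" "(l + 1) div 2 <= CARD('n)" "1 <= (k + 1) div 2" "(k + 1) div 2 <= CARD('n)"
  using assms by auto
 have i: "(rkinv ((l + 1) div 2) :: 'n) = rkinv ((k + 1) div 2) \<longleftrightarrow> (l + 1) div 2 = (k + 1) div 2"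
  using rk_rkinv[OF a(1,2)] rk_rkinv[OF a(3,4)] by metis
 have e: "l = k \<longleftrightarrow> (l + 1) div 2 = (k + 1) div 2 \<and> (odd l \<longleftrightarrow> odd k)" by presburger
 show ?thesis
 proof (cases "(l + 1) div 2 = (k + 1) div 2")
  case True
  show ?thesis unfolding crd_def ebas_def inner_axis_axis e True
   by (cases "odd l"; cases "odd k") (simp_all add: inner_complex_def)
 next
  case False
  hence "l \<noteq> k" "(rkinv ((l + 1) div 2) :: 'n) \<noteq> rkinv ((k + 1) div 2)" using e i by blast+
  thus ?thesis unfolding crd_def ebas_def inner_axis_axis by (simp only: if_False) (metis)
 qed
qed

lemma sum_even_odd: "(\<Sum>k=1..(N::nat). (f (2 * k - 1) :: real) + f (2 * k)) = (\<Sum>i=1..2*N. f i)"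
proof (induction N)
 case (Suc N)
 have "(\<Sum>i=1..2*Suc N. f i) = (\<Sum>i=1..2*N. f i) + f (2*N+1) + f (2*N+2)" by simp
 thus ?case using Suc by (simp add: algebra_simps)
qed simp

lemma norm_complex_of_coords:
 "(norm (complex_of_coords u :: complex ^ 'n::{finite,wellorder}))\<^sup>2 = (\<Sum>i=1..2 * CARD('n). (u i)\<^sup>2)"
proof -
 have "(norm (complex_of_coords u :: 'n cvec))\<^sup>2 = (\<Sum>j\<in>(UNIV::'n set). (cmod (complex_of_coords u $ j))\<^sup>2)"
  by (simp add: norm_vec_def L2_set_def sum_nonneg)
 also have "... = (\<Sum>j\<in>(UNIV::'n set). (u (2 * rk j - 1))\<^sup>2 + (u (2 * rk j))\<^sup>2)"
  by (simp add: complex_of_coords_def rk_def cmod_power2)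
 also have "... = (\<Sum>k=1..CARD('n). (u (2 * k - 1))\<^sup>2 + (u (2 * k))\<^sup>2)"
  by (rule sum.reindex_bij_betw[OF bij_rk])
 also have "... = (\<Sum>i=1..2 * CARD('n). (u i)\<^sup>2)" by (rule sum_even_odd)
 finally show ?thesis .
qed

section \<open>Spherical coordinates\<close>

text \<open>The product of the radius and the first sines: the Euclidean norm of the tail of the coordinates from position \<open>i\<close> on, up
to sign.\<close>

definition srad :: "(nat => real) => nat => real" where
 "srad x i = x 1 * (\<Prod>k=2..i. sin (x k))"

lemma srad_1 [simp]: "srad x (Suc 0) = x (Suc 0)" by (simp add: srad_def)

lemma srad_Suc: "1 <= i ==> srad x (Suc i) = srad x i * sin (x (Suc i))"
 by (simp add: srad_def)

lemma sph_coord_srad: "sph_coord d x i = (if i < d then srad x i * cos (x (Suc i)) else srad x d)"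
 by (simp add: sph_coord_def srad_def)

text \<open>The sum of squares collapses from the last coordinate by Pythagoras.\<close>

lemma sum_sph_coord_sq:
 assumes "1 <= i" "i <= d"
 shows "(\<Sum>l=i..d. (sph_coord d x l)\<^sup>2) = (srad x i)\<^sup>2"
 using assms(2,1)
proof (induction i rule: inc_induct)
 case base thus ?case by (simp add: sph_coord_srad)
next
 case (step i)
 have "(\<Sum>l=i..d. (sph_coord d x l)\<^sup>2) = (sph_coord d x i)\<^sup>2 + (\<Sum>l=Suc i..d. (sph_coord d x l)\<^sup>2)"
  using step by (intro sum.atLeast_Suc_atMost) simp
 also have "... = (srad x i)\<^sup>2 * ((cos (x (Suc i)))\<^sup>2 + (sin (x (Suc i)))\<^sup>2)"
 proof -
  have 1: "(sph_coord d x i)\<^sup>2 = (srad x i)\<^sup>2 * (cos (x (Suc i)))\<^sup>2"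
   using step by (simp add: sph_coord_srad power_mult_distrib)
  have 2: "(\<Sum>l=Suc i..d. (sph_coord d x l)\<^sup>2) = (srad x i)\<^sup>2 * (sin (x (Suc i)))\<^sup>2"
   using step by (simp add: srad_Suc power_mult_distrib)
  show ?thesis by (simp only: 1 2 distrib_left)
 qed
 finally show ?case by simp
qed

lemma norm_sph_map: "norm (sph_map x :: complex ^ 'n::{finite,wellorder}) = \<bar>x 1\<bar>"
proof -
 have "(norm (sph_map x :: 'n cvec))\<^sup>2 = (srad x 1)\<^sup>2"
  unfolding sph_map_def norm_complex_of_coords by (rule sum_sph_coord_sq) (auto simp: Suc_leI)
 hence "sqrt ((norm (sph_map x :: 'n cvec))\<^sup>2) = sqrt ((x 1)\<^sup>2)" by simp
 thus ?thesis by simp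
qed

lemma sph_domainD:
 assumes "x \<in> sph_domain d" "d >= 2"
 shows "0 <= x 1" "x 1 < 1" "\<And>i. 1 < i ==> i < d ==> 0 <= x i \<and> x i <= pi" "0 <= x d" "x d <= 2 * pi"
proof -
 have *: "x i \<in> (if i = 1 then {0..<1} else if i = d then {0..2 * pi} else {0..pi})" if "i \<in> {1..d}" for i
  using assms(1) that unfolding sph_domain_def by (rule PiE_mem)
 show "0 <= x 1" "x 1 < 1" "0 <= x d" "x d <= 2 * pi" using *[of 1] *[of d] assms(2) by auto
 show "1 < i ==> i < d ==> 0 <= x i \<and> x i <= pi" for i using *[of i] by auto
qed

lemma srad_factors:
 assumes "srad x d \<noteq> 0" "1 <= i" "i <= d"
 shows "srad x i \<noteq> 0"
 using assms(3,1,2)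
proof (induction i rule: inc_induct)
 case (step i) thus ?case by (auto simp: srad_Suc)
qed simp

lemma srad_nonneg:
 assumes "x \<in> sph_domain d" "d >= 2" "1 <= i" "i < d"
 shows "srad x i >= 0"
 unfolding srad_def using sph_domainD[OF assms(1,2)] assms(3,4)
 by (intro mult_nonneg_nonneg prod_nonneg) (auto intro!: sin_ge_zero)

text \<open>A nonzero last coordinate forces all sines to be nonzero. Then the tail norms determine the radius, the cosines
determine the inner angles in \<open>[0, \<pi>]\<close>, and sine and cosine together determine the last angle away from \<open>0\<close> and \<open>2 \<pi>\<close>.\<close>

lemma sph_coord_inj:
 assumes x: "x \<in> sph_domain d" and y: "y \<in> sph_domain d" and d: "d >= 2"
  and eq: "\<And>l. 1 <= l ==> l <= d ==> sph_coord d x l = sph_coord d y l"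
  and nz: "sph_coord d x d \<noteq> 0"
 shows "x = y"
proof -
 have nzx: "srad x d \<noteq> 0" using nz by (simp add: sph_coord_srad)
 have Rd: "srad x d = srad y d" using eq[of d] d by (simp add: sph_coord_srad)
 have R: "srad x i = srad y i \<and> srad x i > 0" if "1 <= i" "i < d" for i
 proof -
  have "(\<Sum>l=i..d. (sph_coord d x l)\<^sup>2) = (\<Sum>l=i..d. (sph_coord d y l)\<^sup>2)"
   by (intro sum.cong refl) (use eq that in auto)
  hence "(srad x i)\<^sup>2 = (srad y i)\<^sup>2"
   using sum_sph_coord_sq[of i d x] sum_sph_coord_sq[of i d y] that by simp
  moreover have "srad x i >= 0" "srad y i >= 0" using srad_nonneg x y d that by auto
  moreover have "srad x i \<noteq> 0" using srad_factors[OF nzx] that by simp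
  ultimately show ?thesis by (simp add: power2_eq_iff_nonneg)
 qed
 have cosq: "cos (x (Suc i)) = cos (y (Suc i))" if "1 <= i" "i < d" for i
  using eq[of i] R[OF that] that by (simp add: sph_coord_srad)
 have "x i = y i" if i: "i \<in> {1..d}" for i
 proof -
  consider "i = 1" | "1 < i" "i < d" | "i = d" "1 < i" using i d by force
  thus ?thesis
  proof cases
   case 1 thus ?thesis using R[of 1] d by simp
  next
   case 2
   then obtain k where k: "i = Suc k" "1 <= k" "k < d" by (cases i) auto
   show ?thesis
    using cosq[of k] k cos_inj_pi[of "x i" "y i"] sph_domainD(3)[OF x d, of i] sph_domainD(3)[OF y d, of i] 2 by auto
  next
   case 3
   then obtain k where k: "i = Suc k" "1 <= k" "k < d" by (cases i) auto
   have c: "cos (x d) = cos (y d)" using cosq[of k] k 3 by simp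
   have s: "sin (x d) = sin (y d)"
    using Rd R[of k] k 3 srad_Suc[of k x] srad_Suc[of k y] by auto
   have sn: "sin (x d) \<noteq> 0" using nzx k 3 srad_Suc[of k x] by auto
   obtain n :: int where n: "x d = y d + 2 * pi * n" using c s sin_cos_eq_iff[of "x d" "y d"] by auto
   have nd: "x d \<noteq> 0" "x d \<noteq> 2 * pi" using sn by auto
   have nd': "y d \<noteq> 0" "y d \<noteq> 2 * pi" using sn s by auto
   have b: "0 < x d" "x d < 2 * pi" "0 < y d" "y d < 2 * pi"
    using sph_domainD(4,5)[OF x d] sph_domainD(4,5)[OF y d] nd nd' by auto
   have "2 * pi * of_int n < 2 * pi * 1" "2 * pi * (-1) < 2 * pi * of_int n" using b n by linarith+
   hence "real_of_int n < 1" "-1 < real_of_int n" by (simp_all only: mult_less_cancel_left_pos pi_gt_zero zero_less_mult_iff zero_less_numeral simp_thms)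
   hence "n = 0" by linarith
   thus ?thesis using n 3 by simp
  qed
 qed
 thus ?thesis using x y unfolding sph_domain_def by (intro PiE_ext) auto
qed

text \<open>The hyperplane off which spherical coordinates are injective.\<close>

definition sph_null :: "(complex ^ 'n::{finite,wellorder}) set" where
 "sph_null = {w. crd (2 * CARD('n)) w = 0}"

lemma two_le_d: "2 <= 2 * CARD('n::finite)" using zero_less_card_finite[where 'a='n] by linarith

lemma crd_sph_map: "1 <= l ==> l <= 2 * CARD('n::{finite,wellorder}) ==> crd l (sph_map x :: complex ^ 'n::{finite,wellorder}) = sph_coord (2 * CARD('n::{finite,wellorder})) x l"
 unfolding sph_map_def by (rule crd_complex_of_coords)

lemma sph_map_inj:
 assumes x: "x \<in> sph_domain (2 * CARD('n::{finite,wellorder}))" and y: "y \<in> sph_domain (2 * CARD('n::{finite,wellorder}))"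
  and eq: "sph_map x = (sph_map y :: complex ^ 'n::{finite,wellorder})" and nz: "sph_map x \<notin> (sph_null :: ('n cvec) set)"
 shows "x = y"
proof (rule sph_coord_inj[OF x y two_le_d])
 show "sph_coord (2 * CARD('n)) x l = sph_coord (2 * CARD('n)) y l" if "1 <= l" "l <= 2 * CARD('n)" for l
  using crd_sph_map[OF that, of x] crd_sph_map[OF that, of y] eq by simp
 show "sph_coord (2 * CARD('n)) x (2 * CARD('n)) \<noteq> 0"
  using nz crd_sph_map[where 'n='n and l = "2 * CARD('n)" and x = x] two_le_d[where 'n='n] by (simp add: sph_null_def)
qed

lemma ebas_nz: "1 <= l ==> l <= 2 * CARD('n::{finite,wellorder}) ==> (ebas l :: complex ^ 'n::{finite,wellorder}) \<noteq> 0"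
 using crd_ebas[of l l, where 'n='n] by (auto simp: crd_def)

lemma negligible_sph_null: "negligible (sph_null :: (complex ^ 'n::{finite,wellorder}) set)"
proof -
 have "(ebas (2 * CARD('n)) :: 'n cvec) \<noteq> 0" using two_le_d[where 'n='n] by (intro ebas_nz) auto
 from negligible_hyperplane[of "ebas (2 * CARD('n)) :: 'n cvec" 0] this
 show ?thesis by (simp add: sph_null_def crd_def inner_commute)
qed

text \<open>Fixing one inner angle cuts out a cone. Translated by a basis vector it meets every ray
from the origin at most once, so it is negligible without any computation of measures.\<close>

lemma negligible_cone:
 assumes k: "1 <= k" "k < 2 * CARD('n::{finite,wellorder})"
 shows "negligible {w :: complex ^ 'n::{finite,wellorder}. crd k w = \<gamma> * sqrt (\<Sum>l=Suc k..2 * CARD('n). (crd l w)\<^sup>2)}"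
proof (rule starlike_negligible[where a = "- ebas k"])
 show "closed {w :: 'n cvec. crd k w = \<gamma> * sqrt (\<Sum>l=Suc k..2 * CARD('n). (crd l w)\<^sup>2)}"
  by (intro closed_Collect_eq continuous_intros)
 fix c :: real and x :: "'n cvec"
 assume 1: "- ebas k + c *\<^sub>R x \<in> {w. crd k w = \<gamma> * sqrt (\<Sum>l=Suc k..2 * CARD('n). (crd l w)\<^sup>2)}"
  and c: "0 <= c" and 2: "- ebas k + x \<in> {w. crd k w = \<gamma> * sqrt (\<Sum>l=Suc k..2 * CARD('n). (crd l w)\<^sup>2)}"
 define \<rho> where "\<rho> = sqrt (\<Sum>l=Suc k..2 * CARD('n). (crd l x)\<^sup>2)"
 have cs: "crd l (- ebas k + s *\<^sub>R x) = s * crd l x" if "l \<in> {Suc k..2 * CARD('n)}" for l s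
  using that k by (simp add: crd_diff crd_scaleR crd_ebas)
 have ck: "crd k (- ebas k + s *\<^sub>R x) = -1 + s * crd k x" for s
  using k by (simp add: crd_diff crd_scaleR crd_ebas)
 have sq: "sqrt (\<Sum>l=Suc k..2 * CARD('n). (crd l (- ebas k + s *\<^sub>R x))\<^sup>2) = s * \<rho>" if "s >= 0" for s
 proof -
  have "(\<Sum>l=Suc k..2 * CARD('n). (crd l (- ebas k + s *\<^sub>R x))\<^sup>2) = s\<^sup>2 * (\<Sum>l=Suc k..2 * CARD('n). (crd l x)\<^sup>2)"
   unfolding sum_distrib_left by (intro sum.cong refl) (simp only: cs power_mult_distrib)
  thus ?thesis using that by (simp add: \<rho>_def real_sqrt_mult)
 qed
 have e1: "-1 + c * crd k x = \<gamma> * (c * \<rho>)" using 1 ck[of c] sq[OF c] by simp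
 have e2: "-1 + crd k x = \<gamma> * \<rho>" using 2 ck[of 1] sq[of 1] by simp
 have "c * (crd k x - \<gamma> * \<rho>) = 1" using e1 by (simp add: algebra_simps)
 moreover have "crd k x - \<gamma> * \<rho> = 1" using e2 by simp
 ultimately show "c = 1" by simp
qed

text \<open>Off the hyperplane, a common point has a single parameter, hence lies in a sphere, a cone or a
hyperplane, according to which coordinate is fixed.\<close>

lemma negligible_sph_overlap:
 fixes P :: "(nat => real) set"
 assumes P: "P \<subseteq> sph_domain (2 * CARD('n::{finite,wellorder}))" and P': "P' \<subseteq> sph_domain (2 * CARD('n::{finite,wellorder}))"
  and i: "i \<in> {1..2 * CARD('n::{finite,wellorder})}" and c: "\<And>x. x \<in> P ==> x \<in> P' ==> x i = c"
 shows "negligible (sph_map ` P \<inter> sph_map ` P' :: (complex ^ 'n::{finite,wellorder}) set)"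
proof -
 let ?d = "2 * CARD('n)"
 have d2: "2 <= ?d" by (rule two_le_d)
 define Z where "Z = {w :: 'n cvec. \<exists>x\<in>sph_domain ?d. x i = c \<and> w = sph_map x \<and> w \<notin> sph_null}"
 have sub: "sph_map ` P \<inter> sph_map ` P' \<subseteq> sph_null \<union> Z"
 proof
  fix w :: "'n cvec" assume w: "w \<in> sph_map ` P \<inter> sph_map ` P'"
  then obtain x y where xy: "x \<in> P" "y \<in> P'" "w = sph_map x" "w = sph_map y" by blast
  show "w \<in> sph_null \<union> Z"
  proof (cases "w \<in> sph_null")
   case False
   hence "x = y" using sph_map_inj[where 'n = 'n, of x y] xy P P' by auto
   hence "x i = c" using c xy by blast
   thus ?thesis unfolding Z_def using xy P False by blast
  qed simp
 qed
 have "negligible Z"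
 proof -
  consider "i = 1" | k where "i = Suc k" "1 <= k" "i < ?d" | k where "i = Suc k" "1 <= k" "i = ?d"
  proof (cases "i = 1")
   case False
   then obtain k where "i = Suc k" "1 <= k" using i by (cases i) auto
   thus ?thesis using that i by fastforce
  qed
  thus ?thesis
  proof cases
   case 1
   have "Z \<subseteq> sphere 0 \<bar>c\<bar>" using 1 by (auto simp: Z_def norm_sph_map)
   thus ?thesis using negligible_sphere negligible_subset by blast
  next
   case (2 k)
   have "Z \<subseteq> {w. crd k w = (cos c / sin c) * sqrt (\<Sum>l=Suc k..?d. (crd l w)\<^sup>2)}"
   proof
    fix w assume "w \<in> Z"
    then obtain x where x: "x \<in> sph_domain ?d" "x i = c" "w = sph_map x" "w \<notin> sph_null" unfolding Z_def by blast
    have "(\<Sum>l=Suc k..?d. (crd l w)\<^sup>2) = (\<Sum>l=Suc k..?d. (sph_coord ?d x l)\<^sup>2)"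
     unfolding x(3) by (intro sum.cong refl) (simp add: crd_sph_map)
    also have "... = (srad x (Suc k))\<^sup>2" using 2 by (intro sum_sph_coord_sq) auto
    finally have s: "sqrt (\<Sum>l=Suc k..?d. (crd l w)\<^sup>2) = srad x (Suc k)"
     using srad_nonneg[OF x(1) d2, of "Suc k"] 2 by simp
    have nz: "srad x ?d \<noteq> 0"
     using x(4) crd_sph_map[where 'n='n and l = "?d" and x = x] d2 unfolding x(3) by (simp add: sph_null_def sph_coord_srad)
    have "srad x (Suc k) \<noteq> 0" using srad_factors[OF nz] 2 by simp
    hence "sin c \<noteq> 0" using srad_Suc[of k x] 2 x(2) by auto
    moreover have "crd k w = srad x k * cos c" using 2 x(2) unfolding x(3) by (simp add: crd_sph_map sph_coord_srad)
    moreover have "srad x (Suc k) = srad x k * sin c" using srad_Suc[of k x] 2 x(2) by simp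
    ultimately show "w \<in> {w. crd k w = (cos c / sin c) * sqrt (\<Sum>l=Suc k..?d. (crd l w)\<^sup>2)}"
     by (simp add: s)
   qed
   moreover have "k < ?d" using 2 by simp
   ultimately show ?thesis using negligible_cone[OF 2(2)] negligible_subset by blast
  next
   case (3 k)
   define a where "a = sin c *\<^sub>R (ebas k :: 'n cvec) - cos c *\<^sub>R ebas ?d"
   have "a \<noteq> 0"
   proof
    assume "a = 0"
    hence "crd k a = 0" "crd ?d a = 0" by (auto simp: crd_def)
    hence "sin c = 0" "cos c = 0" using 3
     by (auto simp: a_def crd_def inner_diff_left crd_ebas[unfolded crd_def])
    thus False using sin_cos_squared_add[of c] by simp
   qed
   have "Z \<subseteq> {w. a \<bullet> w = 0}"
   proof
    fix w assume "w \<in> Z"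
    then obtain x where x: "x \<in> sph_domain ?d" "x i = c" "w = sph_map x" unfolding Z_def by blast
    have "crd k w = srad x k * cos c" using 3 x(2) unfolding x(3) by (simp add: crd_sph_map sph_coord_srad)
    moreover have "crd ?d w = srad x k * sin c"
     using 3 x(2) srad_Suc[of k x] d2 unfolding x(3) by (simp add: crd_sph_map sph_coord_srad)
    moreover have "a \<bullet> w = sin c * crd k w - cos c * crd ?d w"
     by (simp add: a_def crd_def inner_diff_left inner_diff_right inner_commute)
    ultimately show "w \<in> {w. a \<bullet> w = 0}" by simp
   qed
   thus ?thesis using negligible_hyperplane[of a 0] \<open>a \<noteq> 0\<close> negligible_subset by blast
  qed
 qed
 thus ?thesis using negligible_sph_null sub negligible_Un negligible_subset by blast
qed

section \<open>Compact coordinate boxes\<close>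

text \<open>Coordinates outside \<open>I\<close> are frozen at \<open>undefined\<close>, so Tychonoff's theorem for the full product applies.\<close>

lemma compact_PiE_boxes:
 fixes a b :: "nat => real"
 shows "compact (\<Pi>\<^sub>E i\<in>I. {a i..b i})"
proof -
 have eq: "(\<Pi>\<^sub>E i\<in>I. {a i..b i}) = (\<Pi>\<^sub>E i\<in>UNIV. if i \<in> I then {a i..b i} else {undefined})"
  by (auto simp: PiE_def Pi_def extensional_def split: if_splits) 
 have "compactin (product_topology (\<lambda>i. euclidean) UNIV) (\<Pi>\<^sub>E i\<in>UNIV. if i \<in> I then {a i..b i} else {undefined :: real})"
  by (subst compactin_PiE) auto
 thus ?thesis unfolding eq by (simp add: euclidean_product_topology)
qed

lemma continuous_sph_map: "continuous_on S (sph_map :: (nat => real) => complex ^ 'n::{finite,wellorder})"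
proof -
 have c: "continuous_on S (\<lambda>x. x i)" for i :: nat and S :: "(nat => real) set"
  using continuous_on_subset[OF continuous_on_product_coordinates[of i] subset_UNIV] .
 have s: "continuous_on S (\<lambda>x. sph_coord d x i)" for d i
  unfolding sph_coord_def by (cases "i < d") (auto intro!: continuous_intros c)
 show ?thesis unfolding sph_map_def complex_of_coords_def Complex_eq
  by (intro continuous_intros s)
qed

lemma compact_sph_image: "compact (sph_map ` (\<Pi>\<^sub>E i\<in>I. {a i..b i}) :: (complex ^ 'n::{finite,wellorder}) set)"
 by (intro compact_continuous_image continuous_sph_map compact_PiE_boxes)

section \<open>Explicit dyadic boxes\<close>

text \<open>The size of the product of the first \<open>i\<close> spherical factors on the box, relative to the radius: consecutive quotients
bound the sines, while the side length in direction \<open>i\<close> is inversely proportional to the preceding value. The two effects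
cancel, which makes all boxes of one shell comparable to cubes of side \<open>2^(-m)\<close>.\<close>

definition side_scale :: "nat => (nat => nat) => nat => real" where
 "side_scale d k i = (if i <= 1 then 1 else (real (k i) + 1) / 2 ^ k 1)"

definition side_lo :: "nat => (nat => nat) => nat => real" where
 "side_lo d k i = (if i = 1 then 1 - 1 / 2 ^ k 1 else
  (if i = d then 2 * pi else pi / 2) * (real (k i) / (if i = 2 then 2 ^ k 1 else real (k (i - 1)) + 1)))"

definition side_hi :: "nat => (nat => nat) => nat => real" where
 "side_hi d k i = (if i = 1 then 1 - 1 / 2 ^ (k 1 + 1) else
  (if i = d then 2 * pi else pi / 2) * ((real (k i) + 1) / (if i = 2 then 2 ^ k 1 else real (k (i - 1)) + 1)))"

lemma dyadic_side_eq: "dyadic_side d k i = {side_lo d k i..side_hi d k i}"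
 by (auto simp: dyadic_side_def side_lo_def side_hi_def Let_def)

lemma side_scale_pos: "side_scale d k i > 0"
 by (simp add: side_scale_def add_nonneg_pos)

lemma side_scale_denominator:
 assumes "2 <= i"
 shows "(if i = 2 then 2 ^ k 1 else real (k (i - 1)) + 1) = side_scale d k (i - 1) * 2 ^ k 1"
 using assms by (auto simp: side_scale_def)

lemma side_width:
 assumes "2 <= i"
 shows "side_hi d k i - side_lo d k i = (if i = d then 2 * pi else pi / 2) / (side_scale d k (i - 1) * 2 ^ k 1)"
 using assms unfolding side_hi_def side_lo_def side_scale_denominator[OF assms, of k d]
 by (simp add: right_diff_distrib[symmetric] diff_divide_distrib[symmetric])

lemma side_width_1: "side_hi d k (Suc 0) - side_lo d k (Suc 0) = 1 / 2 ^ (k (Suc 0) + 1)"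
 by (simp add: side_hi_def side_lo_def)

lemma side_hi_scale:
 assumes "2 <= i"
 shows "side_hi d k i = (if i = d then 2 * pi else pi / 2) * (side_scale d k i / side_scale d k (i - 1))"
proof -
 have "side_scale d k i * 2 ^ k 1 = real (k i) + 1" using assms by (simp add: side_scale_def)
 hence "side_hi d k i = (if i = d then 2 * pi else pi / 2) * ((side_scale d k i * 2 ^ k 1) / (side_scale d k (i - 1) * 2 ^ k 1))"
  using assms unfolding side_hi_def side_scale_denominator[OF assms, of k d] by simp
 thus ?thesis by simp
qed

lemma side_lt: "side_lo d k i < side_hi d k i" if "1 <= i"
proof (cases "i = 1")
 case True thus ?thesis using side_width_1[of d k] by (metis diff_gt_0_iff_gt One_nat_def divide_pos_pos zero_less_one zero_less_numeral zero_less_power)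
next
 case False
 have "side_hi d k i - side_lo d k i > 0"
  using that False side_scale_pos[of d k "i - 1"] by (subst side_width) auto
 thus ?thesis by simp
qed

lemma side_lo_nonneg: "1 <= i ==> side_lo d k i >= 0"
 by (auto simp: side_lo_def intro!: mult_nonneg_nonneg divide_nonneg_nonneg)

lemma side_hi_1: "side_hi d k (Suc 0) < 1" by (simp add: side_hi_def)

lemma side_ratio_le:
 assumes k: "k \<in> dyadic_index d" and i: "2 <= i" "i <= d"
 shows "side_scale d k i / side_scale d k (i - 1) <= 1"
proof (cases "i = 2")
 case True
 \<comment> \<open>Truncated subtraction is harmless here as powers of two are positive.\<close>
 have "k 2 <= 2 ^ k 1 - 1" using k by (simp add: dyadic_index_def)
 hence "k 2 + 1 <= 2 ^ k 1" using le_diff_conv2[of 1 "2 ^ k 1" "k 2"] by simp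
 hence "real (k 2 + 1) <= real (2 ^ k 1)" by (rule of_nat_mono)
 thus ?thesis using True by (simp add: side_scale_def)
next
 case False
 hence "k i <= k (i - 1)" using k i by (simp add: dyadic_index_def)
 hence "real (k i) <= real (k (i - 1))" by simp
 moreover have "\<not> i - 1 <= 1" "\<not> i <= 1" using False i by auto
 ultimately have "side_scale d k i <= side_scale d k (i - 1)" by (simp add: side_scale_def divide_right_mono)
 thus ?thesis using side_scale_pos[of d k "i - 1"] by (simp add: divide_le_eq_1)
qed

lemma side_hi_le:
 assumes k: "k \<in> dyadic_index d" and i: "2 <= i" "i <= d"
 shows "side_hi d k i <= (if i = d then 2 * pi else pi / 2)"
 using side_ratio_le[OF assms] mult_left_mono[OF side_ratio_le[OF assms], of "if i = d then 2 * pi else pi / 2"]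
 unfolding side_hi_scale[OF i(1)] by simp

text \<open>Each reflection acts on one coordinate, so a box is given by its multi-index and the set \<open>T\<close> of
reflected coordinates. The corner closest to the poles becomes the upper end of a reflected side, and
\<open>dlo\<close> and \<open>dhi\<close> follow the corner rather than the order of the interval.\<close>

definition dlo :: "nat => (nat => nat) => nat set => nat => real" where
 "dlo d k T i = (if i \<in> T then pi - side_lo d k i else side_lo d k i)"

definition dhi :: "nat => (nat => nat) => nat set => nat => real" where
 "dhi d k T i = (if i \<in> T then pi - side_hi d k i else side_hi d k i)"

definition dbox :: "nat => (nat => nat) => nat set => (nat => real) set" where
 "dbox d k T = (\<Pi>\<^sub>E i\<in>{1..d}. {min (dlo d k T i) (dhi d k T i)..max (dlo d k T i) (dhi d k T i)})"

lemma dlo_dhi_ne: "1 <= i ==> dlo d k T i \<noteq> dhi d k T i"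
 using side_lt[of i d k] by (auto simp: dlo_def dhi_def)

lemma dbox_side: "1 <= i ==> {min (dlo d k T i) (dhi d k T i)..max (dlo d k T i) (dhi d k T i)}
 = (if i \<in> T then {pi - side_hi d k i..pi - side_lo d k i} else {side_lo d k i..side_hi d k i})"
 using side_lt[of i d k] by (auto simp: dlo_def dhi_def)

lemma dbox_empty: "dyadic_box d k = dbox d k {}"
 unfolding dyadic_box_def dbox_def by (intro PiE_cong) (auto simp: dyadic_side_eq dbox_side)

lemma reflect_dbox:
 assumes i: "i \<in> {2..d - 1}"
 shows "(\<lambda>x. x(i := pi - x i)) ` dbox d k T = dbox d k (if i \<in> T then T - {i} else insert i T)"
proof -
 define T' where "T' = (if i \<in> T then T - {i} else insert i T)"
 define I where "I T j = {min (dlo d k T j) (dhi d k T j)..max (dlo d k T j) (dhi d k T j)}" for T j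
 have same: "I T' j = I T j" if "j \<noteq> i" for j using that by (simp add: I_def T'_def dlo_def dhi_def)
 have refl: "pi - t \<in> I T' i \<longleftrightarrow> t \<in> I T i" for t
  unfolding I_def using i by (subst dbox_side, simp)+ (auto simp: T'_def)
 have refl': "pi - t \<in> I T i \<longleftrightarrow> t \<in> I T' i" for t using refl[of "pi - t"] by simp
 have id: "i \<in> {1..d}" using i by auto
 have fwd: "x(i := pi - x i) \<in> Pi\<^sub>E {1..d} (I T')" if "x \<in> Pi\<^sub>E {1..d} (I T)" for x
 proof (rule PiE_I)
  fix j assume j: "j \<in> {1..d}"
  show "(x(i := pi - x i)) j \<in> I T' j"
   using PiE_mem[OF that j] same refl by (cases "j = i") auto
 next
  fix j assume "j \<notin> {1..d}" thus "(x(i := pi - x i)) j = undefined" using that id by (auto simp: PiE_def extensional_def)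
 qed
 have bwd: "x(i := pi - x i) \<in> Pi\<^sub>E {1..d} (I T)" if "x \<in> Pi\<^sub>E {1..d} (I T')" for x
 proof (rule PiE_I)
  fix j assume j: "j \<in> {1..d}"
  show "(x(i := pi - x i)) j \<in> I T j"
   using PiE_mem[OF that j] same refl' by (cases "j = i") auto
 next
  fix j assume "j \<notin> {1..d}" thus "(x(i := pi - x i)) j = undefined" using that id by (auto simp: PiE_def extensional_def)
 qed
 have "(\<lambda>x. x(i := pi - x i)) ` Pi\<^sub>E {1..d} (I T) = Pi\<^sub>E {1..d} (I T')"
 proof
  show "(\<lambda>x. x(i := pi - x i)) ` Pi\<^sub>E {1..d} (I T) \<subseteq> Pi\<^sub>E {1..d} (I T')" using fwd by blast
  show "Pi\<^sub>E {1..d} (I T') \<subseteq> (\<lambda>x. x(i := pi - x i)) ` Pi\<^sub>E {1..d} (I T)"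
  proof
   fix x assume x: "x \<in> Pi\<^sub>E {1..d} (I T')"
   have "x = (x(i := pi - x i))(i := pi - (x(i := pi - x i)) i)" by auto
   thus "x \<in> (\<lambda>x. x(i := pi - x i)) ` Pi\<^sub>E {1..d} (I T)" using bwd[OF x] by blast
  qed
 qed
 thus ?thesis unfolding dbox_def I_def[abs_def] T'_def .
qed

text \<open>Reflections in the same coordinate cancel, so every composition is determined by a set of coordinates.\<close>

lemma dyadic_boxes_dbox:
 assumes "Q \<in> dyadic_boxes d"
 shows "\<exists>k\<in>dyadic_index d. \<exists>T\<subseteq>{2..d - 1}. Q = dbox d k T"
 using assms
proof induction
 case (base k)
 thus ?case using dbox_empty[of d k] by blast
next
 case (reflect Q i)
 then obtain k T where kT: "k \<in> dyadic_index d" "T \<subseteq> {2..d - 1}" "Q = dbox d k T" by blast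
 hence "(\<lambda>x. x(i := pi - x i)) ` Q = dbox d k (if i \<in> T then T - {i} else insert i T)"
  using reflect_dbox[OF reflect.hyps(2)] by simp
 moreover have "(if i \<in> T then T - {i} else insert i T) \<subseteq> {2..d - 1}" using kT reflect.hyps(2) by auto
 ultimately show ?case using kT(1) by blast
qed

locale dyadic_param =
 fixes d :: nat and k :: "nat => nat" and T :: "nat set"
 assumes d2: "2 <= d" and k: "k \<in> dyadic_index d" and T: "T \<subseteq> {2..d - 1}"
begin

abbreviation "lo \<equiv> dlo d k T"
abbreviation "hi \<equiv> dhi d k T"

lemma T_bounds: "i \<in> T ==> 2 <= i \<and> i < d" using T d2 by fastforce

lemma not_T: "Suc 0 \<notin> T" "d \<notin> T" using T_bounds by fastforce+

lemma dbox_mem: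
 assumes "x \<in> dbox d k T" "i \<in> {1..d}"
 shows "if i \<in> T then pi - side_hi d k i <= x i \<and> x i <= pi - side_lo d k i else side_lo d k i <= x i \<and> x i <= side_hi d k i"
proof -
 have "x i \<in> {min (lo i) (hi i)..max (lo i) (hi i)}" using assms unfolding dbox_def by (rule PiE_mem)
 thus ?thesis using assms(2) by (subst (asm) dbox_side) (auto split: if_splits)
qed

lemma dbox_radius:
 assumes "x \<in> dbox d k T"
 shows "1 - 1 / 2 ^ k 1 <= x 1" "x 1 <= 1 - 1 / 2 ^ (k 1 + 1)"
 using dbox_mem[OF assms, of 1] d2 not_T by (auto simp: side_lo_def side_hi_def)

lemma dbox_subset_domain: "dbox d k T \<subseteq> sph_domain d"
proof
 fix x assume x: "x \<in> dbox d k T"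
 show "x \<in> sph_domain d" unfolding sph_domain_def
 proof (rule PiE_I)
  fix i assume i: "i \<in> {1..d}"
  show "x i \<in> (if i = 1 then {0..<1} else if i = d then {0..2 * pi} else {0..pi})"
   using dbox_mem[OF x i] side_lo_nonneg[of i d k] side_hi_1[of d k] side_hi_le[OF k, of i] not_T i
   by (auto split: if_splits)
 next
  fix i assume "i \<notin> {1..d}" thus "x i = undefined" using x unfolding dbox_def by (auto simp: PiE_def extensional_def)
 qed
qed

lemma lo_in: "restrict lo {1..d} \<in> dbox d k T"
 unfolding dbox_def by auto

text \<open>The unreflected sides lie in \<open>[0, \<pi>/2]\<close>, where the distance to \<open>\<pi>/2\<close> decreases along the side; reflection
preserves that distance. So the coordinatewise starting corner is the least element.\<close>

lemma low_corner_dbox: "low_corner d (dbox d k T) = restrict lo {1..d}"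
 unfolding low_corner_def
proof (rule the_equality, intro conjI lo_in ballI)
 fix y assume y: "y \<in> dbox d k T"
 show "sph_le d (restrict lo {1..d}) y"
  unfolding sph_le_def
 proof (intro conjI ballI)
  show "restrict lo {1..d} 1 <= y 1" using dbox_mem[OF y, of 1] d2 not_T by (simp add: dlo_def)
  show "restrict lo {1..d} d <= y d" using dbox_mem[OF y, of d] d2 not_T by (simp add: dlo_def)
  fix i assume i: "i \<in> {2..d - 1}"
  hence "i \<in> {1..d}" "i \<noteq> d" "2 <= i" "i <= d" using d2 by auto
  thus "\<bar>pi / 2 - y i\<bar> <= \<bar>pi / 2 - restrict lo {1..d} i\<bar>"
   using dbox_mem[OF y, of i] side_hi_le[OF k, of i] side_lt[of i d k] by (auto simp: dlo_def split: if_splits)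
 qed
next
 fix x assume x: "x \<in> dbox d k T \<and> (\<forall>y\<in>dbox d k T. sph_le d x y)"
 hence le: "sph_le d x (restrict lo {1..d})" and xb: "x \<in> dbox d k T" using lo_in by auto
 show "x = restrict lo {1..d}"
 proof (rule PiE_ext)
  show "x \<in> Pi\<^sub>E {1..d} (\<lambda>i. {min (lo i) (hi i)..max (lo i) (hi i)})" using xb unfolding dbox_def .
  show "restrict lo {1..d} \<in> Pi\<^sub>E {1..d} (\<lambda>i. {min (lo i) (hi i)..max (lo i) (hi i)})" using lo_in unfolding dbox_def .
  fix i assume i: "i \<in> {1..d}"
  consider "i = 1" | "i = d" | "i \<in> {2..d - 1}" using i by force
  thus "x i = restrict lo {1..d} i"
  proof cases
   case 1 thus ?thesis using le dbox_mem[OF xb, of 1] not_T d2 by (simp add: sph_le_def dlo_def)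
  next
   case 2 thus ?thesis using le dbox_mem[OF xb, of d] not_T d2 by (simp add: sph_le_def dlo_def)
  next
   case 3
   have "\<forall>i\<in>{2..d - 1}. \<bar>pi / 2 - restrict lo {1..d} i\<bar> <= \<bar>pi / 2 - x i\<bar>"
    using le unfolding sph_le_def by blast
   from bspec[OF this 3] have "\<bar>pi / 2 - lo i\<bar> <= \<bar>pi / 2 - x i\<bar>" using i by simp
   thus ?thesis using dbox_mem[OF xb i] side_hi_le[OF k, of i] side_lt[of i d k] 3 i d2
    by (auto simp: dlo_def split: if_splits)
  qed
 qed
qed

section \<open>Complexified spherical coordinates\<close>

text \<open>The angles (and the radius) of the box as affine functions of complexified parameters, where the unit cube
parametrises the box itself and \<open>cang0\<close> is the version without reflections.\<close>

definition cang :: "(nat => complex) => nat => complex" where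
 "cang z i = of_real (lo i) + z i * of_real (hi i - lo i)"

definition cang0 :: "(nat => complex) => nat => complex" where
 "cang0 z i = of_real (side_lo d k i) + z i * of_real (side_hi d k i - side_lo d k i)"

definition csrad :: "(nat => complex) => nat => complex" where
 "csrad z i = cang z 1 * (\<Prod>j=2..i. sin (cang z j))"

definition ccoord :: "(nat => complex) => nat => complex" where
 "ccoord z i = (if i < d then csrad z i * cos (cang z (Suc i)) else csrad z d)"

definition dpoint :: "(nat => real) => nat => real" where
 "dpoint t = restrict (\<lambda>i. lo i + t i * (hi i - lo i)) {1..d}"

lemma csrad_1 [simp]: "csrad z (Suc 0) = cang z (Suc 0)" by (simp add: csrad_def)

lemma csrad_Suc: "1 <= i ==> csrad z (Suc i) = csrad z i * sin (cang z (Suc i))"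
 by (simp add: csrad_def)

lemma cang_real: "i \<in> {1..d} ==> cang (\<lambda>i. of_real (t i)) i = of_real (dpoint t i)"
 by (simp add: cang_def dpoint_def)

lemma csrad_real: "i \<in> {1..d} ==> csrad (\<lambda>i. of_real (t i)) i = of_real (srad (dpoint t) i)"
 unfolding csrad_def srad_def of_real_mult of_real_prod
 using d2 by (intro arg_cong2[of _ _ _ _ "(*)"] prod.cong) (auto simp: cang_real sin_of_real)

lemma ccoord_real: "i \<in> {1..d} ==> ccoord (\<lambda>i. of_real (t i)) i = of_real (sph_coord d (dpoint t) i)"
 unfolding ccoord_def sph_coord_srad using d2 by (auto simp: csrad_real cang_real cos_of_real)

lemma dpoint_in:
 assumes "\<And>i. i \<in> {1..d} ==> 0 <= t i \<and> t i <= 1"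
 shows "dpoint t \<in> dbox d k T"
 unfolding dbox_def dpoint_def
proof (rule PiE_I)
 fix i assume i: "i \<in> {1..d}"
 have "lo i + t i * (hi i - lo i) = (1 - t i) * lo i + t i * hi i" by (simp add: algebra_simps)
 moreover have "min (lo i) (hi i) <= (1 - t i) * lo i + t i * hi i"
  using assms[OF i] convex_bound_le[of "- lo i" "- min (lo i) (hi i)" "- hi i" "1 - t i" "t i"] by simp
 moreover have "(1 - t i) * lo i + t i * hi i <= max (lo i) (hi i)"
  using assms[OF i] convex_bound_le[of "lo i" "max (lo i) (hi i)" "hi i" "1 - t i" "t i"] by simp
 ultimately show "restrict (\<lambda>i. lo i + t i * (hi i - lo i)) {1..d} i \<in> {min (lo i) (hi i)..max (lo i) (hi i)}"
  using i by simp
qed (simp only: restrict_apply if_False)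

lemma dpoint_surj:
 assumes x: "x \<in> dbox d k T"
 shows "dpoint (\<lambda>i. (x i - lo i) / (hi i - lo i)) = x"
proof
 fix i show "dpoint (\<lambda>i. (x i - lo i) / (hi i - lo i)) i = x i"
  using dlo_dhi_ne[of i d k T] x by (auto simp: dpoint_def dbox_def PiE_def extensional_def)
qed

lemma dpoint_surj_range:
 assumes x: "x \<in> dbox d k T" and i: "i \<in> {1..d}"
 shows "0 <= (x i - lo i) / (hi i - lo i)" "(x i - lo i) / (hi i - lo i) <= 1"
proof -
 have m: "x i \<in> {min (lo i) (hi i)..max (lo i) (hi i)}" using assms unfolding dbox_def by (rule PiE_mem)
 have ne: "lo i \<noteq> hi i" using dlo_dhi_ne[of i d k T] i by simp
 show "0 <= (x i - lo i) / (hi i - lo i)" "(x i - lo i) / (hi i - lo i) <= 1"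
  using m ne by (cases "lo i < hi i"; auto simp: zero_le_divide_iff divide_le_eq)+
qed

lemma cang_T: "i \<in> T ==> cang z i = of_real pi - cang0 z i" "i \<notin> T ==> cang z i = cang0 z i"
 by (simp_all add: cang_def cang0_def dlo_def dhi_def algebra_simps)

lemma sin_cang: "sin (cang z i) = sin (cang0 z i)"
 by (cases "i \<in> T") (simp_all add: cang_T sin_diff flip: sin_of_real cos_of_real)

lemma cos_cang: "cos (cang z i) = (if i \<in> T then - cos (cang0 z i) else cos (cang0 z i))"
 by (cases "i \<in> T") (simp_all add: cang_T cos_diff flip: sin_of_real cos_of_real)

end

definition trigC :: real where "trigC = exp (4 * pi)"

lemma trigC_ge1: "trigC >= 1" by (simp add: trigC_def)

lemma norm_exp_le: "cmod (exp z) <= exp (cmod z)"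
 using abs_Re_le_cmod[of z] by simp

lemma cmod_exp_i_le: "cmod (exp (\<i> * z)) <= exp (cmod z)" "cmod (exp (- (\<i> * z))) <= exp (cmod z)"
 using norm_exp_le[of "\<i> * z"] norm_exp_le[of "- (\<i> * z)"] by (simp_all only: norm_mult norm_ii mult_1 norm_minus_cancel)

lemma cmod_cos_le: "cmod (cos z) <= exp (cmod z)"
proof -
 have "cmod (cos z) = cmod (exp (\<i> * z) + exp (- (\<i> * z))) / 2"
  unfolding cos_exp_eq norm_divide by simp
 also have "... <= (exp (cmod z) + exp (cmod z)) / 2"
  by (intro divide_right_mono order_trans[OF norm_triangle_ineq] add_mono cmod_exp_i_le) simp
 finally show ?thesis by simp
qed

lemma cmod_sin_le: "cmod (sin z) <= exp (cmod z)"
proof -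
 have "cmod (sin z) = cmod (exp (\<i> * z) - exp (- (\<i> * z))) / 2"
  unfolding sin_exp_eq norm_divide norm_mult by simp
 also have "... <= (exp (cmod z) + exp (cmod z)) / 2"
  by (intro divide_right_mono order_trans[OF norm_triangle_ineq4] add_mono cmod_exp_i_le) simp
 finally show ?thesis by simp
qed

lemma trig_bounds:
 assumes "cmod z <= 4 * pi" shows "cmod (sin z) <= trigC" "cmod (cos z) <= trigC"
 using cmod_sin_le[of z] cmod_cos_le[of z] assms unfolding trigC_def by (meson exp_le_cancel_iff order_trans)+

lemma trig_lipschitz:
 assumes "cmod z <= 4 * pi" "cmod z' <= 4 * pi"
 shows "cmod (sin z - sin z') <= trigC * cmod (z - z')" "cmod (cos z - cos z') <= trigC * cmod (z - z')"
proof -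
 show "cmod (sin z - sin z') <= trigC * cmod (z - z')"
  by (rule field_differentiable_bound[of "cball 0 (4 * pi)" sin cos])
   (use assms trig_bounds in \<open>auto intro!: derivative_eq_intros\<close>)
 show "cmod (cos z - cos z') <= trigC * cmod (z - z')"
  by (rule field_differentiable_bound[of "cball 0 (4 * pi)" cos "\<lambda>x. - sin x"])
   (use assms trig_bounds in \<open>auto intro!: derivative_eq_intros\<close>)
qed

definition trigD :: real where "trigD = 4 * pi * trigC"

lemma trigD_ge: "trigD >= 1" "trigC <= trigD"
proof -
 have "4 * pi >= 1" using pi_gt3 by simp
 thus "trigD >= 1" "trigC <= trigD" using trigC_ge1 mult_mono[of 1 "4 * pi" 1 trigC] mult_right_mono[of 1 "4 * pi" trigC]
  by (auto simp: trigD_def)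
qed

context dyadic_param
begin

lemma cang0_bound:
 assumes i: "i \<in> {1..d}" and z: "cmod (c i) <= 2"
 shows "cmod (cang0 c i) <= 2 * side_hi d k i"
proof -
 have w: "side_hi d k i - side_lo d k i >= 0" "side_lo d k i >= 0"
  using side_lt[of i d k] side_lo_nonneg[of i d k] i by auto
 have "cmod (cang0 c i) <= side_lo d k i + cmod (c i) * (side_hi d k i - side_lo d k i)"
  unfolding cang0_def using w by (intro order_trans[OF norm_triangle_ineq]) (simp add: norm_mult flip: of_real_diff)
 also have "... <= side_lo d k i + 2 * (side_hi d k i - side_lo d k i)"
  using w z by (intro add_left_mono mult_right_mono) auto
 also have "... <= 2 * side_hi d k i" using w by simp
 finally show ?thesis .
qed

lemma cang0_4pi:
 assumes i: "i \<in> {2..d}" and z: "cmod (c i) <= 2"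
 shows "cmod (cang0 c i) <= 4 * pi"
proof -
 have "cmod (cang0 c i) <= 2 * side_hi d k i" by (rule cang0_bound) (use i z in auto)
 also have "... <= 2 * (2 * pi)"
 proof -
  have "side_hi d k i <= (if i = d then 2 * pi else pi / 2)" using side_hi_le[OF k, of i] i by simp
  also have "... <= 2 * pi" using pi_gt_zero by (simp del: pi_gt_zero)
  finally show ?thesis by simp
 qed
 finally show ?thesis by simp
qed

lemma cang0_diff:
 assumes i: "i \<in> {2..d}" and z: "cmod (c i - c' i) <= \<eta>"
 shows "cmod (cang0 c i - cang0 c' i) <= \<eta> * (2 * pi / (side_scale d k (i - 1) * 2 ^ k 1))"
proof -
 have s: "side_scale d k (i - 1) > 0" by (rule side_scale_pos)
 have w: "side_hi d k i - side_lo d k i >= 0" using side_lt[of i d k] i by auto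
 have "cang0 c i - cang0 c' i = (c i - c' i) * of_real (side_hi d k i - side_lo d k i)"
  unfolding cang0_def by (simp add: algebra_simps)
 hence "cmod (cang0 c i - cang0 c' i) = cmod (c i - c' i) * (side_hi d k i - side_lo d k i)"
  using w by (simp only: norm_mult norm_of_real abs_of_nonneg)
 also have "... <= \<eta> * (2 * pi / (side_scale d k (i - 1) * 2 ^ k 1))"
 proof (rule mult_mono)
  show "side_hi d k i - side_lo d k i <= 2 * pi / (side_scale d k (i - 1) * 2 ^ k 1)"
  proof -
   have "side_hi d k i - side_lo d k i = (if i = d then 2 * pi else pi / 2) / (side_scale d k (i - 1) * 2 ^ k 1)"
    by (rule side_width) (use i in simp)
   also have "... <= 2 * pi / (side_scale d k (i - 1) * 2 ^ k 1)"
    using s pi_gt_zero by (intro divide_right_mono) auto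
   finally show ?thesis .
  qed
 qed (use z w order_trans[OF norm_ge_zero z] in auto)
 finally show ?thesis .
qed

lemma cang_1_bound:
 assumes "cmod (z 1) <= 2" shows "cmod (cang z 1) <= 1"
proof -
 have "cang z 1 = of_real (1 - 1 / 2 ^ k 1) + z 1 * of_real (1 / 2 ^ (k 1 + 1))"
  using not_T side_width_1[of d k] by (simp add: cang_def dlo_def dhi_def side_lo_def)
 hence "cmod (cang z 1) <= cmod (of_real (1 - 1 / 2 ^ k 1)) + cmod (z 1 * of_real (1 / 2 ^ (k 1 + 1)))"
  by (metis norm_triangle_ineq)
 also have "... <= (1 - 1 / 2 ^ k 1) + 2 * (1 / 2 ^ (k 1 + 1))"
 proof (rule add_mono)
  show "cmod (of_real (1 - 1 / 2 ^ k 1)) <= 1 - 1 / 2 ^ k 1" by (simp only: norm_of_real) simp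
  show "cmod (z 1 * of_real (1 / 2 ^ (k 1 + 1))) <= 2 * (1 / 2 ^ (k 1 + 1))"
   unfolding norm_mult norm_of_real using assms by (intro mult_mono) auto
 qed
 also have "... = 1" by simp
 finally show ?thesis .
qed

lemma cang_1_diff:
 assumes "cmod (z 1 - z' 1) <= \<eta>" shows "cmod (cang z 1 - cang z' 1) <= \<eta> * (1 / 2 ^ k 1)"
proof -
 have "cang z 1 = of_real (side_lo d k 1) + z 1 * of_real (1 / 2 ^ (k 1 + 1))" for z
  using not_T side_width_1[of d k] by (simp add: cang_def dlo_def dhi_def)
 hence "cang z 1 - cang z' 1 = (z 1 - z' 1) * of_real (1 / 2 ^ (k 1 + 1))"
  by (simp only: left_diff_distrib) simp
 hence "cmod (cang z 1 - cang z' 1) = cmod (z 1 - z' 1) * (1 / 2 ^ (k 1 + 1))"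
  by (simp only: norm_mult norm_of_real) simp
 also have "... <= \<eta> * (1 / 2 ^ k 1)"
  using assms order_trans[OF norm_ge_zero assms] by (intro mult_mono) (auto simp: field_simps)
 finally show ?thesis .
qed

text \<open>A sine is at most a multiple of its angle, and the angle is at most a multiple of the quotient of consecutive
scales; the product telescopes.\<close>

lemma csrad_bound:
 assumes z: "\<And>i. i \<in> {1..d} ==> cmod (c i) <= 2" and i: "1 <= i" "i < d"
 shows "cmod (csrad c i) <= trigD ^ i * side_scale d k i"
 using i
proof (induction i rule: dec_induct)
 case base
 have "cmod (cang c 1) <= 1" using cang_1_bound z d2 by simp
 thus ?case using trigD_ge by (simp add: side_scale_def)
next
 case (step i)
 have i2: "Suc i \<in> {2..d}" "Suc i \<noteq> d" using step by auto
 have "cmod (sin (cang0 c (Suc i))) <= trigD * (side_scale d k (Suc i) / side_scale d k i)"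
 proof -
  have 4: "cmod (cang0 c (Suc i)) <= 4 * pi" by (rule cang0_4pi) (use z i2 in auto)
  have "cmod (sin (cang0 c (Suc i)) - sin 0) <= trigC * cmod (cang0 c (Suc i) - 0)"
   by (rule trig_lipschitz) (use 4 in auto)
  also have "... <= trigC * (2 * side_hi d k (Suc i))"
   using cang0_bound[of "Suc i" c] z i2 trigC_ge1 by (intro mult_left_mono) auto
  also have "... = trigC * pi * (side_scale d k (Suc i) / side_scale d k i)"
   using i2 by (subst side_hi_scale) auto
  also have "... <= trigD * (side_scale d k (Suc i) / side_scale d k i)"
   using side_scale_pos[of d k i] side_scale_pos[of d k "Suc i"] trigC_ge1 unfolding trigD_def
   by (intro mult_right_mono) auto
  finally show ?thesis by simp
 qed
 hence "cmod (csrad c (Suc i)) <= (trigD ^ i * side_scale d k i) * (trigD * (side_scale d k (Suc i) / side_scale d k i))"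
  using step trigD_ge side_scale_pos[of d k i] unfolding csrad_Suc[OF step(1)] norm_mult sin_cang
  by (intro mult_mono) auto
 also have "... = trigD ^ Suc i * side_scale d k (Suc i)" using side_scale_pos[of d k i] by simp
 finally show ?case .
qed

text \<open>The small denominators in the side length cancel against the scale of the radial factor in front.\<close>

lemma csrad_trig_diff:
 assumes z: "\<And>i. i \<in> {1..d} ==> cmod (c i) <= 2" "\<And>i. i \<in> {1..d} ==> cmod (c' i) <= 2"
  and \<eta>: "\<And>i. i \<in> {1..d} ==> cmod (c i - c' i) <= \<eta>" and i: "1 <= i" "i < d"
  and tr: "tr = sin \<or> tr = cos"
 shows "cmod (csrad c i) * cmod (tr (cang0 c (Suc i)) - tr (cang0 c' (Suc i))) <= trigD ^ Suc i * (\<eta> / 2 ^ k 1)"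
proof -
 have i2: "Suc i \<in> {2..d}" using i by auto
 have b: "cmod (cang0 c (Suc i)) <= 4 * pi" "cmod (cang0 c' (Suc i)) <= 4 * pi" using cang0_4pi[OF i2] z i2 by auto
 have sp: "side_scale d k i > 0" by (rule side_scale_pos)
 have \<eta>0: "\<eta> >= 0" using \<eta>[of 1] d2 order_trans[OF norm_ge_zero] by auto
 have "cmod (tr (cang0 c (Suc i)) - tr (cang0 c' (Suc i))) <= trigC * cmod (cang0 c (Suc i) - cang0 c' (Suc i))"
  using trig_lipschitz[OF b] tr by auto
 also have "... <= trigC * (\<eta> * (2 * pi / (side_scale d k (Suc i - 1) * 2 ^ k 1)))"
  using cang0_diff[OF i2, of c c' \<eta>] \<eta> i2 trigC_ge1 by (intro mult_left_mono) auto
 also have "... = (2 * pi * trigC) * (\<eta> / (side_scale d k i * 2 ^ k 1))" by simp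
 also have "... <= trigD * (\<eta> / (side_scale d k i * 2 ^ k 1))"
  using sp \<eta>0 trigC_ge1 unfolding trigD_def by (intro mult_right_mono) auto
 finally have t: "cmod (tr (cang0 c (Suc i)) - tr (cang0 c' (Suc i))) <= trigD * (\<eta> / (side_scale d k i * 2 ^ k 1))" .
 have "cmod (csrad c i) * cmod (tr (cang0 c (Suc i)) - tr (cang0 c' (Suc i)))
  <= (trigD ^ i * side_scale d k i) * (trigD * (\<eta> / (side_scale d k i * 2 ^ k 1)))"
  using csrad_bound[OF z(1) i] t sp trigD_ge by (intro mult_mono) auto
 also have "... = trigD ^ Suc i * (\<eta> / 2 ^ k 1)" using sp by simp
 finally show ?thesis .
qed

lemma csrad_diff:
 assumes z: "\<And>i. i \<in> {1..d} ==> cmod (c i) <= 2" "\<And>i. i \<in> {1..d} ==> cmod (c' i) <= 2"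
  and \<eta>: "\<And>i. i \<in> {1..d} ==> cmod (c i - c' i) <= \<eta>" and i: "1 <= i" "i <= d"
 shows "cmod (csrad c i - csrad c' i) <= real i * trigD ^ i * (\<eta> / 2 ^ k 1)"
 using i
proof (induction i rule: dec_induct)
 case base
 have \<eta>0: "\<eta> >= 0" using \<eta>[of 1] d2 order_trans[OF norm_ge_zero] by auto
 have "cmod (cang c 1 - cang c' 1) <= \<eta> * (1 / 2 ^ k 1)" by (rule cang_1_diff) (use \<eta> d2 in auto)
 also have "... <= trigD * (\<eta> / 2 ^ k 1)" using trigD_ge \<eta>0 mult_right_mono[of 1 trigD "\<eta> / 2 ^ k 1"] by simp
 finally show ?case by simp
next
 case (step i)
 have i2: "Suc i \<in> {2..d}" using step by auto
 have id: "i < d" using step by simp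
 have e: "csrad c (Suc i) - csrad c' (Suc i) = csrad c i * (sin (cang0 c (Suc i)) - sin (cang0 c' (Suc i)))
  + (csrad c i - csrad c' i) * sin (cang0 c' (Suc i))"
  unfolding csrad_Suc[OF step(1)] sin_cang by (simp add: algebra_simps)
 have s: "cmod (sin (cang0 c' (Suc i))) <= trigD"
 proof -
  have "cmod (cang0 c' (Suc i)) <= 4 * pi" by (rule cang0_4pi) (use z i2 in auto)
  from trig_bounds(1)[OF this] show ?thesis using trigD_ge by linarith
 qed
 have "cmod (csrad c (Suc i) - csrad c' (Suc i)) <= trigD ^ Suc i * (\<eta> / 2 ^ k 1) + (real i * trigD ^ i * (\<eta> / 2 ^ k 1)) * trigD"
  unfolding e
 proof (rule order_trans[OF norm_triangle_ineq], rule add_mono)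
  show "cmod (csrad c i * (sin (cang0 c (Suc i)) - sin (cang0 c' (Suc i)))) <= trigD ^ Suc i * (\<eta> / 2 ^ k 1)"
   unfolding norm_mult by (rule csrad_trig_diff[OF z \<eta> step(1) id]) auto
  show "cmod ((csrad c i - csrad c' i) * sin (cang0 c' (Suc i))) <= (real i * trigD ^ i * (\<eta> / 2 ^ k 1)) * trigD"
   unfolding norm_mult using step.IH id s by (intro mult_mono) (auto intro: order_trans[OF norm_ge_zero])
 qed
 also have "... = real (Suc i) * trigD ^ Suc i * (\<eta> / 2 ^ k 1)" by (simp add: algebra_simps)
 finally show ?case .
qed

text \<open>Parameters at distance \<open>\<eta>\<close> give complexified points at distance of order \<open>\<eta> 2^(-m)\<close>, with a constant depending on the dimension
only. This is the statement that all boxes look like cubes of side \<open>2^(-m)\<close> after rescaling.\<close>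

lemma ccoord_diff:
 assumes z: "\<And>i. i \<in> {1..d} ==> cmod (v i) <= 2" "\<And>i. i \<in> {1..d} ==> cmod (v' i) <= 2"
  and \<eta>: "\<And>i. i \<in> {1..d} ==> cmod (v i - v' i) <= \<eta>" and i: "i \<in> {1..d}"
 shows "cmod (ccoord v i - ccoord v' i) <= real d * trigD ^ d * (\<eta> / 2 ^ k 1)"
proof (cases "i < d")
 case False
 hence "i = d" using i by simp
 thus ?thesis using csrad_diff[where i = d, OF z \<eta>] i by (simp add: ccoord_def)
next
 case True
 have \<eta>0: "\<eta> >= 0" using \<eta>[of 1] d2 order_trans[OF norm_ge_zero] by auto
 have i1: "1 <= i" using i by simp
 have i2: "Suc i \<in> {2..d}" using True i by auto
 have "cmod (cos (cang0 v' (Suc i))) <= trigC" by (rule trig_bounds(2)[OF cang0_4pi[OF i2]]) (use z i2 in auto)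
 hence c: "cmod (cos (cang0 v' (Suc i))) <= trigD" using trigD_ge by linarith
 define sg :: complex where "sg = (if Suc i \<in> T then -1 else 1)"
 have sg: "cmod sg = 1" by (simp add: sg_def)
 have cc: "cos (cang v (Suc i)) = sg * cos (cang0 v (Suc i))" for v by (simp add: cos_cang sg_def)
 have e: "ccoord v i - ccoord v' i = sg * (csrad v i * (cos (cang0 v (Suc i)) - cos (cang0 v' (Suc i)))
  + (csrad v i - csrad v' i) * cos (cang0 v' (Suc i)))"
  using True unfolding ccoord_def cc by (simp add: algebra_simps)
 have "cmod (ccoord v i - ccoord v' i) <= trigD ^ Suc i * (\<eta> / 2 ^ k 1) + (real i * trigD ^ i * (\<eta> / 2 ^ k 1)) * trigD"
  unfolding e norm_mult[of sg] sg mult_1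
 proof (rule order_trans[OF norm_triangle_ineq], rule add_mono)
  show "cmod (csrad v i * (cos (cang0 v (Suc i)) - cos (cang0 v' (Suc i)))) <= trigD ^ Suc i * (\<eta> / 2 ^ k 1)"
   unfolding norm_mult by (rule csrad_trig_diff[OF z \<eta> i1 True]) auto
  have "cmod (csrad v i - csrad v' i) <= real i * trigD ^ i * (\<eta> / 2 ^ k 1)"
   by (rule csrad_diff[OF z \<eta> i1]) (use True in auto)
  thus "cmod ((csrad v i - csrad v' i) * cos (cang0 v' (Suc i))) <= (real i * trigD ^ i * (\<eta> / 2 ^ k 1)) * trigD"
   unfolding norm_mult using c by (intro mult_mono) (auto intro: order_trans[OF norm_ge_zero])
 qed
 also have "... = real (Suc i) * trigD ^ Suc i * (\<eta> / 2 ^ k 1)" by (simp add: algebra_simps)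
 also have "... <= real d * trigD ^ d * (\<eta> / 2 ^ k 1)"
  using True \<eta>0 trigD_ge by (intro mult_right_mono mult_mono power_increasing) auto
 finally show ?thesis .
qed

end

section \<open>Almost disjointness\<close>

text \<open>At the first coordinate where the descriptions differ, the sides have the same grid (or belong to different
shells, or to different reflections), so they share at most an end point.\<close>

lemma dbox_overlap:
 assumes "dyadic_param d k T" "dyadic_param d k' T'" and ne: "dbox d k T \<noteq> dbox d k' T'"
 shows "\<exists>i\<in>{1..d}. \<exists>c. \<forall>x. x \<in> dbox d k T --> x \<in> dbox d k' T' --> x i = c"
proof -
 interpret A: dyadic_param d k T by fact
 interpret B: dyadic_param d k' T' by fact
 define same where "same i \<longleftrightarrow> k i = k' i \<and> (i \<in> T \<longleftrightarrow> i \<in> T')" for i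
 have "\<exists>i. i \<in> {1..d} \<and> \<not> same i"
 proof (rule ccontr)
  assume "\<not> (\<exists>i. i \<in> {1..d} \<and> \<not> same i)"
  hence s: "same i" if "i \<in> {1..d}" for i using that by blast
  have "side_lo d k i = side_lo d k' i \<and> side_hi d k i = side_hi d k' i" if i: "i \<in> {1..d}" for i
  proof -
   have "k 1 = k' 1" using s[of 1] A.d2 by (simp add: same_def)
   moreover have "k i = k' i" using s[OF i] by (simp add: same_def)
   moreover have "i = 1 \<or> k (i - 1) = k' (i - 1)"
   proof (cases "i = 1")
    case False
    hence "i - 1 \<in> {1..d}" using i by auto
    thus ?thesis using s by (simp add: same_def)
   qed simp
   ultimately show ?thesis by (auto simp: side_lo_def side_hi_def)
  qed
  hence "dbox d k T = dbox d k' T'"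
   unfolding dbox_def using s by (intro PiE_cong) (auto simp: dlo_def dhi_def same_def)
  thus False using ne by simp
 qed
 define i where "i = (LEAST i. i \<in> {1..d} \<and> \<not> same i)"
 have i: "i \<in> {1..d}" "\<not> same i" and least: "\<And>j. j \<in> {1..d} ==> j < i ==> same j"
  using LeastI_ex[OF \<open>\<exists>i. i \<in> {1..d} \<and> \<not> same i\<close>] not_less_Least[of _ "\<lambda>i. i \<in> {1..d} \<and> \<not> same i"]
  unfolding i_def by blast+
 have "\<exists>c. \<forall>x. x \<in> dbox d k T --> x \<in> dbox d k' T' --> x i = c"
 proof (cases "i = 1")
  case True
  have "i \<notin> T" "i \<notin> T'" using A.not_T B.not_T True by auto
  hence ne1: "k 1 \<noteq> k' 1" using i(2) True by (simp add: same_def)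
  have half: "(1::real) / 2 ^ b <= 1 / 2 ^ (a + 1)" if "a < b" for a b :: nat
   using that by (intro divide_left_mono power_increasing) auto
  have "x 1 = 1 - 1 / 2 ^ max (k 1) (k' 1)" if x: "x \<in> dbox d k T" "x \<in> dbox d k' T'" for x
   using A.dbox_radius[OF x(1)] B.dbox_radius[OF x(2)] ne1 half[of "k 1" "k' 1"] half[of "k' 1" "k 1"]
   by (cases "k 1 < k' 1") (auto simp: max_def)
  thus ?thesis using True by blast
 next
  case False
  hence i2: "2 <= i" "i <= d" using i by auto
  have prev: "k j = k' j" if "1 <= j" "j < i" for j using least[of j] that i by (auto simp: same_def)
  define N where "N = (if i = 2 then (2::real) ^ k 1 else real (k (i - 1)) + 1)"
  have N': "(if i = 2 then (2::real) ^ k' 1 else real (k' (i - 1)) + 1) = N"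
   unfolding N_def using prev[of 1] prev[of "i - 1"] i2 by auto
  have Npos: "N > 0" by (auto simp: N_def add_nonneg_pos)
  define Ai where "Ai = (if i = d then 2 * pi else pi / 2)"
  have Ai: "Ai > 0" by (simp add: Ai_def)
  have sd: "side_lo d k i = Ai * (real (k i) / N)" "side_hi d k i = Ai * ((real (k i) + 1) / N)"
   "side_lo d k' i = Ai * (real (k' i) / N)" "side_hi d k' i = Ai * ((real (k' i) + 1) / N)"
   using False i2 N' unfolding side_lo_def side_hi_def N_def Ai_def by auto
  show ?thesis
  proof (cases "i \<in> T \<longleftrightarrow> i \<in> T'")
   case True
   hence nek: "k i \<noteq> k' i" using i(2) by (simp add: same_def)
   define c0 where "c0 = Ai * (real (max (k i) (k' i)) / N)"
   have key: "t = c0" if "side_lo d k i <= t" "t <= side_hi d k i" "side_lo d k' i <= t" "t <= side_hi d k' i" for t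
   proof -
    have mono: "Ai * ((real a + 1) / N) <= Ai * (real b / N)" if "a < b" for a b :: nat
     using that Ai Npos by (intro mult_left_mono divide_right_mono) auto
    show ?thesis using that nek mono[of "k i" "k' i"] mono[of "k' i" "k i"] unfolding sd c0_def
     by (cases "k i < k' i") (auto simp: max_def)
   qed
   have "x i = (if i \<in> T then pi - c0 else c0)" if x: "x \<in> dbox d k T" "x \<in> dbox d k' T'" for x
    using A.dbox_mem[OF x(1) i(1)] B.dbox_mem[OF x(2) i(1)] key[of "x i"] key[of "pi - x i"] True
    by (auto split: if_splits)
   thus ?thesis by blast
  next
   case False
   hence "i \<noteq> d" using A.not_T B.not_T by auto
   hence "side_hi d k i <= pi / 2" "side_hi d k' i <= pi / 2"
    using side_hi_le[OF A.k i2] side_hi_le[OF B.k i2] by auto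
   hence "x i = pi / 2" if x: "x \<in> dbox d k T" "x \<in> dbox d k' T'" for x
    using A.dbox_mem[OF x(1) i(1)] B.dbox_mem[OF x(2) i(1)] False by (auto split: if_splits)
   thus ?thesis by blast
  qed
 qed
 thus ?thesis using i(1) by blast
qed

section \<open>The estimate on one box\<close>

declare weighted_vol_id [measurable del]

lemma AE_weighted_vol_negligible:
 fixes N :: "'a::euclidean_space set"
 assumes lam: "lam > -1" and N: "negligible N"
 shows "AE x in weighted_vol lam. x \<notin> N"
proof -
 have "AE x in lebesgue. x \<notin> N"
  unfolding eventually_ae_filter_negligible using N by auto
 hence "AE x in lebesgue_on (ball 0 1). x \<notin> N"
  by (subst AE_restrict_space_iff) auto
 moreover have "(\<lambda>x. ennreal (wconst TYPE('a) lam * bwt lam x)) \<in> borel_measurable (lebesgue_on (ball 0 1))"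
  by (intro measurable_restrict_space1 measurable_completion) measurable
 ultimately show ?thesis
  unfolding weighted_vol_eq[OF lam] by (subst AE_density) auto
qed

lemma compact_subset_ball_radius:
 assumes "compact K" "K \<subseteq> ball (0::'a::euclidean_space) 1"
 shows "\<exists>\<rho>. 0 < \<rho> \<and> \<rho> < 1 \<and> (\<forall>x\<in>K. norm x <= \<rho>)"
proof (cases "K = {}")
 case True thus ?thesis by (intro exI[of _ "1/2"]) auto
next
 case False
 obtain x0 where x0: "x0 \<in> K" "\<And>x. x \<in> K ==> norm x <= norm x0"
  using continuous_attains_sup[OF assms(1) False, of norm] by (auto intro: continuous_intros)
 hence "norm x0 < 1" using assms(2) by auto
 thus ?thesis using x0(2) by (intro exI[of _ "(1 + norm x0) / 2"]) (force simp: add_pos_nonneg)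
qed

lemma bwt_upper:
 assumes "norm x <= \<rho>" "\<rho> < 1" "0 <= \<rho>"
 shows "bwt lam x <= (1 - \<rho>\<^sup>2) powr (- \<bar>lam\<bar>)"
proof -
 have p: "(norm x)\<^sup>2 <= \<rho>\<^sup>2" "\<rho>\<^sup>2 < 1" using assms by (auto intro: power_mono simp: abs_square_less_1)
 have b: "0 < 1 - \<rho>\<^sup>2" "1 - \<rho>\<^sup>2 <= 1 - (norm x)\<^sup>2" "1 - (norm x)\<^sup>2 <= 1" using p by auto
 have "(1 - (norm x)\<^sup>2) powr lam <= (1 - \<rho>\<^sup>2) powr (- \<bar>lam\<bar>)"
 proof (cases "lam >= 0")
  case True
  have "(1 - (norm x)\<^sup>2) powr lam <= 1 powr lam" using b True by (intro powr_mono2) auto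
  also have "... = 1" by simp
  also have "1 <= (1 - \<rho>\<^sup>2) powr (- \<bar>lam\<bar>)"
   using powr_mono2'[of "- \<bar>lam\<bar>" "1 - \<rho>\<^sup>2" 1] b by simp
  finally show ?thesis .
 next
  case False
  thus ?thesis using powr_mono2'[of lam "1 - \<rho>\<^sup>2" "1 - (norm x)\<^sup>2"] b by simp
 qed
 thus ?thesis using b by (auto simp: bwt_def indicator_def)
qed

text \<open>On a compact subset of the ball the weight is bounded above.\<close>

lemma locally_integrable_compact:
 fixes \<psi> :: "'a::euclidean_space => complex"
 assumes lam: "lam > -1" and \<psi>: "locally_integrable_ball \<psi>" and K: "compact K" "K \<subseteq> ball 0 1"
 shows "integrable (weighted_vol lam) (\<lambda>w. indicator K w *\<^sub>R \<psi> w)"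
proof -
 have c: "wconst TYPE('a) lam > 0" by (rule wconst_pos[OF lam])
 have si: "integrable lebesgue (\<lambda>w. indicator K w *\<^sub>R \<psi> w)"
  using \<psi> K unfolding locally_integrable_ball_def set_integrable_def by blast
 obtain \<rho> where \<rho>: "0 < \<rho>" "\<rho> < 1" "\<And>x. x \<in> K ==> norm x <= \<rho>" using compact_subset_ball_radius[OF K] by blast
 define b where "b = wconst TYPE('a) lam * (1 - \<rho>\<^sup>2) powr (- \<bar>lam\<bar>)"
 have ml: "(\<lambda>w. indicator K w *\<^sub>R \<psi> w) \<in> borel_measurable (lebesgue_on (ball 0 1))"
  using si by (intro measurable_restrict_space1) auto
 have mb: "(\<lambda>x::'a. wconst TYPE('a) lam * bwt lam x) \<in> borel_measurable lebesgue"
  by (intro measurable_completion) measurable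
 have "integrable lebesgue (\<lambda>x. indicator (ball 0 1) x *\<^sub>R (wconst TYPE('a) lam * bwt lam x) *\<^sub>R (indicator K x *\<^sub>R \<psi> x))"
 proof (rule integrable_dominated_on)
  show "integrable lebesgue (\<lambda>w. b *\<^sub>R (indicator K w *\<^sub>R \<psi> w))" using si by (rule integrable_scaleR_right)
  show "(\<lambda>x. indicator (ball 0 1) x *\<^sub>R (wconst TYPE('a) lam * bwt lam x) *\<^sub>R (indicator K x *\<^sub>R \<psi> x)) \<in> borel_measurable lebesgue"
   by (rule borel_measurable_scaleR[OF borel_measurable_indicator borel_measurable_scaleR[OF mb borel_measurable_integrable[OF si]]]) simp
  fix x :: 'a
  show "norm (indicator (ball 0 1) x *\<^sub>R (wconst TYPE('a) lam * bwt lam x) *\<^sub>R (indicator K x *\<^sub>R \<psi> x)) <= norm (b *\<^sub>R (indicator K x *\<^sub>R \<psi> x))"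
  proof (cases "x \<in> K")
   case True
   have "wconst TYPE('a) lam * bwt lam x <= b"
    unfolding b_def using bwt_upper[OF \<rho>(3)[OF True] \<rho>(2)] \<rho>(1) c by (intro mult_left_mono) auto
   thus ?thesis using True c by (auto simp: indicator_def b_def intro!: mult_right_mono)
  qed simp
 qed
 hence "integrable (lebesgue_on (ball 0 1)) (\<lambda>x. (wconst TYPE('a) lam * bwt lam x) *\<^sub>R (indicator K x *\<^sub>R \<psi> x))"
  by (subst integrable_restrict_space) auto
 thus ?thesis unfolding weighted_vol_eq[OF lam]
  by (subst integrable_density) (use c ml mb in \<open>auto intro!: AE_I2 measurable_restrict_space1\<close>)
qed

text \<open>The complex points whose real coordinates have been complexified: the identification is complex linear in the
real coordinates, so holomorphic dependence is preserved.\<close>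

definition ccoords :: "(nat => complex) => complex ^ 'n::{finite,wellorder}" where
 "ccoords U = (\<chi> j. U (2 * rk j - 1) + \<i> * U (2 * rk j))"

lemma rk_index: "2 * rk (j::'n::{finite,wellorder}) - 1 \<in> {1..2 * CARD('n)}" "2 * rk j \<in> {1..2 * CARD('n)}"
 using rk_range[of j] by auto

lemma ccoords_real:
 assumes "\<And>i. i \<in> {1..2 * CARD('n)} ==> U i = of_real (u i)"
 shows "ccoords U = (complex_of_coords u :: complex ^ 'n::{finite,wellorder})"
 using assms[OF rk_index(1)] assms[OF rk_index(2)]
 by (simp add: ccoords_def complex_of_coords_def Complex_eq vec_eq_iff flip: rk_def)

lemma norm_ccoords_diff:
 assumes b: "\<And>i. i \<in> {1..2 * CARD('n)} ==> cmod (U i - U' i) <= b"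
 shows "norm (ccoords U - ccoords U' :: complex ^ 'n::{finite,wellorder}) <= real (2 * CARD('n)) * b"
proof -
 have "norm (ccoords U - ccoords U' :: 'n cvec) <= (\<Sum>j\<in>(UNIV::'n set). cmod ((ccoords U - ccoords U') $ j))"
  unfolding norm_vec_def by (rule L2_set_le_sum) simp
 also have "... <= (\<Sum>j\<in>(UNIV::'n set). 2 * b)"
 proof (rule sum_mono)
  fix j :: 'n
  have "(ccoords U - ccoords U') $ j = (U (2 * rk j - 1) - U' (2 * rk j - 1)) + \<i> * (U (2 * rk j) - U' (2 * rk j))"
   by (simp add: ccoords_def algebra_simps)
  also have "cmod ... <= cmod (U (2 * rk j - 1) - U' (2 * rk j - 1)) + cmod (\<i> * (U (2 * rk j) - U' (2 * rk j)))"
   by (rule norm_triangle_ineq)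
  also have "... <= b + b" using b[OF rk_index(1)] b[OF rk_index(2)] by (intro add_mono) (auto simp: norm_mult)
  finally show "cmod ((ccoords U - ccoords U') $ j) <= 2 * b" by simp
 qed
 finally show ?thesis by simp
qed

text \<open>Half-width of the parameter neighbourhood: small enough that, by \<open>ccoord_diff\<close> and the sum over the \<open>d\<close>
coordinates, complexified points stay within \<open>2^(-m) / 8\<close> of the box.\<close>

definition boxeps :: "nat => real" where "boxeps d = 1 / (8 * (real d * (real d * trigD ^ d)))"

definition boxC :: "nat => real" where "boxC d = (1 + 4 / boxeps d) ^ d"

lemma boxeps: assumes "d >= 2" shows "boxeps d > 0" "boxeps d <= 1"
proof -
 have "real d * trigD ^ d >= 1 * 1" using assms trigD_ge by (intro mult_mono one_le_power) auto
 hence "real d * (real d * trigD ^ d) >= 1 * 1" using assms by (intro mult_mono) auto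
 thus "boxeps d > 0" "boxeps d <= 1" by (auto simp: boxeps_def divide_le_eq)
qed

lemma boxC_pos: "d >= 2 ==> boxC d > 0"
 unfolding boxC_def using boxeps[of d] by (intro zero_less_power add_pos_pos divide_pos_pos) auto

locale dyadic_box_n = dyadic_param "2 * CARD('n::{finite,wellorder})" k T for k T +
 fixes ty :: "'n::{finite,wellorder} itself"
begin

definition bx :: "('n cvec) set" where "bx = sph_map ` dbox (2 * CARD('n)) k T"

lemma compact_bx: "compact bx" unfolding bx_def dbox_def by (rule compact_sph_image)

lemma bx_norm:
 assumes "w \<in> bx" shows "1 - 1 / 2 ^ k 1 <= norm w" "norm w <= 1 - 1 / 2 ^ (k 1 + 1)"
proof -
 obtain x where x: "x \<in> dbox (2 * CARD('n)) k T" "w = sph_map x" using assms unfolding bx_def by blast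
 have "(1::real) - 1 / 2 ^ k 1 >= 0" by simp
 hence "x 1 >= 0" using dbox_radius[OF x(1)] by linarith
 thus "1 - 1 / 2 ^ k 1 <= norm w" "norm w <= 1 - 1 / 2 ^ (k 1 + 1)"
  using dbox_radius[OF x(1)] x(2) by (auto simp: norm_sph_map)
qed

lemma bx_ball: "bx \<subseteq> ball 0 1"
proof
 fix w assume "w \<in> bx"
 have "(0::real) < 1 / 2 ^ (k 1 + 1)" by simp
 hence "norm w < 1" using bx_norm(2)[OF \<open>w \<in> bx\<close>] by linarith
 thus "w \<in> ball 0 1" by simp
qed

lemma dom: "x \<in> dbox (2 * CARD('n)) k T ==> x \<in> sph_domain (2 * CARD('n))" using dbox_subset_domain by blast

text \<open>A point between two points of the box lies in the box, hence in the parameter domain, so the domain condition in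
\<open>param_box\<close> is automatic.\<close>

lemma sub_box:
 assumes y: "y \<in> dbox (2 * CARD('n)) k T"
 shows "param_box (2 * CARD('n)) (restrict lo {1..2 * CARD('n)}) y = (\<Pi>\<^sub>E i\<in>{1..2 * CARD('n)}. {min (lo i) (y i)..max (lo i) (y i)})"
  and "param_box (2 * CARD('n)) (restrict lo {1..2 * CARD('n)}) y \<subseteq> dbox (2 * CARD('n)) k T"
proof -
 have ym: "y i \<in> {min (lo i) (hi i)..max (lo i) (hi i)}" if "i \<in> {1..2 * CARD('n)}" for i
  using y that unfolding dbox_def by (rule PiE_mem)
 have 1: "(\<Pi>\<^sub>E i\<in>{1..2 * CARD('n)}. {min (lo i) (y i)..max (lo i) (y i)}) \<subseteq> dbox (2 * CARD('n)) k T"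
  unfolding dbox_def by (intro PiE_mono) (use ym in force)
 have 2: "param_box (2 * CARD('n)) (restrict lo {1..2 * CARD('n)}) y \<subseteq> (\<Pi>\<^sub>E i\<in>{1..2 * CARD('n)}. {min (lo i) (y i)..max (lo i) (y i)})"
 proof
  fix x assume x: "x \<in> param_box (2 * CARD('n)) (restrict lo {1..2 * CARD('n)}) y"
  hence "x \<in> sph_domain (2 * CARD('n))" by (simp add: param_box_def)
  hence "x \<in> extensional {1..2 * CARD('n)}" unfolding sph_domain_def by (simp add: PiE_def)
  thus "x \<in> (\<Pi>\<^sub>E i\<in>{1..2 * CARD('n)}. {min (lo i) (y i)..max (lo i) (y i)})"
   using x by (auto simp: PiE_def param_box_def)
 qed
 have 3: "(\<Pi>\<^sub>E i\<in>{1..2 * CARD('n)}. {min (lo i) (y i)..max (lo i) (y i)}) \<subseteq> param_box (2 * CARD('n)) (restrict lo {1..2 * CARD('n)}) y"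
 proof
  fix x assume x: "x \<in> (\<Pi>\<^sub>E i\<in>{1..2 * CARD('n)}. {min (lo i) (y i)..max (lo i) (y i)})"
  hence "x \<in> sph_domain (2 * CARD('n))" using 1 dom by blast
  moreover have "x i \<in> {min (lo i) (y i)..max (lo i) (y i)}" if "i \<in> {1..2 * CARD('n)}" for i
   using x that by (rule PiE_mem)
  ultimately show "x \<in> param_box (2 * CARD('n)) (restrict lo {1..2 * CARD('n)}) y"
   by (auto simp: param_box_def)
 qed
 show "param_box (2 * CARD('n)) (restrict lo {1..2 * CARD('n)}) y = (\<Pi>\<^sub>E i\<in>{1..2 * CARD('n)}. {min (lo i) (y i)..max (lo i) (y i)})" using 2 3 by blast
 show "param_box (2 * CARD('n)) (restrict lo {1..2 * CARD('n)}) y \<subseteq> dbox (2 * CARD('n)) k T" using 1 2 by blast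
qed

abbreviation sbox :: "(nat => real) => ('n cvec) set" where
 "sbox y \<equiv> sph_box (restrict lo {1..2 * CARD('n)}) y"

lemma sbox_compact: "y \<in> dbox (2 * CARD('n)) k T ==> compact (sbox y)"
 unfolding sph_box_def by (subst sub_box(1)) (auto intro: compact_sph_image)

lemma sbox_subset: "y \<in> dbox (2 * CARD('n)) k T ==> sbox y \<subseteq> bx"
 unfolding sph_box_def bx_def using sub_box(2) by blast

lemma sets_compact_bx: "compact A ==> A \<subseteq> bx ==> A \<in> sets (weighted_vol lam)"
 using bx_ball by (intro sets_weighted_vol_borel borel_compact) auto

lemma psi_integrable:
 assumes "lam > -1" "locally_integrable_ball \<psi>"
 shows "integrable (weighted_vol lam) (\<lambda>w. indicator bx w *\<^sub>R \<psi> w)"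
 by (rule locally_integrable_compact[OF assms compact_bx bx_ball])

lemma sbox_integral_bound:
 assumes lam: "lam > -1" and \<psi>: "locally_integrable_ball \<psi>" and y: "y \<in> dbox (2 * CARD('n)) k T"
 shows "cmod (LINT z:sbox y|weighted_vol lam. \<psi> z) <= (LINT w|weighted_vol lam. cmod (indicator bx w *\<^sub>R \<psi> w))"
proof -
 have e: "indicator (sbox y) w *\<^sub>R \<psi> w = indicator (sbox y) w *\<^sub>R (indicator bx w *\<^sub>R \<psi> w)" for w
  using sbox_subset[OF y] by (auto simp: indicator_def)
 have i: "integrable (weighted_vol lam) (\<lambda>w. indicator (sbox y) w *\<^sub>R (indicator bx w *\<^sub>R \<psi> w))"
  by (intro integrable_mult_indicator sets_compact_bx sbox_compact sbox_subset y psi_integrable lam \<psi>)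
 show ?thesis unfolding set_lebesgue_integral_def e
 proof (rule order_trans[OF integral_norm_bound], rule integral_mono)
  show "cmod (indicator (sbox y) w *\<^sub>R (indicator bx w *\<^sub>R \<psi> w)) <= cmod (indicator bx w *\<^sub>R \<psi> w)" for w
   by (auto simp: indicator_def)
 qed (rule integrable_norm[OF i] integrable_norm[OF psi_integrable[OF lam \<psi>]])+
qed

lemma box_sup_eq: "box_sup lam \<psi> (dbox (2 * CARD('n)) k T) = (SUP y\<in>dbox (2 * CARD('n)) k T. cmod (LINT z:sbox y|weighted_vol lam. \<psi> z))"
 unfolding box_sup_def low_corner_dbox ..

lemma box_sup_upper:
 assumes lam: "lam > -1" and \<psi>: "locally_integrable_ball \<psi>" and y: "y \<in> dbox (2 * CARD('n)) k T"
 shows "cmod (LINT z:sbox y|weighted_vol lam. \<psi> z) <= box_sup lam \<psi> (dbox (2 * CARD('n)) k T)"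
 unfolding box_sup_eq
proof (rule cSUP_upper[OF y])
 show "bdd_above ((\<lambda>y. cmod (LINT z:sbox y|weighted_vol lam. \<psi> z)) ` dbox (2 * CARD('n)) k T)"
  using sbox_integral_bound[OF lam \<psi>] by (intro bdd_aboveI2)
qed

lemma box_sup_least:
 assumes "\<And>y. y \<in> dbox (2 * CARD('n)) k T ==> cmod (LINT z:sbox y|weighted_vol lam. \<psi> z) <= b"
 shows "box_sup lam \<psi> (dbox (2 * CARD('n)) k T) <= b"
 unfolding box_sup_eq using lo_in assms by (intro cSUP_least) auto

lemma box_sup_nonneg:
 fixes \<psi> :: "'n cvec => complex"
 assumes "lam > -1" "locally_integrable_ball \<psi>"
 shows "0 <= box_sup lam \<psi> (dbox (2 * CARD('n)) k T)"
 using box_sup_upper[OF assms lo_in] norm_ge_zero order_trans by blast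

definition binv :: "'n cvec => nat => real" where
 "binv w = inv_into (dbox (2 * CARD('n)) k T) sph_map w"

lemma binv_sph_map:
 assumes "x \<in> dbox (2 * CARD('n)) k T" "sph_map x \<notin> (sph_null :: ('n cvec) set)"
 shows "binv (sph_map x) = x"
proof -
 have "(sph_map x :: 'n cvec) \<in> sph_map ` dbox (2 * CARD('n)) k T" using assms(1) by blast
 hence "binv (sph_map x) \<in> dbox (2 * CARD('n)) k T" "sph_map (binv (sph_map x)) = (sph_map x :: 'n cvec)"
  unfolding binv_def by (rule inv_into_into, rule f_inv_into_f)
 thus ?thesis using sph_map_inj[OF dom[OF assms(1)] dom, of "binv (sph_map x)"] assms(2) by simp
qed

text \<open>The normalised box parameters of a point. They are set to zero off the box and on the null set where
the coordinates are not unique.\<close>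

definition bpar :: "'n cvec => nat => real" where
 "bpar w i = (if w \<in> bx \<and> w \<notin> sph_null then (binv w i - lo i) / (hi i - lo i) else 0)"

lemma bpar_sph_map:
 assumes "x \<in> dbox (2 * CARD('n)) k T" "sph_map x \<notin> (sph_null :: ('n cvec) set)"
 shows "bpar (sph_map x) i = (x i - lo i) / (hi i - lo i)"
 using assms by (auto simp: bpar_def binv_sph_map bx_def)

lemma bpar_range:
 assumes "i \<in> {1..2 * CARD('n)}" shows "0 <= bpar w i" "bpar w i <= 1"
proof -
 have "0 <= bpar w i \<and> bpar w i <= 1"
 proof (cases "w \<in> bx \<and> w \<notin> sph_null")
  case True
  then obtain x where x: "x \<in> dbox (2 * CARD('n)) k T" "w = sph_map x" unfolding bx_def by blast
  thus ?thesis using dpoint_surj_range[OF x(1) assms] bpar_sph_map[OF x(1), of i] True by simp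
 next
  case False
  hence "bpar w i = 0" unfolding bpar_def by (simp only: if_False)
  thus ?thesis by simp
 qed
 thus "0 <= bpar w i" "bpar w i <= 1" by auto
qed

lemma closed_sph_null: "closed (sph_null :: ('n cvec) set)"
 unfolding sph_null_def by (intro closed_Collect_eq continuous_intros)

text \<open>Sublevel sets are images of compact parameter sets, up to the exceptional closed set.\<close>

lemma bpar_measurable:
 assumes i: "i \<in> {1..2 * CARD('n)}"
 shows "(\<lambda>w. bpar w i) \<in> borel_measurable (weighted_vol lam)"
proof (rule measurable_weighted_vol_borel, subst borel_measurable_iff_le, rule allI)
 fix a :: real
 define Qa where "Qa = dbox (2 * CARD('n)) k T \<inter> {x. (x i - lo i) / (hi i - lo i) <= a}"
 have "continuous_on UNIV (\<lambda>x::nat => real. (x i - lo i) / (hi i - lo i))"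
  using dlo_dhi_ne[of i "2 * CARD('n)" k T] i by (intro continuous_intros continuous_on_product_coordinates) auto
 hence "closed {x :: nat => real. (x i - lo i) / (hi i - lo i) <= a}" by (rule closed_Collect_le[OF _ continuous_on_const])
 hence "compact Qa" unfolding Qa_def dbox_def using compact_PiE_boxes by (intro compact_Int_closed)
 hence "compact (sph_map ` Qa :: ('n cvec) set)" by (intro compact_continuous_image continuous_sph_map)
 hence m1: "(sph_map ` Qa :: ('n cvec) set) \<in> sets borel" by (rule borel_compact)
 have m2: "bx \<in> sets borel" by (rule borel_compact[OF compact_bx])
 have m3: "(sph_null :: ('n cvec) set) \<in> sets borel" using closed_sph_null by simp
 have on: "bpar w i <= a \<longleftrightarrow> w \<in> sph_map ` Qa" if w: "w \<in> bx" "w \<notin> sph_null" for w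
 proof -
  obtain x where x: "x \<in> dbox (2 * CARD('n)) k T" "w = sph_map x" using w unfolding bx_def by blast
  have "w \<in> sph_map ` Qa \<longleftrightarrow> x \<in> Qa"
  proof
   assume "w \<in> sph_map ` Qa"
   then obtain x' where x': "x' \<in> Qa" "w = sph_map x'" by blast
   hence "x' \<in> dbox (2 * CARD('n)) k T" by (simp add: Qa_def)
   hence "x' = x" using binv_sph_map[of x'] binv_sph_map[OF x(1)] x x' w(2) by metis
   thus "x \<in> Qa" using x' by simp
  qed (use x in blast)
  thus ?thesis using x bpar_sph_map[OF x(1), of i] w by (simp add: Qa_def)
 qed
 have off: "bpar w i = 0" if "\<not> (w \<in> bx \<and> w \<notin> sph_null)" for w using that unfolding bpar_def by (simp only: if_False)
 have "{w \<in> space borel. bpar w i <= a} = ((bx - sph_null) \<inter> sph_map ` Qa) \<union> (if 0 <= a then UNIV - (bx - sph_null) else {})"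
 proof (rule set_eqI)
  fix w
  show "w \<in> {w \<in> space borel. bpar w i <= a} \<longleftrightarrow> w \<in> ((bx - sph_null) \<inter> sph_map ` Qa) \<union> (if 0 <= a then UNIV - (bx - sph_null) else {})"
  proof (cases "w \<in> bx \<and> w \<notin> sph_null")
   case True thus ?thesis using on[of w] by simp
  next
   case False thus ?thesis using off[OF False] by auto
  qed
 qed
 also have "... \<in> sets borel" using m1 m2 m3 by auto
 finally show "{w \<in> space borel. bpar w i <= a} \<in> sets borel" .
qed

lemma near_points:
 assumes x: "\<And>j. j \<in> {1..2 * CARD('n)} ==> x j \<in> unit_nbhd (boxeps (2 * CARD('n)))"
 shows "\<exists>w\<in>bx. norm (ccoords (ccoord x) - w) <= 1 / (8 * 2 ^ k 1) \<and> norm (ccoords (\<lambda>i. cnj (ccoord x i)) - w) <= 1 / (8 * 2 ^ k 1)"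
proof -
 have "\<forall>j\<in>{1..2 * CARD('n)}. \<exists>s. 0 <= s \<and> s <= 1 \<and> cmod (x j - of_real s) < boxeps (2 * CARD('n))"
 proof
  fix j assume "j \<in> {1..2 * CARD('n)}"
  from x[OF this] show "\<exists>s. 0 <= s \<and> s <= 1 \<and> cmod (x j - of_real s) < boxeps (2 * CARD('n))"
   unfolding unit_nbhd_def by (auto simp: dist_norm norm_minus_commute)
 qed
 then obtain t where t: "\<And>j. j \<in> {1..2 * CARD('n)} ==> 0 <= t j \<and> t j <= 1 \<and> cmod (x j - of_real (t j)) < boxeps (2 * CARD('n))" by metis
 define w where "w = (sph_map (dpoint t) :: 'n cvec)"
 have wB: "w \<in> bx" unfolding w_def bx_def using dpoint_in t by blast
 have weq: "ccoords (\<lambda>i. of_real (sph_coord (2 * CARD('n)) (dpoint t) i)) = w"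
  unfolding w_def sph_map_def by (rule ccoords_real) simp
 have e: "boxeps (2 * CARD('n)) > 0" "boxeps (2 * CARD('n)) <= 1" using boxeps[OF d2] by auto
 have x2: "cmod (x i) <= 2" if "i \<in> {1..2 * CARD('n)}" for i
 proof -
  have "cmod (x i) <= cmod (of_real (t i)) + cmod (x i - of_real (t i))" by (rule norm_triangle_sub)
  thus ?thesis using t[OF that] e by (simp only: norm_of_real) linarith
 qed
 have cd: "cmod (ccoord x i - of_real (sph_coord (2 * CARD('n)) (dpoint t) i)) <= real (2 * CARD('n)) * trigD ^ (2 * CARD('n)) * (boxeps (2 * CARD('n)) / 2 ^ k 1)" if i: "i \<in> {1..2 * CARD('n)}" for i
 proof -
  have "cmod (ccoord x i - ccoord (\<lambda>i. of_real (t i)) i) <= real (2 * CARD('n)) * trigD ^ (2 * CARD('n)) * (boxeps (2 * CARD('n)) / 2 ^ k 1)"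
  proof (rule ccoord_diff[OF _ _ _ i])
   show "cmod (complex_of_real (t i)) <= 2" if "i \<in> {1..2 * CARD('n)}" for i using t[OF that] by simp
  qed (use x2 t in \<open>auto intro: less_imp_le\<close>)
  thus ?thesis by (simp only: ccoord_real[OF i])
 qed
 have val: "real (2 * CARD('n)) * (real (2 * CARD('n)) * trigD ^ (2 * CARD('n)) * (boxeps (2 * CARD('n)) / 2 ^ k 1)) = 1 / (8 * 2 ^ k 1)"
 proof -
  have "real (2 * CARD('n)) * (real (2 * CARD('n)) * trigD ^ (2 * CARD('n))) > 0" using d2 trigD_ge by (auto intro!: mult_pos_pos zero_less_power)
  moreover have "trigD \<noteq> 0" using trigD_ge by auto
  ultimately show ?thesis unfolding boxeps_def by simp
 qed
 have "norm (ccoords (ccoord x) - w) <= 1 / (8 * 2 ^ k 1)"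
  unfolding weq[symmetric] val[symmetric] by (rule norm_ccoords_diff[OF cd])
 moreover have "norm (ccoords (\<lambda>i. cnj (ccoord x i)) - w) <= 1 / (8 * 2 ^ k 1)"
  unfolding weq[symmetric] val[symmetric]
 proof (rule norm_ccoords_diff)
  fix i assume i: "i \<in> {1..2 * CARD('n)}"
  have "cnj (ccoord x i) - of_real (sph_coord (2 * CARD('n)) (dpoint t) i) = cnj (ccoord x i - of_real (sph_coord (2 * CARD('n)) (dpoint t) i))" by simp
  thus "cmod (cnj (ccoord x i) - of_real (sph_coord (2 * CARD('n)) (dpoint t) i)) <= real (2 * CARD('n)) * trigD ^ (2 * CARD('n)) * (boxeps (2 * CARD('n)) / 2 ^ k 1)"
   using cd[OF i] by (simp only: complex_mod_cnj)
 qed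
 ultimately show ?thesis using wB by blast
qed

lemma ccoord_holomorphic: "(\<lambda>\<zeta>. ccoord (x(i := \<zeta>)) l) holomorphic_on A"
proof -
 have c: "(\<lambda>\<zeta>. cang (x(i := \<zeta>)) j) holomorphic_on A" for j
  by (cases "j = i") (auto simp: cang_def intro!: holomorphic_intros)
 show ?thesis unfolding ccoord_def csrad_def
  by (cases "l < (2 * CARD('n))") (simp_all, (intro holomorphic_intros c)+)
qed

text \<open>On the box, \<open>f(w)\<close> times the Bergman kernel is the restriction of a function that is holomorphic in the
complexified parameters, because the kernel is antiholomorphic in \<open>w\<close> and may be evaluated at the conjugated coordinates.
The initial boxes of the parameters are the boxes \<open>B(x, y)\<close> in the definition of \<open>box_sup\<close>, so \<open>abel_estimate\<close> applies.\<close>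

theorem box_term_estimate:
 fixes \<psi> f :: "'n cvec => complex"
 assumes lam: "lam > -1" and \<psi>: "locally_integrable_ball \<psi>" and f: "analytic_several f (ball 0 1)"
  and z: "norm z < 1"
  and F: "\<And>v w. w \<in> bx ==> norm (v - w) <= 1 / (8 * 2 ^ k 1) ==> cmod (f v) <= F"
  and G: "\<And>v w. w \<in> bx ==> norm (v - w) <= 1 / (8 * 2 ^ k 1) ==> kab lam z v <= G"
 shows "cmod (bergman_proj lam (\<lambda>w. \<psi> w * indicator bx w * f w) z) <= boxC (2 * CARD('n)) * box_sup lam \<psi> (dbox (2 * CARD('n)) k T) * (F * G)"
proof -
 define W where "W = (weighted_vol lam :: ('n cvec) measure)"
 define \<psi>' where "\<psi>' w = indicator bx w *\<^sub>R \<psi> w" for w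
 have \<psi>'i: "integrable W \<psi>'" unfolding W_def \<psi>'_def by (rule psi_integrable[OF lam \<psi>])
 have bxW: "bx \<in> sets W" unfolding W_def by (rule sets_compact_bx[OF compact_bx]) simp
 have F0: "F >= 0" and G0: "G >= 0"
 proof -
  obtain w where w: "w \<in> bx" unfolding bx_def using lo_in by blast
  show "F >= 0" "G >= 0" using F[OF w, of w] G[OF w, of w] by (auto intro: order_trans[OF norm_ge_zero] order_trans[OF kab_nonneg])
 qed
 define H where "H \<zeta> = f (ccoords (ccoord \<zeta>)) * kc lam z (ccoords (\<lambda>i. cnj (ccoord \<zeta> i)))" for \<zeta>
 have small: "norm v < 1" if "w \<in> bx" "norm (v - w) <= 1 / (8 * 2 ^ k 1)" for v w
 proof -
  have "norm v <= norm w + norm (v - w)" by (rule norm_triangle_sub)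
  also have "... <= (1 - 1 / 2 ^ (k 1 + 1)) + 1 / (8 * 2 ^ k 1)" by (intro add_mono bx_norm that)
  also have "... < 1" by (simp add: field_simps)
  finally show ?thesis .
 qed
 have key: "(\<lambda>\<omega>. H (\<lambda>i. if i \<in> {1..2 * CARD('n)} then complex_of_real (bpar \<omega> i) else 0)) \<in> borel_measurable W \<and>
  cmod (LINT \<omega>|W. indicator bx \<omega> *\<^sub>R (\<psi>' \<omega> * H (\<lambda>i. if i \<in> {1..2 * CARD('n)} then complex_of_real (bpar \<omega> i) else 0)))
   <= (1 + 4 / boxeps (2 * CARD('n))) ^ card {1..2 * CARD('n)} * box_sup lam \<psi> (dbox (2 * CARD('n)) k T) * (F * G)"
 proof (rule abel_estimate)
  show "finite {1..2 * CARD('n)}" "0 < boxeps (2 * CARD('n))" "integrable W \<psi>'" "bx \<in> sets W" using boxeps[OF d2] \<psi>'i bxW by auto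
  show "(\<lambda>\<omega>. bpar \<omega> i) \<in> borel_measurable W" if "i \<in> {1..2 * CARD('n)}" for i
   unfolding W_def by (rule bpar_measurable[OF that])
  show "0 <= bpar \<omega> i \<and> bpar \<omega> i <= 1" if "i \<in> {1..2 * CARD('n)}" for i \<omega> using bpar_range[OF that] by blast
  show "cmod (H x) <= F * G" if x: "\<And>j. j \<in> {1..2 * CARD('n)} ==> x j \<in> unit_nbhd (boxeps (2 * CARD('n)))" for x
  proof -
   obtain w where w: "w \<in> bx" "norm (ccoords (ccoord x) - w) <= 1 / (8 * 2 ^ k 1)" "norm (ccoords (\<lambda>i. cnj (ccoord x i)) - w) <= 1 / (8 * 2 ^ k 1)"
    using near_points[of x] x by blast
   show ?thesis unfolding H_def norm_mult cmod_kc using F[OF w(1,2)] G[OF w(1,3)] F0 by (intro mult_mono) auto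
  qed
  show "(\<lambda>\<zeta>. H (x(i := \<zeta>))) holomorphic_on unit_nbhd (boxeps (2 * CARD('n)))"
   if i: "i \<in> {1..2 * CARD('n)}" and x: "\<And>j. j \<in> {1..2 * CARD('n)} ==> x j \<in> unit_nbhd (boxeps (2 * CARD('n)))" for i x
  proof -
   have near: "norm (ccoords (ccoord (x(i := \<zeta>))) :: 'n cvec) < 1"
    "norm (ccoords (\<lambda>l. cnj (ccoord (x(i := \<zeta>)) l)) :: 'n cvec) < 1" if \<zeta>: "\<zeta> \<in> unit_nbhd (boxeps (2 * CARD('n)))" for \<zeta>
   proof -
    have "\<And>j. j \<in> {1..2 * CARD('n)} ==> (x(i := \<zeta>)) j \<in> unit_nbhd (boxeps (2 * CARD('n)))" using x \<zeta> by auto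
    from near_points[of "x(i := \<zeta>)", OF this] obtain w where "w \<in> bx" "norm (ccoords (ccoord (x(i := \<zeta>))) - w) <= 1 / (8 * 2 ^ k 1)" "norm (ccoords (\<lambda>l. cnj (ccoord (x(i := \<zeta>)) l)) - w) <= 1 / (8 * 2 ^ k 1)"
     by blast
    thus "norm (ccoords (ccoord (x(i := \<zeta>))) :: 'n cvec) < 1"
     "norm (ccoords (\<lambda>l. cnj (ccoord (x(i := \<zeta>)) l)) :: 'n cvec) < 1" using small by blast+
   qed
   have 1: "(\<lambda>\<zeta>. f (ccoords (ccoord (x(i := \<zeta>))))) holomorphic_on unit_nbhd (boxeps (2 * CARD('n)))"
   proof (rule analytic_several_compose[OF f open_unit_nbhd])
    show "(\<lambda>\<zeta>. (ccoords (ccoord (x(i := \<zeta>))) :: 'n cvec) $ j) holomorphic_on unit_nbhd (boxeps (2 * CARD('n)))" for j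
     unfolding ccoords_def vec_lambda_beta by (intro holomorphic_intros ccoord_holomorphic)
   qed (use near in auto)
   have h: "(\<lambda>\<zeta>. herm_inner z (ccoords (\<lambda>l. cnj (ccoord (x(i := \<zeta>)) l)))) holomorphic_on unit_nbhd (boxeps (2 * CARD('n)))"
    unfolding herm_inner_def ccoords_def vec_lambda_beta complex_cnj_add complex_cnj_mult complex_cnj_cnj complex_cnj_i
    by (intro holomorphic_intros ccoord_holomorphic)
   have 2: "(\<lambda>\<zeta>. kc lam z (ccoords (\<lambda>l. cnj (ccoord (x(i := \<zeta>)) l)))) holomorphic_on unit_nbhd (boxeps (2 * CARD('n)))"
   proof -
    have nz: "1 - herm_inner z (ccoords (\<lambda>l. cnj (ccoord (x(i := \<zeta>)) l))) \<notin> \<real>\<^sub>\<le>\<^sub>0" if "\<zeta> \<in> unit_nbhd (boxeps (2 * CARD('n)))" for \<zeta>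
     by (intro not_nonpos_Reals Re_one_minus herm_inner_less_1 z near that)
    have pw: "(\<lambda>\<zeta>. (1 - herm_inner z (ccoords (\<lambda>l. cnj (ccoord (x(i := \<zeta>)) l)))) powr complex_of_real (real CARD('n) + 1 + lam)) holomorphic_on unit_nbhd (boxeps (2 * CARD('n)))"
     by (rule holomorphic_on_powr[OF holomorphic_on_diff[OF holomorphic_on_const h] holomorphic_on_const nz])
    show ?thesis unfolding kc_def
    proof (rule holomorphic_on_divide[OF holomorphic_on_const pw])
     fix \<zeta> assume "\<zeta> \<in> unit_nbhd (boxeps (2 * CARD('n)))"
     from nz[OF this] have "1 - herm_inner z (ccoords (\<lambda>l. cnj (ccoord (x(i := \<zeta>)) l))) \<noteq> 0" by auto
     thus "(1 - herm_inner z (ccoords (\<lambda>l. cnj (ccoord (x(i := \<zeta>)) l)))) powr complex_of_real (real CARD('n) + 1 + lam) \<noteq> 0" by simp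
    qed
   qed
   show ?thesis unfolding H_def by (rule holomorphic_on_mult[OF 1 2])
  qed
  fix s :: "nat => real" assume s: "\<And>i. i \<in> {1..2 * CARD('n)} ==> 0 <= s i \<and> s i <= 1"
  define y where "y = dpoint s"
  have y: "y \<in> dbox (2 * CARD('n)) k T" unfolding y_def by (rule dpoint_in) (use s in auto)
  define D where "D = bx \<inter> {\<omega> \<in> space W. \<forall>i\<in>{1..2 * CARD('n)}. bpar \<omega> i <= s i}"
  have DW: "D \<in> sets W"
  proof -
   have "{\<omega> \<in> space W. \<forall>i\<in>{1..2 * CARD('n)}. bpar \<omega> i <= s i} \<in> sets W"
   proof (intro sets.sets_Collect_finite_All)
    fix i assume "i \<in> {1..2 * CARD('n)}"
    from bpar_measurable[OF this, of lam, folded W_def]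
    show "{\<omega> \<in> space W. bpar \<omega> i <= s i} \<in> sets W" unfolding borel_measurable_iff_le by blast
   qed simp
   thus ?thesis unfolding D_def using bxW by auto
  qed
  have eq: "indicator D \<omega> *\<^sub>R \<psi>' \<omega> = indicator (sbox y) \<omega> *\<^sub>R \<psi> \<omega>" if \<omega>: "\<omega> \<notin> sph_null" for \<omega>
  proof (cases "\<omega> \<in> bx")
   case False
   thus ?thesis using sbox_subset[OF y] by (auto simp: \<psi>'_def indicator_def D_def)
  next
   case True
   then obtain x where x: "x \<in> dbox (2 * CARD('n)) k T" "\<omega> = sph_map x" unfolding bx_def by blast
   have xn: "sph_map x \<notin> (sph_null :: ('n cvec) set)" using \<omega> x by simp
   have "\<omega> \<in> sbox y \<longleftrightarrow> x \<in> param_box (2 * CARD('n)) (restrict lo {1..2 * CARD('n)}) y"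
   proof
    assume "\<omega> \<in> sbox y"
    then obtain x' where x': "x' \<in> param_box (2 * CARD('n)) (restrict lo {1..2 * CARD('n)}) y" "\<omega> = sph_map x'" unfolding sph_box_def by blast
    hence x'd: "x' \<in> dbox (2 * CARD('n)) k T" using sub_box(2)[OF y] by blast
    have "x' = x" using binv_sph_map[OF x'd] binv_sph_map[OF x(1) xn] x(2) x'(2) xn by metis
    thus "x \<in> param_box (2 * CARD('n)) (restrict lo {1..2 * CARD('n)}) y" using x' by simp
   qed (use x in \<open>auto simp: sph_box_def\<close>)
   also have "... \<longleftrightarrow> (\<forall>i\<in>{1..2 * CARD('n)}. x i \<in> {min (lo i) (y i)..max (lo i) (y i)})"
    using dom[OF x(1)] by (auto simp: param_box_def)
   also have "... \<longleftrightarrow> (\<forall>i\<in>{1..2 * CARD('n)}. bpar \<omega> i <= s i)"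
   proof (rule ball_cong[OF refl])
    fix i assume i: "i \<in> {1..2 * CARD('n)}"
    have yi: "y i = lo i + s i * (hi i - lo i)" using i by (simp add: y_def dpoint_def)
    have bp: "bpar \<omega> i = (x i - lo i) / (hi i - lo i)" using bpar_sph_map[OF x(1) xn] x(2) by simp
    have r: "0 <= (x i - lo i) / (hi i - lo i)" by (rule dpoint_surj_range[OF x(1) i])
    have ne: "lo i \<noteq> hi i" using dlo_dhi_ne[of i "2 * CARD('n)" k T] i by simp
    show "x i \<in> {min (lo i) (y i)..max (lo i) (y i)} \<longleftrightarrow> bpar \<omega> i <= s i"
    proof (cases "lo i < hi i")
     case True
     hence "lo i <= x i" using r by (simp add: zero_le_divide_iff)
     moreover have "lo i <= y i" using True s[OF i] yi by simp
     moreover have "x i <= y i \<longleftrightarrow> bpar \<omega> i <= s i" using True unfolding bp yi by (simp add: divide_le_eq algebra_simps)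
     ultimately show ?thesis by auto
    next
     case False
     hence lt: "hi i - lo i < 0" using ne by simp
     hence "x i <= lo i" using r by (simp add: zero_le_divide_iff)
     moreover have "y i <= lo i" using lt s[OF i] yi by (simp add: mult_nonneg_nonpos)
     moreover have "y i <= x i \<longleftrightarrow> bpar \<omega> i <= s i" using lt unfolding bp yi by (simp add: neg_divide_le_eq algebra_simps)
     ultimately show ?thesis by auto
    qed
   qed
   finally have "\<omega> \<in> sbox y \<longleftrightarrow> \<omega> \<in> D" using True bx_ball by (auto simp: D_def W_def)
   thus ?thesis using True by (simp add: \<psi>'_def indicator_def)
  qed
  have "(LINT \<omega>|W. indicator D \<omega> *\<^sub>R \<psi>' \<omega>) = (LINT \<omega>|W. indicator (sbox y) \<omega> *\<^sub>R \<psi>' \<omega>)"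
  proof (rule integral_cong_AE)
   show "(\<lambda>\<omega>. indicator D \<omega> *\<^sub>R \<psi>' \<omega>) \<in> borel_measurable W"
    using \<psi>'i DW by (intro borel_measurable_scaleR borel_measurable_indicator) auto
   show "(\<lambda>\<omega>. indicator (sbox y) \<omega> *\<^sub>R \<psi>' \<omega>) \<in> borel_measurable W"
    using \<psi>'i sets_compact_bx[OF sbox_compact[OF y] sbox_subset[OF y], of lam] by (intro borel_measurable_scaleR borel_measurable_indicator) (auto simp: W_def)
   have "AE \<omega> in W. \<omega> \<notin> sph_null" unfolding W_def by (rule AE_weighted_vol_negligible[OF lam negligible_sph_null])
   thus "AE \<omega> in W. indicator D \<omega> *\<^sub>R \<psi>' \<omega> = indicator (sbox y) \<omega> *\<^sub>R \<psi>' \<omega>"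
   proof eventually_elim
    case (elim \<omega>)
    show ?case unfolding eq[OF elim] using sbox_subset[OF y] by (auto simp: \<psi>'_def indicator_def)
   qed
  qed
  also have "... = (LINT z:sbox y|weighted_vol lam. \<psi> z)"
   unfolding set_lebesgue_integral_def W_def using sbox_subset[OF y]
   by (intro LINT_cong) (auto simp: \<psi>'_def indicator_def)
  finally show "cmod (LINT \<omega>|W. indicator (bx \<inter> {\<omega> \<in> space W. \<forall>i\<in>{1..2 * CARD('n)}. bpar \<omega> i <= s i}) \<omega> *\<^sub>R \<psi>' \<omega>) <= box_sup lam \<psi> (dbox (2 * CARD('n)) k T)"
   unfolding D_def[symmetric] using box_sup_upper[OF lam \<psi> y] by simp
 qed
 have Heq: "H (\<lambda>i. if i \<in> {1..2 * CARD('n)} then complex_of_real (bpar \<omega> i) else 0) = f \<omega> * kc lam z \<omega>"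
  if \<omega>: "\<omega> \<in> bx" "\<omega> \<notin> sph_null" for \<omega>
 proof -
  obtain x where x: "x \<in> dbox (2 * CARD('n)) k T" "\<omega> = sph_map x" using \<omega> unfolding bx_def by blast
  define t where "t i = (if i \<in> {1..2 * CARD('n)} then bpar \<omega> i else 0)" for i
  have tz: "(\<lambda>i. if i \<in> {1..2 * CARD('n)} then complex_of_real (bpar \<omega> i) else 0) = (\<lambda>i. of_real (t i))" by (auto simp: t_def)
  have "dpoint t = dpoint (\<lambda>i. (x i - lo i) / (hi i - lo i))"
   unfolding dpoint_def t_def using bpar_sph_map[OF x(1)] \<omega> x(2) by (intro restrict_ext) auto
  hence dx: "dpoint t = x" using dpoint_surj[OF x(1)] by simp
  have 1: "ccoords (ccoord (\<lambda>i. of_real (t i))) = \<omega>"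
   unfolding x(2) sph_map_def by (rule ccoords_real) (simp only: ccoord_real dx)
  have 2: "ccoords (\<lambda>i. cnj (ccoord (\<lambda>i. of_real (t i)) i)) = \<omega>"
   unfolding x(2) sph_map_def by (rule ccoords_real) (simp only: ccoord_real dx complex_cnj_complex_of_real)
  show ?thesis unfolding tz H_def 1 2 ..
 qed
 have "bergman_proj lam (\<lambda>w. \<psi> w * indicator bx w * f w) z = (LINT \<omega>|W. \<psi>' \<omega> * (f \<omega> * kc lam z \<omega>))"
  unfolding bergman_proj_kc W_def by (intro LINT_cong) (auto simp: \<psi>'_def indicator_def)
 also have "... = (LINT \<omega>|W. indicator bx \<omega> *\<^sub>R (\<psi>' \<omega> * H (\<lambda>i. if i \<in> {1..2 * CARD('n)} then complex_of_real (bpar \<omega> i) else 0)))"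
 proof (rule integral_cong_AE)
  have idm: "(\<lambda>x. x) \<in> borel_measurable W" unfolding W_def by (rule weighted_vol_id)
  show "(\<lambda>\<omega>. \<psi>' \<omega> * (f \<omega> * kc lam z \<omega>)) \<in> borel_measurable W"
   using \<psi>'i analytic_measurable[OF f, of lam, folded W_def]
   by (intro borel_measurable_times kc_measurable idm) auto
  show "(\<lambda>\<omega>. indicator bx \<omega> *\<^sub>R (\<psi>' \<omega> * H (\<lambda>i. if i \<in> {1..2 * CARD('n)} then complex_of_real (bpar \<omega> i) else 0))) \<in> borel_measurable W"
   using \<psi>'i key bxW by (intro borel_measurable_scaleR borel_measurable_indicator borel_measurable_times) auto
  have "AE \<omega> in W. \<omega> \<notin> sph_null" unfolding W_def by (rule AE_weighted_vol_negligible[OF lam negligible_sph_null])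
  thus "AE \<omega> in W. \<psi>' \<omega> * (f \<omega> * kc lam z \<omega>) = indicator bx \<omega> *\<^sub>R (\<psi>' \<omega> * H (\<lambda>i. if i \<in> {1..2 * CARD('n)} then complex_of_real (bpar \<omega> i) else 0))"
  proof eventually_elim
   case (elim \<omega>)
   show ?case
   proof (cases "\<omega> \<in> bx")
    case True thus ?thesis by (simp only: Heq[OF True elim]) simp
   qed (simp add: \<psi>'_def)
  qed
 qed
 finally show "cmod (bergman_proj lam (\<lambda>w. \<psi> w * indicator bx w * f w) z) <= boxC (2 * CARD('n)) * box_sup lam \<psi> (dbox (2 * CARD('n)) k T) * (F * G)"
  using key by (simp add: boxC_def)
qed

end

section \<open>Comparison with neighbourhoods of the boxes\<close>

lemma powr_comparable:
 assumes s: "s > (0::real)" and x: "s / 4 <= x" "x <= 4 * s"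
 shows "x powr lam <= 4 powr \<bar>lam\<bar> * s powr lam" "s powr lam <= 4 powr \<bar>lam\<bar> * x powr lam"
proof -
 have x0: "x > 0" using s x by linarith
 have up: "x powr lam <= 4 powr \<bar>lam\<bar> * s powr lam" if "s > 0" "x > 0" "x <= 4 * s" "s <= 4 * x" for x s :: real
 proof (cases "lam >= 0")
  case True
  have "x powr lam <= (4 * s) powr lam" using that True by (intro powr_mono2) auto
  thus ?thesis using that True by (simp add: powr_mult)
 next
  case False
  have "x powr lam <= (s / 4) powr lam" using that False by (intro powr_mono2') auto
  also have "... = 4 powr \<bar>lam\<bar> * s powr lam" using that False by (simp add: powr_divide powr_minus field_simps)
  finally show ?thesis .
 qed
 show "x powr lam <= 4 powr \<bar>lam\<bar> * s powr lam" using up[of s x] s x x0 by simp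
 show "s powr lam <= 4 powr \<bar>lam\<bar> * x powr lam" using up[of x s] s x x0 by simp
qed

lemma bwt_comparable:
 assumes s: "s > 0" "s / 4 <= 1 - norm x" "1 - norm x <= 2 * s"
 shows "bwt lam x <= 4 powr \<bar>lam\<bar> * s powr lam" "s powr lam <= 4 powr \<bar>lam\<bar> * bwt lam x"
proof -
 have n: "norm x < 1" using s by linarith
 have e: "1 - (norm x)\<^sup>2 = (1 - norm x) * (1 + norm x)" by (simp add: power2_eq_square algebra_simps)
 define a where "a = (1 - norm x) * (1 + norm x)"
 have "(1 - norm x) * 1 <= a" unfolding a_def using n by (intro mult_left_mono) auto
 moreover have "a <= (1 - norm x) * 2" unfolding a_def using n by (intro mult_left_mono) auto
 moreover have "(1 - norm x) * 2 <= 4 * s" "s / 4 <= (1 - norm x) * 1" using s by simp_all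
 ultimately have "s / 4 <= a" "a <= 4 * s" by (blast intro: order_trans)+
 hence b: "s / 4 <= 1 - (norm x)\<^sup>2" "1 - (norm x)\<^sup>2 <= 4 * s" unfolding e a_def .
 show "bwt lam x <= 4 powr \<bar>lam\<bar> * s powr lam" "s powr lam <= 4 powr \<bar>lam\<bar> * bwt lam x"
  using powr_comparable[OF s(1) b, of lam] n by (simp_all add: bwt_def)
qed

text \<open>The increment of \<open>1 - \<langle>z, v\<rangle>\<close> is at most the distance of the points, and \<open>|1 - \<langle>z, v\<rangle>|\<close> is at least the distance
of \<open>v\<close> from the sphere; hence the kernel is comparable at points closer than a multiple of that distance.\<close>

lemma kab_compare:
 fixes z :: "complex ^ 'n"
 assumes lam: "lam > -1" and z: "norm z < 1" and v: "norm v <= 1 - \<delta>" "\<delta> > 0" and u: "norm (u - v) <= Y * \<delta>" "norm u < 1"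
 shows "kab lam z v <= (1 + Y) powr (real CARD('n) + 1 + lam) * kab lam z u"
proof -
 define s where "s = real CARD('n) + 1 + lam"
 have s: "s > 0" using lam by (simp add: s_def add_nonneg_pos add.assoc)
 have Y: "Y >= 0" using u(1) v(2) norm_ge_zero[of "u - v"] by (metis mult_neg_pos not_le order_trans)
 have "cmod (herm_inner z v) <= 1 - \<delta>"
 proof -
  have "norm z * norm v <= 1 * (1 - \<delta>)" using z v by (intro mult_mono) auto
  thus ?thesis using herm_inner_bound[of z v] by simp
 qed
 hence lv: "\<delta> <= cmod (1 - herm_inner z v)" using norm_triangle_ineq2[of 1 "herm_inner z v"] by simp
 have "1 - herm_inner z u = (1 - herm_inner z v) - herm_inner z (u - v)" by (simp add: herm_inner_diff_right)
 hence "cmod (1 - herm_inner z u) <= cmod (1 - herm_inner z v) + cmod (herm_inner z (u - v))"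
  by (metis norm_triangle_ineq4)
 also have "cmod (herm_inner z (u - v)) <= 1 * norm (u - v)"
 proof -
  have "norm z * norm (u - v) <= 1 * norm (u - v)" using z by (intro mult_right_mono) auto
  thus ?thesis using herm_inner_bound[of z "u - v"] by (rule order_trans[rotated])
 qed
 also have "1 * norm (u - v) <= Y * cmod (1 - herm_inner z v)"
  using u(1) mult_left_mono[OF lv Y] by simp
 finally have le: "cmod (1 - herm_inner z u) <= (1 + Y) * cmod (1 - herm_inner z v)" by (simp add: algebra_simps)
 have pu: "cmod (1 - herm_inner z u) > 0"
  using one_minus_herm_low[of u z] u z by linarith
 have "((1 + Y) * cmod (1 - herm_inner z v)) powr (- s) <= cmod (1 - herm_inner z u) powr (- s)"
  using s pu le by (intro powr_mono2') auto
 hence "(1 + Y) powr s * ((1 + Y) powr (- s) * cmod (1 - herm_inner z v) powr (- s)) <= (1 + Y) powr s * cmod (1 - herm_inner z u) powr (- s)"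
  using Y by (intro mult_left_mono) (auto simp: powr_mult)
 moreover have "(1 + Y) powr s * (1 + Y) powr (- s) = 1" using Y by (simp flip: powr_add)
 ultimately show ?thesis unfolding kab_def s_def[symmetric] by (simp add: mult.assoc[symmetric])
qed

definition DC :: "nat => real" where "DC d = real d * (real d * trigD ^ d)"

lemma DC_pos: "DC d >= 0" using trigD_ge by (simp add: DC_def)

context dyadic_box_n
begin

abbreviation "rr \<equiv> (1 / 2 ^ k 1 :: real)"

lemma rr_pos: "rr > 0" by simp

lemma bx_norm': assumes "w \<in> bx" shows "1 - rr <= norm w" "norm w <= 1 - rr / 2"
 using bx_norm[OF assms] by (simp_all add: field_simps)

lemma bx_diam:
 assumes "w \<in> bx" "w' \<in> bx"
 shows "norm (w - w') <= DC (2 * CARD('n)) * rr"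
proof -
 obtain x x' where x: "x \<in> dbox (2 * CARD('n)) k T" "w = sph_map x" "x' \<in> dbox (2 * CARD('n)) k T" "w' = sph_map x'"
  using assms unfolding bx_def by blast
 define t where "t i = (if i \<in> {1..2 * CARD('n)} then (x i - lo i) / (hi i - lo i) else 0)" for i
 define t' where "t' i = (if i \<in> {1..2 * CARD('n)} then (x' i - lo i) / (hi i - lo i) else 0)" for i
 have tr: "0 <= t i \<and> t i <= 1" "0 <= t' i \<and> t' i <= 1" for i
  using dpoint_surj_range[OF x(1), of i] dpoint_surj_range[OF x(3), of i] by (auto simp: t_def t'_def)
 have dt: "dpoint t = x" "dpoint t' = x'"
 proof -
  have "dpoint t = dpoint (\<lambda>i. (x i - lo i) / (hi i - lo i))" "dpoint t' = dpoint (\<lambda>i. (x' i - lo i) / (hi i - lo i))"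
   unfolding dpoint_def t_def t'_def by (intro restrict_ext; simp)+
  thus "dpoint t = x" "dpoint t' = x'" using dpoint_surj[OF x(1)] dpoint_surj[OF x(3)] by auto
 qed
 have w: "ccoords (\<lambda>i. of_real (sph_coord (2 * CARD('n)) x i)) = w" "ccoords (\<lambda>i. of_real (sph_coord (2 * CARD('n)) x' i)) = w'"
  unfolding x sph_map_def by (rule ccoords_real, simp)+
 have "norm (ccoords (\<lambda>i. of_real (sph_coord (2 * CARD('n)) x i)) - ccoords (\<lambda>i. of_real (sph_coord (2 * CARD('n)) x' i)) :: 'n cvec)
  <= real (2 * CARD('n)) * (real (2 * CARD('n)) * trigD ^ (2 * CARD('n)) * (1 / 2 ^ k 1))"
 proof (rule norm_ccoords_diff)
  fix i assume i: "i \<in> {1..2 * CARD('n)}"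
  have "cmod (ccoord (\<lambda>i. of_real (t i)) i - ccoord (\<lambda>i. of_real (t' i)) i) <= real (2 * CARD('n)) * trigD ^ (2 * CARD('n)) * (1 / 2 ^ k 1)"
  proof (rule ccoord_diff[OF _ _ _ i])
   fix i
   show "cmod (complex_of_real (t i)) <= 2" "cmod (complex_of_real (t' i)) <= 2" using tr[of i] by auto
   show "cmod (complex_of_real (t i) - complex_of_real (t' i)) <= 1"
    unfolding of_real_diff[symmetric] norm_of_real using tr[of i] by auto
  qed
  thus "cmod (complex_of_real (sph_coord (2 * CARD('n)) x i) - complex_of_real (sph_coord (2 * CARD('n)) x' i)) <= real (2 * CARD('n)) * trigD ^ (2 * CARD('n)) * (1 / 2 ^ k 1)"
   by (simp only: ccoord_real[OF i] dt)
 qed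
 thus ?thesis unfolding w DC_def by (simp add: mult.assoc)
qed

text \<open>A neighbourhood of the box on which the local mean values live; it stays at distance comparable to \<open>2^(-m)\<close> from the
sphere.\<close>

definition nb :: "('n cvec) set" where
 "nb = {x + y |x y. x \<in> bx \<and> y \<in> cball 0 (rr / 4)}"

lemma nb_mem: "v \<in> nb \<longleftrightarrow> (\<exists>w\<in>bx. norm (v - w) <= rr / 4)"
proof
 assume "v \<in> nb" thus "\<exists>w\<in>bx. norm (v - w) <= rr / 4" unfolding nb_def by force
next
 assume "\<exists>w\<in>bx. norm (v - w) <= rr / 4"
 then obtain w where w: "w \<in> bx" "norm (v - w) <= rr / 4" by blast
 have "v = w + (v - w)" by simp
 thus "v \<in> nb" unfolding nb_def using w by (smt (verit, ccfv_threshold) mem_Collect_eq mem_cball_0)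
qed

lemma nb_borel: "nb \<in> sets borel"
 unfolding nb_def by (rule borel_compact[OF compact_sums[OF compact_bx compact_cball]])

lemma nb_norm:
 assumes "v \<in> nb" shows "rr / 4 <= 1 - norm v" "1 - norm v <= 2 * rr"
proof -
 obtain w where w: "w \<in> bx" "norm (v - w) <= rr / 4" using assms nb_mem by blast
 define r where "r = rr"
 note b = bx_norm'[OF w(1), folded r_def] w(2)[folded r_def] rr_pos[folded r_def]
 have "norm v <= norm w + norm (v - w)" by (rule norm_triangle_sub)
 hence "r / 4 <= 1 - norm v" using b by linarith
 thus "rr / 4 <= 1 - norm v" unfolding r_def .
 have "norm w <= norm v + norm (v - w)" using norm_triangle_sub[of w v] by (simp add: norm_minus_commute)
 hence "1 - norm v <= 2 * r" using b by linarith
 thus "1 - norm v <= 2 * rr" unfolding r_def .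
qed

lemma nb_ball: "nb \<subseteq> ball 0 1"
proof
 fix v assume "v \<in> nb"
 define r where "r = rr"
 have "norm v < 1" using nb_norm(1)[OF \<open>v \<in> nb\<close>, folded r_def] rr_pos[folded r_def] by linarith
 thus "v \<in> ball 0 1" by simp
qed

lemma bx_sub_nb: "bx \<subseteq> nb"
proof
 fix v assume "v \<in> bx"
 moreover have "norm (v - v) <= rr / 4" by simp
 ultimately show "v \<in> nb" unfolding nb_mem by blast
qed

lemma near_nb:
 assumes "w \<in> bx" "norm (v - w) <= 1 / (8 * 2 ^ k 1)"
 shows "norm v <= 1 - rr / 4" "ball v (rr / 8) \<subseteq> nb" "\<And>u. u \<in> nb ==> norm (u - v) <= (DC (2 * CARD('n)) + 1) * rr"
proof -
 define r where "r = rr"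
 define D where "D = DC (2 * CARD('n))"
 have "1 / (8 * 2 ^ k 1) = rr / 8" by simp
 hence a: "norm (v - w) <= r / 8" using assms(2) unfolding r_def by simp
 have r0: "r > 0" by (simp add: r_def)
 have "norm v <= norm w + norm (v - w)" by (rule norm_triangle_sub)
 hence "norm v <= 1 - r / 4" using bx_norm'[OF assms(1), folded r_def] a r0 by linarith
 thus "norm v <= 1 - rr / 4" unfolding r_def .
 show "ball v (rr / 8) \<subseteq> nb"
 proof
  fix u assume "u \<in> ball v (rr / 8)"
  hence "norm (u - v) <= r / 8" unfolding r_def[symmetric] by (simp add: dist_norm norm_minus_commute)
  moreover have "norm (u - w) <= norm (u - v) + norm (v - w)" using norm_triangle_ineq[of "u - v" "v - w"] by simp
  ultimately have "norm (u - w) <= r / 4" using a by linarith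
  thus "u \<in> nb" using assms(1) unfolding nb_mem r_def by blast
 qed
 fix u assume "u \<in> nb"
 then obtain w' where w': "w' \<in> bx" "norm (u - w') <= r / 4" unfolding nb_mem r_def by blast
 have e: "u - v = (u - w') + ((w' - w) - (v - w))" by simp
 have "norm (u - v) <= norm (u - w') + norm ((w' - w) - (v - w))" unfolding e by (rule norm_triangle_ineq)
 moreover have "norm ((w' - w) - (v - w)) <= norm (w' - w) + norm (v - w)" by (rule norm_triangle_ineq4)
 moreover have "norm (w' - w) <= D * r" using bx_diam[OF w'(1) assms(1)] unfolding D_def r_def .
 moreover have "(D + 1) * r = D * r + r" by (simp add: algebra_simps)
 ultimately have "norm (u - v) <= (D + 1) * r" using w'(2) a r0 by linarith
 thus "norm (u - v) <= (DC (2 * CARD('n)) + 1) * rr" unfolding D_def r_def .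
qed

definition unitvol :: real where "unitvol = measure lborel (ball (0 :: 'n cvec) 1)"

lemma unitvol_pos: "unitvol > 0" unfolding unitvol_def using content_ball_pos[of 1 "0 :: 'n cvec"] by simp

definition cA :: "real => real" where
 "cA lam = 8 ^ (2 * CARD('n)) * 4 powr \<bar>lam\<bar> / (unitvol * wconst TYPE('n cvec) lam)"

lemma rr_powr: "rr ^ (2 * CARD('n)) * rr powr lam = rr powr (real (2 * CARD('n)) + lam)"
 using powr_realpow[OF rr_pos, of "2 * CARD('n)"] by (simp only: powr_add)

text \<open>The mean value inequality on a ball of radius \<open>2^(-m) / 8\<close>, where the weight is comparable to a constant.\<close>

lemma near_bound:
 fixes f :: "'n cvec => complex"
 assumes lam: "lam > -1" and f: "analytic_several f (ball 0 1)" and int: "integrable (weighted_vol lam) f"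
  and vw: "w \<in> bx" "norm (v - w) <= 1 / (8 * 2 ^ k 1)"
 shows "cmod (f v) * rr powr (real (2 * CARD('n)) + lam) <= cA lam * (LINT u|weighted_vol lam. indicator nb u * cmod (f u))"
proof -
 note [measurable] = nb_borel
 define f1 where "f1 w = indicator (ball 0 1) w *\<^sub>R f w" for w
 have f1[measurable]: "f1 \<in> borel_measurable borel" unfolding f1_def[abs_def] by (rule borel_measurable_ball_indicator[OF f])
 define c where "c = wconst TYPE('n cvec) lam"
 have c: "c > 0" unfolding c_def by (rule wconst_pos[OF lam])
 have "cball v (rr / 8) \<subseteq> ball 0 1"
 proof
  fix x assume "x \<in> cball v (rr / 8)"
  hence "norm (x - v) <= rr / 8" by (simp only: mem_cball dist_norm norm_minus_commute)
  moreover define r where "r = rr"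
  ultimately have "norm x < 1"
   using near_nb(1)[OF vw] norm_triangle_sub[of x v] rr_pos unfolding r_def[symmetric] by linarith
  thus "x \<in> ball 0 1" by simp
 qed
 note mv = analytic_mean_value[OF f _ this]
 define I where "I = (LINT u|weighted_vol lam. indicator nb u * cmod (f u))"
 have W: "integrable (weighted_vol lam) (\<lambda>u. indicator nb u * cmod (f1 u))"
  using integrable_mult_indicator[OF sets_weighted_vol_borel[OF nb_borel nb_ball] integrable_norm[OF int]]
  by (rule Bochner_Integration.integrable_cong[THEN iffD1, rotated -1]) (auto simp: f1_def)
 have gm: "(\<lambda>u. indicator nb u * cmod (f1 u)) \<in> borel_measurable borel" by measurable
 have "I = (LINT u|weighted_vol lam. indicator nb u * cmod (f1 u))"
  unfolding I_def by (rule LINT_cong) (auto simp: f1_def)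
 also have "... = c * (LINT u|lborel. bwt lam u * (indicator nb u * cmod (f1 u)))"
  unfolding c_def using integral_weighted_vol_borel(2)[OF lam gm] by simp
 finally have I: "(LINT u|lborel. bwt lam u * (indicator nb u * cmod (f1 u))) = I / c" using c by simp
 have "(LINT u|lborel. rr powr lam * (indicator (ball v (rr / 8)) u * cmod (f u)))
   <= (LINT u|lborel. 4 powr \<bar>lam\<bar> * (bwt lam u * (indicator nb u * cmod (f1 u))))"
 proof (rule integral_mono)
  show "integrable lborel (\<lambda>u. rr powr lam * (indicator (ball v (rr / 8)) u * cmod (f u)))"
   using integrable_norm[OF mv(1)] by simp
  show "integrable lborel (\<lambda>u. 4 powr \<bar>lam\<bar> * (bwt lam u * (indicator nb u * cmod (f1 u))))"
   using W unfolding integral_weighted_vol_borel(1)[OF lam gm] by simp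
  fix u :: "'n cvec"
  show "rr powr lam * (indicator (ball v (rr / 8)) u * cmod (f u)) <= 4 powr \<bar>lam\<bar> * (bwt lam u * (indicator nb u * cmod (f1 u)))"
  proof (cases "u \<in> ball v (rr / 8)")
   case True
   hence u: "u \<in> nb" using near_nb(2)[OF vw] by blast
   have "rr powr lam * cmod (f u) <= (4 powr \<bar>lam\<bar> * bwt lam u) * cmod (f u)"
    by (intro mult_right_mono bwt_comparable(2)[OF rr_pos nb_norm[OF u]]) simp
   moreover have "u \<in> ball 0 1" using u nb_ball by blast
   ultimately show ?thesis using True u by (simp only: f1_def indicator_simps scaleR_one mult_1 mult.assoc)
  qed simp
 qed
 also have "... = 4 powr \<bar>lam\<bar> * (I / c)" by (simp only: integral_mult_right_zero I)
 finally have le1: "rr powr lam * (LINT u|lborel. indicator (ball v (rr / 8)) u * cmod (f u)) <= 4 powr \<bar>lam\<bar> * (I / c)"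
  by (simp only: integral_mult_right_zero)
 have le2: "rr powr lam * (measure lborel (ball (0 :: 'n cvec) (rr / 8)) * cmod (f v))
   <= rr powr lam * (LINT u|lborel. indicator (ball v (rr / 8)) u * cmod (f u))"
  by (intro mult_left_mono mv(2)) simp_all
 have vol: "measure lborel (ball (0 :: 'n cvec) (rr / 8)) = (rr / 8) ^ (2 * CARD('n)) * unitvol"
  using content_ball_conv_unit_ball[of "rr / 8" "0 :: 'n cvec"] rr_pos by (simp add: unitvol_def mult.commute)
 have le: "rr powr lam * ((rr / 8) ^ (2 * CARD('n)) * unitvol * cmod (f v)) <= 4 powr \<bar>lam\<bar> * (I / c)"
  using order_trans[OF le2 le1] unfolding vol .
 define P where "P = 8 ^ (2 * CARD('n)) / unitvol"
 have P: "P >= 0" using unitvol_pos by (simp add: P_def)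
 have "P * (rr powr lam * ((rr / 8) ^ (2 * CARD('n)) * unitvol * cmod (f v))) = cmod (f v) * (rr ^ (2 * CARD('n)) * rr powr lam)"
  unfolding P_def power_divide using unitvol_pos by simp
 moreover have "P * (4 powr \<bar>lam\<bar> * (I / c)) = cA lam * I" by (simp add: P_def cA_def c_def)
 ultimately show ?thesis using mult_left_mono[OF le P] unfolding rr_powr I_def by (simp only:)
qed
definition cK :: "real => real" where
 "cK lam = (1 + 4 * (DC (2 * CARD('n)) + 1)) powr (real CARD('n) + 1 + lam)"

text \<open>Combining the box estimate with local mean values: the supremum of \<open>|f|\<close> near the box is replaced by an
average over \<open>nb\<close>, and the kernel is nearly constant there, so it may be moved under the integral.\<close>

lemma term_dominated:
 fixes \<psi> f :: "'n cvec => complex"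
 assumes lam: "lam > -1" and \<psi>: "locally_integrable_ball \<psi>" and f: "analytic_several f (ball 0 1)"
  and int: "integrable (weighted_vol lam) f" and z: "norm z < 1"
 shows "cmod (bergman_proj lam (\<lambda>w. \<psi> w * indicator bx w * f w) z) * rr powr (real (2 * CARD('n)) + lam)
  <= boxC (2 * CARD('n)) * box_sup lam \<psi> (dbox (2 * CARD('n)) k T) * (cA lam * (cK lam)\<^sup>2)
    * (LINT u|weighted_vol lam. indicator nb u * (cmod (f u) * kab lam z u))"
proof -
 define s where "s = rr powr (real (2 * CARD('n)) + lam)"
 have s: "s > 0" by (simp add: s_def)
 obtain w0 where w0: "w0 \<in> bx" unfolding bx_def using lo_in by blast
 define I where "I = (LINT u|weighted_vol lam. indicator nb u * cmod (f u))"
 define F where "F = cA lam * I / s"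
 define G where "G = cK lam * kab lam z w0"
 have cK0: "cK lam >= 0" by (simp add: cK_def)
 have cA0: "cA lam >= 0" using unitvol_pos wconst_pos[OF lam, where 'a = "'n cvec"] by (simp add: cA_def)
 have nbW: "nb \<in> sets (weighted_vol lam)" by (rule sets_weighted_vol_borel[OF nb_borel nb_ball])
 have cmp: "kab lam z v <= cK lam * kab lam z u" if "w \<in> bx" "norm (v - w) <= 1 / (8 * 2 ^ k 1)" "u \<in> nb" for v w u
  unfolding cK_def
 proof (rule kab_compare[OF lam z near_nb(1)[OF that(1,2)]])
  have "4 * x * (y / 4) = x * y" for x y :: real by simp
  thus "norm (u - v) <= 4 * (DC (2 * CARD('n)) + 1) * (rr / 4)" using near_nb(3)[OF that] by (simp only:)
  show "norm u < 1" using that(3) nb_ball by auto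
 qed simp
 have F: "cmod (f v) <= F" if "w \<in> bx" "norm (v - w) <= 1 / (8 * 2 ^ k 1)" for v w
  unfolding F_def I_def s_def using near_bound[OF lam f int that] s unfolding s_def by (simp add: le_divide_eq)
 have G: "kab lam z v <= G" if "w \<in> bx" "norm (v - w) <= 1 / (8 * 2 ^ k 1)" for v w
  unfolding G_def by (rule cmp[OF that]) (use w0 bx_sub_nb in blast)
 have est: "cmod (bergman_proj lam (\<lambda>w. \<psi> w * indicator bx w * f w) z) <= boxC (2 * CARD('n)) * box_sup lam \<psi> (dbox (2 * CARD('n)) k T) * (F * G)"
  by (rule box_term_estimate[OF lam \<psi> f z F G])
 have IG: "I * G <= (cK lam)\<^sup>2 * (LINT u|weighted_vol lam. indicator nb u * (cmod (f u) * kab lam z u))"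
 proof -
  have i1: "integrable (weighted_vol lam) (\<lambda>u. indicator nb u * cmod (f u))"
   using integrable_mult_indicator[OF nbW integrable_norm[OF int]] by simp
  have i2: "integrable (weighted_vol lam) (\<lambda>u. indicator nb u * (cmod (f u) * kab lam z u))"
   using integrable_mult_indicator[OF nbW kab_mult_integrable[OF lam integrable_norm[OF int] z]] by (simp add: mult_ac)
  have "I * G = (LINT u|weighted_vol lam. indicator nb u * cmod (f u) * G)" unfolding I_def by simp
  also have "... <= (LINT u|weighted_vol lam. (cK lam)\<^sup>2 * (indicator nb u * (cmod (f u) * kab lam z u)))"
  proof (rule integral_mono)
   fix u
   show "indicator nb u * cmod (f u) * G <= (cK lam)\<^sup>2 * (indicator nb u * (cmod (f u) * kab lam z u))"
   proof (cases "u \<in> nb")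
    case True
    have "kab lam z w0 <= cK lam * kab lam z u" by (rule cmp[OF w0 _ True]) simp
    hence "G <= (cK lam)\<^sup>2 * kab lam z u" unfolding G_def power2_eq_square mult.assoc using cK0 by (intro mult_left_mono) auto
    hence "cmod (f u) * G <= cmod (f u) * ((cK lam)\<^sup>2 * kab lam z u)" by (intro mult_left_mono) auto
    thus ?thesis using True by (simp add: mult_ac)
   qed simp
  qed (use i1 i2 in auto)
  finally show ?thesis by simp
 qed
 have b0: "boxC (2 * CARD('n)) * box_sup lam \<psi> (dbox (2 * CARD('n)) k T) >= 0"
  using boxC_pos[OF d2] box_sup_nonneg[OF lam \<psi>] by simp
 have "cmod (bergman_proj lam (\<lambda>w. \<psi> w * indicator bx w * f w) z) * s <= boxC (2 * CARD('n)) * box_sup lam \<psi> (dbox (2 * CARD('n)) k T) * (F * G) * s"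
  using est s by (intro mult_right_mono) auto
 also have "... = boxC (2 * CARD('n)) * box_sup lam \<psi> (dbox (2 * CARD('n)) k T) * (cA lam * (I * G))"
  using s by (simp add: F_def)
 also have "... <= boxC (2 * CARD('n)) * box_sup lam \<psi> (dbox (2 * CARD('n)) k T) * (cA lam * ((cK lam)\<^sup>2 * (LINT u|weighted_vol lam. indicator nb u * (cmod (f u) * kab lam z u))))"
  using IG cA0 b0 by (intro mult_left_mono) auto
 finally show ?thesis unfolding s_def by (simp add: mult.assoc)
qed

lemma bx_measure:
 assumes lam: "lam > -1"
 shows "measure (weighted_vol lam) bx <= wconst TYPE('n cvec) lam * (4 powr \<bar>lam\<bar> * rr powr lam) * measure lebesgue bx"
proof -
 have wc: "wconst TYPE('n cvec) lam > 0" by (rule wconst_pos[OF lam])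
 have bb[measurable]: "bx \<in> sets borel" by (rule borel_compact[OF compact_bx])
 have bW: "bx \<in> sets (weighted_vol lam)" by (rule sets_weighted_vol_borel[OF bb bx_ball])
 interpret W: finite_measure "weighted_vol lam :: ('n cvec) measure" by (rule finite_measure_weighted_vol[OF lam])
 have fin: "emeasure lborel bx < \<infinity>" by (rule emeasure_compact_finite[OF compact_bx])
 have "measure (weighted_vol lam) bx = (LINT w|weighted_vol lam. indicator bx w)" using bW bx_ball by (simp add: Int_absorb2)
 also have "... = wconst TYPE('n cvec) lam *\<^sub>R (LINT w|lborel. bwt lam w *\<^sub>R indicator bx w)"
  by (rule integral_weighted_vol_borel(2)[OF lam]) measurable
 also have "... <= wconst TYPE('n cvec) lam *\<^sub>R (LINT w|lborel. (4 powr \<bar>lam\<bar> * rr powr lam) * indicator bx w)"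
 proof (rule scaleR_left_mono)
  show "(LINT w|lborel. bwt lam w *\<^sub>R indicator bx w) <= (LINT w|lborel. (4 powr \<bar>lam\<bar> * rr powr lam) * indicator bx w)"
  proof (rule integral_mono)
   show "integrable lborel (\<lambda>w :: 'n cvec. bwt lam w *\<^sub>R indicator bx w :: real)"
    using integrable_real_mult_indicator[OF _ bwt_integrable[OF lam], of bx] bb by simp
   show "integrable lborel (\<lambda>w. (4 powr \<bar>lam\<bar> * rr powr lam) * indicator bx w :: real)" using fin bb by simp
   fix w :: "'n cvec"
   show "bwt lam w *\<^sub>R indicator bx w <= (4 powr \<bar>lam\<bar> * rr powr lam) * indicator bx w"
   proof (cases "w \<in> bx")
    case True
    hence "w \<in> nb" using bx_sub_nb by blast
    from bwt_comparable(1)[OF rr_pos nb_norm[OF this], of lam] show ?thesis using True by simp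
   qed simp
  qed
 qed (use wc in simp)
 also have "... = wconst TYPE('n cvec) lam * (4 powr \<bar>lam\<bar> * rr powr lam) * measure lborel bx"
  using bb by simp
 also have "measure lborel bx = measure lebesgue bx" using bb by simp
 finally show ?thesis .
qed

end

section \<open>Bergman spaces\<close>

lemma bergman_spaceD:
 fixes f :: "complex ^ 'n => complex"
 assumes lam: "lam > -1" and p: "p > 1" and f: "f \<in> bergman_space lam p"
 shows "analytic_several f (ball 0 1)" "integrable (weighted_vol lam) (\<lambda>w. cmod (f w) powr p)"
  "integrable (weighted_vol lam) f"
proof -
 show a: "analytic_several f (ball 0 1)" and i: "integrable (weighted_vol lam) (\<lambda>w. cmod (f w) powr p)"
  using f by (auto simp: bergman_space_def Lp_space_def)
 have m[measurable]: "f \<in> borel_measurable (weighted_vol lam)" by (rule analytic_measurable[OF a])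
 have "integrable (weighted_vol lam) (\<lambda>w. cmod (f w))"
  by (rule Lp_imp_integrable[OF lam _ _ _ i]) (use p in auto)
 thus "integrable (weighted_vol lam) f" using m by (simp add: integrable_norm_iff)
qed

lemma bergman_spaceI:
 assumes "analytic_several f (ball 0 1)" "integrable (weighted_vol lam) (\<lambda>w. cmod (f w) powr p)"
 shows "f \<in> bergman_space lam p"
 using assms analytic_measurable[OF assms(1)] by (auto simp: bergman_space_def Lp_space_def)

lemma Lp_norm_le:
 assumes K: "K >= 0" and p: "p > 0"
  and le: "(LINT x|weighted_vol lam. norm (h x) powr p) <= K * (LINT x|weighted_vol lam. norm (f x) powr p)"
 shows "Lp_norm lam p h <= K powr (1 / p) * Lp_norm lam p f"
proof -
 have "(LINT x|weighted_vol lam. norm (h x) powr p) powr (1 / p) <= (K * (LINT x|weighted_vol lam. norm (f x) powr p)) powr (1 / p)"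
  using le p by (intro powr_mono2) auto
 thus ?thesis unfolding Lp_norm_def using K by (simp add: powr_mult)
qed

lemma Lp_norm_tendsto_0:
 assumes p: "p > 0" and lim: "((\<lambda>i. \<integral>x. norm (h i x) powr p \<partial>weighted_vol lam) \<longlongrightarrow> 0) F"
 shows "((\<lambda>i. Lp_norm lam p (h i)) \<longlongrightarrow> 0) F"
proof -
 have "((\<lambda>i. Lp_norm lam p (h i)) \<longlongrightarrow> 0 powr (1 / p)) F"
  unfolding Lp_norm_def by (rule tendsto_powr'[OF lim tendsto_const]) (use p in auto)
 thus ?thesis by simp
qed

lemma integral_powr_of_Lp_norm:
 assumes p: "p > 0" and M: "Lp_norm lam p f <= M"
 shows "(LINT x|weighted_vol lam. norm (f x) powr p) <= M powr p"
proof -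
 have n: "(LINT x|weighted_vol lam. norm (f x) powr p) >= 0" by simp
 have "(LINT x|weighted_vol lam. norm (f x) powr p) = Lp_norm lam p f powr p"
  unfolding Lp_norm_def using p n by (simp add: powr_powr)
 also have "... <= M powr p" using M p by (intro powr_mono2) (auto simp: Lp_norm_def)
 finally show ?thesis .
qed

lemma add_powr_le:
 fixes a b :: real assumes "a >= 0" "b >= 0" "p > 0"
 shows "(a + b) powr p <= 2 powr p * (a powr p + b powr p)"
proof -
 have "(a + b) powr p <= (2 * max a b) powr p" using assms by (intro powr_mono2) auto
 also have "... = 2 powr p * max a b powr p" using assms by (simp add: powr_mult)
 also have "max a b powr p <= a powr p + b powr p" by (auto simp: max_def)
 finally show ?thesis by simp
qed

lemma pplus_nonneg: "(\<And>w. f w >= 0) ==> pplus lam f z >= 0"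
 unfolding pplus_def by (intro integral_nonneg_AE) auto

lemma pplus_le_radius:
 fixes f :: "complex ^ 'n => real"
 assumes lam: "lam > -1" and int: "integrable (weighted_vol lam) f" and f: "\<And>w. f w >= 0" and z: "norm z <= r" "r < 1"
 shows "pplus lam f z <= (1 - r) powr (- (real CARD('n) + 1 + lam)) * (LINT w|weighted_vol lam. f w)"
proof -
 have "pplus lam f z <= (LINT w|weighted_vol lam. (1 - r) powr (- (real CARD('n) + 1 + lam)) * f w)"
  unfolding pplus_def
 proof (rule integral_mono)
  show "integrable (weighted_vol lam) (\<lambda>w. kab lam z w * f w)" using z by (intro kab_mult_integrable[OF lam int]) auto
  fix w :: "complex ^ 'n" assume "w \<in> space (weighted_vol lam)"
  hence "kab lam z w <= (1 - norm z) powr (- (real CARD('n) + 1 + lam))" using z by (intro kab_bound[OF lam]) auto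
  also have "... <= (1 - r) powr (- (real CARD('n) + 1 + lam))"
   using z lam by (intro powr_mono2') (auto simp: add_nonneg_nonneg)
  finally show "kab lam z w * f w <= (1 - r) powr (- (real CARD('n) + 1 + lam)) * f w" using f by (rule mult_right_mono)
 qed (use int in auto)
 thus ?thesis by simp
qed

text \<open>The reproducing formula bounds point values by the \<open>L^1\<close> norm, uniformly on smaller balls.\<close>

lemma bergman_point_bound:
 fixes f :: "complex ^ 'n => complex"
 assumes lam: "lam > -1" and f: "analytic_several f (ball 0 1)" and int: "integrable (weighted_vol lam) f" and z: "norm z <= r" "r < 1"
 shows "cmod (f z) <= (1 - r) powr (- (real CARD('n) + 1 + lam)) * (LINT w|weighted_vol lam. cmod (f w)) / berg_const TYPE(complex ^ 'n) lam"
proof -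
 have c: "berg_const TYPE(complex ^ 'n) lam > 0" by (rule berg_const_pos[OF lam])
 have "z \<in> ball 0 1" using z by simp
 from bergman_proj_analytic[OF lam f int this]
 have "berg_const TYPE(complex ^ 'n) lam * cmod (f z) = cmod (bergman_proj lam f z)" using c by (simp add: norm_mult)
 also have "... <= pabs lam f z" by (rule bergman_proj_bound)
 also have "... <= (1 - r) powr (- (real CARD('n) + 1 + lam)) * (LINT w|weighted_vol lam. cmod (f w))"
  by (rule pplus_le_radius[OF lam integrable_norm[OF int] _ z]) simp
 finally show ?thesis using c by (simp add: field_simps)
qed

lemma integral_cmod_le:
 fixes f :: "complex ^ 'n => complex"
 assumes lam: "lam > -1" and p: "p > 1" and f: "f \<in> bergman_space lam p"
 shows "(LINT w|weighted_vol lam. cmod (f w)) <= measure (weighted_vol lam) (ball (0 :: complex ^ 'n) 1) + (LINT w|weighted_vol lam. cmod (f w) powr p)"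
proof -
 interpret W: finite_measure "weighted_vol lam :: (complex ^ 'n) measure" by (rule finite_measure_weighted_vol[OF lam])
 note D = bergman_spaceD[OF lam p f]
 have "(LINT w|weighted_vol lam. cmod (f w)) <= (LINT w|weighted_vol lam. 1 + cmod (f w) powr p)"
 proof (rule integral_mono)
  fix w
  show "cmod (f w) <= 1 + cmod (f w) powr p"
  proof (cases "cmod (f w) <= 1")
   case False
   hence "cmod (f w) powr 1 <= cmod (f w) powr p" using p by (intro powr_mono) auto
   thus ?thesis using False by simp
  qed (simp add: add_increasing2)
 qed (use D in auto)
 also have "... = measure (weighted_vol lam) (ball (0 :: complex ^ 'n) 1) + (LINT w|weighted_vol lam. cmod (f w) powr p)"
  using D by (subst Bochner_Integration.integral_add) (auto simp: W.emeasure_eq_measure)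
 finally show ?thesis .
qed

lemma bergman_space_lincomb:
 fixes f g :: "complex ^ 'n => complex"
 assumes lam: "lam > -1" and p: "p > 1" and f: "f \<in> bergman_space lam p" and g: "g \<in> bergman_space lam p"
 shows "(\<lambda>w. a * f w + b * g w) \<in> bergman_space lam p"
proof (rule bergman_spaceI)
 note F = bergman_spaceD[OF lam p f] and G = bergman_spaceD[OF lam p g]
 show an: "analytic_several (\<lambda>w. a * f w + b * g w) (ball 0 1)"
  by (intro analytic_several_add analytic_several_cmult F G)
 have [measurable]: "(\<lambda>w. a * f w + b * g w) \<in> borel_measurable (weighted_vol lam)" by (rule analytic_measurable[OF an])
 show "integrable (weighted_vol lam) (\<lambda>w. cmod (a * f w + b * g w) powr p)"
 proof (rule integrable_dominated)
  show "integrable (weighted_vol lam) (\<lambda>w. 2 powr p * (cmod a powr p * cmod (f w) powr p + cmod b powr p * cmod (g w) powr p))"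
   using F G by auto
  show "(\<lambda>w. cmod (a * f w + b * g w) powr p) \<in> borel_measurable (weighted_vol lam)" by measurable
  show "AE w in weighted_vol lam. norm (cmod (a * f w + b * g w) powr p)
   <= norm (2 powr p * (cmod a powr p * cmod (f w) powr p + cmod b powr p * cmod (g w) powr p))"
  proof (rule AE_I2)
   fix w
   have "cmod (a * f w + b * g w) powr p <= (cmod a * cmod (f w) + cmod b * cmod (g w)) powr p"
    using p norm_triangle_ineq[of "a * f w" "b * g w"] by (intro powr_mono2) (auto simp: norm_mult)
   also have "... <= 2 powr p * ((cmod a * cmod (f w)) powr p + (cmod b * cmod (g w)) powr p)"
    using p by (intro add_powr_le) auto
   finally show "norm (cmod (a * f w + b * g w) powr p) <= norm (2 powr p * (cmod a powr p * cmod (f w) powr p + cmod b powr p * cmod (g w) powr p))"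
    by (simp add: powr_mult)
  qed
 qed
qed

text \<open>Stated for pointwise bounds on the open ball, the only set that the norm sees.\<close>

lemma Lp_norm_dominated_convergence:
 fixes h :: "nat => complex ^ 'n => complex"
 assumes p: "p > 0" and h[measurable]: "\<And>n. h n \<in> borel_measurable (weighted_vol lam)"
  and G: "integrable (weighted_vol lam) (\<lambda>z. G z powr p)"
  and bd: "\<And>n z. norm z < 1 ==> cmod (h n z) <= G z"
  and lim: "\<And>z. norm z < 1 ==> (\<lambda>n. h n z) \<longlonglongrightarrow> 0"
 shows "(\<lambda>n. Lp_norm lam p (h n)) \<longlonglongrightarrow> 0"
proof (rule Lp_norm_tendsto_0[OF p])
 have "(\<lambda>n. \<integral>z. cmod (h n z) powr p \<partial>weighted_vol lam) \<longlonglongrightarrow> (LINT z|(weighted_vol lam :: (complex ^ 'n) measure). (0::real))"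
 proof (rule integral_dominated_convergence[OF _ _ G])
  show "AE z in weighted_vol lam. (\<lambda>n. cmod (h n z) powr p) \<longlonglongrightarrow> 0"
  proof (rule AE_I2)
   fix z :: "complex ^ 'n" assume "z \<in> space (weighted_vol lam)"
   hence "(\<lambda>n. h n z) \<longlonglongrightarrow> 0" by (intro lim) simp
   hence "(\<lambda>n. cmod (h n z) powr p) \<longlonglongrightarrow> 0 powr p"
    using p by (intro tendsto_powr' tendsto_norm_zero tendsto_const) auto
   thus "(\<lambda>n. cmod (h n z) powr p) \<longlonglongrightarrow> 0" by simp
  qed
  show "AE z in weighted_vol lam. norm (cmod (h n z) powr p) <= G z powr p" for n
   by (rule AE_I2) (use bd p in \<open>auto intro!: powr_mono2\<close>)
 qed measurable
 thus "(\<lambda>n. \<integral>z. cmod (h n z) powr p \<partial>weighted_vol lam) \<longlonglongrightarrow> 0" by simp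
qed

section \<open>Operations on symbols\<close>

lemma locally_integrable_cnj: "locally_integrable_ball \<psi> ==> locally_integrable_ball (\<lambda>z. cnj (\<psi> z))"
 unfolding locally_integrable_ball_def set_integrable_def by (auto simp flip: complex_cnj_scaleR)

lemma locally_integrable_truncate:
 assumes \<psi>: "locally_integrable_ball \<psi>" shows "locally_integrable_ball (truncate_symbol \<rho> \<psi>)"
 unfolding locally_integrable_ball_def
proof (intro allI impI)
 fix K :: "'a set" assume K: "compact K \<and> K \<subseteq> ball 0 1"
 have "compact (K \<inter> cball 0 \<rho>)" "K \<inter> cball 0 \<rho> \<subseteq> ball 0 1" using K by (auto intro: compact_Int_closed)
 hence "\<psi> absolutely_integrable_on (K \<inter> cball 0 \<rho>)" using \<psi> unfolding locally_integrable_ball_def by blast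
 moreover have "indicat_real (K \<inter> cball 0 \<rho>) x *\<^sub>R \<psi> x = indicat_real K x *\<^sub>R truncate_symbol \<rho> \<psi> x" for x
  by (auto simp: truncate_symbol_def indicator_def)
 ultimately show "truncate_symbol \<rho> \<psi> absolutely_integrable_on K" unfolding set_integrable_def by simp
qed

lemma box_sup_cnj: "box_sup lam (\<lambda>z. cnj (\<psi> z)) Q = box_sup lam \<psi> Q"
 unfolding box_sup_def set_lebesgue_integral_def
 by (simp flip: complex_cnj_scaleR)

context dyadic_box_n
begin

text \<open>Intersecting an initial box \<open>B(x, y)\<close> with a ball around the origin lowers the radial coordinate of \<open>y\<close>
and gives again an initial box (or the empty set), so truncation does not increase the supremum.\<close>

lemma box_sup_truncate:
 fixes \<psi> :: "'n cvec => complex"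
 assumes lam: "lam > -1" and \<psi>: "locally_integrable_ball \<psi>"
 shows "box_sup lam (truncate_symbol \<rho> \<psi>) (dbox (2 * CARD('n)) k T) <= box_sup lam \<psi> (dbox (2 * CARD('n)) k T)"
proof (rule box_sup_least)
 fix y assume y: "y \<in> dbox (2 * CARD('n)) k T"
 define D where "D = {1..2 * CARD('n)}"
 have lo1: "lo 1 = 1 - 1 / 2 ^ k 1" "lo 1 <= y 1"
  using d2 not_T dbox_radius(1)[OF y] by (auto simp: dlo_def side_lo_def)
 have pos: "0 <= lo 1" unfolding lo1 by simp
 define P where "P y = (\<Pi>\<^sub>E i\<in>D. {min (lo i) (y i)..max (lo i) (y i)})" for y :: "nat => real"
 have sb: "sbox y' = sph_map ` P y'" if "y' \<in> dbox (2 * CARD('n)) k T" for y'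
  unfolding sph_box_def sub_box(1)[OF that] P_def D_def ..
 have D1: "1 \<in> D" using two_le_d[where 'n = 'n] by (simp add: D_def)
 have rad: "lo 1 <= x 1" "norm (sph_map x :: 'n cvec) = x 1" if "x \<in> P y" for x
 proof -
  have "x 1 \<in> {min (lo 1) (y 1)..max (lo 1) (y 1)}" using that D1 unfolding P_def by (rule PiE_mem)
  thus "lo 1 <= x 1" using lo1 by simp
  thus "norm (sph_map x :: 'n cvec) = x 1" using pos by (simp add: norm_sph_map)
 qed
 show "cmod (LINT z:sbox y|weighted_vol lam. truncate_symbol \<rho> \<psi> z) <= box_sup lam \<psi> (dbox (2 * CARD('n)) k T)"
 proof (cases "lo 1 <= \<rho>")
  case True
  define y' where "y' = y(1 := min (y 1) \<rho>)"
  have y'1: "lo 1 <= y' 1" "y' 1 <= y 1" "y' 1 <= \<rho>" using lo1 True by (auto simp: y'_def)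
  have y'db: "y' \<in> dbox (2 * CARD('n)) k T"
   unfolding dbox_def
  proof (rule PiE_I)
   fix i assume i: "i \<in> {1..2 * CARD('n)}"
   have "y i \<in> {min (lo i) (hi i)..max (lo i) (hi i)}" using y i unfolding dbox_def by (rule PiE_mem)
   thus "y' i \<in> {min (lo i) (hi i)..max (lo i) (hi i)}"
    using y'1 by (cases "i = 1") (auto simp: y'_def)
  next
   fix i assume "i \<notin> {1..2 * CARD('n)}"
   thus "y' i = undefined" using y D1 unfolding dbox_def D_def y'_def by (auto simp: PiE_def extensional_def)
  qed
  have Pe: "P y' = {x \<in> P y. x 1 <= \<rho>}"
  proof (intro equalityI subsetI)
   fix x assume x: "x \<in> P y'"
   have m: "x i \<in> {min (lo i) (y' i)..max (lo i) (y' i)}" if "i \<in> D" for i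
    using x that unfolding P_def by (rule PiE_mem)
   have "x i \<in> {min (lo i) (y i)..max (lo i) (y i)}" if "i \<in> D" for i
    using m[OF that] y'1 lo1 by (cases "i = 1") (auto simp: y'_def)
   moreover have "x \<in> extensional D" using x by (simp add: P_def PiE_def)
   ultimately have "x \<in> P y" by (auto simp: P_def PiE_def)
   moreover have "x 1 <= \<rho>" using m[OF D1] y'1 by auto
   ultimately show "x \<in> {x \<in> P y. x 1 <= \<rho>}" by simp
  next
   fix x assume x: "x \<in> {x \<in> P y. x 1 <= \<rho>}"
   hence xP: "x \<in> P y" and xr: "x 1 <= \<rho>" by auto
   have m: "x i \<in> {min (lo i) (y i)..max (lo i) (y i)}" if "i \<in> D" for i
    using xP that unfolding P_def by (rule PiE_mem)
   have "x i \<in> {min (lo i) (y' i)..max (lo i) (y' i)}" if "i \<in> D" for i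
    using m[OF that] y'1 lo1 xr by (cases "i = 1") (auto simp: y'_def)
   moreover have "x \<in> extensional D" using xP by (simp add: P_def PiE_def)
   ultimately show "x \<in> P y'" by (auto simp: P_def PiE_def)
  qed
  have "indicator (sbox y) z *\<^sub>R truncate_symbol \<rho> \<psi> z = indicator (sbox y') z *\<^sub>R \<psi> z" for z
  proof -
   have "z \<in> sbox y' \<longleftrightarrow> z \<in> sbox y \<and> norm z <= \<rho>"
    unfolding sb[OF y] sb[OF y'db] Pe using rad(2) by auto
   thus ?thesis by (auto simp: truncate_symbol_def indicator_def)
  qed
  hence "(LINT z:sbox y|weighted_vol lam. truncate_symbol \<rho> \<psi> z) = (LINT z:sbox y'|weighted_vol lam. \<psi> z)"
   unfolding set_lebesgue_integral_def by simp
  thus ?thesis using box_sup_upper[OF lam \<psi> y'db] by simp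
 next
  case False
  have "indicator (sbox y) z *\<^sub>R truncate_symbol \<rho> \<psi> z = 0" for z
   unfolding sb[OF y] using rad False by (force simp: truncate_symbol_def indicator_def)
  hence "(LINT z:sbox y|weighted_vol lam. truncate_symbol \<rho> \<psi> z) = 0"
   by (simp only: set_lebesgue_integral_def Bochner_Integration.integral_zero)
  thus ?thesis using box_sup_nonneg[OF lam \<psi>] by simp
 qed
qed

end

section \<open>The generalized Toeplitz operator\<close>

locale dyadic_toeplitz =
 fixes lam :: real and Q :: "nat => (nat => real) set" and B :: "nat => (complex ^ 'n::{finite,wellorder}) set"
 assumes lam: "lam > -1" and injQ: "inj Q" and ranQ: "range Q \<subseteq> dyadic_boxes (2 * CARD('n))"
  and B: "B = (\<lambda>j. sph_map ` Q j)"
begin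

abbreviation W :: "('n cvec) measure" where "W \<equiv> weighted_vol lam"

abbreviation "tterm \<equiv> toeplitz_term lam B"
abbreviation "toep \<equiv> toeplitz lam B"

sublocale W: finite_measure W by (rule finite_measure_weighted_vol[OF lam])

definition box_controlled :: "real => ('n cvec => complex) => bool" where
 "box_controlled C \<psi> \<longleftrightarrow> C >= 0 \<and> locally_integrable_ball \<psi> \<and> (\<forall>j. box_sup lam \<psi> (Q j) <= C * measure W (B j))"

text \<open>A sequence that bounds the terms of the Toeplitz series simultaneously for all symbols, in proportion to the size of
their box integrals. The uniformity in the symbol is what later allows limits of symbols under the sum.\<close>

definition majorizes :: "('n cvec => complex) => 'n cvec => (nat => real) => bool" where
 "majorizes f z M \<longleftrightarrow> (\<forall>j. 0 <= M j) \<and> (\<forall>\<psi> j e. locally_integrable_ball \<psi> --> 0 <= e -->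
  box_sup lam \<psi> (Q j) <= e * measure W (B j) --> cmod (tterm \<psi> f z j) <= e * M j)"

text \<open>Each term is at most the measure of the box, relative to that of a ball of radius \<open>2^(-m)\<close>, times the integral
of \<open>|f|\<close> against the modulus of the kernel over the neighbourhood of the box. For a
fixed point \<open>u\<close>, all boxes whose neighbourhood contains \<open>u\<close> lie in one ball of radius comparable to \<open>1 - |u|\<close> and are almost disjoint, so
their measures add up to at most the measure of that ball. Although the boxes near the poles are numerous, the overlap
is thereby bounded after weighting by measure.\<close>

theorem majorant:
 "\<exists>A\<ge>0. \<forall>f z. analytic_several f (ball 0 1) --> integrable W f --> norm z < 1 -->
  (\<exists>M. majorizes f z M \<and> summable M \<and> suminf M <= A * pabs lam f z)"
proof -
 define d where "d = 2 * CARD('n)"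
 define V where "V = measure lborel (ball (0 :: 'n cvec) 1)"
 define wc where "wc = wconst TYPE('n cvec) lam"
 have V: "V > 0" unfolding V_def using content_ball_pos[of 1 "0 :: 'n cvec"] by simp
 have wc: "wc > 0" unfolding wc_def by (rule wconst_pos[OF lam])
 have d2: "2 <= d" unfolding d_def by (rule two_le_d)
 define A1 where "A1 = boxC d * ((8 ^ d * 4 powr \<bar>lam\<bar> / (V * wc)) * ((1 + 4 * (DC d + 1)) powr (real CARD('n) + 1 + lam))\<^sup>2)"
 define R where "R = 4 * (DC d + 1)"
 define A2 where "A2 = wc * 4 powr \<bar>lam\<bar> * (2 ^ d * ((R + 1) ^ d * V))"
 have A1: "A1 >= 0" unfolding A1_def using boxC_pos[OF d2] V wc by simp
 have R0: "R >= 0" using DC_pos[of d] by (simp add: R_def)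
 have A2: "A2 >= 0" unfolding A2_def using V wc R0 by simp
 show ?thesis
 proof (intro exI[of _ "A1 * A2"] conjI allI impI)
  show "0 <= A1 * A2" using A1 A2 by simp
  fix f and z :: "'n cvec"
  assume f: "analytic_several f (ball 0 1)" and int: "integrable W f" and z: "norm z < 1"
  have "\<forall>j. \<exists>k T. k \<in> dyadic_index d \<and> T \<subseteq> {2..d - 1} \<and> Q j = dbox d k T"
   using dyadic_boxes_dbox ranQ unfolding d_def by (metis rangeI subsetD)
  then obtain k T where kT: "\<And>j. k j \<in> dyadic_index d" "\<And>j. T j \<subseteq> {2..d - 1}" "\<And>j. Q j = dbox d (k j) (T j)" by metis
  have loc: "dyadic_box_n TYPE('n) (k j) (T j)" for j
  proof -
   have "dyadic_param d (k j) (T j)" by (unfold_locales) (use d2 kT in auto)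
   thus ?thesis unfolding dyadic_box_n_def d_def .
  qed
  define rr where "rr j = (1 / 2 ^ k j 1 :: real)" for j
  define N where "N j = (dyadic_box_n.nb (k j) (T j) :: ('n cvec) set)" for j
  have Bbx: "B j = dyadic_box_n.bx (k j) (T j)" for j
   unfolding B dyadic_box_n.bx_def[OF loc] kT(3) d_def ..
  have rr0: "rr j > 0" for j by (simp add: rr_def)
  have NW: "N j \<in> sets W" for j
   unfolding N_def by (rule sets_weighted_vol_borel[OF dyadic_box_n.nb_borel[OF loc] dyadic_box_n.nb_ball[OF loc]])
  have Nn: "rr j / 4 <= 1 - norm u" "1 - norm u <= 2 * rr j" if "u \<in> N j" for u j
   using dyadic_box_n.nb_norm[OF loc, of u j] that unfolding N_def rr_def by auto
  define m where "m j = measure W (B j)" for j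
  \<comment> \<open>The exponents match the scaling of the measure of a ball of radius \<open>2^(-m)\<close>.\<close>
  define \<alpha> where "\<alpha> j = m j / rr j powr (real d + lam)" for j
  have m0: "m j >= 0" for j by (simp add: m_def)
  have \<alpha>0: "\<alpha> j >= 0" for j using m0 by (simp add: \<alpha>_def)
  define g where "g u = cmod (f u) * kab lam z u" for u
  have gint: "integrable W g"
   using kab_mult_integrable[OF lam integrable_norm[OF int] z] by (simp add: g_def[abs_def] mult.commute)
  have g0: "g u >= 0" for u by (simp add: g_def)
  have gNint: "integrable W (\<lambda>u. indicator (N j) u * g u)" for j
   using integrable_mult_indicator[OF NW gint, of j] by simp
  define M where "M j = A1 * (LINT u|W. \<alpha> j * (indicator (N j) u * g u))" for j
  have M0: "M j >= 0" for j
   unfolding M_def using A1 \<alpha>0 g0 by (intro mult_nonneg_nonneg integral_nonneg_AE) auto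
  have single: "cmod (tterm \<psi> f z j) <= e * M j"
   if \<psi>: "locally_integrable_ball \<psi>" and sup: "box_sup lam \<psi> (Q j) <= e * measure W (B j)" for \<psi> j e
  proof -
   have t: "tterm \<psi> f z j = bergman_proj lam (\<lambda>w. \<psi> w * indicator (dyadic_box_n.bx (k j) (T j)) w * f w) z"
    unfolding toeplitz_term_def Bbx[symmetric] ..
   define I where "I = (LINT u|W. indicator (N j) u * g u)"
   have I0: "I >= 0" unfolding I_def by (rule integral_nonneg_AE) (simp add: g0)
   have s: "rr j powr (real d + lam) > 0" using rr0[of j] by simp
   define tt where "tt = tterm \<psi> f z j"
   note t' = t[folded tt_def]
   have "cmod tt * rr j powr (real d + lam)
    <= boxC d * box_sup lam \<psi> (Q j) * ((8 ^ d * 4 powr \<bar>lam\<bar> / (V * wc)) * ((1 + 4 * (DC d + 1)) powr (real CARD('n) + 1 + lam))\<^sup>2) * I"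
    using dyadic_box_n.term_dominated[OF loc lam \<psi> f int z, of j]
    unfolding t' rr_def kT(3) I_def g_def N_def d_def wc_def V_def
     dyadic_box_n.cA_def[OF loc] dyadic_box_n.cK_def[OF loc] dyadic_box_n.unitvol_def[OF loc] .
   also have "... = A1 * I * box_sup lam \<psi> (Q j)" by (simp add: A1_def mult_ac)
   also have "... <= A1 * I * (e * m j)"
    using sup A1 I0 unfolding m_def by (intro mult_left_mono) auto
   finally have "cmod tt <= A1 * I * (e * m j) / rr j powr (real d + lam)"
    using s by (simp add: le_divide_eq)
   also have "... = e * M j"
    unfolding M_def integral_mult_right_zero I_def \<alpha>_def by (simp add: mult_ac)
   finally show ?thesis unfolding tt_def .
  qed
  have overlap: "(\<Sum>j\<in>J. \<alpha> j * indicator (N j) u) <= A2" if u: "norm u < 1" and J: "finite J" for u J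
  proof -
   define J' where "J' = {j\<in>J. u \<in> N j}"
   define \<delta> where "\<delta> = 1 - norm u"
   have \<delta>: "\<delta> > 0" using u by (simp add: \<delta>_def)
   have J': "finite J'" using J by (simp add: J'_def)
   have lm: "B j \<in> lmeasurable" for j
    unfolding Bbx by (intro lmeasurable_compact dyadic_box_n.compact_bx loc)
   have "(\<Sum>j\<in>J. \<alpha> j * indicator (N j) u) = (\<Sum>j\<in>J'. \<alpha> j)"
    unfolding J'_def sum.inter_filter[OF J] by (intro sum.cong) (auto simp: indicator_def)
   \<comment> \<open>All these boxes have size comparable to \<open>\<delta>\<close>, so the weight and the power of \<open>2^(-m)\<close> may be frozen.\<close>
   also have "... <= (\<Sum>j\<in>J'. wc * 4 powr \<bar>lam\<bar> * (2 / \<delta>) ^ d * measure lebesgue (B j))"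
   proof (rule sum_mono)
    fix j assume j: "j \<in> J'"
    hence un: "u \<in> N j" by (simp add: J'_def)
    have "m j <= wc * (4 powr \<bar>lam\<bar> * rr j powr lam) * measure lebesgue (B j)"
     using dyadic_box_n.bx_measure[OF loc lam, of j] unfolding m_def wc_def rr_def Bbx .
    hence "\<alpha> j <= wc * (4 powr \<bar>lam\<bar> * rr j powr lam) * measure lebesgue (B j) / rr j powr (real d + lam)"
     unfolding \<alpha>_def by (rule divide_right_mono) simp
    also have "... = wc * 4 powr \<bar>lam\<bar> * (1 / rr j) ^ d * measure lebesgue (B j)"
     using rr0[of j] by (simp add: powr_add powr_realpow power_divide)
    also have "... <= wc * 4 powr \<bar>lam\<bar> * (2 / \<delta>) ^ d * measure lebesgue (B j)"
    proof (intro mult_right_mono mult_left_mono power_mono)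
     show "1 / rr j <= 2 / \<delta>" using Nn(2)[OF un] rr0[of j] \<delta> unfolding \<delta>_def[symmetric] by (simp add: field_simps)
    qed (use wc rr0[of j] in auto)
    finally show "\<alpha> j <= wc * 4 powr \<bar>lam\<bar> * (2 / \<delta>) ^ d * measure lebesgue (B j)" .
   qed
   also have "... = wc * 4 powr \<bar>lam\<bar> * (2 / \<delta>) ^ d * (\<Sum>j\<in>J'. measure lebesgue (B j))" by (simp add: sum_distrib_left)
   also have "(\<Sum>j\<in>J'. measure lebesgue (B j)) = measure lebesgue (\<Union>(B ` J'))"
   proof (rule measure_negligible_finite_Union_image[symmetric, OF J' lm])
    show "pairwise (\<lambda>x y. negligible (B x \<inter> B y)) J'"
     unfolding pairwise_def
    proof (intro ballI impI)
     fix i j :: nat assume "i \<noteq> j"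
     hence ne: "dbox d (k i) (T i) \<noteq> dbox d (k j) (T j)" using injQ kT(3) by (metis injD)
     have dp: "dyadic_param d (k j) (T j)" for j by (unfold_locales) (use d2 kT in auto)
     obtain l c where lc: "l \<in> {1..d}" "\<And>x. x \<in> dbox d (k i) (T i) ==> x \<in> dbox d (k j) (T j) ==> x l = c"
      using dbox_overlap[OF dp dp ne] by blast
     show "negligible (B i \<inter> B j)" unfolding B kT(3)
      by (rule negligible_sph_overlap[of _ _ l c])
       (use lc dyadic_param.dbox_subset_domain[OF dp] in \<open>auto simp: d_def\<close>)
    qed
   qed
   also have "... <= measure lebesgue (ball u ((R + 1) * \<delta>))"
   proof (rule measure_mono_fmeasurable)
    show "\<Union>(B ` J') \<subseteq> ball u ((R + 1) * \<delta>)"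
    proof
     fix w assume "w \<in> \<Union>(B ` J')"
     then obtain j where j: "j \<in> J'" "w \<in> B j" by blast
     hence un: "u \<in> N j" by (simp add: J'_def)
     have "norm (u - w) <= (DC d + 1) * rr j"
      unfolding d_def rr_def
      by (rule dyadic_box_n.near_nb(3)[OF loc, of w j w u]) (use j un in \<open>auto simp: Bbx N_def\<close>)
     also have "... <= (DC d + 1) * (4 * \<delta>)"
      using Nn(1)[OF un] DC_pos[of d] unfolding \<delta>_def[symmetric] by (intro mult_left_mono) auto
     also have "... < (R + 1) * \<delta>" using \<delta> by (simp add: R_def algebra_simps)
     finally show "w \<in> ball u ((R + 1) * \<delta>)" by (simp add: dist_norm)
    qed
    show "\<Union>(B ` J') \<in> sets lebesgue" using J' lm by (intro sets.finite_UN fmeasurableD) auto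
   qed simp
   also have "measure lebesgue (ball u ((R + 1) * \<delta>)) = ((R + 1) * \<delta>) ^ d * V"
    using content_ball_conv_unit_ball[of "(R + 1) * \<delta>" u] \<delta> R0 by (simp add: V_def d_def mult.commute)
   also have "wc * 4 powr \<bar>lam\<bar> * (2 / \<delta>) ^ d * (((R + 1) * \<delta>) ^ d * V) = A2"
    using \<delta> by (simp add: A2_def power_mult_distrib power_divide)
   finally show ?thesis using wc \<delta> by (simp add: mult_left_mono)
  qed
  have total: "sum M J <= A1 * A2 * pabs lam f z" if J: "finite J" for J
  proof -
   have "sum M J = A1 * (LINT u|W. (\<Sum>j\<in>J. \<alpha> j * (indicator (N j) u * g u)))"
    unfolding M_def sum_distrib_left[symmetric]
    by (subst Bochner_Integration.integral_sum) (auto intro!: integrable_mult_right gNint)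
   also have "... <= A1 * (LINT u|W. A2 * g u)"
   proof (intro mult_left_mono integral_mono)
    fix u :: "'n cvec" assume "u \<in> space W"
    hence "(\<Sum>j\<in>J. \<alpha> j * indicator (N j) u) * g u <= A2 * g u"
     by (intro mult_right_mono overlap g0 J) simp
    thus "(\<Sum>j\<in>J. \<alpha> j * (indicator (N j) u * g u)) <= A2 * g u" by (simp add: sum_distrib_right mult.assoc)
   qed (use A1 gint gNint in \<open>auto intro!: Bochner_Integration.integrable_sum integrable_mult_right\<close>)
   also have "... = A1 * A2 * pabs lam f z"
    unfolding pplus_def g_def by (simp add: mult_ac)
   finally show ?thesis .
  qed
  have s: "summable M" by (rule summableI_nonneg_bounded[OF M0]) (rule total, simp)
  have "suminf M <= A1 * A2 * pabs lam f z" by (rule suminf_le_const[OF s]) (rule total, simp)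
  moreover have "majorizes f z M" unfolding majorizes_def using M0 single by blast
  ultimately show "\<exists>M. majorizes f z M \<and> summable M \<and> suminf M <= A1 * A2 * pabs lam f z" using s by blast
 qed
qed

definition domA :: real where
 "domA = (SOME A. A >= 0 \<and> (\<forall>f z. analytic_several f (ball 0 1) --> integrable W f --> norm z < 1 -->
  (\<exists>M. majorizes f z M \<and> summable M \<and> suminf M <= A * pabs lam f z)))"

lemma domA: "domA >= 0"
 "analytic_several f (ball 0 1) ==> integrable W f ==> norm z < 1 ==>
  \<exists>M. majorizes f z M \<and> summable M \<and> suminf M <= domA * pabs lam f z"
 using someI_ex[OF majorant, folded domA_def] by blast+

lemma box_ex:
 obtains k T where "dyadic_box_n TYPE('n) k T" "Q j = dbox (2 * CARD('n)) k T"
  "B j = (dyadic_box_n.bx k T :: ('n cvec) set)"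
proof -
 have "Q j \<in> dyadic_boxes (2 * CARD('n))" using ranQ by blast
 from dyadic_boxes_dbox[OF this] obtain k T where kT: "k \<in> dyadic_index (2 * CARD('n))" "T \<subseteq> {2..2 * CARD('n) - 1}" "Q j = dbox (2 * CARD('n)) k T"
  using two_le_d[where 'n = 'n] by blast
 have "dyadic_param (2 * CARD('n)) k T" by unfold_locales (use kT two_le_d[where 'n = 'n] in auto)
 hence l: "dyadic_box_n TYPE('n) k T" unfolding dyadic_box_n_def .
 show ?thesis by (rule that[OF l kT(3)]) (simp add: B kT(3) dyadic_box_n.bx_def[OF l])
qed

lemma compact_B: "compact (B j)" and B_ball: "B j \<subseteq> ball 0 1"
proof -
 obtain k T where l: "dyadic_box_n TYPE('n) k T" "B j = (dyadic_box_n.bx k T :: ('n cvec) set)" by (rule box_ex)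
 show "compact (B j)" "B j \<subseteq> ball 0 1" using dyadic_box_n.compact_bx[OF l(1)] dyadic_box_n.bx_ball[OF l(1)] l(2) by auto
qed

lemma controlled_cnj: "box_controlled C \<psi> ==> box_controlled C (\<lambda>z. cnj (\<psi> z))"
 unfolding box_controlled_def box_sup_cnj by (auto intro: locally_integrable_cnj)

lemma controlled_truncate:
 assumes "box_controlled C \<psi>" shows "box_controlled C (truncate_symbol \<rho> \<psi>)"
proof -
 have \<psi>: "locally_integrable_ball \<psi>" using assms by (simp add: box_controlled_def)
 have "box_sup lam (truncate_symbol \<rho> \<psi>) (Q j) <= box_sup lam \<psi> (Q j)" for j
 proof -
  obtain k T where l: "dyadic_box_n TYPE('n) k T" "Q j = dbox (2 * CARD('n)) k T" by (rule box_ex)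
  show ?thesis unfolding l(2) by (rule dyadic_box_n.box_sup_truncate[OF l(1) lam \<psi>])
 qed
 thus ?thesis using assms locally_integrable_truncate unfolding box_controlled_def by (meson order_trans)
qed

lemma term_integrable:
 assumes \<psi>: "locally_integrable_ball \<psi>" and f: "analytic_several f (ball 0 1)"
 shows "integrable W (\<lambda>w. \<psi> w * indicator (B j) w * f w)"
proof -
 obtain r where r: "0 < r" "r < 1" "\<And>x. x \<in> B j ==> norm x <= r"
  using compact_subset_ball_radius[OF compact_B B_ball] by blast
 obtain b where b: "\<And>u. norm u <= r ==> cmod (f u) <= b" using analytic_several_bounded[OF f r(2)] by blast
 have i: "integrable W (\<lambda>w. indicator (B j) w *\<^sub>R \<psi> w)"
  by (rule locally_integrable_compact[OF lam \<psi> compact_B B_ball])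
 hence [measurable]: "(\<lambda>w. indicator (B j) w *\<^sub>R \<psi> w) \<in> borel_measurable W" by auto
 have [measurable]: "f \<in> borel_measurable W" by (rule analytic_measurable[OF f])
 have "integrable W (\<lambda>w. (indicator (B j) w *\<^sub>R \<psi> w) * f w)"
 proof (rule integrable_dominated_on)
  show "integrable W (\<lambda>w. b * cmod (indicator (B j) w *\<^sub>R \<psi> w))" using i by (intro integrable_mult_right integrable_norm)
  fix w
  show "norm ((indicator (B j) w *\<^sub>R \<psi> w) * f w) <= norm (b * cmod (indicator (B j) w *\<^sub>R \<psi> w))"
  proof (cases "w \<in> B j")
   case True
   hence "cmod (f w) <= b" using r b by blast
   hence "cmod (\<psi> w) * cmod (f w) <= cmod (\<psi> w) * \<bar>b\<bar>" by (intro mult_left_mono) auto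
   thus ?thesis using True by (simp add: norm_mult abs_mult mult.commute)
  qed simp
 qed measurable
 moreover have "(indicator (B j) w *\<^sub>R \<psi> w) * f w = \<psi> w * indicator (B j) w * f w" for w
  by (simp add: indicator_def)
 ultimately show ?thesis by simp
qed

lemma term_analytic:
 assumes "locally_integrable_ball \<psi>" "analytic_several f (ball 0 1)"
 shows "analytic_several (\<lambda>z. tterm \<psi> f z j) (ball 0 1)"
 unfolding toeplitz_term_def by (rule bergman_proj_analytic_several[OF lam term_integrable[OF assms]])

text \<open>Consequently the Toeplitz operator is dominated pointwise by the positive Bergman operator.\<close>

lemma terms_summable:
 assumes \<psi>: "box_controlled C \<psi>" and f: "analytic_several f (ball 0 1)" "integrable W f" and z: "norm z < 1"
 shows "summable (\<lambda>j. cmod (tterm \<psi> f z j))"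
  and "(\<Sum>j\<in>J. cmod (tterm \<psi> f z j)) <= domA * C * pabs lam f z"
  and "cmod (toep \<psi> f z) <= domA * C * pabs lam f z"
proof -
 obtain M where M: "majorizes f z M" "summable M" "suminf M <= domA * pabs lam f z"
  using domA(2)[OF f z] by blast
 have C: "C >= 0" using \<psi> by (simp add: box_controlled_def)
 have t: "cmod (tterm \<psi> f z j) <= C * M j" for j
  using M(1) \<psi> by (auto simp: majorizes_def box_controlled_def)
 have CM: "summable (\<lambda>j. C * M j)" using M(2) by (rule summable_mult)
 show s: "summable (\<lambda>j. cmod (tterm \<psi> f z j))"
  by (rule summable_comparison_test'[OF CM, of 0]) (simp add: t)
 have le: "(\<Sum>j. cmod (tterm \<psi> f z j)) <= domA * C * pabs lam f z"
 proof -
  have "(\<Sum>j. cmod (tterm \<psi> f z j)) <= (\<Sum>j. C * M j)" by (rule suminf_le[OF t s CM])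
  also have "... = C * suminf M" by (rule suminf_mult[OF M(2)])
  also have "... <= C * (domA * pabs lam f z)" using M(3) C by (rule mult_left_mono)
  finally show ?thesis by (simp add: mult_ac)
 qed
 show "(\<Sum>j\<in>J. cmod (tterm \<psi> f z j)) <= domA * C * pabs lam f z"
 proof (cases "finite J")
  case True
  have "(\<Sum>j\<in>J. cmod (tterm \<psi> f z j)) <= (\<Sum>j. cmod (tterm \<psi> f z j))"
   by (rule sum_le_suminf[OF s True]) simp
  thus ?thesis using le by simp
 next
  case False
  have "pabs lam f z >= 0" by (rule pplus_nonneg) simp
  thus ?thesis using False domA(1) C by simp
 qed
 show "cmod (toep \<psi> f z) <= domA * C * pabs lam f z"
  unfolding toeplitz_def using summable_norm[OF s] le by simp
qed

lemma partial_sum_bound: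
 assumes "box_controlled C \<psi>" "analytic_several f (ball 0 1)" "integrable W f" "norm z < 1"
 shows "cmod (\<Sum>j<N. tterm \<psi> f z j) <= domA * C * pabs lam f z"
 using terms_summable(2)[OF assms, of "{..<N}"] norm_sum order_trans by blast

lemma partial_sum_tendsto:
 assumes "box_controlled C \<psi>" "analytic_several f (ball 0 1)" "integrable W f" "norm z < 1"
 shows "(\<lambda>N. \<Sum>j<N. tterm \<psi> f z j) \<longlonglongrightarrow> toep \<psi> f z"
 unfolding toeplitz_def by (rule summable_LIMSEQ[OF summable_norm_cancel[OF terms_summable(1)[OF assms]]])

lemma partial_sum_analytic:
 assumes "locally_integrable_ball \<psi>" "analytic_several f (ball 0 1)"
 shows "analytic_several (\<lambda>z. \<Sum>j<(N::nat). tterm \<psi> f z j) (ball 0 1)"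
proof (induction N)
 case 0
 have "analytic_several (\<lambda>z. 0 * f z) (ball 0 1)" by (rule analytic_several_cmult[OF assms(2)])
 thus ?case by simp
next
 case (Suc N)
 from analytic_several_add[OF this term_analytic[OF assms, of N]] show ?case by simp
qed

text \<open>The partial sums are analytic and locally bounded, uniformly in the number of terms.\<close>

lemma toeplitz_analytic:
 assumes \<psi>: "box_controlled C \<psi>" and f: "analytic_several f (ball 0 1)" "integrable W f"
 shows "analytic_several (toep \<psi> f) (ball 0 1)"
proof (rule analytic_several_limit[where F = "\<lambda>N z. \<Sum>j<N. tterm \<psi> f z j"])
 show "analytic_several (\<lambda>z. \<Sum>j<(N::nat). tterm \<psi> f z j) (ball 0 1)" for N
  using \<psi> f by (intro partial_sum_analytic) (simp_all add: box_controlled_def)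
 show "(\<lambda>N. \<Sum>j<N. tterm \<psi> f z j) \<longlonglongrightarrow> toep \<psi> f z" if "norm z < 1" for z
  by (rule partial_sum_tendsto[OF \<psi> f that])
 fix r :: real assume r: "0 < r" "r < 1"
 define K where "K = domA * C * ((1 - r) powr (- (real CARD('n) + 1 + lam)) * (LINT w|W. cmod (f w)))"
 have "cmod (\<Sum>j<N. tterm \<psi> f z j) <= K" if "norm z <= r" for N z
 proof -
  have C: "C >= 0" using \<psi> by (simp add: box_controlled_def)
  have "cmod (\<Sum>j<N. tterm \<psi> f z j) <= domA * C * pabs lam f z"
   using that r by (intro partial_sum_bound[OF \<psi> f]) simp
  also have "... <= K" unfolding K_def using that r C domA(1)
   by (intro mult_left_mono pplus_le_radius[OF lam integrable_norm[OF f(2)]]) auto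
  finally show ?thesis .
 qed
 thus "\<exists>K. \<forall>N z. norm z <= r --> cmod (\<Sum>j<N. tterm \<psi> f z j) <= K" by blast
qed

definition ppK :: "real => real" where
 "ppK p = (SOME K. K >= 0 \<and> (\<forall>f :: 'n cvec => real. f \<in> borel_measurable W \<and> (\<forall>w. f w >= 0) \<and>
   integrable W (\<lambda>w. f w powr p) -->
  integrable W (\<lambda>z. pplus lam f z powr p) \<and>
  (LINT z|W. pplus lam f z powr p) <= K * (LINT w|W. f w powr p)))"

lemma ppK:
 assumes p: "p > 1" and f: "f \<in> bergman_space lam p"
 shows "ppK p >= 0" "integrable W (\<lambda>z. pabs lam f z powr p)"
  "(LINT z|W. pabs lam f z powr p) <= ppK p * (LINT w|W. cmod (f w) powr p)"
proof -
 have m[measurable]: "f \<in> borel_measurable W" by (rule analytic_measurable[OF bergman_spaceD(1)[OF lam p f]])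
 have "(\<lambda>w. cmod (f w)) \<in> borel_measurable W \<and> (\<forall>w. cmod (f w) >= 0) \<and> integrable W (\<lambda>w. cmod (f w) powr p)"
  using bergman_spaceD(2)[OF lam p f] by simp
 thus "ppK p >= 0" "integrable W (\<lambda>z. pabs lam f z powr p)"
  "(LINT z|W. pabs lam f z powr p) <= ppK p * (LINT w|W. cmod (f w) powr p)"
  using someI_ex[OF pplus_bounded[OF lam p, where 'n = 'n], folded ppK_def] by blast+
qed

theorem toeplitz_bergman:
 assumes \<psi>: "box_controlled C \<psi>" and p: "p > 1" and f: "f \<in> bergman_space lam p"
 shows "toep \<psi> f \<in> bergman_space lam p"
  and "Lp_norm lam p (toep \<psi> f) <= ((domA * C) powr p * ppK p) powr (1 / p) * Lp_norm lam p f"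
proof -
 note D = bergman_spaceD[OF lam p f]
 note P = ppK[OF p f]
 have C: "C >= 0" using \<psi> by (simp add: box_controlled_def)
 have an: "analytic_several (toep \<psi> f) (ball 0 1)" by (rule toeplitz_analytic[OF \<psi> D(1,3)])
 have [measurable]: "toep \<psi> f \<in> borel_measurable W" by (rule analytic_measurable[OF an])
 have le: "cmod (toep \<psi> f z) powr p <= (domA * C) powr p * pabs lam f z powr p" if "z \<in> space W" for z
 proof -
  have "cmod (toep \<psi> f z) powr p <= (domA * C * pabs lam f z) powr p"
   using that p by (intro powr_mono2 terms_summable(3)[OF \<psi> D(1,3)]) auto
  also have "... = (domA * C) powr p * pabs lam f z powr p"
   using C domA(1) by (simp add: powr_mult pplus_nonneg)
  finally show ?thesis .
 qed
 have i: "integrable W (\<lambda>z. cmod (toep \<psi> f z) powr p)"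
 proof (rule integrable_dominated)
  show "integrable W (\<lambda>z. (domA * C) powr p * pabs lam f z powr p)" using P(2) by simp
  show "AE z in W. norm (cmod (toep \<psi> f z) powr p) <= norm ((domA * C) powr p * pabs lam f z powr p)"
   by (rule AE_I2) (use le in simp)
 qed measurable
 show "toep \<psi> f \<in> bergman_space lam p" by (rule bergman_spaceI[OF an i])
 have "(LINT z|W. cmod (toep \<psi> f z) powr p) <= (LINT z|W. (domA * C) powr p * pabs lam f z powr p)"
  by (rule integral_mono[OF i _ le]) (use P(2) in simp)
 also have "... <= (domA * C) powr p * (ppK p * (LINT w|W. cmod (f w) powr p))"
  using P(3) by (simp add: mult_left_mono)
 finally show "Lp_norm lam p (toep \<psi> f) <= ((domA * C) powr p * ppK p) powr (1 / p) * Lp_norm lam p f"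
  using p P(1) by (intro Lp_norm_le) (auto simp: mult.assoc)
qed

lemma term_lincomb:
 assumes \<psi>: "locally_integrable_ball \<psi>" and f: "analytic_several f (ball 0 1)" and g: "analytic_several g (ball 0 1)" and z: "norm z < 1"
 shows "tterm \<psi> (\<lambda>w. a * f w + b * g w) z j = a * tterm \<psi> f z j + b * tterm \<psi> g z j"
proof -
 note i = kc_integrable[OF lam term_integrable[OF \<psi> f] z] kc_integrable[OF lam term_integrable[OF \<psi> g] z]
 have "tterm \<psi> (\<lambda>w. a * f w + b * g w) z j
  = (LINT w|W. a * (\<psi> w * indicator (B j) w * f w * kc lam z w) + b * (\<psi> w * indicator (B j) w * g w * kc lam z w))"
  unfolding toeplitz_term_def bergman_proj_kc by (intro LINT_cong refl) (simp add: algebra_simps)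
 also have "... = a * tterm \<psi> f z j + b * tterm \<psi> g z j"
  unfolding toeplitz_term_def bergman_proj_kc
  by (subst Bochner_Integration.integral_add) (auto intro!: integrable_mult_right i)
 finally show ?thesis .
qed

lemma toeplitz_lincomb:
 assumes \<psi>: "box_controlled C \<psi>" and p: "p > 1" and f: "f \<in> bergman_space lam p" and g: "g \<in> bergman_space lam p" and z: "norm z < 1"
 shows "toep \<psi> (\<lambda>w. a * f w + b * g w) z = a * toep \<psi> f z + b * toep \<psi> g z"
proof -
 note F = bergman_spaceD[OF lam p f] and G = bergman_spaceD[OF lam p g]
 have \<psi>': "locally_integrable_ball \<psi>" using \<psi> by (simp add: box_controlled_def)
 have sf: "summable (tterm \<psi> f z)" and sg: "summable (tterm \<psi> g z)"
  using terms_summable(1)[OF \<psi> F(1,3) z] terms_summable(1)[OF \<psi> G(1,3) z] by (auto intro: summable_norm_cancel)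
 show ?thesis
  unfolding toeplitz_def term_lincomb[OF \<psi>' F(1) G(1) z]
  using sf sg by (simp add: suminf_add[symmetric] suminf_mult[symmetric] summable_mult)
qed

theorem toeplitz_bounded:
 assumes "box_controlled C \<psi>" "p > 1"
 shows "bergman_bounded lam p (toep \<psi>)"
 unfolding bergman_bounded_def using toeplitz_bergman[OF assms] toeplitz_lincomb[OF assms] by auto

lemma toeplitz_well_defined:
 assumes "box_controlled C \<psi>" "p > 1" shows "toeplitz_well_defined lam p B \<psi>"
 unfolding toeplitz_well_defined_def
proof (intro ballI)
 fix f :: "'n cvec => complex" and z :: "'n cvec" assume f: "f \<in> bergman_space lam p" and z: "z \<in> ball 0 1"
 show "summable (tterm \<psi> f z)"
  using z by (intro summable_norm_cancel[OF terms_summable(1)[OF assms(1) bergman_spaceD(1,3)[OF lam assms(2) f]]]) simp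
qed

section \<open>Truncated symbols\<close>

text \<open>Every box is eventually inside the ball of radius \<open>\<rho>\<close>, so each term becomes stationary; the common majorant of all
truncated symbols turns this into convergence of the sums (Tannery's theorem).\<close>

lemma truncate_pointwise:
 assumes \<psi>: "box_controlled C \<psi>" and f: "analytic_several f (ball 0 1)" "integrable W f" and z: "norm z < 1"
 shows "((\<lambda>\<rho>. toep (truncate_symbol \<rho> \<psi>) f z) \<longlongrightarrow> toep \<psi> f z) (at_left 1)"
proof -
 obtain M where M: "majorizes f z M" "summable M" using domA(2)[OF f z] by blast
 have t: "cmod (tterm (truncate_symbol \<rho> \<psi>) f z j) <= C * M j" for \<rho> j
  using M(1) controlled_truncate[OF \<psi>, of \<rho>] by (auto simp: majorizes_def box_controlled_def)
 have ev: "((\<lambda>\<rho>. tterm (truncate_symbol \<rho> \<psi>) f z j) \<longlongrightarrow> tterm \<psi> f z j) (at_left 1)" for j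
 proof (rule tendsto_eventually)
  obtain r where r: "0 < r" "r < 1" "\<And>x. x \<in> B j ==> norm x <= r"
   using compact_subset_ball_radius[OF compact_B B_ball] by blast
  have "tterm (truncate_symbol \<rho> \<psi>) f z j = tterm \<psi> f z j" if "r < \<rho>" for \<rho>
  proof -
   have "truncate_symbol \<rho> \<psi> w * indicator (B j) w * f w = \<psi> w * indicator (B j) w * f w" for w
    using r(3)[of w] that by (auto simp: truncate_symbol_def indicator_def)
   thus ?thesis by (simp only: toeplitz_term_def)
  qed
  thus "\<forall>\<^sub>F \<rho> in at_left 1. tterm (truncate_symbol \<rho> \<psi>) f z j = tterm \<psi> f z j"
   unfolding eventually_at_left_field using r by (intro exI[of _ r]) auto
 qed
 have "\<forall>\<^sub>F (j, \<rho>) in at_top \<times>\<^sub>F at_left (1::real). norm (tterm (truncate_symbol \<rho> \<psi>) f z j) <= C * M j"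
  using t by (intro always_eventually) auto
 from tannerys_theorem[OF ev this summable_mult[OF M(2)]] show ?thesis unfolding toeplitz_def by auto
qed

theorem truncate_limit:
 assumes \<psi>: "box_controlled C \<psi>" and p: "p > 1" and f: "f \<in> bergman_space lam p"
 shows "bergman_limit lam p (\<lambda>\<rho>. toep (truncate_symbol \<rho> \<psi>) f) (toep \<psi> f) (at_left 1)"
 unfolding bergman_limit_def
proof (intro conjI)
 note D = bergman_spaceD[OF lam p f]
 have t: "box_controlled C (truncate_symbol \<rho> \<psi>)" for \<rho> by (rule controlled_truncate[OF \<psi>])
 show 1: "toep \<psi> f \<in> bergman_space lam p" by (rule toeplitz_bergman(1)[OF \<psi> p f])
 show "\<forall>\<^sub>F \<rho> in at_left 1. toep (truncate_symbol \<rho> \<psi>) f \<in> bergman_space lam p"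
  by (intro always_eventually allI toeplitz_bergman(1)[OF t p f])
 show "((\<lambda>\<rho>. Lp_norm lam p (\<lambda>z. toep (truncate_symbol \<rho> \<psi>) f z - toep \<psi> f z)) \<longlongrightarrow> 0) (at_left 1)"
 proof (rule tendsto_at_left_sequentially[of 0])
  fix S :: "nat => real" assume S: "\<And>n. S n < 1" "S \<longlonglongrightarrow> 1"
  have fl: "filterlim S (at_left 1) sequentially"
   using S by (intro tendsto_imp_filterlim_at_left) (auto intro: always_eventually)
  show "(\<lambda>n. Lp_norm lam p (\<lambda>z. toep (truncate_symbol (S n) \<psi>) f z - toep \<psi> f z)) \<longlonglongrightarrow> 0"
  proof (rule Lp_norm_dominated_convergence[where G = "\<lambda>z. 2 * (domA * C) * pabs lam f z"])
   show "p > 0" using p by simp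
   show "(\<lambda>z. toep (truncate_symbol (S n) \<psi>) f z - toep \<psi> f z) \<in> borel_measurable W" for n
    by (intro borel_measurable_diff analytic_measurable toeplitz_analytic[OF t D(1,3)] toeplitz_analytic[OF \<psi> D(1,3)])
   have C: "C >= 0" using \<psi> by (simp add: box_controlled_def)
   show "integrable W (\<lambda>z. (2 * (domA * C) * pabs lam f z) powr p)"
    using ppK(2)[OF p f] C domA(1) by (simp add: powr_mult pplus_nonneg)
   fix z :: "'n cvec" assume z: "norm z < 1"
   show "cmod (toep (truncate_symbol (S n) \<psi>) f z - toep \<psi> f z) <= 2 * (domA * C) * pabs lam f z" for n
    using norm_triangle_ineq4[of "toep (truncate_symbol (S n) \<psi>) f z" "toep \<psi> f z"]
     terms_summable(3)[OF t D(1,3) z, of "S n"] terms_summable(3)[OF \<psi> D(1,3) z] by simp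
   have "(\<lambda>n. toep (truncate_symbol (S n) \<psi>) f z) \<longlonglongrightarrow> toep \<psi> f z"
    by (rule filterlim_compose[OF truncate_pointwise[OF \<psi> D(1,3) z] fl])
   thus "(\<lambda>n. toep (truncate_symbol (S n) \<psi>) f z - toep \<psi> f z) \<longlonglongrightarrow> 0"
    by (rule LIM_zero)
  qed
 qed simp
qed

end

section \<open>The adjoint\<close>

context dyadic_toeplitz
begin

text \<open>Fubini's theorem moves the projection to the other factor, where it reproduces \<open>g\<close>. The support condition
keeps the kernel bounded.\<close>

lemma proj_pairing:
 fixes h g :: "'n cvec => complex"
 assumes h: "integrable W h" and r: "r < 1" and hr: "\<And>w. h w \<noteq> 0 ==> norm w <= r"
  and g: "analytic_several g (ball 0 1)" and gi: "integrable W g"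
 shows "bergman_pairing lam (bergman_proj lam h) g = of_real (berg_const TYPE('n cvec) lam) * (LINT w|W. h w * cnj (g w))"
proof -
 interpret WW: pair_sigma_finite W W ..
 have [measurable]: "h \<in> borel_measurable W" "g \<in> borel_measurable W" "(\<lambda>w. cnj (g w)) \<in> borel_measurable W"
  using h gi borel_measurable_integrable[OF Bochner_Integration.integrable_cnj[OF gi]] by auto
 define k where "k = (1 - r) powr (- (real CARD('n) + 1 + lam))"
 have bound: "cmod (h w * kc lam z w * cnj (g z)) <= k * (cmod (h w) * cmod (g z))" if "z \<in> space W" "w \<in> space W" for z w
 proof (cases "h w = 0")
  case False
  have "kab lam z w = kab lam w z" by (rule kab_commute)
  also have "... <= (1 - norm w) powr (- (real CARD('n) + 1 + lam))" using that by (intro kab_bound[OF lam]) auto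
  also have "... <= k" unfolding k_def using hr[OF False] r lam by (intro powr_mono2') (auto simp: add_nonneg_nonneg)
  finally have "kab lam z w * (cmod (h w) * cmod (g z)) <= k * (cmod (h w) * cmod (g z))" by (intro mult_right_mono) auto
  thus ?thesis by (simp add: norm_mult cmod_kc mult_ac)
 qed simp
 have prod: "integrable (W \<Otimes>\<^sub>M W) (\<lambda>(z, w). k * (cmod (h w) * cmod (g z)))"
 proof (rule WW.Fubini_integrable)
  show "(\<lambda>(z, w). k * (cmod (h w) * cmod (g z))) \<in> borel_measurable (W \<Otimes>\<^sub>M W)" by measurable
  show "integrable W (\<lambda>z. \<integral>w. norm (case (z, w) of (z, w) => k * (cmod (h w) * cmod (g z))) \<partial>W)"
   using gi by (simp add: abs_mult integrable_norm)
  show "AE z in W. integrable W (\<lambda>w. case (z, w) of (z, w) => k * (cmod (h w) * cmod (g z)))"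
   using h by (intro AE_I2) (simp add: integrable_norm)
 qed
 have int: "integrable (W \<Otimes>\<^sub>M W) (\<lambda>(z, w). h w * kc lam z w * cnj (g z))"
 proof (rule integrable_dominated_on[OF prod])
  have fs: "fst \<in> borel_measurable (W \<Otimes>\<^sub>M W)" "snd \<in> borel_measurable (W \<Otimes>\<^sub>M W)"
   by (rule measurable_compose[OF measurable_fst weighted_vol_id] measurable_compose[OF measurable_snd weighted_vol_id])+
  have "(\<lambda>x. h (snd x)) \<in> borel_measurable (W \<Otimes>\<^sub>M W)" "(\<lambda>x. cnj (g (fst x))) \<in> borel_measurable (W \<Otimes>\<^sub>M W)" by measurable
  thus "(\<lambda>(z, w). h w * kc lam z w * cnj (g z)) \<in> borel_measurable (W \<Otimes>\<^sub>M W)"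
   unfolding split_beta' by (intro borel_measurable_times kc_measurable fs)
  fix x assume "x \<in> space (W \<Otimes>\<^sub>M W)"
  thus "norm (case x of (z, w) => h w * kc lam z w * cnj (g z)) <= norm (case x of (z, w) => k * (cmod (h w) * cmod (g z)))"
   using bound[of "fst x" "snd x"] by (auto simp: space_pair_measure split_beta simp del: space_weighted_vol intro: order_trans[OF _ abs_ge_self])
 qed
 have "bergman_pairing lam (bergman_proj lam h) g = (LINT z|W. (LINT w|W. h w * kc lam z w * cnj (g z)))"
  unfolding bergman_pairing_def bergman_proj_kc by simp
 also have "... = (LINT w|W. (LINT z|W. h w * kc lam z w * cnj (g z)))"
  by (rule WW.Fubini_integral[OF int, symmetric])
 also have "... = (LINT w|W. of_real (berg_const TYPE('n cvec) lam) * (h w * cnj (g w)))"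
 proof (rule LINT_cong[OF refl])
  fix w assume w: "w \<in> space W"
  have "(LINT z|W. h w * kc lam z w * cnj (g z)) = (LINT z|W. h w * cnj (g z * kc lam w z))"
   using w by (intro LINT_cong refl) (simp add: cnj_kc mult_ac)
  also have "... = h w * cnj (bergman_proj lam g w)"
   by (simp only: integral_mult_right_zero Bochner_Integration.integral_cnj bergman_proj_kc)
  also have "bergman_proj lam g w = of_real (berg_const TYPE('n cvec) lam) * g w"
   using w by (intro bergman_proj_analytic[OF lam g gi]) simp
  finally show "(LINT z|W. h w * kc lam z w * cnj (g z)) = of_real (berg_const TYPE('n cvec) lam) * (h w * cnj (g w))"
   by (simp add: mult_ac)
 qed
 also have "... = of_real (berg_const TYPE('n cvec) lam) * (LINT w|W. h w * cnj (g w))" by simp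
 finally show ?thesis .
qed

lemma pairing_cnj: "bergman_pairing lam f g = cnj (bergman_pairing lam g f)"
proof -
 have "cnj (bergman_pairing lam g f) = (LINT z|weighted_vol lam. cnj (g z * cnj (f z)))"
  unfolding bergman_pairing_def by (rule Bochner_Integration.integral_cnj[symmetric])
 thus ?thesis unfolding bergman_pairing_def by (simp add: mult.commute)
qed

lemma term_pairing:
 assumes \<psi>: "locally_integrable_ball \<psi>" and f: "analytic_several f (ball 0 1)" "integrable W f"
  and g: "analytic_several g (ball 0 1)" "integrable W g"
 shows "bergman_pairing lam (\<lambda>z. tterm \<psi> f z j) g = bergman_pairing lam f (\<lambda>z. tterm (\<lambda>z. cnj (\<psi> z)) g z j)"
proof -
 obtain r where r: "0 < r" "r < 1" "\<And>x. x \<in> B j ==> norm x <= r"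
  using compact_subset_ball_radius[OF compact_B B_ball] by blast
 let ?c = "of_real (berg_const TYPE('n cvec) lam) :: complex"
 have 1: "bergman_pairing lam (\<lambda>z. tterm \<psi> f z j) g = ?c * (LINT w|W. (\<psi> w * indicator (B j) w * f w) * cnj (g w))"
  unfolding toeplitz_term_def
  by (rule proj_pairing[OF term_integrable[OF \<psi> f(1)] r(2) _ g]) (use r(3) in \<open>auto simp: indicator_def split: if_splits\<close>)
 have 2: "bergman_pairing lam (\<lambda>z. tterm (\<lambda>z. cnj (\<psi> z)) g z j) f = ?c * (LINT w|W. (cnj (\<psi> w) * indicator (B j) w * g w) * cnj (f w))"
  unfolding toeplitz_term_def
  by (rule proj_pairing[OF term_integrable[OF locally_integrable_cnj[OF \<psi>] g(1)] r(2) _ f]) (use r(3) in \<open>auto simp: indicator_def split: if_splits\<close>)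
 have "bergman_pairing lam f (\<lambda>z. tterm (\<lambda>z. cnj (\<psi> z)) g z j) = cnj (?c * (LINT w|W. (cnj (\<psi> w) * indicator (B j) w * g w) * cnj (f w)))"
  by (subst pairing_cnj) (simp only: 2)
 also have "... = ?c * (LINT w|W. cnj ((cnj (\<psi> w) * indicator (B j) w * g w) * cnj (f w)))"
  unfolding complex_cnj_mult[of ?c] Bochner_Integration.integral_cnj by simp
 also have "(LINT w|W. cnj ((cnj (\<psi> w) * indicator (B j) w * g w) * cnj (f w))) = (LINT w|W. (\<psi> w * indicator (B j) w * f w) * cnj (g w))"
  by (intro LINT_cong refl) (simp add: indicator_def mult_ac)
 finally show ?thesis using 1 by simp
qed

text \<open>The partial sums are dominated by \<open>pplus\<close> of \<open>|f|\<close>, which pairs integrably with \<open>|g|\<close> by Hoelder's inequality.\<close>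

lemma toeplitz_pairing_sums:
 assumes \<psi>: "box_controlled C \<psi>" and p: "p > 1" and q: "q > 1" and pq: "1 / p + 1 / q = 1"
  and f: "f \<in> bergman_space lam p" and g: "g \<in> bergman_space lam q"
 shows "(\<lambda>j. bergman_pairing lam (\<lambda>z. tterm \<psi> f z j) g) sums bergman_pairing lam (toep \<psi> f) g"
proof -
 note F = bergman_spaceD[OF lam p f] and G = bergman_spaceD[OF lam q g]
 have \<psi>': "locally_integrable_ball \<psi>" and C: "C >= 0" using \<psi> by (auto simp: box_controlled_def)
 define D where "D z = cmod (g z) * (domA * C * pabs lam f z)" for z
 have mg[measurable]: "g \<in> borel_measurable W" "(\<lambda>w. cnj (g w)) \<in> borel_measurable W"
  using analytic_measurable[OF G(1)] borel_measurable_integrable[OF Bochner_Integration.integrable_cnj[OF G(3)]] by auto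
 have mf[measurable]: "f \<in> borel_measurable W" by (rule analytic_measurable[OF F(1)])
 have [measurable]: "pabs lam f \<in> borel_measurable W" by (rule pplus_measurable[OF lam]) measurable
 have mt[measurable]: "(\<lambda>z. tterm \<psi> f z j) \<in> borel_measurable W" for j
  by (rule analytic_measurable[OF term_analytic[OF \<psi>' F(1)]])
 have [measurable]: "toep \<psi> f \<in> borel_measurable W" by (rule analytic_measurable[OF toeplitz_analytic[OF \<psi> F(1,3)]])
 have "integrable W (\<lambda>z. cmod (g z) * pabs lam f z)"
  by (rule Holder_integral(1)[OF p q pq]) (use ppK(2)[OF p f] G(2) in \<open>auto intro: pplus_nonneg\<close>)
 hence "integrable W (\<lambda>z. (domA * C) * (cmod (g z) * pabs lam f z))" by (rule integrable_mult_right)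
 moreover have "D = (\<lambda>z. (domA * C) * (cmod (g z) * pabs lam f z))"
  by (rule ext) (simp add: D_def mult_ac)
 ultimately have Di: "integrable W D" by simp
 have ti: "integrable W (\<lambda>z. tterm \<psi> f z j * cnj (g z))" for j
 proof (rule integrable_dominated_on[OF Di])
  fix z assume "z \<in> space W"
  hence "cmod (tterm \<psi> f z j) <= domA * C * pabs lam f z"
   using terms_summable(2)[OF \<psi> F(1,3), of z "{j}"] by simp
  hence "cmod (g z) * cmod (tterm \<psi> f z j) <= D z" unfolding D_def by (intro mult_left_mono) auto
  thus "norm (tterm \<psi> f z j * cnj (g z)) <= norm (D z)" by (simp add: norm_mult mult.commute)
 qed measurable
 have "(\<lambda>N. \<integral>z. (\<Sum>j<N. tterm \<psi> f z j) * cnj (g z) \<partial>W) \<longlonglongrightarrow> (LINT z|W. toep \<psi> f z * cnj (g z))"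
 proof (rule integral_dominated_convergence[OF _ _ Di])
  show "AE z in W. (\<lambda>N. (\<Sum>j<N. tterm \<psi> f z j) * cnj (g z)) \<longlonglongrightarrow> toep \<psi> f z * cnj (g z)"
   by (rule AE_I2) (auto intro!: tendsto_mult_right partial_sum_tendsto[OF \<psi> F(1,3)])
  show "AE z in W. norm ((\<Sum>j<N. tterm \<psi> f z j) * cnj (g z)) <= D z" for N
  proof (rule AE_I2)
   fix z assume "z \<in> space W"
   hence "cmod (\<Sum>j<N. tterm \<psi> f z j) <= domA * C * pabs lam f z"
    by (intro partial_sum_bound[OF \<psi> F(1,3)]) simp
   hence "cmod (g z) * cmod (\<Sum>j<N. tterm \<psi> f z j) <= D z" unfolding D_def by (intro mult_left_mono) auto
   thus "norm ((\<Sum>j<N. tterm \<psi> f z j) * cnj (g z)) <= D z" by (simp add: norm_mult mult.commute)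
  qed
 qed measurable
 moreover have "(LINT z|W. (\<Sum>j<N. tterm \<psi> f z j) * cnj (g z)) = (\<Sum>j<N. bergman_pairing lam (\<lambda>z. tterm \<psi> f z j) g)" for N
  unfolding sum_distrib_right bergman_pairing_def by (rule Bochner_Integration.integral_sum[OF ti])
 ultimately show ?thesis unfolding sums_def bergman_pairing_def[of lam "toep \<psi> f"] by simp
qed

text \<open>Termwise, moving the projection across the pairing turns \<open>\<psi>\<close> into its conjugate; both series
converge to the pairings.\<close>

theorem toeplitz_adjoint:
 assumes \<psi>: "box_controlled C \<psi>" and p: "p > 1" and q: "q > 1" and pq: "1 / p + 1 / q = 1"
 shows "bergman_adjoint lam p q (toep \<psi>) (toep (\<lambda>z. cnj (\<psi> z)))"
 unfolding bergman_adjoint_def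
proof (intro conjI ballI)
 note c = controlled_cnj[OF \<psi>]
 show "bergman_bounded lam q (toep (\<lambda>z. cnj (\<psi> z)))" by (rule toeplitz_bounded[OF c q])
 fix f g :: "'n cvec => complex" assume f: "f \<in> bergman_space lam p" and g: "g \<in> bergman_space lam q"
 note F = bergman_spaceD[OF lam p f] and G = bergman_spaceD[OF lam q g]
 have \<psi>': "locally_integrable_ball \<psi>" using \<psi> by (auto simp: box_controlled_def)
 have pq': "1 / q + 1 / p = 1" using pq by simp
 have "(\<lambda>j. cnj (bergman_pairing lam (\<lambda>z. tterm (\<lambda>z. cnj (\<psi> z)) g z j) f)) sums cnj (bergman_pairing lam (toep (\<lambda>z. cnj (\<psi> z)) g) f)"
  using toeplitz_pairing_sums[OF c q p pq' g f] by (simp add: sums_cnj)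
 hence "(\<lambda>j. bergman_pairing lam (\<lambda>z. tterm \<psi> f z j) g) sums bergman_pairing lam f (toep (\<lambda>z. cnj (\<psi> z)) g)"
  unfolding term_pairing[OF \<psi>' F(1,3) G(1,3)] pairing_cnj[symmetric] .
 from sums_unique2[OF toeplitz_pairing_sums[OF \<psi> p q pq f g] this]
 show "bergman_pairing lam (toep \<psi> f) g = bergman_pairing lam f (toep (\<lambda>z. cnj (\<psi> z)) g)" .
qed

lemma bergman_space_kernel:
 fixes z :: "'n cvec"
 assumes p: "p > 0" and z: "norm z < 1"
 shows "(\<lambda>w. kc lam w z) \<in> bergman_space lam p"
proof (rule bergman_spaceI)
 show an: "analytic_several (\<lambda>w. kc lam w z) (ball 0 1)" unfolding kc_def by (rule kernel_analytic[OF z])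
 have [measurable]: "(\<lambda>w. kc lam w z) \<in> borel_measurable W" by (rule analytic_measurable[OF an])
 define k where "k = (1 - norm z) powr (- (real CARD('n) + 1 + lam))"
 show "integrable W (\<lambda>w. cmod (kc lam w z) powr p)"
 proof (rule W.integrable_const_bound[where B = "k powr p"])
  show "AE w in W. norm (cmod (kc lam w z) powr p) <= k powr p"
  proof (rule AE_I2)
   fix w assume "w \<in> space W"
   hence "kab lam z w <= k" unfolding k_def by (intro kab_bound[OF lam z]) simp
   thus "norm (cmod (kc lam w z) powr p) <= k powr p" using p by (simp add: cmod_kc kab_commute[of lam w z] powr_mono2)
  qed
 qed measurable
qed

text \<open>Kernels are bounded on the ball for fixed \<open>z\<close>, hence available as test functions, and pairing with them evaluates
at \<open>z\<close>.\<close>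

lemma pairing_kernel:
 fixes z :: "'n cvec"
 assumes q: "q > 1" and g: "g \<in> bergman_space lam q" and z: "norm z < 1"
 shows "bergman_pairing lam (\<lambda>w. kc lam w z) g = cnj (of_real (berg_const TYPE('n cvec) lam) * g z)"
proof -
 note G = bergman_spaceD[OF lam q g]
 have "bergman_pairing lam (\<lambda>w. kc lam w z) g = (LINT w|W. cnj (g w * kc lam z w))"
  unfolding bergman_pairing_def using z by (intro LINT_cong refl) (simp add: cnj_kc mult.commute)
 also have "... = cnj (bergman_proj lam g z)" unfolding Bochner_Integration.integral_cnj bergman_proj_kc ..
 also have "bergman_proj lam g z = of_real (berg_const TYPE('n cvec) lam) * g z"
  using z by (intro bergman_proj_analytic[OF lam G(1,3)]) simp
 finally show ?thesis .
qed

lemma bergman_adjoint_unique: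
 fixes z :: "'n cvec"
 assumes p: "p > 1" and q: "q > 1" and S: "bergman_adjoint lam p q T S" and S': "bergman_adjoint lam p q T S'"
  and g: "g \<in> bergman_space lam q" and z: "norm z < 1"
 shows "S g z = (S' g z :: complex)"
proof -
 have k: "(\<lambda>w. kc lam w z) \<in> bergman_space lam p" using p by (intro bergman_space_kernel z) simp
 have Sg: "S g \<in> bergman_space lam q" "S' g \<in> bergman_space lam q"
  using S S' g by (auto simp: bergman_adjoint_def bergman_bounded_def)
 have "bergman_pairing lam (\<lambda>w. kc lam w z) (S g) = bergman_pairing lam (\<lambda>w. kc lam w z) (S' g)"
  using S S' g k unfolding bergman_adjoint_def by metis
 thus ?thesis
  unfolding pairing_kernel[OF q Sg(1) z] pairing_kernel[OF q Sg(2) z]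
  using berg_const_pos[OF lam, where 'n = 'n] by simp
qed

lemma bergman_limit_cong:
 assumes "bergman_limit lam q F g Fl" "h \<in> bergman_space lam q" "\<And>z. norm z < 1 ==> g z = (h z :: complex)"
 shows "bergman_limit lam q F h Fl"
proof -
 have "Lp_norm lam q (\<lambda>z. F i z - g z) = Lp_norm lam q (\<lambda>z. F i z - h z)" for i
  unfolding Lp_norm_def by (intro arg_cong[where f = "\<lambda>x. x powr (1 / q)"] LINT_cong refl) (simp add: assms(3))
 thus ?thesis using assms(1,2) unfolding bergman_limit_def by simp
qed

end

section \<open>Compactness of the Toeplitz operator\<close>

lemma countable_dense_ball:
 "\<exists>D :: (complex ^ 'n) set. countable D \<and> (\<forall>a e. e > 0 --> (\<exists>d\<in>D. norm (d - a) < e))"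
proof -
 obtain D :: "(complex ^ 'n) set" where D: "countable D" "\<And>X. open X ==> X \<noteq> {} ==> \<exists>d\<in>D. d \<in> X"
  using countable_dense_exists[where 'a = "complex ^ 'n"] by blast
 have "\<exists>d\<in>D. norm (d - a) < e" if "e > 0" for a e
  using D(2)[of "ball a e"] that by (auto simp: dist_norm norm_minus_commute)
 thus ?thesis using D(1) by blast
qed

text \<open>Restrict to the complex line through both points.\<close>

lemma analytic_equicontinuous:
 fixes f :: "complex ^ 'n => complex"
 assumes f: "analytic_several f (ball 0 1)" and a: "norm a + \<delta> <= r" "r < 1" "\<delta> > 0"
  and K: "\<And>u. norm u <= r ==> cmod (f u) <= K" and b: "norm (b - a) < \<delta> / 2"
 shows "cmod (f b - f a) <= 4 * K / \<delta> * norm (b - a)"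
proof (cases "b = a")
 case False
 define t where "t = norm (b - a)"
 have t: "t > 0" using False by (simp add: t_def)
 define u where "u = of_real (1 / t) *s (b - a)"
 have u: "norm u = 1" unfolding u_def norm_vector_smult using t by (simp add: t_def norm_divide)
 have bu: "a + of_real t *s u = b" unfolding u_def using t by (simp add: vector_smult_assoc)
 have in_r: "norm (a + \<zeta> *s u) <= r" if "\<zeta> \<in> ball 0 \<delta>" for \<zeta>
  using norm_triangle_ineq[of a "\<zeta> *s u"] that u a by (simp add: norm_vector_smult)
 have "(\<lambda>\<zeta>. f (a + \<zeta> *s u)) holomorphic_on ball 0 \<delta>"
 proof (rule analytic_several_slice[OF f open_ball])
  fix \<zeta> :: complex assume "\<zeta> \<in> ball 0 \<delta>"
  from in_r[OF this] show "a + \<zeta> *s u \<in> ball 0 1" using a(2) by simp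
 qed
 from holomorphic_lipschitz[OF this a(3), of K "of_real t" 0]
 have "cmod (f (a + of_real t *s u) - f (a + 0 *s u)) <= 4 * K / \<delta> * cmod (of_real t - 0)"
  using K in_r b t a by (simp add: t_def)
 thus ?thesis unfolding bu using t by (simp add: t_def)
qed simp

text \<open>Norm-bounded sequences are bounded on smaller balls, hence equicontinuous there. A diagonal
subsequence converging on a countable dense set converges everywhere, the limit is analytic, and Fatou's lemma bounds its norm.\<close>

theorem bergman_montel:
 fixes F :: "nat => complex ^ 'n => complex"
 assumes lam: "lam > -1" and p: "p > 1" and F: "\<And>k. F k \<in> bergman_space lam p"
  and M: "\<And>k. (LINT w|weighted_vol lam. cmod (F k w) powr p) <= M"
 shows "\<exists>f r. strict_mono r \<and> f \<in> bergman_space lam p \<and> (LINT w|weighted_vol lam. cmod (f w) powr p) <= M \<and>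
  (\<forall>z. norm z < 1 --> (\<lambda>k. F (r k) z) \<longlonglongrightarrow> f z) \<and>
  (\<forall>\<rho><1. \<exists>K. \<forall>k z. norm z <= \<rho> --> cmod (F k z) <= K)"
proof -
 \<comment> \<open>The summand 1 keeps the normalising divisor below positive.\<close>
 define K where "K \<rho> = (1 - \<rho>) powr (- (real CARD('n) + 1 + lam))
  * (measure (weighted_vol lam) (ball (0 :: complex ^ 'n) 1) + M) / berg_const TYPE(complex ^ 'n) lam + 1" for \<rho>
 have M0: "M >= 0" using M[of 0] by (rule order_trans[rotated]) simp
 have bc: "berg_const TYPE(complex ^ 'n) lam > 0" by (rule berg_const_pos[OF lam])
 have K0: "K \<rho> > 0" for \<rho> unfolding K_def using M0 bc by (intro add_nonneg_pos) auto
 note D = bergman_spaceD[OF lam p F]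
 have K: "cmod (F k z) <= K \<rho>" if "norm z <= \<rho>" "\<rho> < 1" for k z \<rho>
 proof -
  have "cmod (F k z) <= (1 - \<rho>) powr (- (real CARD('n) + 1 + lam)) * (LINT w|weighted_vol lam. cmod (F k w)) / berg_const TYPE(complex ^ 'n) lam"
   by (rule bergman_point_bound[OF lam D(1,3) that])
  also have "... <= (1 - \<rho>) powr (- (real CARD('n) + 1 + lam)) * (measure (weighted_vol lam) (ball (0 :: complex ^ 'n) 1) + M) / berg_const TYPE(complex ^ 'n) lam"
   using integral_cmod_le[OF lam p F, of k] M[of k] bc by (intro divide_right_mono mult_left_mono) auto
  finally show ?thesis by (simp add: K_def)
 qed
 obtain S :: "(complex ^ 'n) set" where S: "countable S" "\<And>a e. e > 0 ==> \<exists>d\<in>S. norm (d - a) < e"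
  using countable_dense_ball by blast
 have "countable (S \<inter> ball 0 1)" using S(1) by auto
 then obtain r where r: "strict_mono r" "\<And>x. x \<in> S \<inter> ball 0 1 ==> \<exists>l. (\<lambda>n. F (r n) x / of_real (K (norm x))) \<longlonglongrightarrow> l"
 proof (rule function_convergent_subsequence[where f = "\<lambda>n x. F n x / of_real (K (norm x))" and M = 1])
  fix n and x :: "complex ^ 'n" assume "x \<in> S \<inter> ball 0 1"
  hence "cmod (F n x) <= K (norm x)" by (intro K) auto
  thus "norm (F n x / of_real (K (norm x))) <= 1" using K0[of "norm x"] by (simp add: norm_divide)
 qed blast
 have conv_S: "Cauchy (\<lambda>n. F (r n) x)" if "x \<in> S" "norm x < 1" for x
 proof -
  have "x \<in> S \<inter> ball 0 1" using that by simp
  from r(2)[OF this] obtain l where "(\<lambda>n. F (r n) x / of_real (K (norm x))) \<longlonglongrightarrow> l" by blast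
  from tendsto_mult_right[OF this, of "of_real (K (norm x))"]
  have "(\<lambda>n. F (r n) x) \<longlonglongrightarrow> l * of_real (K (norm x))" using K0[of "norm x"] by simp
  thus ?thesis by (intro LIMSEQ_imp_Cauchy)
 qed
 have cauchy: "Cauchy (\<lambda>n. F (r n) z)" if z: "norm z < 1" for z
 proof (rule metric_CauchyI)
  fix e :: real assume e: "e > 0"
  define \<rho> where "\<rho> = (1 + norm z) / 2"
  define \<delta> where "\<delta> = (1 - norm z) / 2"
  have \<rho>: "norm z + \<delta> <= \<rho>" "\<rho> < 1" "\<delta> > 0" using z by (auto simp: \<rho>_def \<delta>_def field_simps)
  have L: "4 * K \<rho> / \<delta> > 0" using K0[of \<rho>] \<rho> by simp
  have "e / 3 / (4 * K \<rho> / \<delta>) > 0" by (rule divide_pos_pos[OF _ L]) (use e in simp)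
  hence "min (\<delta> / 2) (e / 3 / (4 * K \<rho> / \<delta>)) > 0" using \<rho> by (simp only: min_less_iff_conj) simp
  then obtain d where d: "d \<in> S" "norm (d - z) < min (\<delta> / 2) (e / 3 / (4 * K \<rho> / \<delta>))" using S(2) by blast
  have eq: "cmod (F k d - F k z) < e / 3" for k
  proof -
   have "cmod (F k d - F k z) <= 4 * K \<rho> / \<delta> * norm (d - z)"
    using d \<rho> K by (intro analytic_equicontinuous[OF D(1)]) auto
   also have "... < 4 * K \<rho> / \<delta> * (e / 3 / (4 * K \<rho> / \<delta>))" using d L by (intro mult_strict_left_mono) auto
   also have "... = e / 3" using L by (metis less_irrefl nonzero_mult_div_cancel_left times_divide_eq_right)
   finally show ?thesis .
  qed
  have "norm d <= norm z + norm (d - z)" by (rule norm_triangle_sub)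
  hence "norm d < 1" using d(2) \<rho> by auto
  from metric_CauchyD[OF conv_S[OF d(1) this], of "e / 3"] e
  obtain N where N: "\<And>m n. m >= N ==> n >= N ==> dist (F (r m) d) (F (r n) d) < e / 3" by auto
  show "\<exists>N. \<forall>m\<ge>N. \<forall>n\<ge>N. dist (F (r m) z) (F (r n) z) < e"
  proof (intro exI[of _ N] allI impI)
   fix m n assume "m >= N" "n >= N"
   hence "dist (F (r m) d) (F (r n) d) < e / 3" by (rule N)
   moreover have "dist (F (r m) z) (F (r m) d) < e / 3" "dist (F (r n) d) (F (r n) z) < e / 3"
    using eq[of "r m"] eq[of "r n"] by (simp_all add: dist_norm norm_minus_commute)
   moreover have "dist (F (r m) z) (F (r n) z) <= dist (F (r m) z) (F (r m) d) + (dist (F (r m) d) (F (r n) d) + dist (F (r n) d) (F (r n) z))"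
    by (meson add_left_mono dist_triangle order_trans)
   ultimately show "dist (F (r m) z) (F (r n) z) < e" by linarith
  qed
 qed
 define f where "f z = lim (\<lambda>n. F (r n) z)" for z
 have lim: "(\<lambda>n. F (r n) z) \<longlonglongrightarrow> f z" if "norm z < 1" for z
  unfolding f_def using cauchy[OF that] by (simp add: Cauchy_convergent_iff convergent_LIMSEQ_iff)
 have an: "analytic_several f (ball 0 1)"
 proof (rule analytic_several_limit[where F = "\<lambda>n. F (r n)"])
  show "\<exists>B. \<forall>k z. norm z <= \<rho> --> cmod (F (r k) z) <= B" if "0 < \<rho>" "\<rho> < 1" for \<rho>
   using K that by blast
 qed (use D(1) lim in auto)
 have [measurable]: "F k \<in> borel_measurable (weighted_vol lam)" for k by (rule analytic_measurable[OF D(1)])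
 have [measurable]: "f \<in> borel_measurable (weighted_vol lam)" by (rule analytic_measurable[OF an])
 have nn: "(\<integral>\<^sup>+w. ennreal (cmod (f w) powr p) \<partial>weighted_vol lam) <= ennreal M"
 proof -
  have "(\<integral>\<^sup>+w. ennreal (cmod (f w) powr p) \<partial>weighted_vol lam) = (\<integral>\<^sup>+w. liminf (\<lambda>n. ennreal (cmod (F (r n) w) powr p)) \<partial>weighted_vol lam)"
  proof (rule nn_integral_cong)
   fix w :: "complex ^ 'n" assume "w \<in> space (weighted_vol lam)"
   hence "(\<lambda>n. F (r n) w) \<longlonglongrightarrow> f w" by (intro lim) simp
   hence "(\<lambda>n. ennreal (cmod (F (r n) w) powr p)) \<longlonglongrightarrow> ennreal (cmod (f w) powr p)"
    using p by (intro tendsto_ennrealI tendsto_powr' tendsto_norm tendsto_const) auto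
   thus "ennreal (cmod (f w) powr p) = liminf (\<lambda>n. ennreal (cmod (F (r n) w) powr p))"
    by (rule lim_imp_Liminf[OF sequentially_bot, symmetric])
  qed
  also have "... <= liminf (\<lambda>n. \<integral>\<^sup>+w. ennreal (cmod (F (r n) w) powr p) \<partial>weighted_vol lam)"
   by (rule nn_integral_liminf) measurable
  also have "... <= ennreal M"
  proof (rule Liminf_le)
   have "(\<integral>\<^sup>+w. ennreal (cmod (F (r n) w) powr p) \<partial>weighted_vol lam) <= ennreal M" for n
    using M[of "r n"] D(2)[of "r n"] by (subst nn_integral_eq_integral) (auto intro: ennreal_leI)
   thus "\<forall>\<^sub>F n in sequentially. (\<integral>\<^sup>+w. ennreal (cmod (F (r n) w) powr p) \<partial>weighted_vol lam) <= ennreal M" by simp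
  qed simp
  finally show ?thesis .
 qed
 have fi: "integrable (weighted_vol lam) (\<lambda>w. cmod (f w) powr p)"
  by (rule integrableI_bounded) (use nn in \<open>auto intro: le_less_trans\<close>)
 have "ennreal (LINT w|weighted_vol lam. cmod (f w) powr p) <= ennreal M"
  using nn by (subst nn_integral_eq_integral[OF fi, symmetric]) auto
 hence fM: "(LINT w|weighted_vol lam. cmod (f w) powr p) <= M" using M0 by (simp add: ennreal_le_iff)
 show ?thesis
  using r(1) bergman_spaceI[OF an fi] fM lim K by blast
qed

context dyadic_toeplitz
begin

text \<open>A single term only involves a compact box, where the kernel is bounded in both variables and the
functions converge boundedly.\<close>

lemma term_uniform_limit:
 fixes H :: "nat => 'n cvec => complex"
 assumes \<psi>: "locally_integrable_ball \<psi>" and H: "\<And>k. analytic_several (H k) (ball 0 1)"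
  and bd: "\<And>\<rho>. \<rho> < 1 ==> \<exists>K. \<forall>k z. norm z <= \<rho> --> cmod (H k z) <= K"
  and lim: "\<And>z. norm z < 1 ==> (\<lambda>k. H k z) \<longlonglongrightarrow> 0"
 shows "\<exists>c. c \<longlonglongrightarrow> 0 \<and> (\<forall>k z. norm z < 1 --> cmod (tterm \<psi> (H k) z j) <= c k)"
proof -
 obtain r where r: "0 < r" "r < 1" "\<And>x. x \<in> B j ==> norm x <= r"
  using compact_subset_ball_radius[OF compact_B B_ball] by blast
 obtain K where K: "\<And>k z. norm z <= r ==> cmod (H k z) <= K" using bd[OF r(2)] by blast
 define t where "t k w = \<psi> w * indicator (B j) w * H k w" for k w
 have ti: "integrable W (t k)" for k unfolding t_def[abs_def] by (rule term_integrable[OF \<psi> H])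
 define s where "s = (1 - r) powr (- (real CARD('n) + 1 + lam))"
 define c where "c k = s * (LINT w|W. cmod (t k w))" for k
 have i: "integrable W (\<lambda>w. indicator (B j) w *\<^sub>R \<psi> w)"
  by (rule locally_integrable_compact[OF lam \<psi> compact_B B_ball])
 have "(\<lambda>k. \<integral>w. cmod (t k w) \<partial>W) \<longlonglongrightarrow> (LINT w|W. (0::real))"
 proof (rule integral_dominated_convergence)
  show "integrable W (\<lambda>w. \<bar>K\<bar> * cmod (indicator (B j) w *\<^sub>R \<psi> w))" using i by (intro integrable_mult_right integrable_norm)
  show "(\<lambda>w. cmod (t k w)) \<in> borel_measurable W" for k using ti[of k] by auto
  show "AE w in W. (\<lambda>k. cmod (t k w)) \<longlonglongrightarrow> 0"
  proof (rule AE_I2)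
   fix w assume "w \<in> space W"
   hence "(\<lambda>k. H k w) \<longlonglongrightarrow> 0" by (intro lim) simp
   from tendsto_mult_left[OF this, of "\<psi> w * indicator (B j) w"]
   show "(\<lambda>k. cmod (t k w)) \<longlonglongrightarrow> 0" unfolding t_def by (intro tendsto_norm_zero) simp
  qed
  show "AE w in W. norm (cmod (t k w)) <= \<bar>K\<bar> * cmod (indicator (B j) w *\<^sub>R \<psi> w)" for k
  proof (rule AE_I2)
   fix w
   show "norm (cmod (t k w)) <= \<bar>K\<bar> * cmod (indicator (B j) w *\<^sub>R \<psi> w)"
   proof (cases "w \<in> B j")
    case True
    hence "cmod (H k w) <= \<bar>K\<bar>" using r(3) K by (meson abs_ge_self order_trans)
    hence "cmod (\<psi> w) * cmod (H k w) <= cmod (\<psi> w) * \<bar>K\<bar>" by (rule mult_left_mono) simp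
    thus ?thesis using True by (simp add: t_def norm_mult mult.commute)
   qed (simp add: t_def)
  qed
 qed simp
 hence "c \<longlonglongrightarrow> s * 0" unfolding c_def[abs_def] by (intro tendsto_mult_left) simp
 moreover have "cmod (tterm \<psi> (H k) z j) <= c k" if z: "norm z < 1" for k z
 proof -
  have "cmod (tterm \<psi> (H k) z j) <= pabs lam (t k) z"
   unfolding toeplitz_term_def t_def by (rule bergman_proj_bound)
  also have "... <= (LINT w|W. s * cmod (t k w))"
   unfolding pplus_def
  proof (rule integral_mono)
   show "integrable W (\<lambda>w. kab lam z w * cmod (t k w))" by (rule kab_mult_integrable[OF lam integrable_norm[OF ti] z])
   show "integrable W (\<lambda>w. s * cmod (t k w))" using ti by (intro integrable_mult_right integrable_norm)
   fix w
   show "kab lam z w * cmod (t k w) <= s * cmod (t k w)"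
   proof (cases "w \<in> B j")
    case True
    hence w: "norm w <= r" by (rule r(3))
    have "kab lam w z <= (1 - norm w) powr (- (real CARD('n) + 1 + lam))" using w r z by (intro kab_bound[OF lam]) auto
    also have "... <= s" unfolding s_def using w r lam by (intro powr_mono2') (auto simp: add_nonneg_nonneg)
    finally show ?thesis unfolding kab_commute[of lam z w] by (rule mult_right_mono) simp
   qed (simp add: t_def)
  qed
  also have "... = c k" by (simp add: c_def)
  finally show ?thesis .
 qed
 ultimately show ?thesis by (intro exI[of _ c]) simp
qed

text \<open>Only finitely many boxes have large box integrals; the others contribute with the factor \<open>\<epsilon>\<close>.\<close>

lemma toeplitz_bound_split:
 assumes \<psi>: "box_controlled C \<psi>" and f: "analytic_several f (ball 0 1)" "integrable W f" and z: "norm z < 1"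
  and e: "e >= 0" "\<And>j. j >= N ==> box_sup lam \<psi> (Q j) <= e * measure W (B j)"
 shows "cmod (toep \<psi> f z) <= (\<Sum>j<N. cmod (tterm \<psi> f z j)) + e * (domA * pabs lam f z)"
proof -
 obtain M where M: "majorizes f z M" "summable M" "suminf M <= domA * pabs lam f z"
  using domA(2)[OF f z] by blast
 have \<psi>': "locally_integrable_ball \<psi>" using \<psi> by (simp add: box_controlled_def)
 have M0: "M j >= 0" for j using M(1) by (simp add: majorizes_def)
 define a where "a j = cmod (tterm \<psi> f z j)" for j
 have t: "a j <= (if j \<in> {..<N} then a j else 0) + e * M j" for j
  using M(1) M0[of j] \<psi>' e by (auto simp: majorizes_def a_def)
 have sa: "summable a" unfolding a_def[abs_def] by (rule terms_summable(1)[OF \<psi> f z])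
 have s1: "(\<lambda>j. if j \<in> {..<N} then a j else 0) sums (\<Sum>j<N. a j)" by (rule sums_If_finite_set) simp
 have s2: "(\<lambda>j. e * M j) sums (e * suminf M)" using M(2) by (intro sums_mult summable_sums)
 have "cmod (toep \<psi> f z) <= suminf a"
  unfolding toeplitz_def a_def using sa by (intro summable_norm) (simp add: a_def[abs_def])
 also have "... <= (\<Sum>j<N. a j) + e * suminf M"
  by (rule sums_le[OF t summable_sums[OF sa] sums_add[OF s1 s2]])
 also have "... <= (\<Sum>j<N. a j) + e * (domA * pabs lam f z)"
  using M(3) e(1) by (intro add_left_mono mult_left_mono)
 finally show ?thesis by (simp add: a_def)
qed

text \<open>From a bounded sequence, \<open>bergman_montel\<close> extracts a pointwise convergent subsequence. The images of the differences
are small: the finitely many terms with large box integrals tend to zero uniformly, and the rest is \<open>\<epsilon>\<close> times a bounded quantity.\<close>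

theorem toeplitz_compact:
 assumes \<psi>: "box_controlled C \<psi>" and p: "p > 1"
  and van: "(\<lambda>j. box_sup lam \<psi> (Q j) / measure W (B j)) \<longlonglongrightarrow> 0"
 shows "bergman_compact lam p (toep \<psi>)"
 unfolding bergman_compact_def
proof (intro conjI allI impI)
 show "bergman_bounded lam p (toep \<psi>)" by (rule toeplitz_bounded[OF \<psi> p])
 fix F :: "nat => 'n cvec => complex"
 assume "range F \<subseteq> bergman_space lam p \<and> (\<exists>M. \<forall>k. Lp_norm lam p (F k) <= M)"
 then obtain M0 where F: "\<And>k. F k \<in> bergman_space lam p" and M0: "\<And>k. Lp_norm lam p (F k) <= M0" by blast
 define M where "M = M0 powr p"
 have M: "(LINT w|W. cmod (F k w) powr p) <= M" for k
  unfolding M_def using p by (intro integral_powr_of_Lp_norm M0) simp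
 obtain f r where r: "strict_mono r" and f: "f \<in> bergman_space lam p" and fM: "(LINT w|W. cmod (f w) powr p) <= M"
  and lim: "\<And>z. norm z < 1 ==> (\<lambda>k. F (r k) z) \<longlonglongrightarrow> f z"
  and bd: "\<And>\<rho>. \<rho> < 1 ==> \<exists>K. \<forall>k z. norm z <= \<rho> --> cmod (F k z) <= K"
  using bergman_montel[where F = F, OF lam p F M] by blast
 define H where "H k w = 1 * F (r k) w + (-1) * f w" for k w
 have Hb: "H k \<in> bergman_space lam p" for k
  unfolding H_def[abs_def] by (rule bergman_space_lincomb[OF lam p F f])
 note D = bergman_spaceD[OF lam p Hb] and Df = bergman_spaceD[OF lam p f] and DF = bergman_spaceD[OF lam p F]
 have TH: "toep \<psi> (H k) z = toep \<psi> (F (r k)) z - toep \<psi> f z" if "norm z < 1" for k z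
  unfolding H_def[abs_def] toeplitz_lincomb[OF \<psi> p F f that] by simp
 have \<psi>': "locally_integrable_ball \<psi>" and C: "C >= 0" using \<psi> by (auto simp: box_controlled_def)
 define M2 where "M2 = 2 powr p * (M + M)"
 have HM: "(LINT w|W. cmod (H k w) powr p) <= M2" for k
 proof -
  have "(LINT w|W. cmod (H k w) powr p) <= (LINT w|W. 2 powr p * (cmod (F (r k) w) powr p + cmod (f w) powr p))"
  proof (rule integral_mono)
   fix w
   have "cmod (H k w) powr p <= (cmod (F (r k) w) + cmod (f w)) powr p"
    using p norm_triangle_ineq4[of "F (r k) w" "f w"] by (intro powr_mono2) (auto simp: H_def)
   also have "... <= 2 powr p * (cmod (F (r k) w) powr p + cmod (f w) powr p)" using p by (intro add_powr_le) auto
   finally show "cmod (H k w) powr p <= 2 powr p * (cmod (F (r k) w) powr p + cmod (f w) powr p)" .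
  qed (use D Df DF in auto)
  also have "... = 2 powr p * ((LINT w|W. cmod (F (r k) w) powr p) + (LINT w|W. cmod (f w) powr p))"
   using Df DF by simp
  also have "... <= M2" unfolding M2_def using M[of "r k"] fM by (intro mult_left_mono add_mono) auto
  finally show ?thesis .
 qed
 have Hlim: "(\<lambda>k. H k z) \<longlonglongrightarrow> 0" if "norm z < 1" for z
  using LIM_zero[OF lim[OF that]] by (simp add: H_def)
 have Hbd: "\<exists>K. \<forall>k z. norm z <= \<rho> --> cmod (H k z) <= K" if \<rho>: "\<rho> < 1" for \<rho>
 proof -
  obtain K where K: "\<And>k z. norm z <= \<rho> ==> cmod (F k z) <= K" using bd[OF \<rho>] by blast
  obtain K' where K': "\<And>z. norm z <= \<rho> ==> cmod (f z) <= K'" using analytic_several_bounded[OF Df(1) \<rho>] by blast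
  have "cmod (H k z) <= K + K'" if "norm z <= \<rho>" for k z
   using norm_triangle_ineq4[of "F (r k) z" "f z"] K[OF that, of "r k"] K'[OF that] by (simp add: H_def)
  thus ?thesis by blast
 qed
 have "\<forall>j. \<exists>c. c \<longlonglongrightarrow> 0 \<and> (\<forall>k z. norm z < 1 --> cmod (tterm \<psi> (H k) z j) <= c k)"
  by (intro allI term_uniform_limit[OF \<psi>' D(1) Hbd Hlim])
 then obtain c where c: "\<And>j. c j \<longlonglongrightarrow> 0" "\<And>j k z. norm z < 1 ==> cmod (tterm \<psi> (H k) z j) <= c j k"
  by metis
 have c0: "c j k >= 0" for j k using c(2)[of 0 k j] norm_ge_zero order_trans by (metis norm_zero zero_less_one)
 have Tm[measurable]: "toep \<psi> (H k) \<in> borel_measurable W" for k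
  by (rule analytic_measurable[OF toeplitz_analytic[OF \<psi> D(1,3)]])
 have key: "(LINT z|W. cmod (toep \<psi> (H k) z) powr p)
   <= 2 powr p * ((\<Sum>j<N. c j k) powr p * measure W (ball 0 1)) + e powr p * (2 powr p * domA powr p * ppK p * M2)"
  if e: "e > 0" "\<And>j. j >= N ==> box_sup lam \<psi> (Q j) <= e * measure W (B j)" for k N e
 proof -
  define PP where "PP z = pabs lam (H k) z" for z
  define S where "S = (\<Sum>j<N. c j k)"
  have S0: "S >= 0" unfolding S_def by (intro sum_nonneg c0)
  have PP0: "PP z >= 0" for z unfolding PP_def by (rule pplus_nonneg) simp
  note P = ppK[OF p Hb[of k], folded PP_def]
  have le: "cmod (toep \<psi> (H k) z) powr p <= 2 powr p * (S powr p + e powr p * domA powr p * PP z powr p)" if "z \<in> space W" for z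
  proof -
   have z: "norm z < 1" using that by simp
   have "cmod (toep \<psi> (H k) z) <= (\<Sum>j<N. cmod (tterm \<psi> (H k) z j)) + e * (domA * PP z)"
    unfolding PP_def using e by (intro toeplitz_bound_split[OF \<psi> D(1,3) z]) auto
   also have "... <= S + e * (domA * PP z)" unfolding S_def by (intro add_right_mono sum_mono c(2) z)
   finally have "cmod (toep \<psi> (H k) z) powr p <= (S + e * (domA * PP z)) powr p"
    using p by (intro powr_mono2) auto
   also have "... <= 2 powr p * (S powr p + (e * (domA * PP z)) powr p)"
    using p S0 e domA(1) PP0 by (intro add_powr_le) auto
   also have "(e * (domA * PP z)) powr p = e powr p * domA powr p * PP z powr p"
    using e domA(1) PP0 by (simp add: powr_mult mult.assoc)
   finally show ?thesis .
  qed
  have "(LINT z|W. cmod (toep \<psi> (H k) z) powr p) <= (LINT z|W. 2 powr p * (S powr p + e powr p * domA powr p * PP z powr p))"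
  proof (rule integral_mono[OF _ _ le])
   show "integrable W (\<lambda>z. cmod (toep \<psi> (H k) z) powr p)"
    by (rule bergman_spaceD(2)[OF lam p toeplitz_bergman(1)[OF \<psi> p Hb]])
   show "integrable W (\<lambda>z. 2 powr p * (S powr p + e powr p * domA powr p * PP z powr p))" using P(2) by simp
  qed
  also have "... = 2 powr p * (S powr p * measure W (ball 0 1) + e powr p * domA powr p * (LINT z|W. PP z powr p))"
   using P(2) by (simp add: mult.commute)
  also have "... <= 2 powr p * (S powr p * measure W (ball 0 1) + e powr p * domA powr p * (ppK p * M2))"
   using P(3) HM[of k] P(1) by (intro mult_left_mono add_left_mono) (auto intro: order_trans mult_left_mono)
  finally show ?thesis by (simp add: S_def algebra_simps)
 qed
 have I0: "(\<lambda>k. \<integral>z. cmod (toep \<psi> (H k) z) powr p \<partial>W) \<longlonglongrightarrow> 0"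
 proof (rule LIMSEQ_I)
  fix \<eta> :: real assume \<eta>: "\<eta> > 0"
  define E where "E = 2 powr p * domA powr p * ppK p * M2"
  have "M2 >= 0" using HM[of 0] by (rule order_trans[rotated]) simp
  hence E: "E >= 0" unfolding E_def using ppK(1)[OF p f] by (intro mult_nonneg_nonneg) auto
  \<comment> \<open>Chosen so that the tail contributes less than half of \<open>\<eta>\<close>.\<close>
  define e where "e = (\<eta> / (2 * (E + 1))) powr (1 / p)"
  have e0: "e > 0" using \<eta> E by (simp add: e_def)
  have ep: "e powr p * E < \<eta> / 2"
  proof -
   have "e powr p * E = \<eta> / 2 * (E / (E + 1))" unfolding e_def using \<eta> E p by (simp add: powr_powr field_simps)
   also have "... < \<eta> / 2 * 1" using \<eta> E by (intro mult_strict_left_mono) auto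
   finally show ?thesis by simp
  qed
  obtain N where N: "\<And>j. j >= N ==> box_sup lam \<psi> (Q j) / measure W (B j) < e"
   using order_tendstoD(2)[OF van e0] unfolding eventually_sequentially by blast
  have Nle: "box_sup lam \<psi> (Q j) <= e * measure W (B j)" if "j >= N" for j
  \<comment> \<open>A box of measure zero would make the quotient zero by convention, but then the standing bound on the symbol already gives zero.\<close>
  proof (cases "measure W (B j) = 0")
   case True
   thus ?thesis using \<psi> unfolding box_controlled_def by (metis mult_zero_right)
  next
   case False
   hence "measure W (B j) > 0" by (simp add: zero_less_measure_iff)
   thus ?thesis using N[OF that] by (simp add: divide_less_eq)
  qed
  have "(\<lambda>k. (\<Sum>j<N. c j k)) \<longlonglongrightarrow> (\<Sum>j<N. 0)" by (intro tendsto_sum c)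
  hence S: "(\<lambda>k. (\<Sum>j<N. c j k)) \<longlonglongrightarrow> 0" by simp
  have "\<forall>\<^sub>F k in sequentially. 0 <= (\<Sum>j<N. c j k)" by (intro always_eventually allI sum_nonneg c0)
  hence "(\<lambda>k. (\<Sum>j<N. c j k) powr p) \<longlonglongrightarrow> 0 powr p"
   by (intro tendsto_powr'[OF S tendsto_const]) (use p in auto)
  hence "(\<lambda>k. 2 powr p * ((\<Sum>j<N. c j k) powr p * measure W (ball 0 1))) \<longlonglongrightarrow> 2 powr p * (0 * measure W (ball 0 1))"
   by (intro tendsto_intros) simp
  from order_tendstoD(2)[OF this, of "\<eta> / 2"] \<eta>
  obtain k0 where k0: "\<And>k. k >= k0 ==> 2 powr p * ((\<Sum>j<N. c j k) powr p * measure W (ball 0 1)) < \<eta> / 2"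
   unfolding eventually_sequentially by auto
  show "\<exists>k0. \<forall>k\<ge>k0. norm ((LINT z|W. cmod (toep \<psi> (H k) z) powr p) - 0) < \<eta>"
  proof (intro exI[of _ k0] allI impI)
   fix k assume "k >= k0"
   from k0[OF this] key[OF e0 Nle, where k = k, of N] ep
   have "(LINT z|W. cmod (toep \<psi> (H k) z) powr p) < \<eta>" unfolding E_def[symmetric] by linarith
   thus "norm ((LINT z|W. cmod (toep \<psi> (H k) z) powr p) - 0) < \<eta>" by simp
  qed
 qed
 have "(\<lambda>k. Lp_norm lam p (\<lambda>z. toep \<psi> (F (r k)) z - toep \<psi> f z)) \<longlonglongrightarrow> 0"
 proof (rule Lp_norm_tendsto_0)
  have "(LINT z|W. cmod (toep \<psi> (H k) z) powr p) = (LINT z|W. cmod (toep \<psi> (F (r k)) z - toep \<psi> f z) powr p)" for k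
   by (intro LINT_cong refl) (simp add: TH)
  thus "(\<lambda>k. \<integral>z. cmod (toep \<psi> (F (r k)) z - toep \<psi> f z) powr p \<partial>W) \<longlonglongrightarrow> 0" using I0 by simp
 qed (use p in simp)
 hence "bergman_limit lam p (\<lambda>k. toep \<psi> (F (r k))) (toep \<psi> f) sequentially"
  unfolding bergman_limit_def using toeplitz_bergman(1)[OF \<psi> p] f F by simp
 thus "\<exists>g r. strict_mono r \<and> bergman_limit lam p (\<lambda>k. toep \<psi> (F (r k))) g sequentially"
  using r by blast
qed

end

section \<open>Boundedness, compactness and the adjoint\<close>

theorem corollary2p6:
  fixes lam p q C :: real
    and \<psi> :: "complex ^ 'n::{finite,wellorder} \<Rightarrow> complex"
    and Q :: "nat \<Rightarrow> (nat \<Rightarrow> real) set"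
    and B :: "nat \<Rightarrow> (complex ^ 'n::{finite,wellorder}) set"
  assumes "lam > -1" and "1 < p" and "1 / p + 1 / q = 1"
    and "locally_integrable_ball \<psi>"
    and "bij_betw Q UNIV (dyadic_boxes (2 * CARD('n)))"
    and "\<And>j. B j = sph_map ` Q j"
    and "C \<ge> 0"
    and "\<And>j. box_sup lam \<psi> (Q j) \<le> C * measure (weighted_vol lam) (B j)"
  shows
    "(toeplitz_well_defined lam p B \<psi> \<and> bergman_bounded lam p (toeplitz lam B \<psi>)) \<and>
     ((\<lambda>j. box_sup lam \<psi> (Q j) / measure (weighted_vol lam) (B j)) \<longlonglongrightarrow> 0 \<longrightarrow>
        bergman_compact lam p (toeplitz lam B \<psi>)) \<and>
     (\<forall>\<rho>\<in>{0<..<1}.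
        toeplitz_well_defined lam p B (truncate_symbol \<rho> \<psi>) \<and>
        toeplitz_well_defined lam q B (truncate_symbol \<rho> (\<lambda>z. cnj (\<psi> z)))) \<and>
     (\<forall>f\<in>bergman_space lam p.
        bergman_limit lam p (\<lambda>\<rho>. toeplitz lam B (truncate_symbol \<rho> \<psi>) f)
          (toeplitz lam B \<psi> f) (at_left 1)) \<and>
     (\<exists>S. bergman_adjoint lam p q (toeplitz lam B \<psi>) S) \<and>
     (\<forall>S. bergman_adjoint lam p q (toeplitz lam B \<psi>) S \<longrightarrow>
        (\<forall>f\<in>bergman_space lam q.
           bergman_limit lam q
             (\<lambda>\<rho>. toeplitz lam B (truncate_symbol \<rho> (\<lambda>z. cnj (\<psi> z))) f)
             (S f) (at_left 1)))"
proof -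
 have "1 / q = 1 - 1 / p" using assms(3) by simp
 moreover have "0 < 1 - 1 / p" "1 - 1 / p < 1" using assms(2) by auto
 ultimately have "0 < 1 / q" "1 / q < 1" by auto
 hence q: "q > 1" by (simp add: divide_less_eq_1)
 have "inj Q" "range Q = dyadic_boxes (2 * CARD('n))"
  using assms(5) by (auto simp: bij_betw_def)
 then interpret dyadic_toeplitz lam Q B
  using assms(1,6) by unfold_locales auto
 have \<psi>: "box_controlled C \<psi>" unfolding box_controlled_def using assms(4,7,8) by blast
 note adj = toeplitz_adjoint[OF \<psi> assms(2) q assms(3)]
 show ?thesis
 proof (intro conjI ballI allI impI)
  show "toeplitz_well_defined lam p B \<psi>" by (rule toeplitz_well_defined[OF \<psi> assms(2)])
  show "bergman_bounded lam p (toeplitz lam B \<psi>)" by (rule toeplitz_bounded[OF \<psi> assms(2)])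
  show "bergman_compact lam p (toeplitz lam B \<psi>)"
   if "(\<lambda>j. box_sup lam \<psi> (Q j) / measure (weighted_vol lam) (B j)) \<longlonglongrightarrow> 0"
   by (rule toeplitz_compact[OF \<psi> assms(2) that])
  fix \<rho> :: real
  show "toeplitz_well_defined lam p B (truncate_symbol \<rho> \<psi>)"
   by (rule toeplitz_well_defined[OF controlled_truncate[OF \<psi>] assms(2)])
  show "toeplitz_well_defined lam q B (truncate_symbol \<rho> (\<lambda>z. cnj (\<psi> z)))"
   by (rule toeplitz_well_defined[OF controlled_truncate[OF controlled_cnj[OF \<psi>]] q])
 next
  show "bergman_limit lam p (\<lambda>\<rho>. toeplitz lam B (truncate_symbol \<rho> \<psi>) f) (toeplitz lam B \<psi> f) (at_left 1)"
   if "f \<in> bergman_space lam p" for f by (rule truncate_limit[OF \<psi> assms(2) that])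
  show "\<exists>S. bergman_adjoint lam p q (toeplitz lam B \<psi>) S" using adj by blast
  fix S and f :: "'n cvec => complex"
  assume S: "bergman_adjoint lam p q (toeplitz lam B \<psi>) S" and f: "f \<in> bergman_space lam q"
  show "bergman_limit lam q (\<lambda>\<rho>. toeplitz lam B (truncate_symbol \<rho> (\<lambda>z. cnj (\<psi> z))) f) (S f) (at_left 1)"
  proof (rule bergman_limit_cong[OF truncate_limit[OF controlled_cnj[OF \<psi>] q f]])
   show "S f \<in> bergman_space lam q" using S f by (simp add: bergman_adjoint_def bergman_bounded_def)
   show "toeplitz lam B (\<lambda>z. cnj (\<psi> z)) f z = S f z" if "norm z < 1" for z
    by (rule bergman_adjoint_unique[OF assms(2) q adj S f that])
  qed
 qed
qed

end
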